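(* Let $(M^n, g, X, \rho)$ be an almost Yamabe soliton, i.e. $\frac12 \mathcal{L}_X g=(R-\rho)\,g$. Assume that $X$ is a non-trivial (i.e. not Killing) closed vector field such that each level hypersurface $|X|^{-1}(t)$ is compact. Then $M$ is locally a warped product $I \times_f \Sigma$, where $I$ is an interval, $\Sigma$ is a Riemannian $(n-1)$-manifold and $f = f(t)$ is a positive function on $I$, so that the metric tensor $g$ takes the form $$g = dt^2 + f^2 g_\Sigma .$$
   Context: An almost Yamabe soliton $(M^n,g,X,\rho)$ is a (smooth) Riemannian $n$-manifold $(M^n,g)$ together with a smooth vector field $X$ and a smooth function $\rho$ on $M$ such that $\frac12 \mathcal{L}_X g = (R-\rho)\, g$, where $\mathcal{L}$ is the Lie derivative and $R$ is the scalar curvature of $g$. $X$ is called closed if $\nabla_Y X = (R-\rho)Y$ for every vector field $Y$. $X$ is Killing if $R-\rho\equiv 0$, and non-trivial if it is not Killing. $|X|^{-1}(t)$ denotes the level set $\{p\in M: |X|(p)=t\}$. $g_\Sigma$ is the Riemannian metric of $\Sigma$ and $t$ is the coordinate on $I$.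
   Formalization: The local warped product form is asserted only around points of M where X does not vanish; at zeros of X it can fail, e.g. R^n (n ≥ 3) with g = dr² + (r+r³)² g_S and X = (r+r³)∂_r. Compactness is required only of |X|^{-1}(t) with t > 0. *)

theory Defs
  imports "HOL-Analysis.Analysis"
begin

text \<open>
  A manifold of dimension \<open>n\<close> is modelled on a coordinate subspace \<open>span B\<close> of a Euclidean space,
  where \<open>B \<subseteq> Basis\<close> has \<open>n\<close> elements.  Keeping the axes \<open>B\<close> as data allows manifolds of dimensions
  \<open>n\<close>, \<open>n - 1\<close> (including \<open>0\<close>) and products with an interval to live over the same types.
\<close>

definition partial_deriv :: "'e::euclidean_space \<Rightarrow> ('e \<Rightarrow> real) \<Rightarrow> 'e \<Rightarrow> real" where
  "partial_deriv b F x = deriv (\<lambda>s. F (x + s *\<^sub>R b)) 0"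

text \<open>
  \<open>Ck_on B k U F\<close>: all partial derivatives of \<open>F\<close> of order \<open>\<le> k\<close> along the axes in \<open>B\<close>
  exist and are continuous on \<open>U\<close>.  To be used for \<open>U\<close> relatively open in \<open>span B\<close>.
\<close>
primrec Ck_on :: "'e::euclidean_space set \<Rightarrow> nat \<Rightarrow> 'e set \<Rightarrow> ('e \<Rightarrow> real) \<Rightarrow> bool" where
  "Ck_on B 0 U F \<longleftrightarrow> continuous_on U F"
| "Ck_on B (Suc k) U F \<longleftrightarrow> continuous_on U F \<and>
     (\<forall>b\<in>B. (\<forall>x\<in>U. (\<lambda>s. F (x + s *\<^sub>R b)) differentiable (at (0::real))) \<and>
            Ck_on B k U (partial_deriv b F))"

definition smooth_on :: "'e::euclidean_space set \<Rightarrow> 'e set \<Rightarrow> ('e \<Rightarrow> real) \<Rightarrow> bool" where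
  "smooth_on B U F \<longleftrightarrow> (\<forall>k. Ck_on B k U F)"


section \<open>Smooth manifolds\<close>

type_synonym ('a, 'e) chart = "'a set \<times> ('a \<Rightarrow> 'e)"

record ('a, 'e) mfd =
  mtop :: "'a topology"
  axes :: "'e set"
  atlas :: "('a, 'e) chart set"

definition mfd_dim :: "('a, 'e) mfd \<Rightarrow> nat" where
  "mfd_dim M = card (axes M)"

definition chart_inv :: "('a, 'e) chart \<Rightarrow> 'e \<Rightarrow> 'a" where
  "chart_inv c = inv_into (fst c) (snd c)"

definition coordinate :: "('a, 'e::euclidean_space) chart \<Rightarrow> 'e \<Rightarrow> 'a \<Rightarrow> real" where
  "coordinate c b = (\<lambda>p. snd c p \<bullet> b)"

definition smooth_manifold :: "('a, 'e::euclidean_space) mfd \<Rightarrow> bool" where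
  "smooth_manifold M \<longleftrightarrow>
     axes M \<subseteq> Basis \<and> Hausdorff_space (mtop M) \<and> second_countable (mtop M) \<and>
     topspace (mtop M) = (\<Union>c\<in>atlas M. fst c) \<and>
     (\<forall>c\<in>atlas M.
        openin (mtop M) (fst c) \<and>
        openin (top_of_set (span (axes M))) (snd c ` fst c) \<and>
        homeomorphic_map (subtopology (mtop M) (fst c)) (top_of_set (snd c ` fst c)) (snd c)) \<and>
     (\<forall>c\<in>atlas M. \<forall>d\<in>atlas M. \<forall>b\<in>axes M.
        smooth_on (axes M) (snd c ` (fst c \<inter> fst d)) (coordinate d b \<circ> chart_inv c))"

text \<open>Smoothness of a function in a neighbourhood of \<open>p\<close>.\<close>
definition smooth_at :: "('a, 'e::euclidean_space) mfd \<Rightarrow> 'a \<Rightarrow> ('a \<Rightarrow> real) \<Rightarrow> bool" where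
  "smooth_at M p F \<longleftrightarrow>
     (\<exists>c\<in>atlas M. \<exists>W. openin (mtop M) W \<and> p \<in> W \<and> W \<subseteq> fst c \<and>
        smooth_on (axes M) (snd c ` W) (F \<circ> chart_inv c))"

definition smooth_fun :: "('a, 'e::euclidean_space) mfd \<Rightarrow> ('a \<Rightarrow> real) \<Rightarrow> bool" where
  "smooth_fun M F \<longleftrightarrow> (\<forall>p\<in>topspace (mtop M). smooth_at M p F)"

definition smooth_map ::
  "('a, 'e::euclidean_space) mfd \<Rightarrow> 'a set \<Rightarrow> ('b, 'e) mfd \<Rightarrow> ('a \<Rightarrow> 'b) \<Rightarrow> bool" where
  "smooth_map M U N \<Phi> \<longleftrightarrow>
     continuous_map (subtopology (mtop M) U) (mtop N) \<Phi> \<and>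
     (\<forall>p\<in>U. \<forall>d\<in>atlas N. \<Phi> p \<in> fst d \<longrightarrow>
        (\<forall>b\<in>axes N. smooth_at M p (coordinate d b \<circ> \<Phi>)))"


section \<open>Tangent vectors and vector fields\<close>

text \<open>
  A tangent vector at \<open>p\<close> acts on functions that are smooth near \<open>p\<close> as
  \<open>F \<mapsto> \<Sum>b. \<xi>\<^sub>b (\<partial>F/\<partial>x\<^sub>b)(p)\<close> in some chart.  So that equality of tangent vectors is equality
  of HOL functions, it takes the value \<open>0\<close> on functions not smooth near \<open>p\<close>.
\<close>

type_synonym 'a tvec = "('a \<Rightarrow> real) \<Rightarrow> real"

definition chart_deriv ::
  "('a, 'e::euclidean_space) chart \<Rightarrow> 'e \<Rightarrow> ('a \<Rightarrow> real) \<Rightarrow> 'a \<Rightarrow> real" where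
  "chart_deriv c b F p = partial_deriv b (F \<circ> chart_inv c) (snd c p)"

definition coord_vec ::
  "('a, 'e::euclidean_space) mfd \<Rightarrow> ('a, 'e) chart \<Rightarrow> 'a \<Rightarrow> 'e \<Rightarrow> 'a tvec" where
  "coord_vec M c p \<xi> =
     (\<lambda>F. if smooth_at M p F then \<Sum>b\<in>axes M. (\<xi> \<bullet> b) * chart_deriv c b F p else 0)"

definition tangent_space :: "('a, 'e::euclidean_space) mfd \<Rightarrow> 'a \<Rightarrow> 'a tvec set" where
  "tangent_space M p = {coord_vec M c p \<xi> | c \<xi>. c \<in> atlas M \<and> p \<in> fst c}"

definition vector_field :: "('a, 'e::euclidean_space) mfd \<Rightarrow> ('a \<Rightarrow> 'a tvec) \<Rightarrow> bool" where
  "vector_field M X \<longleftrightarrow>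
     (\<forall>p\<in>topspace (mtop M). X p \<in> tangent_space M p) \<and>
     (\<forall>c\<in>atlas M. \<forall>b\<in>axes M. \<forall>p\<in>fst c. smooth_at M p (\<lambda>q. X q (coordinate c b)))"

definition lie_bracket ::
  "('a, 'e::euclidean_space) mfd \<Rightarrow> ('a \<Rightarrow> 'a tvec) \<Rightarrow> ('a \<Rightarrow> 'a tvec) \<Rightarrow> 'a \<Rightarrow> 'a tvec" where
  "lie_bracket M X Y p =
     (\<lambda>F. if smooth_at M p F then X p (\<lambda>q. Y q F) - Y p (\<lambda>q. X q F) else 0)"

text \<open>The differential, at a point mapped to \<open>q \<in> N\<close>, of a smooth map \<open>\<Phi>\<close> into \<open>N\<close>.\<close>
definition differential ::
  "('b, 'e::euclidean_space) mfd \<Rightarrow> 'b \<Rightarrow> ('a \<Rightarrow> 'b) \<Rightarrow> 'a tvec \<Rightarrow> 'b tvec" where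
  "differential N q \<Phi> v = (\<lambda>F. if smooth_at N q F then v (F \<circ> \<Phi>) else 0)"


section \<open>Riemannian metrics\<close>

type_synonym 'a metric = "'a \<Rightarrow> 'a tvec \<Rightarrow> 'a tvec \<Rightarrow> real"

definition metric_coeff ::
  "('a, 'e::euclidean_space) mfd \<Rightarrow> 'a metric \<Rightarrow> ('a, 'e) chart \<Rightarrow> 'e \<Rightarrow> 'e \<Rightarrow> 'a \<Rightarrow> real" where
  "metric_coeff M g c a b p = g p (coord_vec M c p a) (coord_vec M c p b)"

definition riemannian_metric :: "('a, 'e::euclidean_space) mfd \<Rightarrow> 'a metric \<Rightarrow> bool" where
  "riemannian_metric M g \<longleftrightarrow>
     (\<forall>p\<in>topspace (mtop M).
        (\<forall>v\<in>tangent_space M p. \<forall>w\<in>tangent_space M p. g p v w = g p w v) \<and>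
        (\<forall>u\<in>tangent_space M p. \<forall>v\<in>tangent_space M p. \<forall>w\<in>tangent_space M p. \<forall>r.
           g p (\<lambda>F. r * u F + v F) w = r * g p u w + g p v w) \<and>
        (\<forall>v\<in>tangent_space M p. v \<noteq> (\<lambda>F. 0) \<longrightarrow> g p v v > 0)) \<and>
     (\<forall>c\<in>atlas M. \<forall>a\<in>axes M. \<forall>b\<in>axes M. \<forall>p\<in>fst c. smooth_at M p (metric_coeff M g c a b))"

definition riemannian_manifold :: "('a, 'e::euclidean_space) mfd \<Rightarrow> 'a metric \<Rightarrow> bool" where
  "riemannian_manifold M g \<longleftrightarrow> smooth_manifold M \<and> riemannian_metric M g"

text \<open>\<open>(L\<^sub>X g)(Y,Z) = X(g(Y,Z)) - g([X,Y],Z) - g(Y,[X,Z])\<close>\<close>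
definition lie_deriv_metric ::
  "('a, 'e::euclidean_space) mfd \<Rightarrow> 'a metric \<Rightarrow> ('a \<Rightarrow> 'a tvec) \<Rightarrow>
     ('a \<Rightarrow> 'a tvec) \<Rightarrow> ('a \<Rightarrow> 'a tvec) \<Rightarrow> 'a \<Rightarrow> real" where
  "lie_deriv_metric M g X Y Z p =
     X p (\<lambda>q. g q (Y q) (Z q)) - g p (lie_bracket M X Y p) (Z p) - g p (Y p) (lie_bracket M X Z p)"

definition vector_norm :: "'a metric \<Rightarrow> ('a \<Rightarrow> 'a tvec) \<Rightarrow> 'a \<Rightarrow> real" where
  "vector_norm g X p = sqrt (g p (X p) (X p))"

definition norm_level_set ::
  "('a, 'e) mfd \<Rightarrow> 'a metric \<Rightarrow> ('a \<Rightarrow> 'a tvec) \<Rightarrow> real \<Rightarrow> 'a set" where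
  "norm_level_set M g X t = {p \<in> topspace (mtop M). vector_norm g X p = t}"


section \<open>Levi-Civita connection and scalar curvature\<close>

definition inverse_metric_coeff ::
  "('a, 'e::euclidean_space) mfd \<Rightarrow> 'a metric \<Rightarrow> ('a, 'e) chart \<Rightarrow> 'e \<Rightarrow> 'e \<Rightarrow> 'a \<Rightarrow> real" where
  "inverse_metric_coeff M g c a b p =
     (THE h. (\<forall>i j. i \<notin> axes M \<or> j \<notin> axes M \<longrightarrow> h i j = 0) \<and>
             (\<forall>i\<in>axes M. \<forall>j\<in>axes M.
                (\<Sum>k\<in>axes M. metric_coeff M g c i k p * h k j) = (if i = j then 1 else 0))) a b"

text \<open>\<open>christoffel M g c k i j = \<Gamma>\<^sup>k\<^sub>i\<^sub>j\<close>\<close>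
definition christoffel ::
  "('a, 'e::euclidean_space) mfd \<Rightarrow> 'a metric \<Rightarrow> ('a, 'e) chart \<Rightarrow> 'e \<Rightarrow> 'e \<Rightarrow> 'e \<Rightarrow> 'a \<Rightarrow> real" where
  "christoffel M g c k i j p =
     1 / 2 * (\<Sum>l\<in>axes M. inverse_metric_coeff M g c k l p *
       (chart_deriv c i (metric_coeff M g c j l) p
        + chart_deriv c j (metric_coeff M g c i l) p
        - chart_deriv c l (metric_coeff M g c i j) p))"

text \<open>
  \<open>\<nabla>\<^sub>Y X\<close> at \<open>p\<close> for the Levi-Civita connection, computed in a chart \<open>c\<close> around \<open>p\<close>;
  the value does not depend on \<open>c\<close>.
\<close>
definition cov_deriv ::
  "('a, 'e::euclidean_space) mfd \<Rightarrow> 'a metric \<Rightarrow> ('a, 'e) chart \<Rightarrow>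
     ('a \<Rightarrow> 'a tvec) \<Rightarrow> ('a \<Rightarrow> 'a tvec) \<Rightarrow> 'a \<Rightarrow> 'a tvec" where
  "cov_deriv M g c Y X p =
     coord_vec M c p (\<Sum>k\<in>axes M.
       (\<Sum>i\<in>axes M. Y p (coordinate c i) *
          (chart_deriv c i (\<lambda>q. X q (coordinate c k)) p +
           (\<Sum>j\<in>axes M. christoffel M g c k i j p * X p (coordinate c j)))) *\<^sub>R k)"

text \<open>
  \<open>riemann_coeff M g c l i j k = R\<^sup>l\<^sub>i\<^sub>j\<^sub>k\<close> with
  \<open>R(\<partial>\<^sub>i,\<partial>\<^sub>j)\<partial>\<^sub>k = \<Sum>l. R\<^sup>l\<^sub>i\<^sub>j\<^sub>k \<partial>\<^sub>l\<close> and \<open>R(X,Y)\<close> the commutator of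
  \<open>\<nabla>\<^sub>X, \<nabla>\<^sub>Y\<close> minus the derivative along \<open>[X,Y]\<close>;
  the Ricci tensor is \<open>Ric(Y,Z) = tr (X \<mapsto> R(X,Y)Z)\<close>, so round spheres have positive curvature.
\<close>
definition riemann_coeff ::
  "('a, 'e::euclidean_space) mfd \<Rightarrow> 'a metric \<Rightarrow> ('a, 'e) chart \<Rightarrow>
     'e \<Rightarrow> 'e \<Rightarrow> 'e \<Rightarrow> 'e \<Rightarrow> 'a \<Rightarrow> real" where
  "riemann_coeff M g c l i j k p =
     chart_deriv c i (christoffel M g c l j k) p - chart_deriv c j (christoffel M g c l i k) p
     + (\<Sum>m\<in>axes M. christoffel M g c l i m p * christoffel M g c m j k p
                    - christoffel M g c l j m p * christoffel M g c m i k p)"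

definition ricci_coeff ::
  "('a, 'e::euclidean_space) mfd \<Rightarrow> 'a metric \<Rightarrow> ('a, 'e) chart \<Rightarrow> 'e \<Rightarrow> 'e \<Rightarrow> 'a \<Rightarrow> real" where
  "ricci_coeff M g c j k p = (\<Sum>i\<in>axes M. riemann_coeff M g c i i j k p)"

text \<open>The sum is independent of the chart around \<open>p\<close>; an arbitrary one is selected.\<close>
definition scalar_curvature ::
  "('a, 'e::euclidean_space) mfd \<Rightarrow> 'a metric \<Rightarrow> 'a \<Rightarrow> real" where
  "scalar_curvature M g p =
     (let c = (SOME c. c \<in> atlas M \<and> p \<in> fst c)
      in \<Sum>j\<in>axes M. \<Sum>k\<in>axes M. inverse_metric_coeff M g c j k p * ricci_coeff M g c j k p)"


section \<open>Almost Yamabe solitons\<close>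

definition almost_yamabe_soliton ::
  "('a, 'e::euclidean_space) mfd \<Rightarrow> 'a metric \<Rightarrow> ('a \<Rightarrow> 'a tvec) \<Rightarrow> ('a \<Rightarrow> real) \<Rightarrow> bool" where
  "almost_yamabe_soliton M g X \<rho> \<longleftrightarrow>
     riemannian_manifold M g \<and> vector_field M X \<and> smooth_fun M \<rho> \<and>
     (\<forall>Y Z. vector_field M Y \<longrightarrow> vector_field M Z \<longrightarrow>
        (\<forall>p\<in>topspace (mtop M).
           1 / 2 * lie_deriv_metric M g X Y Z p = (scalar_curvature M g p - \<rho> p) * g p (Y p) (Z p)))"

definition closed_soliton ::
  "('a, 'e::euclidean_space) mfd \<Rightarrow> 'a metric \<Rightarrow> ('a \<Rightarrow> 'a tvec) \<Rightarrow> ('a \<Rightarrow> real) \<Rightarrow> bool" where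
  "closed_soliton M g X \<rho> \<longleftrightarrow>
     (\<forall>Y. vector_field M Y \<longrightarrow>
        (\<forall>c\<in>atlas M. \<forall>p\<in>fst c.
           cov_deriv M g c Y X p = (\<lambda>F. (scalar_curvature M g p - \<rho> p) * Y p F)))"

definition killing_soliton ::
  "('a, 'e::euclidean_space) mfd \<Rightarrow> 'a metric \<Rightarrow> ('a \<Rightarrow> real) \<Rightarrow> bool" where
  "killing_soliton M g \<rho> \<longleftrightarrow> (\<forall>p\<in>topspace (mtop M). scalar_curvature M g p - \<rho> p = 0)"


section \<open>Warped products and isometries\<close>

text \<open>
  The product of an open interval \<open>I\<close> with \<open>S\<close>; the coordinate of the interval is placed on an
  axis \<open>e\<close> not used by \<open>S\<close>.
\<close>
definition interval_product ::
  "real set \<Rightarrow> 'e::euclidean_space \<Rightarrow> ('a, 'e) mfd \<Rightarrow> (real \<times> 'a, 'e) mfd" where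
  "interval_product I e S =
     \<lparr> mtop = prod_topology (top_of_set I) (mtop S),
       axes = insert e (axes S),
       atlas = {(I \<times> fst c, \<lambda>(t, q). t *\<^sub>R e + snd c q) | c. c \<in> atlas S} \<rparr>"

text \<open>
  The metric \<open>dt\<^sup>2 + f(t)\<^sup>2 h\<close>: for a tangent vector \<open>v\<close> of the product, \<open>dt(v) = v fst\<close>
  since \<open>t\<close> is the function \<open>fst\<close>, and \<open>snd\<close> is the projection to \<open>S\<close>.
\<close>
definition warped_metric ::
  "(real \<Rightarrow> real) \<Rightarrow> ('a, 'e::euclidean_space) mfd \<Rightarrow> 'a metric \<Rightarrow> (real \<times> 'a) metric" where
  "warped_metric f S h = (\<lambda>(t, q) v w.
     v fst * w fst + (f t)\<^sup>2 * h q (differential S q snd v) (differential S q snd w))"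

definition isometry_onto ::
  "('a, 'e::euclidean_space) mfd \<Rightarrow> 'a metric \<Rightarrow> 'a set \<Rightarrow> ('b, 'e) mfd \<Rightarrow> 'b metric \<Rightarrow>
     ('a \<Rightarrow> 'b) \<Rightarrow> bool" where
  "isometry_onto M g U N h \<Phi> \<longleftrightarrow>
     homeomorphic_map (subtopology (mtop M) U) (mtop N) \<Phi> \<and>
     smooth_map M U N \<Phi> \<and>
     smooth_map N (topspace (mtop N)) M (inv_into U \<Phi>) \<and>
     (\<forall>p\<in>U. \<forall>v\<in>tangent_space M p. \<forall>w\<in>tangent_space M p.
        g p v w = h (\<Phi> p) (differential N (\<Phi> p) \<Phi> v) (differential N (\<Phi> p) \<Phi> w))"

end

theory Submission
  imports Defs
begin

text \<open>
  Write \<open>N = X / |X|\<close>.  The equation \<open>\<nabla>\<^sub>Y X = \<phi> Y\<close> gives \<open>d|X| = \<phi> \<langle>N, -\<rangle>\<close>, shows that the form \<open>\<langle>N, -\<rangle>\<close>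
  is closed, and gives \<open>L\<^sub>N g = 2 (\<phi> / |X|) (g - \<langle>N, -\<rangle>\<^sup>2)\<close>.  Let \<open>\<tau>\<close> be a local primitive of \<open>\<langle>N, -\<rangle>\<close> and \<open>\<theta>\<close>
  the flow of \<open>N\<close>.  If \<open>y\<close> runs through a hyperplane transverse to \<open>N\<close>, then \<open>(t, y) \<mapsto> \<theta>(y, t - \<tau>(y))\<close> is a
  coordinate system in which \<open>N = \<partial>\<^sub>t\<close> and \<open>\<tau> = t\<close>.  In it \<open>g(\<partial>\<^sub>t, -) = dt\<close>, the function \<open>f = |X|\<close>
  depends on \<open>t\<close> only, with \<open>f' = \<phi>\<close>, and the derivative of \<open>g(\<partial>\<^sub>a, \<partial>\<^sub>b) / f\<^sup>2\<close> in \<open>t\<close> vanishes.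

  The flow is smooth because the difference quotients of solutions converge to the solution of the linearized
  equation, whose coefficients are as regular as the flow itself.
\<close>

section \<open>Calculus of \<open>C\<^sup>k\<close> functions on coordinate subspaces\<close>

text \<open>The norm \<open>|X|\<close> cannot itself serve as the coordinate \<open>t\<close>: it
  is critical wherever \<open>\<phi>\<close> vanishes, whereas \<open>\<langle>N, -\<rangle>\<close>
  has length one wherever \<open>X\<close> is nonzero. Hence the primitive \<open>\<tau>\<close>,
  and hence a purely local construction at a point with \<open>X \<noteq> 0\<close>. Shifting the
  flow time by \<open>\<tau> y\<close> lets the flow start on a plain coordinate hyperplane; no
  level set of \<open>\<tau>\<close> has to be parametrized beforehand.

  Two features of the setting shape the work. Charts take values in \<open>span B\<close>, while the
  flow and the inverse function theorem live on open subsets of the whole space; fields and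
  functions are therefore extended constantly in the missing directions and the results are
  restricted back. Moreover, the equation for \<open>X\<close> quantifies over globally defined
  fields \<open>Y\<close>, so its coordinate form at a point is reached only after extending a
  multiple of a coordinate vector by a bump function.\<close>

abbreviation relopen :: "'e::euclidean_space set \<Rightarrow> 'e set \<Rightarrow> bool" where
  "relopen B U \<equiv> openin (top_of_set (span B)) U"

lemma relopen_Basis [simp]: "relopen Basis U \<longleftrightarrow> open U"
  by (simp add: span_Basis)

text \<open>Since \<open>b\<close> is one of the axes, the line through \<open>x\<close> never
  leaves \<open>span B\<close>. Relative openness therefore suffices for ordinary two-sided
  derivatives in \<open>s\<close> at 0.\<close>

lemma eventually_relopen:
  assumes "relopen B U" "x \<in> U" "b \<in> B"
  shows "\<forall>\<^sub>F s in nhds (0::real). x + s *\<^sub>R b \<in> U"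
proof -
  obtain T where T: "open T" "U = span B \<inter> T"
    using assms(1) by (metis openin_open)
  have "((\<lambda>s::real. x + s *\<^sub>R b) \<longlongrightarrow> x + 0 *\<^sub>R b) (nhds 0)"
    by (intro tendsto_intros filterlim_ident)
  then have "\<forall>\<^sub>F s in nhds (0::real). x + s *\<^sub>R b \<in> T"
    using T assms(2) by (auto intro: topological_tendstoD)
  moreover have "x + s *\<^sub>R b \<in> span B" for s :: real
    using assms T by (auto intro: span_add span_mul span_base)
  ultimately show ?thesis using T by (auto elim: eventually_mono)
qed

lemma relopen_line:
  assumes "relopen B U" "x \<in> U" "b \<in> B"
  obtains S where "open S" "(0::real) \<in> S" "\<And>s. s \<in> S \<Longrightarrow> x + s *\<^sub>R b \<in> U"
  using eventually_relopen[OF assms] by (auto simp: eventually_nhds)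

lemma partial_deriv_eqI:
  "((\<lambda>s. F (x + s *\<^sub>R b)) has_real_derivative D) (at 0) \<Longrightarrow> partial_deriv b F x = D"
  unfolding partial_deriv_def by (rule DERIV_imp_deriv)

lemma partial_deriv_cong:
  assumes "relopen B U" "x \<in> U" "b \<in> B" "\<And>y. y \<in> U \<Longrightarrow> F y = G y"
  shows "partial_deriv b F x = partial_deriv b G x"
  unfolding partial_deriv_def using eventually_relopen[OF assms(1-3)]
  by (intro deriv_cong_ev) (auto elim: eventually_mono simp: assms(4))

lemma has_partial_cong:
  assumes "relopen B U" "x \<in> U" "b \<in> B" "\<And>y. y \<in> U \<Longrightarrow> F y = G y"
  shows "((\<lambda>s. F (x + s *\<^sub>R b)) has_real_derivative D) (at 0) \<longleftrightarrow>
         ((\<lambda>s. G (x + s *\<^sub>R b)) has_real_derivative D) (at 0)"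
  using eventually_relopen[OF assms(1-3)]
  by (intro DERIV_cong_ev) (auto elim: eventually_mono simp: assms(4))

text \<open>Partial derivatives are taken at parameter 0 only. Moving the base point along the line
  yields derivatives at every parameter, as mean value arguments require.\<close>

lemma has_partial_shift:
  fixes x b :: "'e::real_vector"
  assumes "((\<lambda>s. F ((x + s0 *\<^sub>R b) + s *\<^sub>R b)) has_real_derivative D) (at 0)"
  shows "((\<lambda>s. F (x + s *\<^sub>R b)) has_real_derivative D) (at s0)"
proof -
  have eq: "(\<lambda>s. F ((x + s0 *\<^sub>R b) + s *\<^sub>R b)) = (\<lambda>s. F (x + (s + s0) *\<^sub>R b))"
    by (intro ext arg_cong[of _ _ F]) (simp add: algebra_simps)
  then have "((\<lambda>s. F (x + (s + s0) *\<^sub>R b)) has_real_derivative D) (at 0)"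
    using assms by simp
  then show ?thesis
    using DERIV_shift[of "\<lambda>s. F (x + s *\<^sub>R b)" D 0 s0] by simp
qed

section \<open>The algebra of \<open>Ck_on\<close>\<close>

lemma Ck_on_imp_continuous_on: "Ck_on B k U F \<Longrightarrow> continuous_on U F"
  by (cases k) auto

lemma Ck_on_Suc_imp: "Ck_on B (Suc k) U F \<Longrightarrow> Ck_on B k U F"
  by (induction k arbitrary: F) auto

lemma Ck_on_subset: "Ck_on B k U F \<Longrightarrow> V \<subseteq> U \<Longrightarrow> Ck_on B k V F"
  by (induction k arbitrary: F) (auto intro: continuous_on_subset)

lemma Ck_on_has_partial:
  "Ck_on B (Suc k) U F \<Longrightarrow> b \<in> B \<Longrightarrow> x \<in> U \<Longrightarrow>
   ((\<lambda>s. F (x + s *\<^sub>R b)) has_real_derivative partial_deriv b F x) (at 0)"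
  by (auto simp: partial_deriv_def DERIV_deriv_iff_real_differentiable)

lemma Ck_on_partial: "Ck_on B (Suc k) U F \<Longrightarrow> b \<in> B \<Longrightarrow> Ck_on B k U (partial_deriv b F)"
  by auto

text \<open>Difference quotients at a point of a relatively open set see only values inside that
  set, so agreement on \<open>U\<close> passes to partial derivatives of every order.\<close>

lemma Ck_on_cong:
  assumes "relopen B U" "\<And>y. y \<in> U \<Longrightarrow> F y = G y" "Ck_on B k U F"
  shows "Ck_on B k U G"
  using assms(2,3)
proof (induction k arbitrary: F G)
  case 0
  then show ?case by (auto cong: continuous_on_cong)
next
  case (Suc k)
  have "(\<lambda>s. G (x + s *\<^sub>R b)) differentiable (at (0::real))" if "b \<in> B" "x \<in> U" for b x
    using has_partial_cong[OF assms(1) that(2,1), of F G] Suc.prems(1) that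
      Ck_on_has_partial[OF Suc.prems(2) that] by (auto simp: real_differentiable_def)
  moreover have "Ck_on B k U (partial_deriv b G)" if "b \<in> B" for b
    by (rule Suc.IH[where F="partial_deriv b F"])
      (use that Suc.prems in \<open>auto intro!: partial_deriv_cong[OF assms(1)]\<close>)
  moreover have "continuous_on U G"
    using Suc.prems by (auto cong: continuous_on_cong)
  ultimately show ?case by auto
qed

text \<open>The introduction rule behind most regularity proofs: the derivatives are exhibited as
  explicit functions \<open>D\<close>, whose regularity is then inherited by
  \<open>partial_deriv\<close>.\<close>

lemma Ck_on_SucI:
  assumes "relopen B U" "continuous_on U F"
    and D: "\<And>b x. b \<in> B \<Longrightarrow> x \<in> U \<Longrightarrow> ((\<lambda>s. F (x + s *\<^sub>R b)) has_real_derivative D b x) (at 0)"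
    and "\<And>b. b \<in> B \<Longrightarrow> Ck_on B k U (D b)"
  shows "Ck_on B (Suc k) U F"
proof -
  have "Ck_on B k U (partial_deriv b F)" if "b \<in> B" for b
    by (rule Ck_on_cong[OF assms(1) _ assms(4)[OF that]])
      (rule partial_deriv_eqI[OF D[OF that], symmetric])
  then show ?thesis using assms(2) D by (auto simp: real_differentiable_def)
qed

lemma Ck_on_const: "relopen B U \<Longrightarrow> Ck_on B k U (\<lambda>x. c)"
proof (induction k arbitrary: c)
  case (Suc k)
  show ?case by (rule Ck_on_SucI[where D="\<lambda>b x. 0"]) (use Suc in auto)
qed auto

lemma Ck_on_inner: "relopen B U \<Longrightarrow> Ck_on B k U (\<lambda>x. x \<bullet> v)"
proof (induction k)
  case (Suc k)
  show ?case
    by (rule Ck_on_SucI[where D="\<lambda>b x. b \<bullet> v"])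
      (use Suc in \<open>auto intro!: continuous_intros Ck_on_const derivative_eq_intros simp: inner_add_left\<close>)
qed (auto intro!: continuous_intros)

lemma Ck_on_add:
  assumes "relopen B U" "Ck_on B k U F" "Ck_on B k U G"
  shows "Ck_on B k U (\<lambda>x. F x + G x)"
  using assms(2,3)
proof (induction k arbitrary: F G)
  case (Suc k)
  show ?case
  proof (rule Ck_on_SucI[where D="\<lambda>b x. partial_deriv b F x + partial_deriv b G x", OF assms(1)])
    show "continuous_on U (\<lambda>x. F x + G x)"
      using Suc.prems by (auto intro: continuous_intros)
    show "((\<lambda>s. F (x + s *\<^sub>R b) + G (x + s *\<^sub>R b)) has_real_derivative
        partial_deriv b F x + partial_deriv b G x) (at 0)" if "b \<in> B" "x \<in> U" for b x
      using DERIV_add[OF Ck_on_has_partial[OF Suc.prems(1) that] Ck_on_has_partial[OF Suc.prems(2) that]] .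
    show "Ck_on B k U (\<lambda>x. partial_deriv b F x + partial_deriv b G x)" if "b \<in> B" for b
      by (rule Suc.IH[OF Ck_on_partial[OF Suc.prems(1) that] Ck_on_partial[OF Suc.prems(2) that]])
  qed
qed (auto intro: continuous_intros)

lemma Ck_on_mult:
  assumes "relopen B U" "Ck_on B k U F" "Ck_on B k U G"
  shows "Ck_on B k U (\<lambda>x. F x * G x)"
  using assms(2,3)
proof (induction k arbitrary: F G)
  case (Suc k)
  show ?case
  proof (rule Ck_on_SucI[where D="\<lambda>b x. partial_deriv b F x * G x + partial_deriv b G x * F x", OF assms(1)])
    show "((\<lambda>s. F (x + s *\<^sub>R b) * G (x + s *\<^sub>R b)) has_real_derivative
        partial_deriv b F x * G x + partial_deriv b G x * F x) (at 0)" if "b \<in> B" "x \<in> U" for b x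
      using DERIV_mult[OF Ck_on_has_partial[OF Suc.prems(1) that] Ck_on_has_partial[OF Suc.prems(2) that]]
      by simp
    show "continuous_on U (\<lambda>x. F x * G x)"
      using Suc.prems by (auto intro: continuous_intros)
    show "Ck_on B k U (\<lambda>x. partial_deriv b F x * G x + partial_deriv b G x * F x)" if "b \<in> B" for b
      using Suc.prems that
      by (intro Ck_on_add[OF assms(1)] Suc.IH Ck_on_partial[OF _ that] Ck_on_Suc_imp[of _ k])
  qed
qed (auto intro: continuous_intros)

lemma Ck_on_sum:
  assumes "relopen B U" "\<And>i. i \<in> I \<Longrightarrow> Ck_on B k U (F i)"
  shows "Ck_on B k U (\<lambda>x. \<Sum>i\<in>I. F i x)"
  using assms(2)
  by (induction I rule: infinite_finite_induct)
    (auto intro!: Ck_on_add Ck_on_const assms(1))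

lemma Ck_on_minus:
  assumes "relopen B U" "Ck_on B k U F"
  shows "Ck_on B k U (\<lambda>x. - F x)"
  using Ck_on_mult[OF assms(1) Ck_on_const[OF assms(1), of _ "-1"] assms(2)] by simp

lemma Ck_on_diff:
  assumes "relopen B U" "Ck_on B k U F" "Ck_on B k U G"
  shows "Ck_on B k U (\<lambda>x. F x - G x)"
  using Ck_on_add[OF assms(1,2) Ck_on_minus[OF assms(1,3)]] by simp

text \<open>The derivative of a reciprocal contains only the reciprocal itself and the derivative of
  \<open>F\<close>, so regularity of order \<open>k\<close> bootstraps to order
  \<open>k + 1\<close>.\<close>

lemma Ck_on_inverse:
  assumes "relopen B U" "Ck_on B k U F" "\<And>x. x \<in> U \<Longrightarrow> F x \<noteq> 0"
  shows "Ck_on B k U (\<lambda>x. inverse (F x))"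
  using assms(2)
proof (induction k)
  case (Suc k)
  have IH: "Ck_on B k U (\<lambda>x. inverse (F x))"
    using Suc by (meson Ck_on_Suc_imp)
  show ?case
  proof (rule Ck_on_SucI[where D="\<lambda>b x. - (partial_deriv b F x * (inverse (F x) * inverse (F x)))", OF assms(1)])
    show "continuous_on U (\<lambda>x. inverse (F x))"
      using IH by (rule Ck_on_imp_continuous_on)
    show "((\<lambda>s. inverse (F (x + s *\<^sub>R b))) has_real_derivative
        - (partial_deriv b F x * (inverse (F x) * inverse (F x)))) (at 0)" if "b \<in> B" "x \<in> U" for b x
      using DERIV_inverse_fun[OF Ck_on_has_partial[OF Suc.prems that]] assms(3) that
      by (simp add: power2_eq_square field_simps)
    show "Ck_on B k U (\<lambda>x. - (partial_deriv b F x * (inverse (F x) * inverse (F x))))" if "b \<in> B" for b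
      using IH that Suc.prems by (intro Ck_on_minus Ck_on_mult assms) auto
  qed
qed (use assms in \<open>auto intro: continuous_intros\<close>)

lemma Ck_on_sqrt:
  assumes "relopen B U" "Ck_on B k U F" "\<And>x. x \<in> U \<Longrightarrow> F x > 0"
  shows "Ck_on B k U (\<lambda>x. sqrt (F x))"
  using assms(2)
proof (induction k)
  case (Suc k)
  have IH: "Ck_on B k U (\<lambda>x. sqrt (F x))"
    using Suc by (meson Ck_on_Suc_imp)
  have IH': "Ck_on B k U (\<lambda>x. inverse (sqrt (F x)))"
    by (rule Ck_on_inverse[OF assms(1) IH]) (use assms(3) in force)
  show ?case
  proof (rule Ck_on_SucI[where D="\<lambda>b x. partial_deriv b F x * (inverse (sqrt (F x)) * (1/2))", OF assms(1)])
    show "continuous_on U (\<lambda>x. sqrt (F x))"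
      using IH by (rule Ck_on_imp_continuous_on)
    show "((\<lambda>s. sqrt (F (x + s *\<^sub>R b))) has_real_derivative
        partial_deriv b F x * (inverse (sqrt (F x)) * (1/2))) (at 0)" if "b \<in> B" "x \<in> U" for b x
      using DERIV_chain2[OF _ Ck_on_has_partial[OF Suc.prems that], of sqrt "inverse (sqrt (F x)) / 2"]
        DERIV_real_sqrt[OF assms(3)[OF that(2)]] by (simp add: mult.commute)
    show "Ck_on B k U (\<lambda>x. partial_deriv b F x * (inverse (sqrt (F x)) * (1/2)))" if "b \<in> B" for b
      using IH' that Suc.prems by (intro Ck_on_const Ck_on_mult assms) auto
  qed
qed (auto intro: continuous_intros)

section \<open>Total derivative, chain rule and symmetry of second derivatives\<close>

lemma span_coord_sum:
  assumes "B \<subseteq> Basis" "x \<in> span B"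
  shows "(\<Sum>b\<in>B. (x \<bullet> b) *\<^sub>R b) = (x::'e::euclidean_space)"
proof (rule euclidean_eqI)
  fix i :: 'e assume i: "i \<in> Basis"
  have fin: "finite B" using assms finite_subset finite_Basis by blast
  have "(\<Sum>b\<in>B. (x \<bullet> b) *\<^sub>R b) \<bullet> i = (\<Sum>b\<in>B. (x \<bullet> b) * (if b = i then 1 else 0))"
    unfolding inner_sum_left using i assms(1) by (intro sum.cong) (auto simp: inner_Basis)
  also have "\<dots> = (if i \<in> B then x \<bullet> i else 0)" using fin by (simp add: if_distrib cong: if_cong)
  also have "\<dots> = x \<bullet> i"
  proof (cases "i \<in> B")
    case False
    have "orthogonal i x"
    proof (rule orthogonal_to_span[OF assms(2)])
      fix y assume "y \<in> B" then show "orthogonal i y"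
        using False i assms(1) by (auto simp: orthogonal_def inner_Basis)
    qed
    then show ?thesis using False by (simp add: orthogonal_def inner_commute)
  qed auto
  finally show "(\<Sum>b\<in>B. (x \<bullet> b) *\<^sub>R b) \<bullet> i = x \<bullet> i" .
qed

lemma inner_coord_sum:
  assumes "B \<subseteq> Basis" "i \<in> Basis"
  shows "(\<Sum>b\<in>B. c b *\<^sub>R b) \<bullet> i = (if i \<in> B then c i else (0::real))"
proof -
  have fin: "finite B" using assms finite_subset finite_Basis by blast
  have "(\<Sum>b\<in>B. c b *\<^sub>R b) \<bullet> i = (\<Sum>b\<in>B. c b * (if b = i then 1 else 0))"
    unfolding inner_sum_left using assms by (intro sum.cong) (auto simp: inner_Basis)
  also have "\<dots> = (if i \<in> B then c i else 0)" using fin by (simp add: if_distrib cong: if_cong)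
  finally show ?thesis .
qed

text \<open>The increment is split into steps parallel to the axes; each is estimated by the mean value theorem.\<close>
lemma has_derivative_of_partials:
  fixes F :: "'e::euclidean_space \<Rightarrow> real"
  assumes B: "B \<subseteq> Basis" and U: "relopen B U" and x: "x \<in> U"
    and F: "Ck_on B (Suc 0) U F"
  shows "(F has_derivative (\<lambda>h. \<Sum>b\<in>B. (h \<bullet> b) * partial_deriv b F x)) (at x within U)"
  unfolding has_derivative_within_alt
proof (intro conjI allI impI)
  show "bounded_linear (\<lambda>h. \<Sum>b\<in>B. (h \<bullet> b) * partial_deriv b F x)"
    by (intro bounded_linear_sum bounded_linear_mult_const bounded_linear_inner_left)
  fix e :: real assume e: "e > 0"
  have fin: "finite B" using B finite_subset finite_Basis by blast
  \<comment> \<open>Each axis will contribute an error of at most \<open>e / n * norm h\<close>. The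
    added 1 keeps \<open>n\<close> positive when \<open>B\<close> is empty.\<close>
  define n where "n = real (card B) + 1"
  have n: "n > 0" by (simp add: n_def)
  obtain T where T: "open T" "U = span B \<inter> T" using U by (metis openin_open)
  obtain d0 where d0: "d0 > 0" "ball x d0 \<subseteq> T"
    using T x by (meson IntE openE)
  have "\<exists>d>0. \<forall>y\<in>U. dist y x < d \<longrightarrow> \<bar>partial_deriv b F y - partial_deriv b F x\<bar> < e / n" if "b \<in> B" for b
  proof -
    have "continuous_on U (partial_deriv b F)" using F that by simp
    then show ?thesis using x e n unfolding continuous_on_iff dist_real_def
      by (meson divide_pos_pos)
  qed
  then obtain db where db: "\<And>b. b \<in> B \<Longrightarrow> db b > 0"
    "\<And>b y. b \<in> B \<Longrightarrow> y \<in> U \<Longrightarrow> dist y x < db b \<Longrightarrow> \<bar>partial_deriv b F y - partial_deriv b F x\<bar> < e / n"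
    by metis
  define d where "d = Min (insert d0 (db ` B))"
  have d: "d > 0" "d \<le> d0" "\<And>b. b \<in> B \<Longrightarrow> d \<le> db b"
    using fin d0 db by (auto simp: d_def)
  have near: "y \<in> U" "b \<in> B \<Longrightarrow> \<bar>partial_deriv b F y - partial_deriv b F x\<bar> \<le> e / n"
    if "y \<in> span B" "norm (y - x) < d" for y b
  proof -
    show "y \<in> U" using that d0 d T by (auto simp: dist_norm norm_minus_commute)
    then show "b \<in> B \<Longrightarrow> \<bar>partial_deriv b F y - partial_deriv b F x\<bar> \<le> e / n"
      using db(2)[of b y] d(3)[of b] that by (auto simp: dist_norm less_imp_le)
  qed
  have xs: "x \<in> span B" using x T by auto
  show "\<exists>d>0. \<forall>y\<in>U. norm (y - x) < d \<longrightarrow>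
      norm (F y - F x - (\<Sum>b\<in>B. ((y - x) \<bullet> b) * partial_deriv b F x)) \<le> e * norm (y - x)"
  proof (intro exI conjI ballI impI)
    fix y assume y: "y \<in> U" "norm (y - x) < d"
    define h where "h = y - x"
    define p where "p A = x + (\<Sum>b\<in>A. (h \<bullet> b) *\<^sub>R b)" for A
    have claim: "\<bar>F (p A) - F x - (\<Sum>b\<in>A. (h \<bullet> b) * partial_deriv b F x)\<bar> \<le> card A * (e / n * norm h)"
      if "A \<subseteq> B" for A
      using finite_subset[OF that fin] that
    proof (induction A rule: finite_induct)
      case empty then show ?case by (simp add: p_def)
    next
      case (insert a A)
      then have A: "A \<subseteq> B" "a \<in> B" "a \<in> Basis" "A \<subseteq> Basis" using B by auto
      define S where "S = closed_segment 0 (h \<bullet> a)"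
      have seg: "p A + s *\<^sub>R a \<in> span B" "norm (p A + s *\<^sub>R a - x) < d" if "s \<in> S" for s
      proof -
        show "p A + s *\<^sub>R a \<in> span B" unfolding p_def
          using A xs by (intro span_add span_sum) (auto intro!: span_mul intro: span_base)
        \<comment> \<open>Coordinatewise, an intermediate point is no farther from \<open>x\<close>
          than \<open>y\<close> is, so the broken path stays where the partial derivatives are
          controlled.\<close>
        have "norm (p A + s *\<^sub>R a - x) \<le> norm h"
        proof (rule norm_le_componentwise)
          fix i :: 'e assume i: "i \<in> Basis"
          have "\<bar>s\<bar> \<le> \<bar>h \<bullet> a\<bar>" using that unfolding S_def by (auto simp: closed_segment_eq_real_ivl split: if_splits)
          moreover have "(p A + s *\<^sub>R a - x) \<bullet> i = (if i \<in> A then h \<bullet> i else 0) + (if i = a then s else 0)"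
            using i A by (simp add: p_def inner_add_left inner_coord_sum inner_Basis)
          ultimately show "\<bar>(p A + s *\<^sub>R a - x) \<bullet> i\<bar> \<le> \<bar>h \<bullet> i\<bar>"
            using insert.hyps by auto
        qed
        then show "norm (p A + s *\<^sub>R a - x) < d" using y by (simp add: h_def)
      qed
      \<comment> \<open>Subtracting the linear term turns the mean value bound into a bound by the
        oscillation of the partial derivative.\<close>
      let ?\<phi> = "\<lambda>s. F (p A + s *\<^sub>R a) - s * partial_deriv a F x"
      have "norm (?\<phi> (h \<bullet> a) - ?\<phi> 0) \<le> e / n * norm (h \<bullet> a - 0)"
      proof (rule field_differentiable_bound[where S=S])
        show "convex S" by (simp add: S_def)
        fix s assume s: "s \<in> S"
        show "(?\<phi> has_field_derivative partial_deriv a F (p A + s *\<^sub>R a) - partial_deriv a F x) (at s within S)"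
          using DERIV_diff[OF has_field_derivative_at_within[OF has_partial_shift[OF
              Ck_on_has_partial[OF F A(2) near(1)[OF seg[OF s]]]]]
              DERIV_cmult_right[OF DERIV_ident, of "partial_deriv a F x"]] by simp
        show "norm (partial_deriv a F (p A + s *\<^sub>R a) - partial_deriv a F x) \<le> e / n"
          using near(2)[OF seg[OF s] A(2)] by simp
      qed (auto simp: S_def)
      moreover have "p A + (h \<bullet> a) *\<^sub>R a = p (insert a A)"
        using insert by (simp add: p_def algebra_simps)
      moreover have "\<bar>h \<bullet> a\<bar> \<le> norm h" using A(3) by (rule Basis_le_norm)
      then have "e / n * \<bar>h \<bullet> a\<bar> \<le> e / n * norm h" using e n by (intro mult_left_mono) auto
      ultimately have "\<bar>F (p (insert a A)) - F (p A) - (h \<bullet> a) * partial_deriv a F x\<bar> \<le> e / n * norm h"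
        by simp
      moreover have "(\<Sum>b\<in>insert a A. (h \<bullet> b) * partial_deriv b F x) =
          (h \<bullet> a) * partial_deriv a F x + (\<Sum>b\<in>A. (h \<bullet> b) * partial_deriv b F x)"
        using insert by simp
      moreover have "card (insert a A) * (e / n * norm h) = card A * (e / n * norm h) + e / n * norm h"
        by (simp add: insert.hyps distrib_right add_divide_distrib)
      ultimately show ?case using insert.IH[OF A(1)] by linarith
    qed
    have "p B = y"
      using span_coord_sum[OF B, of h] y T xs by (simp add: p_def h_def span_diff)
    then have "\<bar>F y - F x - (\<Sum>b\<in>B. (h \<bullet> b) * partial_deriv b F x)\<bar> \<le> card B * (e / n * norm h)"
      using claim[OF subset_refl] by simp
    also have "\<dots> = (card B / n) * (e * norm h)" using n by simp
    also have "\<dots> \<le> 1 * (e * norm h)"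
      using e n by (intro mult_right_mono) (auto simp: n_def)
    finally show "norm (F y - F x - (\<Sum>b\<in>B. ((y - x) \<bullet> b) * partial_deriv b F x)) \<le> e * norm (y - x)"
      by (simp add: h_def)
  qed (use d in auto)
qed

text \<open>Total differentiability of \<open>F\<close> is available only within \<open>V\<close>.
  The chain rule is therefore applied within the image of a short piece of the line; as its
  parameter set is open, an ordinary derivative results.\<close>

lemma has_partial_compose:
  fixes F :: "'e::euclidean_space \<Rightarrow> real" and G :: "'d::euclidean_space \<Rightarrow> 'e"
  assumes B: "B \<subseteq> Basis" and V: "relopen B V" and U: "relopen C U"
    and F: "Ck_on B (Suc 0) V F" and G: "\<And>b. b \<in> B \<Longrightarrow> Ck_on C (Suc 0) U (\<lambda>x. G x \<bullet> b)"
    and GV: "\<And>x. x \<in> U \<Longrightarrow> G x \<in> V" and x: "x \<in> U" and c: "c \<in> C"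
  shows "((\<lambda>s. F (G (x + s *\<^sub>R c))) has_real_derivative
    (\<Sum>b\<in>B. partial_deriv b F (G x) * partial_deriv c (\<lambda>x. G x \<bullet> b) x)) (at 0)"
proof -
  obtain S where S: "open S" "(0::real) \<in> S" "\<And>s. s \<in> S \<Longrightarrow> x + s *\<^sub>R c \<in> U"
    using relopen_line[OF U x c] by blast
  have Vs: "V \<subseteq> span B" using V by (simp add: openin_euclidean_subtopology_iff)
  define G' where "G' = (\<Sum>b\<in>B. partial_deriv c (\<lambda>x. G x \<bullet> b) x *\<^sub>R b)"
  have "((\<lambda>s. (G (x + s *\<^sub>R c) \<bullet> b) *\<^sub>R b) has_vector_derivative
      partial_deriv c (\<lambda>x. G x \<bullet> b) x *\<^sub>R b) (at 0)" if "b \<in> B" for b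
    using has_vector_derivative_scaleR[OF Ck_on_has_partial[OF G[OF that] c x] has_vector_derivative_const[of b]]
    by simp
  then have "((\<lambda>s. \<Sum>b\<in>B. (G (x + s *\<^sub>R c) \<bullet> b) *\<^sub>R b) has_vector_derivative G') (at 0)"
    unfolding G'_def by (intro has_vector_derivative_sum)
  then have "((\<lambda>s. G (x + s *\<^sub>R c)) has_vector_derivative G') (at 0)"
    by (rule has_vector_derivative_transform_within_open[OF _ S(1,2)])
      (use S(3) GV Vs in \<open>auto intro!: span_coord_sum[OF B]\<close>)
  then have 1: "((\<lambda>s. G (x + s *\<^sub>R c)) has_derivative (\<lambda>s. s *\<^sub>R G')) (at 0 within S)"
    unfolding has_vector_derivative_def by (rule has_derivative_at_withinI)
  have 2: "(F has_derivative (\<lambda>h. \<Sum>b\<in>B. (h \<bullet> b) * partial_deriv b F (G x)))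
      (at (G (x + 0 *\<^sub>R c)) within ((\<lambda>s. G (x + s *\<^sub>R c)) ` S))"
    using has_derivative_of_partials[OF B V GV[OF x] F] S(3) GV
    by (auto intro: has_derivative_subset)
  have inn: "G' \<bullet> b = partial_deriv c (\<lambda>x. G x \<bullet> b) x" if "b \<in> B" for b
    using that inner_coord_sum[OF B subsetD[OF B that]] by (simp add: G'_def)
  have "((\<lambda>s. F (G (x + s *\<^sub>R c))) has_derivative
     (\<lambda>s. \<Sum>b\<in>B. ((s *\<^sub>R G') \<bullet> b) * partial_deriv b F (G x))) (at 0 within S)"
    by (rule has_derivative_in_compose[OF 1 2])
  also have "(\<lambda>s. \<Sum>b\<in>B. ((s *\<^sub>R G') \<bullet> b) * partial_deriv b F (G x)) =
      (*) (\<Sum>b\<in>B. partial_deriv b F (G x) * partial_deriv c (\<lambda>x. G x \<bullet> b) x)"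
    by (intro ext, unfold sum_distrib_right, intro sum.cong refl) (simp add: inn)
  finally show ?thesis
    unfolding has_field_derivative_def at_within_open[OF S(2,1)] .
qed

text \<open>Induction on \<open>k\<close> through the chain rule, whose terms are again compositions
  with \<open>G\<close>. Regularity of the components along \<open>B\<close> is enough: the
  remaining ones vanish because \<open>G\<close> maps into \<open>span B\<close>.\<close>

lemma Ck_on_compose:
  fixes F :: "'e::euclidean_space \<Rightarrow> real" and G :: "'d::euclidean_space \<Rightarrow> 'e"
  assumes B: "B \<subseteq> Basis" and V: "relopen B V" and U: "relopen C U"
    and F: "Ck_on B k V F" and G: "\<And>b. b \<in> B \<Longrightarrow> Ck_on C k U (\<lambda>x. G x \<bullet> b)"
    and GV: "\<And>x. x \<in> U \<Longrightarrow> G x \<in> V"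
  shows "Ck_on C k U (\<lambda>x. F (G x))"
proof -
  have Vs: "V \<subseteq> span B" using V by (simp add: openin_euclidean_subtopology_iff)
  have contG: "continuous_on U G"
  proof -
    have "continuous_on U (\<lambda>x. \<Sum>b\<in>B. (G x \<bullet> b) *\<^sub>R b)"
      by (intro continuous_on_sum continuous_on_scaleR continuous_on_const Ck_on_imp_continuous_on[OF G])
    then show ?thesis
      by (rule continuous_on_eq) (use GV Vs in \<open>auto intro!: span_coord_sum[OF B]\<close>)
  qed
  have cont: "continuous_on U (\<lambda>x. F (G x))" if "continuous_on V F" for F :: "'e \<Rightarrow> real"
    using continuous_on_compose2[OF that contG] GV by auto
  show ?thesis using F G
  proof (induction k arbitrary: F)
    case 0 then show ?case using cont by auto
  next
    case (Suc k)
    have 1: "Ck_on B (Suc 0) V F" using Suc.prems(1) by (auto dest: Ck_on_imp_continuous_on)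
    have 2: "Ck_on C (Suc 0) U (\<lambda>x. G x \<bullet> b)" if "b \<in> B" for b
      using Suc.prems(2)[OF that] by (auto dest: Ck_on_imp_continuous_on)
    show ?case
    proof (rule Ck_on_SucI[OF U])
      show "continuous_on U (\<lambda>x. F (G x))" using Suc.prems(1) by (auto intro: cont Ck_on_imp_continuous_on)
      show "((\<lambda>s. F (G (x + s *\<^sub>R c))) has_real_derivative
        (\<Sum>b\<in>B. partial_deriv b F (G x) * partial_deriv c (\<lambda>x. G x \<bullet> b) x)) (at 0)"
        if "c \<in> C" "x \<in> U" for c x
        by (rule has_partial_compose[OF B V U 1 2 GV that(2,1)])
      show "Ck_on C k U (\<lambda>x. \<Sum>b\<in>B. partial_deriv b F (G x) * partial_deriv c (\<lambda>x. G x \<bullet> b) x)"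
        if "c \<in> C" for c
      proof (intro Ck_on_sum Ck_on_mult U)
        fix b assume b: "b \<in> B"
        show "Ck_on C k U (\<lambda>x. partial_deriv b F (G x))"
          by (rule Suc.IH[OF Ck_on_partial[OF Suc.prems(1) b] Ck_on_Suc_imp[OF Suc.prems(2)]])
        show "Ck_on C k U (partial_deriv c (\<lambda>x. G x \<bullet> b))"
          using Ck_on_partial[OF Suc.prems(2)[OF b] that] .
      qed
    qed
  qed
qed

text \<open>The mean value theorem is applied twice to a second difference. The order of the two
  applications decides which mixed partial derivative appears.\<close>

lemma mixed_difference:
  fixes F :: "'e::euclidean_space \<Rightarrow> real"
  assumes F: "Ck_on B (Suc (Suc 0)) U F" and bc: "b \<in> B" "c \<in> B" and h: "h > 0"
    and box: "\<And>s t. 0 \<le> s \<Longrightarrow> s \<le> h \<Longrightarrow> 0 \<le> t \<Longrightarrow> t \<le> h \<Longrightarrow> x + s *\<^sub>R b + t *\<^sub>R c \<in> U"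
  shows "\<exists>\<xi> \<eta>. 0 < \<xi> \<and> \<xi> < h \<and> 0 < \<eta> \<and> \<eta> < h \<and>
     F (x + h *\<^sub>R b + h *\<^sub>R c) - F (x + h *\<^sub>R b) - F (x + h *\<^sub>R c) + F x =
     h * (h * partial_deriv c (partial_deriv b F) (x + \<xi> *\<^sub>R b + \<eta> *\<^sub>R c))"
proof -
  have F1: "Ck_on B (Suc 0) U F" using F by (rule Ck_on_Suc_imp)
  have d: "((\<lambda>s. F (x + s *\<^sub>R b + t *\<^sub>R c)) has_real_derivative partial_deriv b F (x + s *\<^sub>R b + t *\<^sub>R c)) (at s)"
    if "0 \<le> s" "s \<le> h" "0 \<le> t" "t \<le> h" for s t
    using has_partial_shift[of F "x + t *\<^sub>R c" s b] Ck_on_has_partial[OF F1 bc(1) box[OF that]]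
    by (simp add: algebra_simps)
  have "\<exists>\<xi>. 0 < \<xi> \<and> \<xi> < h \<and>
      (F (x + h *\<^sub>R b + h *\<^sub>R c) - F (x + h *\<^sub>R b + 0 *\<^sub>R c)) - (F (x + 0 *\<^sub>R b + h *\<^sub>R c) - F (x + 0 *\<^sub>R b + 0 *\<^sub>R c)) =
      (h - 0) * (partial_deriv b F (x + \<xi> *\<^sub>R b + h *\<^sub>R c) - partial_deriv b F (x + \<xi> *\<^sub>R b + 0 *\<^sub>R c))"
    by (rule MVT2[OF h]) (rule DERIV_diff; rule d; use h in simp)
  then obtain \<xi> where \<xi>: "0 < \<xi>" "\<xi> < h" and 1:
      "F (x + h *\<^sub>R b + h *\<^sub>R c) - F (x + h *\<^sub>R b) - F (x + h *\<^sub>R c) + F x =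
       h * (partial_deriv b F (x + \<xi> *\<^sub>R b + h *\<^sub>R c) - partial_deriv b F (x + \<xi> *\<^sub>R b))"
    by (auto simp: algebra_simps)
  have "\<exists>\<eta>. 0 < \<eta> \<and> \<eta> < h \<and>
      partial_deriv b F (x + \<xi> *\<^sub>R b + h *\<^sub>R c) - partial_deriv b F (x + \<xi> *\<^sub>R b + 0 *\<^sub>R c) =
      (h - 0) * partial_deriv c (partial_deriv b F) (x + \<xi> *\<^sub>R b + \<eta> *\<^sub>R c)"
    by (rule MVT2[OF h])
      (use \<xi> in \<open>auto intro!: has_partial_shift Ck_on_has_partial[OF Ck_on_partial[OF F bc(1)] bc(2)] box\<close>)
  then show ?thesis using 1 \<xi> by auto
qed

text \<open>The second difference is symmetric in the two directions. Hence both mixed derivatives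
  take a common value, at possibly different points of an arbitrarily small box, and continuity
  brings both back to \<open>x\<close>.\<close>

lemma partial_deriv_commute:
  fixes F :: "'e::euclidean_space \<Rightarrow> real"
  assumes U: "relopen B U" and F: "Ck_on B (Suc (Suc 0)) U F" and bc: "b \<in> B" "c \<in> B" and x: "x \<in> U"
  shows "partial_deriv b (partial_deriv c F) x = partial_deriv c (partial_deriv b F) x"
proof -
  let ?P = "partial_deriv b (partial_deriv c F)" and ?Q = "partial_deriv c (partial_deriv b F)"
  have cont: "continuous_on U ?P" "continuous_on U ?Q" using F bc by auto
  have "\<bar>?P x - ?Q x\<bar> \<le> e" if "e > 0" for e
  proof -
    obtain d1 where d1: "d1 > 0" "\<And>y. y \<in> U \<Longrightarrow> dist y x < d1 \<Longrightarrow> dist (?P y) (?P x) < e / 2"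
      using cont(1) x \<open>e > 0\<close> unfolding continuous_on_iff by (meson half_gt_zero)
    obtain d2 where d2: "d2 > 0" "\<And>y. y \<in> U \<Longrightarrow> dist y x < d2 \<Longrightarrow> dist (?Q y) (?Q x) < e / 2"
      using cont(2) x \<open>e > 0\<close> unfolding continuous_on_iff by (meson half_gt_zero)
    obtain T where T: "open T" "U = span B \<inter> T" using U by (metis openin_open)
    obtain d0 where d0: "d0 > 0" "ball x d0 \<subseteq> T" using T x by (meson IntE openE)
    define d where "d = min d0 (min d1 d2)"
    \<comment> \<open>With this side length the whole box lies within \<open>d / 2\<close> of
      \<open>x\<close>; the added 1 avoids a zero denominator.\<close>
    define h where "h = d / (2 * (norm b + norm c + 1))"
    have n: "norm b + norm c + 1 > 0" by (intro add_nonneg_pos) auto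
    have d: "d > 0" using d0 d1 d2 by (simp add: d_def)
    then have h: "h > 0" using n by (simp add: h_def)
    have small: "norm (s *\<^sub>R b + t *\<^sub>R c) < d" if "0 \<le> s" "s \<le> h" "0 \<le> t" "t \<le> h" for s t
    proof -
      have "norm (s *\<^sub>R b + t *\<^sub>R c) \<le> s * norm b + t * norm c"
        using that norm_triangle_ineq[of "s *\<^sub>R b" "t *\<^sub>R c"] by simp
      also have "\<dots> \<le> h * norm b + h * norm c"
        using that by (intro add_mono mult_right_mono) auto
      also have "\<dots> \<le> h * (norm b + norm c + 1)" using h by (simp add: algebra_simps)
      also have "\<dots> = d / 2" using n by (simp add: h_def divide_simps)
      finally show ?thesis using d by simp
    qed
    have xs: "x \<in> span B" using x T by auto
    have mem: "x + s *\<^sub>R b + t *\<^sub>R c \<in> U" if "0 \<le> s" "s \<le> h" "0 \<le> t" "t \<le> h" for s t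
    proof -
      have "x + (s *\<^sub>R b + t *\<^sub>R c) \<in> ball x d0"
        using small[OF that] by (simp add: dist_norm d_def del: minus_add_distrib)
      then have "x + s *\<^sub>R b + t *\<^sub>R c \<in> T" using d0 by (auto simp: add.assoc)
      moreover have "x + s *\<^sub>R b + t *\<^sub>R c \<in> span B"
        using xs bc by (intro span_add span_mul) (auto intro: span_base)
      ultimately show ?thesis using T by auto
    qed
    have dst: "dist (x + s *\<^sub>R b + t *\<^sub>R c) x < d" if "0 \<le> s" "s \<le> h" "0 \<le> t" "t \<le> h" for s t
      using small[OF that] by (simp add: dist_norm add.assoc)
    obtain \<xi> \<eta> where 1: "0 < \<xi>" "\<xi> < h" "0 < \<eta>" "\<eta> < h"
      "F (x + h *\<^sub>R b + h *\<^sub>R c) - F (x + h *\<^sub>R b) - F (x + h *\<^sub>R c) + F x = h * (h * ?Q (x + \<xi> *\<^sub>R b + \<eta> *\<^sub>R c))"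
      using mixed_difference[OF F bc h mem] by blast
    have mem': "x + s *\<^sub>R c + t *\<^sub>R b \<in> U" if "0 \<le> s" "s \<le> h" "0 \<le> t" "t \<le> h" for s t
      using mem[OF that(3,4,1,2)] by (simp add: algebra_simps)
    obtain \<xi>' \<eta>' where 2: "0 < \<xi>'" "\<xi>' < h" "0 < \<eta>'" "\<eta>' < h"
      "F (x + h *\<^sub>R c + h *\<^sub>R b) - F (x + h *\<^sub>R c) - F (x + h *\<^sub>R b) + F x = h * (h * ?P (x + \<xi>' *\<^sub>R c + \<eta>' *\<^sub>R b))"
      using mixed_difference[OF F bc(2,1) h mem'] by blast
    have "h * (h * ?Q (x + \<xi> *\<^sub>R b + \<eta> *\<^sub>R c)) = h * (h * ?P (x + \<eta>' *\<^sub>R b + \<xi>' *\<^sub>R c))"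
      using 1(5) 2(5) by (simp add: algebra_simps)
    then have "?Q (x + \<xi> *\<^sub>R b + \<eta> *\<^sub>R c) = ?P (x + \<eta>' *\<^sub>R b + \<xi>' *\<^sub>R c)"
      using h by simp
    moreover have "dist (?Q (x + \<xi> *\<^sub>R b + \<eta> *\<^sub>R c)) (?Q x) < e / 2"
      using 1 dst[of \<xi> \<eta>] by (intro d2 mem) (auto simp: d_def)
    moreover have "dist (?P (x + \<eta>' *\<^sub>R b + \<xi>' *\<^sub>R c)) (?P x) < e / 2"
      using 2 dst[of \<eta>' \<xi>'] by (intro d1 mem) (auto simp: d_def)
    ultimately show ?thesis unfolding dist_real_def by linarith
  qed
  then have "?P x - ?Q x = 0" by (rule dense_eq0_I)
  then show ?thesis by simp
qed

subsection \<open>Smooth functions\<close>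

lemma smooth_on_Ck: "smooth_on B U F \<Longrightarrow> Ck_on B k U F"
  by (simp add: smooth_on_def)

lemma smooth_on_imp_continuous_on: "smooth_on B U F \<Longrightarrow> continuous_on U F"
  using Ck_on_imp_continuous_on smooth_on_Ck by blast

lemma smooth_on_subset: "smooth_on B U F \<Longrightarrow> V \<subseteq> U \<Longrightarrow> smooth_on B V F"
  by (auto simp: smooth_on_def intro: Ck_on_subset)

lemma smooth_on_cong:
  "relopen B U \<Longrightarrow> (\<And>y. y \<in> U \<Longrightarrow> F y = G y) \<Longrightarrow> smooth_on B U F \<Longrightarrow> smooth_on B U G"
  by (auto simp: smooth_on_def intro: Ck_on_cong)

lemma smooth_on_partial: "smooth_on B U F \<Longrightarrow> b \<in> B \<Longrightarrow> smooth_on B U (partial_deriv b F)"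
  unfolding smooth_on_def using Ck_on_partial by blast

lemma smooth_on_const: "relopen B U \<Longrightarrow> smooth_on B U (\<lambda>x. c)"
  and smooth_on_inner: "relopen B U \<Longrightarrow> smooth_on B U (\<lambda>x. x \<bullet> v)"
  and smooth_on_add: "relopen B U \<Longrightarrow> smooth_on B U F \<Longrightarrow> smooth_on B U G \<Longrightarrow> smooth_on B U (\<lambda>x. F x + G x)"
  and smooth_on_diff: "relopen B U \<Longrightarrow> smooth_on B U F \<Longrightarrow> smooth_on B U G \<Longrightarrow> smooth_on B U (\<lambda>x. F x - G x)"
  and smooth_on_mult: "relopen B U \<Longrightarrow> smooth_on B U F \<Longrightarrow> smooth_on B U G \<Longrightarrow> smooth_on B U (\<lambda>x. F x * G x)"
  and smooth_on_sum: "relopen B U \<Longrightarrow> (\<And>i. i \<in> I \<Longrightarrow> smooth_on B U (H i)) \<Longrightarrow> smooth_on B U (\<lambda>x. \<Sum>i\<in>I. H i x)"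
  and smooth_on_inverse: "relopen B U \<Longrightarrow> smooth_on B U F \<Longrightarrow> (\<And>x. x \<in> U \<Longrightarrow> F x \<noteq> 0) \<Longrightarrow>
    smooth_on B U (\<lambda>x. inverse (F x))"
  and smooth_on_sqrt: "relopen B U \<Longrightarrow> smooth_on B U F \<Longrightarrow> (\<And>x. x \<in> U \<Longrightarrow> F x > 0) \<Longrightarrow>
    smooth_on B U (\<lambda>x. sqrt (F x))"
  by (simp_all add: smooth_on_def Ck_on_const Ck_on_inner Ck_on_add Ck_on_diff Ck_on_mult Ck_on_sum
      Ck_on_inverse Ck_on_sqrt)

lemma smooth_on_compose:
  fixes F :: "'e::euclidean_space \<Rightarrow> real" and G :: "'d::euclidean_space \<Rightarrow> 'e"
  assumes "B \<subseteq> Basis" "relopen B V" "relopen C U" "smooth_on B V F"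
    and "\<And>b. b \<in> B \<Longrightarrow> smooth_on C U (\<lambda>x. G x \<bullet> b)" "\<And>x. x \<in> U \<Longrightarrow> G x \<in> V"
  shows "smooth_on C U (\<lambda>x. F (G x))"
  unfolding smooth_on_def
  by (intro allI, rule Ck_on_compose[OF assms(1-3) smooth_on_Ck[OF assms(4)] smooth_on_Ck[OF assms(5)] assms(6)])

lemma smooth_on_has_partial:
  "smooth_on B U F \<Longrightarrow> b \<in> B \<Longrightarrow> x \<in> U \<Longrightarrow>
   ((\<lambda>s. F (x + s *\<^sub>R b)) has_real_derivative partial_deriv b F x) (at 0)"
  by (rule Ck_on_has_partial[OF smooth_on_Ck])

lemma partial_deriv_compose:
  fixes F :: "'e::euclidean_space \<Rightarrow> real" and G :: "'d::euclidean_space \<Rightarrow> 'e"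
  assumes "B \<subseteq> Basis" "relopen B V" "relopen C U" "smooth_on B V F"
    and "\<And>b. b \<in> B \<Longrightarrow> smooth_on C U (\<lambda>x. G x \<bullet> b)" "\<And>x. x \<in> U \<Longrightarrow> G x \<in> V" "x \<in> U" "c \<in> C"
  shows "partial_deriv c (\<lambda>x. F (G x)) x =
    (\<Sum>b\<in>B. partial_deriv b F (G x) * partial_deriv c (\<lambda>x. G x \<bullet> b) x)"
  by (rule partial_deriv_eqI)
    (rule has_partial_compose[OF assms(1-3) smooth_on_Ck[OF assms(4)] smooth_on_Ck[OF assms(5)] assms(6-8)])

lemma partial_deriv_inner: "partial_deriv b (\<lambda>x. x \<bullet> v) x = b \<bullet> v"
  by (rule partial_deriv_eqI) (auto intro!: derivative_eq_intros simp: inner_add_left)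

lemma partial_deriv_mult:
  assumes "smooth_on B U F" "smooth_on B U G" "b \<in> B" "x \<in> U"
  shows "partial_deriv b (\<lambda>x. F x * G x) x = partial_deriv b F x * G x + F x * partial_deriv b G x"
  by (rule partial_deriv_eqI)
    (use DERIV_mult[OF smooth_on_has_partial[OF assms(1,3,4)] smooth_on_has_partial[OF assms(2,3,4)]] in
      \<open>simp add: mult.commute\<close>)

lemma partial_deriv_sum:
  assumes "\<And>i. i \<in> I \<Longrightarrow> smooth_on B U (F i)" "b \<in> B" "x \<in> U"
  shows "partial_deriv b (\<lambda>x. \<Sum>i\<in>I. F i x) x = (\<Sum>i\<in>I. partial_deriv b (F i) x)"
  by (rule partial_deriv_eqI) (intro DERIV_sum smooth_on_has_partial[OF assms(1)] assms)

lemma smooth_on_has_derivative: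
  fixes F :: "'e::euclidean_space \<Rightarrow> real"
  assumes "open U" "smooth_on Basis U F" "x \<in> U"
  shows "(F has_derivative (\<lambda>h. \<Sum>b\<in>Basis. (h \<bullet> b) * partial_deriv b F x)) (at x)"
  using has_derivative_of_partials[OF subset_refl _ assms(3) smooth_on_Ck[OF assms(2)]] assms(1)
  by (simp add: at_within_open[OF assms(3,1)])

lemma smooth_on_curve:
  fixes F :: "'e::euclidean_space \<Rightarrow> real"
  assumes "open U" "smooth_on Basis U F" "\<gamma> t \<in> U" "(\<gamma> has_vector_derivative v) (at t)"
  shows "((\<lambda>t. F (\<gamma> t)) has_real_derivative (\<Sum>b\<in>Basis. (v \<bullet> b) * partial_deriv b F (\<gamma> t))) (at t)"
proof -
  have "((\<lambda>t. F (\<gamma> t)) has_derivative (\<lambda>s. \<Sum>b\<in>Basis. ((s *\<^sub>R v) \<bullet> b) * partial_deriv b F (\<gamma> t))) (at t)"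
    using has_derivative_compose[OF assms(4)[unfolded has_vector_derivative_def]
        smooth_on_has_derivative[OF assms(1-3)]] .
  also have "(\<lambda>s. \<Sum>b\<in>Basis. ((s *\<^sub>R v) \<bullet> b) * partial_deriv b F (\<gamma> t)) =
      (*) (\<Sum>b\<in>Basis. (v \<bullet> b) * partial_deriv b F (\<gamma> t))"
    by (intro ext, unfold sum_distrib_right, intro sum.cong refl) simp
  finally show ?thesis unfolding has_field_derivative_def .
qed

section \<open>Ordinary differential equations\<close>

text \<open>The squared norm is used because it is differentiable also where \<open>d\<close>
  vanishes. The cross term with \<open>\<eta>\<close> is absorbed by
  \<open>2ab \<le> a\<^sup>2 + b\<^sup>2\<close>, which is where the 1 in the rate
  \<open>2 * L + 1\<close> comes from.\<close>

lemma gronwall_forward: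
  fixes d :: "real \<Rightarrow> 'e::real_inner"
  assumes "0 \<le> L" "0 \<le> t"
    and d: "\<And>s. 0 \<le> s \<Longrightarrow> s \<le> t \<Longrightarrow> (d has_vector_derivative d' s) (at s)"
    and bd: "\<And>s. 0 \<le> s \<Longrightarrow> s \<le> t \<Longrightarrow> norm (d' s) \<le> L * norm (d s) + \<eta>"
  shows "(norm (d t))\<^sup>2 \<le> exp ((2 * L + 1) * t) * ((norm (d 0))\<^sup>2 + \<eta>\<^sup>2 * t)"
proof -
  define K where "K = 2 * L + 1"
  have K: "K \<ge> 0" using assms by (simp add: K_def)
  define v where "v s = exp (- K * s) * (d s \<bullet> d s) - \<eta>\<^sup>2 * s" for s
  have "v t \<le> v 0"
  proof (rule DERIV_nonpos_imp_nonincreasing[OF assms(2)])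
    fix s assume s: "0 \<le> s" "s \<le> t"
    have "((\<lambda>s. d s \<bullet> d s) has_real_derivative 2 * (d s \<bullet> d' s)) (at s)"
      using bounded_bilinear.has_vector_derivative[OF bounded_bilinear_inner d[OF s] d[OF s]]
      by (simp add: has_real_derivative_iff_has_vector_derivative inner_commute)
    then have D: "(v has_real_derivative
        exp (- K * s) * (2 * (d s \<bullet> d' s)) + (- K * exp (- K * s)) * (d s \<bullet> d s) - \<eta>\<^sup>2) (at s)"
      unfolding v_def by (auto intro!: derivative_eq_intros)
    have "2 * (d s \<bullet> d' s) \<le> 2 * (norm (d s) * norm (d' s))"
      using norm_cauchy_schwarz[of "d s" "d' s"] by simp
    also have "\<dots> \<le> 2 * (norm (d s) * (L * norm (d s) + \<eta>))"
      by (intro mult_left_mono bd s) auto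
    also have "\<dots> \<le> K * (d s \<bullet> d s) + \<eta>\<^sup>2"
      using sum_squares_bound[of "norm (d s)" \<eta>]
      by (simp add: K_def power2_norm_eq_inner[symmetric] power2_eq_square algebra_simps)
    finally have "2 * (d s \<bullet> d' s) - K * (d s \<bullet> d s) \<le> \<eta>\<^sup>2" by simp
    then have "exp (- K * s) * (2 * (d s \<bullet> d' s) - K * (d s \<bullet> d s)) \<le> exp (- K * s) * \<eta>\<^sup>2"
      by (intro mult_left_mono) auto
    also have "\<dots> \<le> 1 * \<eta>\<^sup>2" using K s by (intro mult_right_mono) auto
    finally show "\<exists>y. (v has_real_derivative y) (at s) \<and> y \<le> 0"
      by (intro exI[of _ "exp (- K * s) * (2 * (d s \<bullet> d' s)) + (- K * exp (- K * s)) * (d s \<bullet> d s) - \<eta>\<^sup>2"] conjI D)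
        (simp add: algebra_simps)
  qed
  then have "exp (- K * t) * (norm (d t))\<^sup>2 \<le> (norm (d 0))\<^sup>2 + \<eta>\<^sup>2 * t"
    by (simp add: v_def power2_norm_eq_inner)
  then have "exp (K * t) * (exp (- K * t) * (norm (d t))\<^sup>2) \<le> exp (K * t) * ((norm (d 0))\<^sup>2 + \<eta>\<^sup>2 * t)"
    by (intro mult_left_mono) auto
  moreover have "exp (K * t) * (exp (- K * t) * x) = x" for x :: real
    by (simp add: mult.assoc[symmetric] exp_add[symmetric])
  ultimately show ?thesis unfolding K_def[symmetric] by (simp only:)
qed

lemma gronwall:
  fixes d :: "real \<Rightarrow> 'e::real_inner"
  assumes L: "0 \<le> L" and t: "\<bar>t\<bar> < T"
    and d: "\<And>s. \<bar>s\<bar> < T \<Longrightarrow> (d has_vector_derivative d' s) (at s)"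
    and bd: "\<And>s. \<bar>s\<bar> < T \<Longrightarrow> norm (d' s) \<le> L * norm (d s) + \<eta>"
  shows "(norm (d t))\<^sup>2 \<le> exp ((2 * L + 1) * T) * ((norm (d 0))\<^sup>2 + \<eta>\<^sup>2 * T)"
proof -
  have "(norm (d t))\<^sup>2 \<le> exp ((2 * L + 1) * \<bar>t\<bar>) * ((norm (d 0))\<^sup>2 + \<eta>\<^sup>2 * \<bar>t\<bar>)"
  proof (cases "t \<ge> 0")
    case True
    then show ?thesis using gronwall_forward[of L t d d' \<eta>] assms by auto
  next
    \<comment> \<open>Reversing time reduces this to the forward estimate.\<close>
    case False
    have "((\<lambda>s. d (- s)) has_vector_derivative - d' (- s)) (at s)" if "0 \<le> s" "s \<le> - t" for s
    proof -
      have "(uminus has_vector_derivative - 1) (at s)"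
        using has_vector_derivative_minus[OF has_vector_derivative_id] by simp
      then show ?thesis
        using vector_diff_chain_at[of uminus "-1" s d "d' (-s)"] d[of "-s"] that t by (auto simp: o_def)
    qed
    then show ?thesis
      using gronwall_forward[of L "-t" "\<lambda>s. d (-s)" "\<lambda>s. - d' (-s)" \<eta>] False L t bd by auto
  qed
  also have "\<dots> \<le> exp ((2 * L + 1) * T) * ((norm (d 0))\<^sup>2 + \<eta>\<^sup>2 * T)"
    using t L by (intro mult_mono add_left_mono mult_left_mono) auto
  finally show ?thesis .
qed

text \<open>The common source of continuity and of differentiability in parameters:
  \<open>d s\<close> is a difference of solutions, or a difference quotient minus its expected
  limit, and \<open>e s\<close> is the error in the equation it satisfies.\<close>

lemma gronwall_limit:
  fixes d :: "'i \<Rightarrow> real \<Rightarrow> 'e::real_inner" and e :: "'i \<Rightarrow> real \<Rightarrow> 'f::real_normed_vector"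
  assumes L: "0 \<le> L" and T: "0 < T"
    and d: "\<forall>\<^sub>F s in F. \<forall>t\<in>{-T<..<T}. \<exists>D. (d s has_vector_derivative D) (at t) \<and>
        norm D \<le> L * norm (d s t) + norm (e s t)"
    and e: "uniform_limit {-T<..<T} e (\<lambda>_. 0) F"
    and 0: "((\<lambda>s. d s 0) \<longlongrightarrow> 0) F"
  shows "uniform_limit {-T<..<T} d (\<lambda>_. 0) F"
proof (rule uniform_limitI)
  fix \<epsilon> :: real assume \<epsilon>: "\<epsilon> > 0"
  define K where "K = exp ((2 * L + 1) * T)"
  have K: "K > 0" by (simp add: K_def)
  \<comment> \<open>Gronwall bounds the norm by
    \<open>sqrt (K * (\<delta>\<^sup>2 + \<delta>\<^sup>2 * T))\<close>, which is at most
    \<open>\<delta> * (sqrt K * (1 + sqrt T))\<close>; this choice makes the latter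
    \<open>\<epsilon> / 2\<close>.\<close>
  define \<delta> where "\<delta> = \<epsilon> / (2 * (sqrt K * (1 + sqrt T)))"
  have pos: "sqrt K * (1 + sqrt T) > 0" using K T by (intro mult_pos_pos add_pos_pos) auto
  have \<delta>: "\<delta> > 0" using \<epsilon> pos by (simp add: \<delta>_def)
  have "K * (\<delta>\<^sup>2 + \<delta>\<^sup>2 * T) \<le> (\<delta> * (sqrt K * (1 + sqrt T)))\<^sup>2"
    using K T \<delta> by (simp add: power_mult_distrib power2_sum algebra_simps)
  also have "\<delta> * (sqrt K * (1 + sqrt T)) = \<epsilon> / 2" using pos by (simp add: \<delta>_def field_simps)
  also have "(\<epsilon> / 2)\<^sup>2 < \<epsilon>\<^sup>2" using \<epsilon> by (simp add: power2_eq_square)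
  finally have *: "K * (\<delta>\<^sup>2 + \<delta>\<^sup>2 * T) < \<epsilon>\<^sup>2" .
  have "\<forall>\<^sub>F s in F. norm (d s 0) < \<delta>"
    using tendstoD[OF 0 \<delta>] by simp
  then show "\<forall>\<^sub>F s in F. \<forall>t\<in>{-T<..<T}. dist (d s t) 0 < \<epsilon>"
    using d uniform_limitD[OF e \<delta>]
  proof eventually_elim
    case (elim s)
    show ?case
    proof
      fix t assume t: "t \<in> {-T<..<T}"
      obtain D where D: "\<And>t. t \<in> {-T<..<T} \<Longrightarrow> (d s has_vector_derivative D t) (at t)"
        "\<And>t. t \<in> {-T<..<T} \<Longrightarrow> norm (D t) \<le> L * norm (d s t) + norm (e s t)"
        using elim(2) by metis
      have bd: "norm (D t) \<le> L * norm (d s t) + \<delta>" if "\<bar>t\<bar> < T" for t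
      proof -
        have "t \<in> {-T<..<T}" using that by auto
        then show ?thesis using D(2)[of t] elim(3) by force
      qed
      have "(norm (d s t))\<^sup>2 \<le> K * ((norm (d s 0))\<^sup>2 + \<delta>\<^sup>2 * T)"
        unfolding K_def using t by (intro gronwall[OF L, where d'=D] D(1) bd) auto
      also have "\<dots> \<le> K * (\<delta>\<^sup>2 + \<delta>\<^sup>2 * T)"
        using K elim(1) \<delta> by (intro mult_left_mono add_right_mono power_mono) auto
      also note *
      finally show "dist (d s t) 0 < \<epsilon>"
        using \<epsilon> by (simp add: power2_less_imp_less)
    qed
  qed
qed

text \<open>The Lipschitz bound is asked only along the two given solutions, so \<open>F\<close> may
  behave arbitrarily elsewhere.\<close>

lemma ode_unique:
  fixes u v :: "real \<Rightarrow> 'e::real_inner"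
  assumes L: "0 \<le> L" and t: "\<bar>t\<bar> < T"
    and u: "\<And>s. \<bar>s\<bar> < T \<Longrightarrow> (u has_vector_derivative F s (u s)) (at s)"
    and v: "\<And>s. \<bar>s\<bar> < T \<Longrightarrow> (v has_vector_derivative F s (v s)) (at s)"
    and lip: "\<And>s. \<bar>s\<bar> < T \<Longrightarrow> norm (F s (u s) - F s (v s)) \<le> L * norm (u s - v s)"
    and 0: "u 0 = v 0"
  shows "u t = v t"
proof -
  have "(norm (u t - v t))\<^sup>2 \<le> exp ((2 * L + 1) * T) * ((norm (u 0 - v 0))\<^sup>2 + 0\<^sup>2 * T)"
    by (rule gronwall[OF L t, where d'="\<lambda>s. F s (u s) - F s (v s)"])
      (auto intro!: has_vector_derivative_diff u v lip)
  then show ?thesis using 0 by simp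
qed

section \<open>Existence of solutions by contraction\<close>

lemma vector_derivative_lipschitz:
  fixes f :: "real \<Rightarrow> 'e::real_normed_vector"
  assumes "convex S" "\<And>x. x \<in> S \<Longrightarrow> (f has_vector_derivative f' x) (at x within S)"
    and "\<And>x. x \<in> S \<Longrightarrow> norm (f' x) \<le> B" "x \<in> S" "y \<in> S"
  shows "norm (f x - f y) \<le> B * norm (x - y)"
proof (rule differentiable_bound[OF assms(1) assms(2)[unfolded has_vector_derivative_def] _ assms(4,5)])
  fix x assume x: "x \<in> S"
  show "onorm (\<lambda>h. h *\<^sub>R f' x) \<le> B"
    by (rule onorm_le) (use assms(3)[OF x] in \<open>auto simp: mult.commute[of B] intro!: mult_left_mono\<close>)
qed

text \<open>Picard's integral operator is a contraction in the supremum norm: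
  \<open>T * L \<le> 1 / 2\<close> is exactly what yields the factor 1/2. The global Lipschitz bound
  gives existence on the whole prescribed interval.\<close>

lemma ode_exists_closed:
  fixes F :: "real \<Rightarrow> 'e::euclidean_space \<Rightarrow> 'e"
  assumes T: "0 < T" and L: "0 \<le> L" "T * L \<le> 1 / 2"
    and F: "continuous_on ({-T..T} \<times> UNIV) (\<lambda>(t, u). F t u)"
    and lip: "\<And>t u v. t \<in> {-T..T} \<Longrightarrow> norm (F t u - F t v) \<le> L * norm (u - v)"
  shows "\<exists>u. u 0 = x0 \<and> (\<forall>t\<in>{-T..T}. (u has_vector_derivative F t (u t)) (at t within {-T..T}))"
proof -
  \<comment> \<open>Clamping time to the interval makes the Picard image a bounded continuous
    function on the whole line, so the fixed point theorem applies to the complete space of such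
    functions.\<close>
  define cl where "cl t = max (-T) (min T t)" for t :: real
  have cl: "cl t \<in> {-T..T}" "t \<in> {-T..T} \<Longrightarrow> cl t = t" for t using T by (auto simp: cl_def)
  have contcl: "continuous_on UNIV cl" unfolding cl_def by (intro continuous_intros)
  define I where "I u t = integral {-T..t} (\<lambda>s. F s (u s))" for u t
  define P where "P u t = x0 + (I u (cl t) - I u 0)" for u t
  have contF: "continuous_on {-T..T} (\<lambda>s. F s (u s))" if "continuous_on UNIV u" for u
  proof -
    have "continuous_on {-T..T} (\<lambda>s. (s, u s))"
      by (intro continuous_on_Pair continuous_on_id continuous_on_subset[OF that]) auto
    then show ?thesis
      using continuous_on_compose2[OF F, of "{-T..T}" "\<lambda>s. (s, u s)"] by auto
  qed
  have dI: "(I u has_vector_derivative F t (u t)) (at t within {-T..T})"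
    if "continuous_on UNIV u" "t \<in> {-T..T}" for u t
    unfolding I_def by (rule integral_has_vector_derivative[OF contF[OF that(1)] that(2)])
  have contP: "continuous_on UNIV (P u)" if "continuous_on UNIV u" for u
  proof -
    have "continuous_on {-T..T} (I u)"
      using has_vector_derivative_continuous[OF dI[OF that]] by (simp add: continuous_on_eq_continuous_within)
    then show ?thesis unfolding P_def
      by (intro continuous_intros continuous_on_compose2[OF _ contcl]) (use cl in auto)
  qed
  have "P u \<in> bcontfun" if "continuous_on UNIV u" for u
  proof -
    have "range (P u) \<subseteq> P u ` {-T..T}"
    proof
      fix y assume "y \<in> range (P u)"
      then obtain t where "y = P u t" by auto
      also have "P u t = P u (cl t)" using cl by (simp add: P_def)
      finally show "y \<in> P u ` {-T..T}" using cl by auto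
    qed
    moreover have "bounded (P u ` {-T..T})"
      using contP[OF that] by (intro compact_imp_bounded compact_continuous_image) (auto intro: continuous_on_subset)
    ultimately show ?thesis using contP[OF that] by (auto simp: bcontfun_def intro: bounded_subset)
  qed
  then have ap: "apply_bcontfun (Bcontfun (P u)) = P u" if "continuous_on UNIV u" for u
    using that by (simp add: Bcontfun_inverse)
  define Q :: "(real \<Rightarrow>\<^sub>C 'e) \<Rightarrow> (real \<Rightarrow>\<^sub>C 'e)" where "Q u = Bcontfun (P (apply_bcontfun u))" for u
  have Q: "apply_bcontfun (Q u) = P (apply_bcontfun u)" for u by (simp add: Q_def ap)
  have "dist (Q u) (Q v) \<le> 1 / 2 * dist u v" for u v
  proof (rule dist_bound)
    fix t
    let ?D = "\<lambda>t. I (apply_bcontfun u) t - I (apply_bcontfun v) t"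
    have "norm (?D (cl t) - ?D 0) \<le> (L * dist u v) * norm (cl t - 0)"
    proof (rule vector_derivative_lipschitz[where S="{-T..T}"])
      fix s assume s: "s \<in> {-T..T}"
      show "(?D has_vector_derivative (F s (u s) - F s (v s))) (at s within {-T..T})"
        by (intro has_vector_derivative_diff dI s) auto
      have "norm (F s (u s) - F s (v s)) \<le> L * norm (u s - v s)" by (rule lip[OF s])
      also have "\<dots> \<le> L * dist u v" using dist_bounded[of u s v] L by (intro mult_left_mono) (auto simp: dist_norm)
      finally show "norm (F s (u s) - F s (v s)) \<le> L * dist u v" .
    qed (use cl T in auto)
    also have "\<dots> \<le> (L * dist u v) * T" using cl[of t] L by (intro mult_left_mono) (auto simp: abs_le_iff)
    also have "\<dots> = (T * L) * dist u v" by simp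
    also have "\<dots> \<le> 1 / 2 * dist u v" using L by (intro mult_right_mono) auto
    finally show "dist (Q u t) (Q v t) \<le> 1 / 2 * dist u v"
      by (simp add: Q P_def dist_norm algebra_simps)
  qed
  then obtain u where u: "Q u = u"
    using banach_fix_type[of "1/2" Q] by auto
  then have eq: "apply_bcontfun u t = P (apply_bcontfun u) t" for t using Q by metis
  show ?thesis
  proof (intro exI[of _ "apply_bcontfun u"] conjI ballI)
    show "apply_bcontfun u 0 = x0" using T by (subst eq) (simp add: P_def cl)
    fix t assume t: "t \<in> {-T..T}"
    have "((\<lambda>t. x0 + (I (apply_bcontfun u) t - I (apply_bcontfun u) 0)) has_vector_derivative F t (u t)) (at t within {-T..T})"
      by (auto intro!: derivative_eq_intros dI t)
    then show "(apply_bcontfun u has_vector_derivative F t (u t)) (at t within {-T..T})"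
      by (rule has_vector_derivative_transform[OF t, rotated])
        (subst eq, simp add: P_def cl)
  qed
qed

text \<open>Coefficients obtained from a flow are continuous only on the open time interval.
  Solutions on smaller closed intervals agree by uniqueness and are glued.\<close>

lemma ode_exists:
  fixes F :: "real \<Rightarrow> 'e::euclidean_space \<Rightarrow> 'e"
  assumes T: "0 < T" and L: "0 \<le> L" "T * L \<le> 1 / 2"
    and F: "continuous_on ({-T<..<T} \<times> UNIV) (\<lambda>(t, u). F t u)"
    and lip: "\<And>t u v. t \<in> {-T<..<T} \<Longrightarrow> norm (F t u - F t v) \<le> L * norm (u - v)"
  shows "\<exists>u. u 0 = x0 \<and> (\<forall>t\<in>{-T<..<T}. (u has_vector_derivative F t (u t)) (at t))"
proof -
  have "\<exists>u. u 0 = x0 \<and> (\<forall>t. \<bar>t\<bar> < S \<longrightarrow> (u has_vector_derivative F t (u t)) (at t))"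
    if S: "0 < S" "S < T" for S
  proof -
    have "\<exists>u. u 0 = x0 \<and> (\<forall>t\<in>{-S..S}. (u has_vector_derivative F t (u t)) (at t within {-S..S}))"
    proof (rule ode_exists_closed[OF S(1) L(1)])
      have "S * L \<le> T * L" using S L by (intro mult_right_mono) auto
      then show "S * L \<le> 1 / 2" using L by simp
      show "continuous_on ({- S..S} \<times> UNIV) (\<lambda>(t, u). F t u)"
        by (rule continuous_on_subset[OF F]) (use S in auto)
      show "\<And>t u v. t \<in> {- S..S} \<Longrightarrow> norm (F t u - F t v) \<le> L * norm (u - v)" using S by (intro lip) auto
    qed
    then obtain u where u: "u 0 = x0" "\<And>t. t \<in> {-S..S} \<Longrightarrow> (u has_vector_derivative F t (u t)) (at t within {-S..S})"
      by blast
    have "(u has_vector_derivative F t (u t)) (at t)" if "\<bar>t\<bar> < S" for t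
    proof -
      have "(u has_vector_derivative F t (u t)) (at t within {-S<..<S})"
        by (rule has_vector_derivative_within_subset[OF u(2)]) (use that in auto)
      moreover have "t \<in> {-S<..<S}" using that by auto
      ultimately show ?thesis by (simp only: at_within_open[OF _ open_greaterThanLessThan])
    qed
    then show ?thesis using u by auto
  qed
  then obtain U where U: "\<And>S. 0 < S \<Longrightarrow> S < T \<Longrightarrow> U S 0 = x0"
    "\<And>S t. 0 < S \<Longrightarrow> S < T \<Longrightarrow> \<bar>t\<bar> < S \<Longrightarrow> (U S has_vector_derivative F t (U S t)) (at t)" by metis
  have eq: "U S t = U S' t" if "0 < S" "S < T" "0 < S'" "S' < T" "\<bar>t\<bar> < S" "\<bar>t\<bar> < S'" for S S' t
  proof (rule ode_unique[where T="min S S'" and F=F and L=L])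
    fix s assume "\<bar>s\<bar> < min S S'"
    then show "(U S has_vector_derivative F s (U S s)) (at s)" "(U S' has_vector_derivative F s (U S' s)) (at s)"
      "norm (F s (U S s) - F s (U S' s)) \<le> L * norm (U S s - U S' s)"
      using that U(2)[of S s] U(2)[of S' s] by (auto intro!: lip)
  qed (use that U(1) L in auto)
  \<comment> \<open>The midpoint of \<open>|t|\<close> and \<open>T\<close>: at each time the
    solution is read off from an interval that still contains a neighbourhood of that time.\<close>
  define R where "R t = (\<bar>t\<bar> + T) / 2" for t
  have R: "0 < R t" "R t < T" "\<bar>t\<bar> < R t" if "\<bar>t\<bar> < T" for t using that by (auto simp: R_def)
  show ?thesis
  proof (intro exI[of _ "\<lambda>t. U (R t) t"] conjI ballI)
    show "U (R 0) 0 = x0" using U R T by simp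
    fix t assume "t \<in> {-T<..<T}"
    then have t: "\<bar>t\<bar> < T" by auto
    have "(U (R t) has_vector_derivative F t (U (R t) t)) (at t)" using U R t by simp
    then show "((\<lambda>t. U (R t) t) has_vector_derivative F t (U (R t) t)) (at t)"
      by (rule has_vector_derivative_transform_within_open[where S="{-R t<..<R t}"])
        (use R[OF t] in \<open>auto intro!: eq R\<close>)
  qed
qed

subsection \<open>Smooth dependence on parameters\<close>

text \<open>Matrices are families of real coefficients indexed by \<open>Basis\<close>, so that
  regularity of a matrix function is \<open>Ck_on\<close> of each coefficient.\<close>

definition matvec :: "('e::euclidean_space \<Rightarrow> 'e \<Rightarrow> real) \<Rightarrow> 'e \<Rightarrow> 'e" where
  "matvec a v = (\<Sum>i\<in>Basis. (\<Sum>j\<in>Basis. a i j * (v \<bullet> j)) *\<^sub>R i)"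

lemma matvec_inner: "i \<in> Basis \<Longrightarrow> matvec a v \<bullet> i = (\<Sum>j\<in>Basis. a i j * (v \<bullet> j))"
  by (simp add: matvec_def inner_sum_left_Basis)

lemma matvec_diff: "matvec a u - matvec a v = matvec a (u - v)"
  by (simp add: matvec_def inner_diff_left algebra_simps sum_subtractf)

lemma norm_matvec_le: "norm (matvec a v) \<le> (\<Sum>i\<in>Basis. \<Sum>j\<in>Basis. \<bar>a i j\<bar>) * norm v"
proof -
  have "norm (matvec a v) \<le> (\<Sum>i\<in>Basis. norm ((\<Sum>j\<in>Basis. a i j * (v \<bullet> j)) *\<^sub>R i))"
    unfolding matvec_def by (rule norm_sum)
  also have "\<dots> \<le> (\<Sum>i\<in>Basis. (\<Sum>j\<in>Basis. \<bar>a i j\<bar>) * norm v)"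
  proof (rule sum_mono)
    fix i :: 'a assume i: "i \<in> Basis"
    have "norm ((\<Sum>j\<in>Basis. a i j * (v \<bullet> j)) *\<^sub>R i) \<le> (\<Sum>j\<in>Basis. \<bar>a i j * (v \<bullet> j)\<bar>)"
      using i by (simp add: sum_abs)
    also have "\<dots> \<le> (\<Sum>j\<in>Basis. \<bar>a i j\<bar> * norm v)"
      by (intro sum_mono) (auto simp: abs_mult intro!: mult_left_mono Basis_le_norm)
    finally show "norm ((\<Sum>j\<in>Basis. a i j * (v \<bullet> j)) *\<^sub>R i) \<le> (\<Sum>j\<in>Basis. \<bar>a i j\<bar>) * norm v"
      by (simp add: sum_distrib_right)
  qed
  finally show ?thesis by (simp add: sum_distrib_right)
qed

section \<open>Uniform limits in a parameter\<close>

lemma uniform_limit_diff_zero: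
  fixes f :: "'i \<Rightarrow> 'a \<Rightarrow> 'b::real_normed_vector"
  shows "uniform_limit K f l F \<Longrightarrow> uniform_limit K (\<lambda>s t. f s t - l t) (\<lambda>_. 0) F"
  by (simp add: uniform_limit_iff dist_norm)

lemma uniform_limit_sum_finite:
  fixes f :: "'j \<Rightarrow> 'i \<Rightarrow> 'a \<Rightarrow> 'b::real_normed_vector"
  assumes "\<And>i. i \<in> I \<Longrightarrow> uniform_limit K (f i) (l i) F"
  shows "uniform_limit K (\<lambda>s t. \<Sum>i\<in>I. f i s t) (\<lambda>t. \<Sum>i\<in>I. l i t) F"
  using assms
  by (induction I rule: infinite_finite_induct) (auto intro!: uniform_limit_add uniform_limit_const)

text \<open>Products of uniform limits converge uniformly when the limits are bounded, hence the two
  boundedness assumptions.\<close>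

lemma uniform_limit_matvec:
  fixes v :: "'i \<Rightarrow> 'a \<Rightarrow> 'e::euclidean_space"
  assumes "\<And>i j. i \<in> Basis \<Longrightarrow> j \<in> Basis \<Longrightarrow> uniform_limit K (\<lambda>s t. a s t i j) (\<lambda>t. a0 t i j) F"
    and "\<And>j. j \<in> Basis \<Longrightarrow> uniform_limit K (\<lambda>s t. v s t \<bullet> j) (\<lambda>t. v0 t \<bullet> j) F"
    and "\<And>i. i \<in> Basis \<Longrightarrow> uniform_limit K (\<lambda>s t. b s t i) (\<lambda>t. b0 t i) F"
    and "\<And>i j. i \<in> Basis \<Longrightarrow> j \<in> Basis \<Longrightarrow> bounded ((\<lambda>t. a0 t i j) ` K)"
    and "\<And>j. j \<in> Basis \<Longrightarrow> bounded ((\<lambda>t. v0 t \<bullet> j) ` K)"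
  shows "uniform_limit K (\<lambda>s t. matvec (a s t) (v s t) + (\<Sum>i\<in>Basis. b s t i *\<^sub>R i))
     (\<lambda>t. matvec (a0 t) (v0 t) + (\<Sum>i\<in>Basis. b0 t i *\<^sub>R i)) F"
  unfolding matvec_def
  by (intro uniform_limit_add uniform_limit_sum_finite
      bounded_linear.uniform_limit[OF bounded_linear_scaleR_left] uniform_lim_mult assms)

text \<open>The tube argument: joint continuity becomes uniform in \<open>t\<close> because
  \<open>K\<close> is compact.\<close>

lemma uniform_limit_param:
  fixes f :: "'d::topological_space \<times> 'b::topological_space \<Rightarrow> 'c::metric_space"
  assumes f: "continuous_on (\<Lambda> \<times> J) f" and "open \<Lambda>" "x \<in> \<Lambda>" "compact K" "K \<subseteq> J"
  shows "uniform_limit K (\<lambda>y t. f (y, t)) (\<lambda>t. f (x, t)) (nhds x)"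
proof (rule uniform_limitI)
  fix e :: real assume e: "e > 0"
  have "continuous_on (\<Lambda> \<times> K) f" by (rule continuous_on_subset[OF f]) (use assms in auto)
  then obtain X where X: "x \<in> X" "open X" "\<forall>y\<in>X \<inter> \<Lambda>. \<forall>t\<in>K. dist (f (y, t)) (f (x, t)) \<le> e / 2"
    by (rule continuous_on_prod_compactE[of \<Lambda> K f x "e/2"]) (use assms e in auto)
  have "\<forall>\<^sub>F y in nhds x. y \<in> X \<inter> \<Lambda>"
    using X assms by (intro eventually_nhds_in_open) auto
  then show "\<forall>\<^sub>F y in nhds x. \<forall>t\<in>K. dist (f (y, t)) (f (x, t)) < e"
  proof eventually_elim
    case (elim y)
    have "e / 2 < e" using e by simp
    then show ?case using X(3) elim le_less_trans by blast
  qed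
qed

lemma uniform_limit_line:
  fixes f :: "'d::real_normed_vector \<times> 'b::topological_space \<Rightarrow> 'c::metric_space"
  assumes f: "continuous_on (\<Lambda> \<times> J) f" and "open \<Lambda>" "x \<in> \<Lambda>" "compact K" "K \<subseteq> J"
  shows "uniform_limit K (\<lambda>s t. f (x + s *\<^sub>R c, t)) (\<lambda>t. f (x, t)) (at (0::real))"
proof -
  have "((\<lambda>s::real. x + s *\<^sub>R c) \<longlongrightarrow> x + 0 *\<^sub>R c) (at 0)" by (intro tendsto_intros)
  then show ?thesis
    using filterlim_compose[OF uniform_limit_param[OF assms]] by simp
qed

text \<open>By the mean value theorem in the parameter, the quotient differs from the derivative at
  most by the oscillation of that derivative along the short segment, and this is small uniformly
  over \<open>K\<close>.\<close>

lemma uniform_limit_quotient: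
  fixes f :: "'d::euclidean_space \<times> real \<Rightarrow> real"
  assumes f: "Ck_on Basis (Suc 0) (\<Lambda> \<times> J) f" and \<Lambda>: "open \<Lambda>" "x \<in> \<Lambda>" and K: "compact K" "K \<subseteq> J" and c: "c \<in> Basis"
  shows "uniform_limit K (\<lambda>s t. (f (x + s *\<^sub>R c, t) - f (x, t)) / s) (\<lambda>t. partial_deriv (c, 0) f (x, t)) (at 0)"
proof (rule uniform_limitI)
  fix e :: real assume e: "e > 0"
  let ?p = "partial_deriv (c, 0) f"
  have c': "(c, 0) \<in> Basis" using c by (auto simp: Basis_prod_def)
  then have "continuous_on (\<Lambda> \<times> J) ?p" using Ck_on_imp_continuous_on[OF Ck_on_partial[OF f]] by blast
  from uniform_limitD[OF uniform_limit_line[OF this \<Lambda> K, of c], of "e/2"] e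
  have "\<forall>\<^sub>F s in at 0. \<forall>t\<in>K. dist (?p (x + s *\<^sub>R c, t)) (?p (x, t)) < e / 2" by simp
  then obtain d1 where d1: "d1 > 0"
    "\<And>s t. s \<noteq> 0 \<Longrightarrow> \<bar>s\<bar> < d1 \<Longrightarrow> t \<in> K \<Longrightarrow> dist (?p (x + s *\<^sub>R c, t)) (?p (x, t)) < e / 2"
    unfolding eventually_at by (auto simp: dist_real_def)
  have "\<forall>\<^sub>F s in nhds (0::real). x + s *\<^sub>R c \<in> \<Lambda>"
    using eventually_relopen[of Basis \<Lambda> x c] \<Lambda> c by simp
  then obtain d2 where d2: "d2 > 0" "\<And>s. \<bar>s\<bar> < d2 \<Longrightarrow> x + s *\<^sub>R c \<in> \<Lambda>"
    unfolding eventually_nhds_metric by (auto simp: dist_real_def)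
  have "dist ((f (x + s *\<^sub>R c, t) - f (x, t)) / s) (?p (x, t)) < e" if s: "s \<noteq> 0" "\<bar>s\<bar> < min d1 d2" and t: "t \<in> K" for s t
  proof -
    let ?\<phi> = "\<lambda>s. f (x + s *\<^sub>R c, t) - s * ?p (x, t)"
    have "norm (?\<phi> s - ?\<phi> 0) \<le> e / 2 * norm (s - 0)"
    proof (rule field_differentiable_bound[where S="closed_segment 0 s"])
      fix r assume "r \<in> closed_segment 0 s"
      then have r: "\<bar>r\<bar> < min d1 d2" using s by (auto simp: closed_segment_eq_real_ivl split: if_splits)
      then have mem: "(x + r *\<^sub>R c, t) \<in> \<Lambda> \<times> J" using d2 K t by auto
      have "((\<lambda>s. f ((x, t) + s *\<^sub>R (c, 0))) has_real_derivative ?p (x + r *\<^sub>R c, t)) (at r)"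
        using has_partial_shift[of f "(x, t)" r "(c, 0)"] Ck_on_has_partial[OF f c' mem] by simp
      then have "((\<lambda>s. f (x + s *\<^sub>R c, t)) has_real_derivative ?p (x + r *\<^sub>R c, t)) (at r)" by simp
      from DERIV_diff[OF this DERIV_cmult_right[OF DERIV_ident, of "?p (x, t)"]]
      have "(?\<phi> has_real_derivative ?p (x + r *\<^sub>R c, t) - ?p (x, t)) (at r)" by simp
      then show "(?\<phi> has_real_derivative ?p (x + r *\<^sub>R c, t) - ?p (x, t)) (at r within closed_segment 0 s)"
        by (rule has_field_derivative_at_within)
      show "norm (?p (x + r *\<^sub>R c, t) - ?p (x, t)) \<le> e / 2"
        using d1(2)[of r t] r t e by (cases "r = 0") (auto simp: dist_real_def less_imp_le)
    qed auto
    then have "\<bar>f (x + s *\<^sub>R c, t) - f (x, t) - s * ?p (x, t)\<bar> \<le> e / 2 * \<bar>s\<bar>" by (simp add: algebra_simps)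
    moreover have "(f (x + s *\<^sub>R c, t) - f (x, t)) / s - ?p (x, t) = (f (x + s *\<^sub>R c, t) - f (x, t) - s * ?p (x, t)) / s"
      using s by (simp add: field_simps)
    ultimately have "\<bar>(f (x + s *\<^sub>R c, t) - f (x, t)) / s - ?p (x, t)\<bar> \<le> e / 2"
      using s by (simp add: abs_divide divide_le_eq)
    then show ?thesis using e by (simp add: dist_real_def)
  qed
  then show "\<forall>\<^sub>F s in at 0. \<forall>t\<in>K. dist ((f (x + s *\<^sub>R c, t) - f (x, t)) / s) (?p (x, t)) < e"
    unfolding eventually_at using d1 d2 by (intro exI[of _ "min d1 d2"]) (auto simp: dist_real_def)
qed

text \<open>Uniform control in the parameter combines with continuity in time by the triangle
  inequality. Intervals with \<open>S < T\<close> suffice, which matters because compactness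
  arguments work only on these.\<close>

lemma continuous_on_uniform_param:
  fixes w :: "'d::metric_space \<times> real \<Rightarrow> 'e::real_normed_vector"
  assumes "open \<Lambda>"
    and c: "\<And>x t. x \<in> \<Lambda> \<Longrightarrow> \<bar>t\<bar> < T \<Longrightarrow> isCont (\<lambda>t. w (x, t)) t"
    and u: "\<And>x S. x \<in> \<Lambda> \<Longrightarrow> 0 < S \<Longrightarrow> S < T \<Longrightarrow>
      uniform_limit {-S<..<S} (\<lambda>y t. w (y, t) - w (x, t)) (\<lambda>_. 0) (nhds x)"
  shows "continuous_on (\<Lambda> \<times> {-T<..<T}) w"
proof (intro continuous_at_imp_continuous_on ballI)
  fix z assume "z \<in> \<Lambda> \<times> {-T<..<T}"
  then obtain x t where z: "z = (x, t)" "x \<in> \<Lambda>" "\<bar>t\<bar> < T" by auto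
  define S where "S = (\<bar>t\<bar> + T) / 2"
  have S: "0 < S" "S < T" "\<bar>t\<bar> < S" using z by (auto simp: S_def)
  have "(w \<longlongrightarrow> w z) (nhds z)"
  proof (rule tendstoI)
    fix e :: real assume e: "e > 0"
    have 1: "\<forall>\<^sub>F y in nhds x. \<forall>t\<in>{-S<..<S}. dist (w (y, t) - w (x, t)) 0 < e / 2"
      using uniform_limitD[OF u[OF z(2) S(1,2)], of "e/2"] e by simp
    have "((\<lambda>r. w (x, r)) \<longlongrightarrow> w (x, t)) (nhds t)"
      using c[OF z(2,3)] tendsto_at_iff_tendsto_nhds[of "\<lambda>r. w (x, r)" t] by (simp add: continuous_at)
    then have "\<forall>\<^sub>F r in nhds t. dist (w (x, r)) (w (x, t)) < e / 2"
      by (rule tendstoD) (use e in simp)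
    moreover have "\<forall>\<^sub>F r in nhds t. r \<in> {-S<..<S}"
      using S by (intro eventually_nhds_in_open) auto
    ultimately have 2: "\<forall>\<^sub>F r in nhds t. dist (w (x, r)) (w (x, t)) < e / 2 \<and> r \<in> {-S<..<S}"
      by eventually_elim auto
    have "\<forall>\<^sub>F p in nhds x \<times>\<^sub>F nhds t. (\<forall>t\<in>{-S<..<S}. dist (w (fst p, t) - w (x, t)) 0 < e / 2) \<and>
        (dist (w (x, snd p)) (w (x, t)) < e / 2 \<and> snd p \<in> {-S<..<S})"
      by (rule eventually_prodI[OF 1 2])
    then show "\<forall>\<^sub>F p in nhds z. dist (w p) (w z) < e"
      unfolding z nhds_prod
    proof eventually_elim
      case (elim p)
      then have "dist (w (fst p, snd p) - w (x, snd p)) 0 < e / 2" "dist (w (x, snd p)) (w (x, t)) < e / 2"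
        by blast+
      then have "norm (w (fst p, snd p) - w (x, snd p)) < e / 2" "norm (w (x, snd p) - w (x, t)) < e / 2"
        by (simp_all add: dist_norm)
      then have "norm ((w (fst p, snd p) - w (x, snd p)) + (w (x, snd p) - w (x, t))) < e / 2 + e / 2"
        by (intro norm_triangle_lt add_strict_mono)
      then show ?case by (simp add: dist_norm)
    qed
  qed
  then show "isCont w z" by (simp add: continuous_at tendsto_at_iff_tendsto_nhds)
qed

section \<open>Regularity of solutions jointly in parameter and time\<close>

lemma Basis_prod_real_cases:
  assumes "b \<in> (Basis :: ('d::euclidean_space \<times> real) set)"
  obtains c where "b = (c, 0)" "c \<in> Basis" | "b = (0, 1)"
  using assms by (auto simp: Basis_prod_def)

lemma has_partial_time:
  fixes w :: "'d::euclidean_space \<times> real \<Rightarrow> 'e::euclidean_space"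
  assumes "((\<lambda>t. w (x, t)) has_vector_derivative D) (at t)"
  shows "((\<lambda>s. w ((x, t) + s *\<^sub>R (0, 1)) \<bullet> i) has_real_derivative D \<bullet> i) (at 0)"
proof -
  have "((\<lambda>t. w (x, t) \<bullet> i) has_real_derivative D \<bullet> i) (at (0 + t))"
    unfolding has_real_derivative_iff_has_vector_derivative
    using bounded_linear.has_vector_derivative[OF bounded_linear_inner_left assms] by simp
  then have "((\<lambda>s. w (x, s + t) \<bullet> i) has_real_derivative D \<bullet> i) (at 0)"
    by (subst (asm) DERIV_shift)
  then show ?thesis by (simp add: add.commute)
qed

lemma norm_sum_split: "D = m + e \<Longrightarrow> norm m \<le> c \<Longrightarrow> norm D \<le> c + norm (e :: 'a::real_normed_vector)"
  using norm_triangle_ineq[of m e] by simp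

text \<open>Differentiating the equation in a parameter direction gives a linear equation with the
  same matrix \<open>a\<close> and a new inhomogeneous term. The induction hypothesis makes its
  solution \<open>Ck_on\<close> of order \<open>k\<close>, and Gronwall identifies that solution
  with the derivative of \<open>w\<close>. As \<open>a\<close> is unchanged, \<open>L\<close> and
  \<open>T\<close> are too, so the time interval does not shrink during the induction.\<close>

lemma linear_ode_Ck:
  fixes w :: "'d::euclidean_space \<times> real \<Rightarrow> 'e::euclidean_space"
  assumes \<Lambda>: "open \<Lambda>" and T: "0 < T" and L: "0 \<le> L" "T * L \<le> 1 / 2"
    and a: "\<And>i j. i \<in> Basis \<Longrightarrow> j \<in> Basis \<Longrightarrow> Ck_on Basis k (\<Lambda> \<times> {-T<..<T}) (\<lambda>z. a z i j)"
    and aL: "\<And>z. z \<in> \<Lambda> \<times> {-T<..<T} \<Longrightarrow> (\<Sum>i\<in>Basis. \<Sum>j\<in>Basis. \<bar>a z i j\<bar>) \<le> L"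
    and b: "\<And>i. i \<in> Basis \<Longrightarrow> Ck_on Basis k (\<Lambda> \<times> {-T<..<T}) (\<lambda>z. b z i)"
    and ode: "\<And>x t. x \<in> \<Lambda> \<Longrightarrow> t \<in> {-T<..<T} \<Longrightarrow>
      ((\<lambda>t. w (x, t)) has_vector_derivative (matvec (a (x, t)) (w (x, t)) + (\<Sum>i\<in>Basis. b (x, t) i *\<^sub>R i))) (at t)"
    and init: "\<And>i. i \<in> Basis \<Longrightarrow> Ck_on Basis k \<Lambda> (\<lambda>x. w (x, 0) \<bullet> i)"
    and i: "i \<in> Basis"
  shows "Ck_on Basis k (\<Lambda> \<times> {-T<..<T}) (\<lambda>z. w z \<bullet> i)"
  using a b ode init i
proof (induction k arbitrary: b w i)
  case 0
  let ?J = "{-T<..<T}"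
  have wc: "isCont (\<lambda>t. w (x, t)) t" if "x \<in> \<Lambda>" "\<bar>t\<bar> < T" for x t
    by (rule has_vector_derivative_continuous[OF 0(3)]) (use that in auto)
  have "continuous_on (\<Lambda> \<times> ?J) w"
  proof (rule continuous_on_uniform_param[OF \<Lambda> wc])
    fix x S assume x: "x \<in> \<Lambda>" and S: "0 < S" "S < T"
    let ?K = "{-S..S}"
    \<comment> \<open>The right-hand sides at \<open>y\<close> and at \<open>x\<close>, both
      evaluated along the solution for \<open>x\<close>. The difference of the solutions obeys the
      homogeneous equation at \<open>y\<close> up to this error.\<close>
    let ?e = "\<lambda>y t. (matvec (a (y, t)) (w (x, t)) + (\<Sum>i\<in>Basis. b (y, t) i *\<^sub>R i))
        - (matvec (a (x, t)) (w (x, t)) + (\<Sum>i\<in>Basis. b (x, t) i *\<^sub>R i))"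
    have KJ: "?K \<subseteq> ?J" using S by auto
    have cK: "continuous_on ?K (\<lambda>t. w (x, t))"
      using wc[OF x] S by (intro continuous_at_imp_continuous_on ballI) auto
    have bK: "bounded ((\<lambda>t. f (x, t)) ` ?K)" if "continuous_on (\<Lambda> \<times> ?J) f" for f :: "'d \<times> real \<Rightarrow> real"
      by (intro compact_imp_bounded compact_continuous_image continuous_on_compose2[OF that])
        (use x KJ in \<open>auto intro!: continuous_intros\<close>)
    have "uniform_limit ?K ?e (\<lambda>_. 0) (nhds x)"
    proof (intro uniform_limit_diff_zero uniform_limit_matvec)
      fix i j :: 'e assume ij: "i \<in> Basis" "j \<in> Basis"
      show "uniform_limit ?K (\<lambda>y t. a (y, t) i j) (\<lambda>t. a (x, t) i j) (nhds x)"
        using uniform_limit_param[OF _ \<Lambda> x compact_Icc KJ, of "\<lambda>z. a z i j"] 0(1)[OF ij] by simp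
      show "bounded ((\<lambda>t. a (x, t) i j) ` ?K)" using bK[of "\<lambda>z. a z i j"] 0(1)[OF ij] by simp
    next
      fix j :: 'e assume j: "j \<in> Basis"
      show "uniform_limit ?K (\<lambda>y t. w (x, t) \<bullet> j) (\<lambda>t. w (x, t) \<bullet> j) (nhds x)"
        by (rule uniform_limit_const)
      show "bounded ((\<lambda>t. w (x, t) \<bullet> j) ` ?K)"
        by (intro compact_imp_bounded compact_continuous_image continuous_intros cK) auto
      show "uniform_limit ?K (\<lambda>y t. b (y, t) j) (\<lambda>t. b (x, t) j) (nhds x)"
        using uniform_limit_param[OF _ \<Lambda> x compact_Icc KJ, of "\<lambda>z. b z j"] 0(2)[OF j] by simp
    qed
    then have e: "uniform_limit {-S<..<S} ?e (\<lambda>_. 0) (nhds x)"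
      by (rule uniform_limit_on_subset) auto
    show "uniform_limit {-S<..<S} (\<lambda>y t. w (y, t) - w (x, t)) (\<lambda>_. 0) (nhds x)"
    proof (rule gronwall_limit[OF L(1) S(1) _ e])
      have "\<forall>\<^sub>F y in nhds x. y \<in> \<Lambda>" using \<Lambda> x by (intro eventually_nhds_in_open)
      then show "\<forall>\<^sub>F y in nhds x. \<forall>t\<in>{-S<..<S}. \<exists>D. ((\<lambda>t. w (y, t) - w (x, t)) has_vector_derivative D) (at t) \<and>
          norm D \<le> L * norm (w (y, t) - w (x, t)) + norm (?e y t)"
      proof (eventually_elim, intro ballI)
        fix y t assume y: "y \<in> \<Lambda>" and "t \<in> {-S<..<S}"
        then have t: "t \<in> ?J" using S by auto
        let ?W = "\<lambda>y. matvec (a (y, t)) (w (y, t)) + (\<Sum>i\<in>Basis. b (y, t) i *\<^sub>R i)"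
        have "?W y - ?W x = matvec (a (y, t)) (w (y, t) - w (x, t)) + ?e y t"
          by (simp add: matvec_diff[symmetric])
        moreover have "norm (matvec (a (y, t)) (w (y, t) - w (x, t))) \<le> L * norm (w (y, t) - w (x, t))"
          by (rule order_trans[OF norm_matvec_le mult_right_mono[OF aL]]) (use y t in auto)
        ultimately have "norm (?W y - ?W x) \<le> L * norm (w (y, t) - w (x, t)) + norm (?e y t)"
          by (rule norm_sum_split)
        then show "\<exists>D. ((\<lambda>t. w (y, t) - w (x, t)) has_vector_derivative D) (at t) \<and>
          norm D \<le> L * norm (w (y, t) - w (x, t)) + norm (?e y t)"
          using has_vector_derivative_diff[OF 0(3)[OF y t] 0(3)[OF x t]] by blast
      qed
      have "((\<lambda>y. (w (y, 0) - w (x, 0)) \<bullet> i) \<longlongrightarrow> 0 \<bullet> i) (nhds x)" if i: "i \<in> Basis" for i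
      proof -
        have "continuous_on \<Lambda> (\<lambda>y. w (y, 0) \<bullet> i)" using 0(4)[OF i] by simp
        then have "((\<lambda>y. w (y, 0) \<bullet> i) \<longlongrightarrow> w (x, 0) \<bullet> i) (nhds x)"
          using \<Lambda> x tendsto_at_iff_tendsto_nhds[of "\<lambda>y. w (y, 0) \<bullet> i" x]
          by (simp add: continuous_on_eq_continuous_at continuous_at)
        then show ?thesis
          using tendsto_diff[OF _ tendsto_const, of _ "w (x, 0) \<bullet> i" "nhds x" "w (x, 0) \<bullet> i"] by (simp add: inner_diff_left)
      qed
      then show "((\<lambda>y. w (y, 0) - w (x, 0)) \<longlongrightarrow> 0) (nhds x)"
        by (rule tendsto_componentwise_iff[THEN iffD2, rule_format])
    qed
  qed
  then show ?case by (auto intro!: continuous_intros)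
next
  case (Suc k)
  let ?J = "{-T<..<T}"
  have opn: "open (\<Lambda> \<times> ?J)" using \<Lambda> by (intro open_Times) auto
  note a' = Suc.prems(1) and b' = Suc.prems(2) and ode = Suc.prems(3) and init = Suc.prems(4)
  have wk: "Ck_on Basis k (\<Lambda> \<times> ?J) (\<lambda>z. w z \<bullet> i)" if "i \<in> Basis" for i
    by (rule Suc.IH[where w=w and b=b]) (use a' b' ode init that in \<open>blast intro: Ck_on_Suc_imp\<close>)+
  have cont: "continuous_on (\<Lambda> \<times> ?J) (\<lambda>z. w z \<bullet> i)" if "i \<in> Basis" for i
    using wk[OF that] by (rule Ck_on_imp_continuous_on)
  \<comment> \<open>The inhomogeneous term of the formally differentiated equation. It contains
    \<open>w\<close> itself, already known to have order \<open>k\<close>, which is all the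
    induction hypothesis needs.\<close>
  define \<beta> where "\<beta> c z i = (\<Sum>j\<in>Basis. partial_deriv (c, 0) (\<lambda>z. a z i j) z * (w z \<bullet> j))
      + partial_deriv (c, 0) (\<lambda>z. b z i) z" for c z i
  have cB: "(c, 0) \<in> (Basis :: ('d \<times> real) set)" if "c \<in> Basis" for c using that by (auto simp: Basis_prod_def)
  have \<beta>: "Ck_on Basis k (\<Lambda> \<times> ?J) (\<lambda>z. \<beta> c z i)" if "c \<in> Basis" "i \<in> Basis" for c i
    unfolding \<beta>_def using opn a' b' wk cB that
    by (intro Ck_on_add Ck_on_sum Ck_on_mult Ck_on_partial[OF a'] Ck_on_partial[OF b'] wk) auto
  define w0 where "w0 c x = (\<Sum>i\<in>Basis. partial_deriv c (\<lambda>x. w (x, 0) \<bullet> i) x *\<^sub>R i)" for c x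
  have exV: "\<exists>v. v 0 = w0 c x \<and> (\<forall>t\<in>?J. (v has_vector_derivative
      (matvec (a (x, t)) (v t) + (\<Sum>i\<in>Basis. \<beta> c (x, t) i *\<^sub>R i))) (at t))"
    if c: "c \<in> Basis" and x: "x \<in> \<Lambda>" for c x
  proof (rule ode_exists[OF T L])
    have 1: "continuous_on (?J \<times> UNIV) (\<lambda>p. f (x, fst p))" if "continuous_on (\<Lambda> \<times> ?J) f" for f :: "'d \<times> real \<Rightarrow> real"
      by (rule continuous_on_compose2[OF that]) (use x in \<open>auto intro!: continuous_intros\<close>)
    show "continuous_on (?J \<times> UNIV) (\<lambda>(t, u). matvec (a (x, t)) u + (\<Sum>i\<in>Basis. \<beta> c (x, t) i *\<^sub>R i))"
      unfolding matvec_def case_prod_beta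
      by (intro continuous_intros 1 Ck_on_imp_continuous_on[OF a'] Ck_on_imp_continuous_on[OF \<beta>] c)
    fix t u v assume "t \<in> ?J"
    then show "norm (matvec (a (x, t)) u + (\<Sum>i\<in>Basis. \<beta> c (x, t) i *\<^sub>R i) -
        (matvec (a (x, t)) v + (\<Sum>i\<in>Basis. \<beta> c (x, t) i *\<^sub>R i))) \<le> L * norm (u - v)"
      using order_trans[OF norm_matvec_le mult_right_mono[OF aL[of "(x, t)"]], of "u - v"] x by (simp add: matvec_diff)
  qed
  \<comment> \<open>Solutions are chosen for each parameter separately; their joint regularity comes
    afterwards from the induction hypothesis.\<close>
  define V where "V c x = (SOME v. v 0 = w0 c x \<and> (\<forall>t\<in>?J. (v has_vector_derivative
      (matvec (a (x, t)) (v t) + (\<Sum>i\<in>Basis. \<beta> c (x, t) i *\<^sub>R i))) (at t)))" for c x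
  have V: "V c x 0 = w0 c x \<and> (\<forall>t\<in>?J. (V c x has_vector_derivative
      (matvec (a (x, t)) (V c x t) + (\<Sum>i\<in>Basis. \<beta> c (x, t) i *\<^sub>R i))) (at t))"
    if "c \<in> Basis" "x \<in> \<Lambda>" for c x
    unfolding V_def by (rule someI_ex[OF exV[OF that]])
  have V: "\<And>c x. c \<in> Basis \<Longrightarrow> x \<in> \<Lambda> \<Longrightarrow> V c x 0 = w0 c x"
    "\<And>c x t. c \<in> Basis \<Longrightarrow> x \<in> \<Lambda> \<Longrightarrow> t \<in> ?J \<Longrightarrow> (V c x has_vector_derivative
      (matvec (a (x, t)) (V c x t) + (\<Sum>i\<in>Basis. \<beta> c (x, t) i *\<^sub>R i))) (at t)"
    using V by blast+
  define v where "v c z = V c (fst z) (snd z)" for c z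
  have vk: "Ck_on Basis k (\<Lambda> \<times> ?J) (\<lambda>z. v c z \<bullet> i)" if c: "c \<in> Basis" and i: "i \<in> Basis" for c i
  proof (rule Suc.IH[where w="v c" and b="\<beta> c"])
    show "Ck_on Basis k \<Lambda> (\<lambda>x. v c (x, 0) \<bullet> i)" if i: "i \<in> Basis" for i
    proof (rule Ck_on_cong[OF _ _ Ck_on_partial[OF init[OF i] c]])
      fix x assume x: "x \<in> \<Lambda>"
      show "partial_deriv c (\<lambda>x. w (x, 0) \<bullet> i) x = v c (x, 0) \<bullet> i"
        using V(1)[OF c x] i by (simp add: v_def w0_def inner_sum_left_Basis)
    qed (use \<Lambda> in simp)
  qed (use a' \<beta> c V(2) i in \<open>auto simp: v_def intro: Ck_on_Suc_imp[of _ k]\<close>)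
  have dv: "((\<lambda>s. w (x + s *\<^sub>R c, t) \<bullet> i) has_real_derivative v c (x, t) \<bullet> i) (at 0)"
    if c: "c \<in> Basis" and i: "i \<in> Basis" and x: "x \<in> \<Lambda>" and t: "t \<in> ?J" for c i x t
  proof -
    define S where "S = (\<bar>t\<bar> + T) / 2"
    have S: "0 < S" "S < T" "t \<in> {-S<..<S}" using t by (auto simp: S_def abs_if field_simps)
    let ?K = "{-S..S}"
    have KJ: "?K \<subseteq> ?J" using S by auto
    have cK: "continuous_on ?K (\<lambda>t. f (x, t))" if "continuous_on (\<Lambda> \<times> ?J) f" for f :: "'d \<times> real \<Rightarrow> real"
      by (rule continuous_on_compose2[OF that]) (use x KJ in \<open>auto intro!: continuous_intros\<close>)
    have bK: "bounded ((\<lambda>t. f (x, t)) ` ?K)" if "continuous_on (\<Lambda> \<times> ?J) f" for f :: "'d \<times> real \<Rightarrow> real"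
      by (intro compact_imp_bounded compact_continuous_image cK[OF that]) auto
    let ?q = "\<lambda>s t. (1 / s) *\<^sub>R (w (x + s *\<^sub>R c, t) - w (x, t))"
    \<comment> \<open>The defect of the difference quotient in the differentiated equation: the
      quotients of the coefficients act on the moved solution, their derivatives on the solution at
      \<open>x\<close>.\<close>
    let ?e = "\<lambda>s t. (matvec (\<lambda>i j. (a (x + s *\<^sub>R c, t) i j - a (x, t) i j) / s) (w (x + s *\<^sub>R c, t))
           + (\<Sum>i\<in>Basis. ((b (x + s *\<^sub>R c, t) i - b (x, t) i) / s) *\<^sub>R i))
        - (matvec (\<lambda>i j. partial_deriv (c, 0) (\<lambda>z. a z i j) (x, t)) (w (x, t))
           + (\<Sum>i\<in>Basis. partial_deriv (c, 0) (\<lambda>z. b z i) (x, t) *\<^sub>R i))"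
    have le1: "Ck_on Basis (Suc 0) U f" if "Ck_on Basis (Suc k) U f" for U and f :: "'d \<times> real \<Rightarrow> real"
      using that by (auto dest: Ck_on_imp_continuous_on)
    have "uniform_limit ?K ?e (\<lambda>_. 0) (at 0)"
    proof (intro uniform_limit_diff_zero uniform_limit_matvec)
      fix i j :: 'e assume ij: "i \<in> Basis" "j \<in> Basis"
      show "uniform_limit ?K (\<lambda>s t. (a (x + s *\<^sub>R c, t) i j - a (x, t) i j) / s)
          (\<lambda>t. partial_deriv (c, 0) (\<lambda>z. a z i j) (x, t)) (at 0)"
        using uniform_limit_quotient[OF le1[OF a'[OF ij]] \<Lambda> x compact_Icc KJ c] .
      show "bounded ((\<lambda>t. partial_deriv (c, 0) (\<lambda>z. a z i j) (x, t)) ` ?K)"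
        using bK Ck_on_imp_continuous_on[OF Ck_on_partial[OF a'[OF ij] cB[OF c]]] .
    next
      fix j :: 'e assume j: "j \<in> Basis"
      show "uniform_limit ?K (\<lambda>s t. w (x + s *\<^sub>R c, t) \<bullet> j) (\<lambda>t. w (x, t) \<bullet> j) (at 0)"
        using uniform_limit_line[OF cont[OF j] \<Lambda> x compact_Icc KJ] .
      show "bounded ((\<lambda>t. w (x, t) \<bullet> j) ` ?K)" using bK cont[OF j] .
      show "uniform_limit ?K (\<lambda>s t. (b (x + s *\<^sub>R c, t) j - b (x, t) j) / s)
          (\<lambda>t. partial_deriv (c, 0) (\<lambda>z. b z j) (x, t)) (at 0)"
        using uniform_limit_quotient[OF le1[OF b'[OF j]] \<Lambda> x compact_Icc KJ c] .
    qed
    then have e: "uniform_limit {-S<..<S} ?e (\<lambda>_. 0) (at 0)"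
      by (rule uniform_limit_on_subset) auto
    have "uniform_limit {-S<..<S} (\<lambda>s t. ?q s t - v c (x, t)) (\<lambda>_. 0) (at 0)"
    proof (rule gronwall_limit[OF L(1) S(1) _ e])
      have ev: "\<forall>\<^sub>F s in at (0::real). x + s *\<^sub>R c \<in> \<Lambda> \<and> s \<noteq> 0"
        using eventually_relopen[of Basis \<Lambda> x c] \<Lambda> c x
        by (auto simp: eventually_at_filter elim: eventually_mono)
      then show "\<forall>\<^sub>F s in at 0. \<forall>t\<in>{-S<..<S}. \<exists>D. ((\<lambda>t. ?q s t - v c (x, t)) has_vector_derivative D) (at t) \<and>
          norm D \<le> L * norm (?q s t - v c (x, t)) + norm (?e s t)"
      proof (eventually_elim, intro ballI)
        fix s t assume s: "x + s *\<^sub>R c \<in> \<Lambda> \<and> s \<noteq> 0" and "t \<in> {-S<..<S}"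
        then have t: "t \<in> ?J" using S by auto
        let ?W = "\<lambda>y. matvec (a (y, t)) (w (y, t)) + (\<Sum>i\<in>Basis. b (y, t) i *\<^sub>R i)"
        let ?D = "(1 / s) *\<^sub>R (?W (x + s *\<^sub>R c) - ?W x) - (matvec (a (x, t)) (v c (x, t)) + (\<Sum>i\<in>Basis. \<beta> c (x, t) i *\<^sub>R i))"
        have D: "((\<lambda>t. ?q s t - v c (x, t)) has_vector_derivative ?D) (at t)"
          unfolding v_def fst_conv snd_conv
          by (intro has_vector_derivative_diff V(2)[OF c x t]
              bounded_linear.has_vector_derivative[OF bounded_linear_scaleR_right] ode) (use s x t in auto)
        have "?D = matvec (a (x, t)) (?q s t - v c (x, t)) + ?e s t"
        proof (rule euclidean_eqI)
          fix i :: 'e assume i: "i \<in> Basis"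
          show "?D \<bullet> i = (matvec (a (x, t)) (?q s t - v c (x, t)) + ?e s t) \<bullet> i"
            using s i by (simp add: inner_add_left inner_diff_left matvec_inner inner_sum_left_Basis \<beta>_def
                sum_subtractf sum_distrib_left sum.distrib diff_divide_distrib sum_divide_distrib algebra_simps)
        qed
        moreover have "norm (matvec (a (x, t)) (?q s t - v c (x, t))) \<le> L * norm (?q s t - v c (x, t))"
          by (rule order_trans[OF norm_matvec_le mult_right_mono[OF aL]]) (use x t in auto)
        ultimately have "norm ?D \<le> L * norm (?q s t - v c (x, t)) + norm (?e s t)"
          by (rule norm_sum_split)
        then show "\<exists>D. ((\<lambda>t. ?q s t - v c (x, t)) has_vector_derivative D) (at t) \<and>
          norm D \<le> L * norm (?q s t - v c (x, t)) + norm (?e s t)"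
          using D by blast
      qed
      have "((\<lambda>s. (?q s 0 - v c (x, 0)) \<bullet> i) \<longlongrightarrow> 0 \<bullet> i) (at 0)" if i: "i \<in> Basis" for i
      proof -
        have "((\<lambda>s. w (x + s *\<^sub>R c, 0) \<bullet> i) has_real_derivative v c (x, 0) \<bullet> i) (at 0)"
          using Ck_on_has_partial[OF init[OF i] c x] V(1)[OF c x] i by (simp add: v_def w0_def inner_sum_left_Basis)
        then have "((\<lambda>s. (w (x + s *\<^sub>R c, 0) \<bullet> i - w (x, 0) \<bullet> i) / s) \<longlongrightarrow> v c (x, 0) \<bullet> i) (at 0)"
          by (simp add: DERIV_def)
        then have "((\<lambda>s. (w (x + s *\<^sub>R c, 0) \<bullet> i - w (x, 0) \<bullet> i) / s - v c (x, 0) \<bullet> i) \<longlongrightarrow> 0) (at 0)"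
          using LIM_zero by blast
        then show ?thesis by (simp add: inner_diff_left)
      qed
      then show "((\<lambda>s. ?q s 0 - v c (x, 0)) \<longlongrightarrow> 0) (at 0)"
        by (rule tendsto_componentwise_iff[THEN iffD2, rule_format])
    qed
    then have "((\<lambda>s. ?q s t - v c (x, t)) \<longlongrightarrow> 0) (at 0)"
      using S(3) tendsto_uniform_limitI by fastforce
    then have "((\<lambda>s. ?q s t) \<longlongrightarrow> v c (x, t)) (at 0)" by (rule LIM_zero_cancel)
    then have "((\<lambda>s. ?q s t \<bullet> i) \<longlongrightarrow> v c (x, t) \<bullet> i) (at 0)" by (intro tendsto_intros)
    then show ?thesis by (simp add: DERIV_def inner_diff_left)
  qed
  \<comment> \<open>The time derivative is read off from the equation; the parameter derivatives are
    the solutions just identified.\<close>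
  define D where "D d z = (if d = (0, 1) then (\<Sum>j\<in>Basis. a z i j * (w z \<bullet> j)) + b z i else v (fst d) z \<bullet> i)" for d :: "'d \<times> real" and z
  show ?case
  proof (rule Ck_on_SucI[where D=D])
    fix d :: "'d \<times> real" and z assume d: "d \<in> Basis" and z: "z \<in> \<Lambda> \<times> ?J"
    then obtain x t where z': "z = (x, t)" "x \<in> \<Lambda>" "t \<in> ?J" by auto
    from d show "((\<lambda>s. w (z + s *\<^sub>R d) \<bullet> i) has_real_derivative D d z) (at 0)"
    proof (cases rule: Basis_prod_real_cases)
      case (1 c)
      then show ?thesis using dv[OF 1(2) Suc.prems(5) z'(2,3)] by (simp add: D_def z')
    next
      case 2
      then show ?thesis using has_partial_time[OF ode[OF z'(2,3)], of i] Suc.prems(5)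
        by (simp add: D_def z' inner_add_left matvec_inner inner_sum_left_Basis)
    qed
  next
    fix d :: "'d \<times> real" assume d: "d \<in> Basis"
    then show "Ck_on Basis k (\<Lambda> \<times> ?J) (D d)"
    proof (cases rule: Basis_prod_real_cases)
      case (1 c)
      then show ?thesis using vk[OF 1(2) Suc.prems(5)] by (simp add: D_def[abs_def])
    next
      case 2
      have "Ck_on Basis k (\<Lambda> \<times> ?J) (\<lambda>z. (\<Sum>j\<in>Basis. a z i j * (w z \<bullet> j)) + b z i)"
        using opn by (intro Ck_on_add Ck_on_sum Ck_on_mult wk Ck_on_Suc_imp[OF a'] Ck_on_Suc_imp[OF b'] Suc.prems(5)) auto
      then show ?thesis using 2 by (simp add: D_def[abs_def])
    qed
  qed (use opn cont[OF Suc.prems(5)] in auto)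
qed

lemma has_derivative_of_smooth_components:
  fixes G :: "'d::euclidean_space \<Rightarrow> 'e::euclidean_space"
  assumes "open U" "\<And>i. i \<in> Basis \<Longrightarrow> smooth_on Basis U (\<lambda>x. G x \<bullet> i)" "x \<in> U"
  shows "(G has_derivative (\<lambda>h. \<Sum>i\<in>Basis. (\<Sum>b\<in>Basis. (h \<bullet> b) * partial_deriv b (\<lambda>x. G x \<bullet> i) x) *\<^sub>R i)) (at x)"
  unfolding has_derivative_componentwise_within[of G]
  using smooth_on_has_derivative[OF assms(1) assms(2) assms(3)] by (auto simp: inner_sum_left_Basis)

text \<open>Composing the field with the closest-point projection onto a compact ball makes it
  globally Lipschitz, so solutions exist for a common time. Those starting in the concentric ball of
  half the radius never leave the large ball, where the projection is the identity, and therefore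
  solve the original equation.\<close>

lemma smooth_local_flow:
  fixes a :: "'e::euclidean_space \<Rightarrow> 'e"
  assumes \<Omega>: "open \<Omega>" "x0 \<in> \<Omega>" and a: "\<And>i. i \<in> Basis \<Longrightarrow> smooth_on Basis \<Omega> (\<lambda>x. a x \<bullet> i)"
  obtains r T \<theta> where "r > 0" "T > 0" "ball x0 r \<subseteq> \<Omega>"
    "\<And>x. x \<in> ball x0 r \<Longrightarrow> \<theta> (x, 0) = x"
    "\<And>x t. x \<in> ball x0 r \<Longrightarrow> t \<in> {-T<..<T} \<Longrightarrow> \<theta> (x, t) \<in> \<Omega>"
    "\<And>x t. x \<in> ball x0 r \<Longrightarrow> t \<in> {-T<..<T} \<Longrightarrow> ((\<lambda>t. \<theta> (x, t)) has_vector_derivative a (\<theta> (x, t))) (at t)"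
    "\<And>i. i \<in> Basis \<Longrightarrow> smooth_on Basis (ball x0 r \<times> {-T<..<T}) (\<lambda>z. \<theta> z \<bullet> i)"
proof -
  obtain R where R: "R > 0" "cball x0 R \<subseteq> \<Omega>" using \<Omega> open_contains_cball by blast
  define C where "C = cball x0 R"
  have C: "compact C" "convex C" "closed C" "C \<noteq> {}" "C \<subseteq> \<Omega>" using R by (auto simp: C_def)
  define r where "r = R / 2"
  have r: "r > 0" using R by (simp add: r_def)
  define A where "A x i j = partial_deriv j (\<lambda>x. a x \<bullet> i) x" for x i j
  have As: "smooth_on Basis \<Omega> (\<lambda>x. A x i j)" if "i \<in> Basis" "j \<in> Basis" for i j
    unfolding A_def by (rule smooth_on_partial[OF a[OF that(1)] that(2)])
  have Ac: "continuous_on C (\<lambda>x. A x i j)" if "i \<in> Basis" "j \<in> Basis" for i j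
    by (rule continuous_on_subset[OF smooth_on_imp_continuous_on[OF As[OF that]] C(5)])
  have da: "(a has_derivative matvec (A x)) (at x)" if "x \<in> \<Omega>" for x
    using has_derivative_of_smooth_components[OF \<Omega>(1) a that]
    by (simp add: matvec_def[abs_def] A_def mult.commute)
  have ac: "continuous_on C a"
    by (rule has_derivative_continuous_on[OF has_derivative_at_withinI[OF da]]) (use C(5) in auto)
  have "continuous_on C (\<lambda>x. \<Sum>i\<in>Basis. \<Sum>j\<in>Basis. \<bar>A x i j\<bar>)"
    by (intro continuous_intros Ac)
  then have "bounded ((\<lambda>x. \<Sum>i\<in>Basis. \<Sum>j\<in>Basis. \<bar>A x i j\<bar>) ` C)"
    using C(1) by (intro compact_imp_bounded compact_continuous_image)
  then obtain N0 where "\<forall>x\<in>C. norm (\<Sum>i\<in>Basis. \<Sum>j\<in>Basis. \<bar>A x i j\<bar>) \<le> N0"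
    unfolding bounded_iff by auto
  then have N0: "(\<Sum>i\<in>Basis. \<Sum>j\<in>Basis. \<bar>A x i j\<bar>) \<le> N0" if "x \<in> C" for x
    using that by (metis abs_le_D1 real_norm_def)
  define N where "N = max 1 N0"
  have N: "N \<ge> 1" "\<And>x. x \<in> C \<Longrightarrow> (\<Sum>i\<in>Basis. \<Sum>j\<in>Basis. \<bar>A x i j\<bar>) \<le> N"
    using order_trans[OF N0] by (auto simp: N_def)
  have "bounded (a ` C)" using C(1) ac by (intro compact_imp_bounded compact_continuous_image)
  then obtain M0 where M0: "\<forall>x\<in>C. norm (a x) \<le> M0" unfolding bounded_iff by auto
  define M where "M = max 1 M0"
  have M: "M \<ge> 1" "\<And>x. x \<in> C \<Longrightarrow> norm (a x) \<le> M"
    using M0 by (auto simp: M_def le_max_iff_disj)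
  have lip: "norm (a x - a y) \<le> N * norm (x - y)" if "x \<in> C" "y \<in> C" for x y
  proof (rule differentiable_bound[OF C(2) _ _ that])
    fix z assume z: "z \<in> C"
    then show "(a has_derivative matvec (A z)) (at z within C)" using da C(5) has_derivative_at_withinI by blast
    show "onorm (matvec (A z)) \<le> N"
      by (rule onorm_le) (rule order_trans[OF norm_matvec_le mult_right_mono[OF N(2)[OF z]]], simp)
  qed
  \<comment> \<open>The first bound makes the Picard operator contract. The second limits the
    displacement, at speed at most \<open>M\<close>, to \<open>r\<close>, so that solutions starting
    within \<open>r\<close> of \<open>x0\<close> remain in the ball of radius
    \<open>2 * r = R\<close>.\<close>
  define T where "T = min (1 / (2 * N)) (r / M)"
  have T: "T > 0" "T * N \<le> 1 / 2" "M * T \<le> r"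
  proof -
    show "T > 0" using N M r by (simp add: T_def)
    have "T * N \<le> 1 / (2 * N) * N" using N by (intro mult_right_mono) (auto simp: T_def)
    then show "T * N \<le> 1 / 2" using N by simp
    have "M * T \<le> M * (r / M)" using M by (intro mult_left_mono) (auto simp: T_def)
    then show "M * T \<le> r" using M by simp
  qed
  let ?J = "{-T<..<T}" and ?\<Lambda> = "ball x0 r"
  define cp where "cp = closest_point C"
  have cp: "cp u \<in> C" for u unfolding cp_def using C by (intro closest_point_in_set) auto
  have "\<exists>u. u 0 = x \<and> (\<forall>t\<in>?J. (u has_vector_derivative a (cp (u t))) (at t))" for x
  proof (rule ode_exists[OF T(1) _ T(2)])
    have "continuous_on UNIV (\<lambda>u. a (cp u))"
      unfolding cp_def
      by (rule continuous_on_compose2[OF ac continuous_on_closest_point[OF C(2-4)]]) (use cp in \<open>auto simp: cp_def\<close>)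
    then show "continuous_on (?J \<times> UNIV) (\<lambda>(t, u). a (cp u))"
      unfolding case_prod_beta by (rule continuous_on_compose2) (auto intro!: continuous_intros)
    show "norm (a (cp u) - a (cp v)) \<le> N * norm (u - v)" for u v
      using closest_point_lipschitz[OF C(2-4), of u v] N(1) order_trans[OF lip[OF cp[of u] cp[of v]] mult_left_mono]
      by (simp add: cp_def dist_norm)
  qed (use N in simp)
  then obtain U where U: "\<And>x. U x 0 = x" "\<And>x t. t \<in> ?J \<Longrightarrow> (U x has_vector_derivative a (cp (U x t))) (at t)"
    by metis
  have UC: "U x t \<in> C" if x: "x \<in> ?\<Lambda>" and t: "t \<in> ?J" for x t
  proof -
    have "norm (U x t - U x 0) \<le> M * norm (t - 0)"
      by (rule vector_derivative_lipschitz[where S="?J"])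
        (use t T U(2) M(2) cp in \<open>auto intro: has_vector_derivative_at_within\<close>)
    also have "\<dots> \<le> M * T" using M t by (intro mult_left_mono) auto
    finally have "norm (U x t - x) \<le> r" using T U(1) by simp
    then have "dist x0 (U x t) \<le> r + r"
      using x dist_triangle[of x0 "U x t" x] by (simp add: dist_norm norm_minus_commute)
    then show ?thesis by (simp add: C_def r_def)
  qed
  define \<theta> where "\<theta> z = U (fst z) (snd z)" for z
  have \<theta>0: "\<theta> (x, 0) = x" for x by (simp add: \<theta>_def U)
  have \<theta>C: "\<theta> (x, t) \<in> C" if "x \<in> ?\<Lambda>" "t \<in> ?J" for x t using UC[OF that] by (simp add: \<theta>_def)
  have d\<theta>: "((\<lambda>t. \<theta> (x, t)) has_vector_derivative a (\<theta> (x, t))) (at t)" if "x \<in> ?\<Lambda>" "t \<in> ?J" for x t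
  proof -
    have "cp (U x t) = U x t" unfolding cp_def using UC[OF that] by (rule closest_point_self)
    then show ?thesis using U(2)[OF that(2), of x] by (simp add: \<theta>_def[abs_def])
  qed
  have c0: "continuous_on (?\<Lambda> \<times> ?J) \<theta>"
  proof (rule continuous_on_uniform_param[OF open_ball])
    show "isCont (\<lambda>t. \<theta> (x, t)) t" if "x \<in> ?\<Lambda>" "\<bar>t\<bar> < T" for x t
      by (rule has_vector_derivative_continuous[OF d\<theta>]) (use that in auto)
    fix x S assume x: "x \<in> ?\<Lambda>" and S: "0 < S" "S < T"
    show "uniform_limit {-S<..<S} (\<lambda>y t. \<theta> (y, t) - \<theta> (x, t)) (\<lambda>_. 0) (nhds x)"
    proof (rule gronwall_limit[where L=N and e="\<lambda>y t. 0::real"])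
      have "\<forall>\<^sub>F y in nhds x. y \<in> ?\<Lambda>" using x by (intro eventually_nhds_in_open) auto
      then show "\<forall>\<^sub>F y in nhds x. \<forall>t\<in>{-S<..<S}. \<exists>D. ((\<lambda>t. \<theta> (y, t) - \<theta> (x, t)) has_vector_derivative D) (at t) \<and>
          norm D \<le> N * norm (\<theta> (y, t) - \<theta> (x, t)) + norm (0::real)"
      proof (eventually_elim, intro ballI)
        fix y t assume y: "y \<in> ?\<Lambda>" and "t \<in> {-S<..<S}"
        then have t: "t \<in> ?J" using S by auto
        show "\<exists>D. ((\<lambda>t. \<theta> (y, t) - \<theta> (x, t)) has_vector_derivative D) (at t) \<and>
          norm D \<le> N * norm (\<theta> (y, t) - \<theta> (x, t)) + norm (0::real)"
          using has_vector_derivative_diff[OF d\<theta>[OF y t] d\<theta>[OF x t]] lip[OF \<theta>C[OF y t] \<theta>C[OF x t]] by auto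
      qed
      have "((\<lambda>y. y - x) \<longlongrightarrow> x - x) (nhds x)" by (intro tendsto_intros filterlim_ident)
      then show "((\<lambda>y. \<theta> (y, 0) - \<theta> (x, 0)) \<longlongrightarrow> 0) (nhds x)" by (simp add: \<theta>0)
    qed (use N S in \<open>auto intro: uniform_limit_const\<close>)
  qed
  \<comment> \<open>The Lipschitz constant of the flow in its initial point, from Gronwall with zero
    error.\<close>
  define K where "K = sqrt (exp ((2 * N + 1) * T))"
  have K: "K > 0" by (simp add: K_def)
  have \<theta>L: "norm (\<theta> (y, t) - \<theta> (x, t)) \<le> K * norm (y - x)" if "x \<in> ?\<Lambda>" "y \<in> ?\<Lambda>" "t \<in> ?J" for x y t
  proof -
    have "(norm (\<theta> (y, t) - \<theta> (x, t)))\<^sup>2 \<le> exp ((2 * N + 1) * T) * ((norm (\<theta> (y, 0) - \<theta> (x, 0)))\<^sup>2 + 0\<^sup>2 * T)"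
    proof (rule gronwall[where d'="\<lambda>t. a (\<theta> (y, t)) - a (\<theta> (x, t))"])
      fix s assume "\<bar>s\<bar> < T"
      then have s: "s \<in> ?J" by auto
      show "((\<lambda>t. \<theta> (y, t) - \<theta> (x, t)) has_vector_derivative a (\<theta> (y, s)) - a (\<theta> (x, s))) (at s)"
        by (intro has_vector_derivative_diff d\<theta> that s)
      show "norm (a (\<theta> (y, s)) - a (\<theta> (x, s))) \<le> N * norm (\<theta> (y, s) - \<theta> (x, s)) + 0"
        using lip \<theta>C that s by simp
    qed (use N that in auto)
    also have "\<dots> = (K * norm (y - x))\<^sup>2" by (simp add: \<theta>0 K_def power_mult_distrib)
    finally show ?thesis by (rule power2_le_imp_le) (use K in simp)
  qed
  \<comment> \<open>The variation of the Jacobian between two points, zero on the diagonal. Its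
    uniform continuity on the compact square gives linearization bounds independent of the base
    point.\<close>
  define H where "H p = (\<Sum>i\<in>Basis. \<Sum>j\<in>Basis. \<bar>A (fst p) i j - A (snd p) i j\<bar>)" for p
  have "continuous_on (C \<times> C) H"
    unfolding H_def
    by (intro continuous_intros continuous_on_compose2[OF Ac continuous_on_fst[OF continuous_on_id]]
        continuous_on_compose2[OF Ac continuous_on_snd[OF continuous_on_id]]) auto
  then have Hu: "uniformly_continuous_on (C \<times> C) H"
    using C(1) by (intro compact_uniformly_continuous compact_Times)
  have lin: "\<exists>\<delta>>0. \<forall>y\<in>C. \<forall>z\<in>C. dist y z < \<delta> \<longrightarrow> norm (a y - a z - matvec (A z) (y - z)) \<le> norm (y - z) * \<eta>"
    if \<eta>: "\<eta> > 0" for \<eta>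
  proof -
    obtain \<delta> where \<delta>: "\<delta> > 0" "\<And>p q. p \<in> C \<times> C \<Longrightarrow> q \<in> C \<times> C \<Longrightarrow> dist p q < \<delta> \<Longrightarrow> dist (H p) (H q) < \<eta>"
      using Hu \<eta> unfolding uniformly_continuous_on_def by metis
    have "norm (a y - a z - matvec (A z) (y - z)) \<le> norm (y - z) * \<eta>" if yz: "y \<in> C" "z \<in> C" "dist y z < \<delta>" for y z
    proof (rule differentiable_bound_linearization[where S="closed_segment z y" and f'="\<lambda>x. matvec (A x)"])
      fix x assume x: "x \<in> closed_segment z y"
      then have xC: "x \<in> C" using yz C(2) closed_segment_subset by blast
      then show "(a has_derivative matvec (A x)) (at x within closed_segment z y)"
        using da C(5) has_derivative_at_withinI by blast
      have "dist x z \<le> dist y z" using x by (metis dist_commute dist_in_closed_segment(1))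
      then have "dist (H (x, z)) (H (z, z)) < \<eta>"
        using yz xC by (intro \<delta>(2)) (auto simp: dist_Pair_Pair)
      then have Hx: "(\<Sum>i\<in>Basis. \<Sum>j\<in>Basis. \<bar>A x i j - A z i j\<bar>) \<le> \<eta>"
        by (simp add: H_def dist_real_def)
      show "onorm (matvec (A x) - matvec (A z)) \<le> \<eta>"
      proof (rule onorm_le)
        fix h
        have "matvec (A x) h - matvec (A z) h = matvec (\<lambda>i j. A x i j - A z i j) h"
          by (simp add: matvec_def algebra_simps sum_subtractf)
        then show "norm ((matvec (A x) - matvec (A z)) h) \<le> \<eta> * norm h"
          using order_trans[OF norm_matvec_le mult_right_mono[OF Hx]] by simp
      qed
    next
      show "z + t *\<^sub>R (y - z) \<in> closed_segment z y" if "t \<in> {0..1}" for t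
        unfolding in_segment(1) using that by (intro exI[of _ t]) (auto simp: algebra_simps)
    qed auto
    then show ?thesis using \<delta>(1) by blast
  qed
  have opn: "open (?\<Lambda> \<times> ?J)" by (intro open_Times) auto
  \<comment> \<open>The bootstrap: a flow of order \<open>k\<close> gives the linearized equation
    coefficients \<open>A (\<theta> z)\<close> of order \<open>k\<close>, hence solutions of order
    \<open>k\<close>. These are the space derivatives of the flow, while its time derivative is
    \<open>a (\<theta> z)\<close>; the flow thus has order \<open>k + 1\<close>.\<close>
  have Ck: "\<forall>i\<in>Basis. Ck_on Basis k (?\<Lambda> \<times> ?J) (\<lambda>z. \<theta> z \<bullet> i)" for k
  proof (induction k)
    case 0
    then show ?case using c0 by (auto intro!: continuous_intros)
  next
    case (Suc k)
    have comp: "Ck_on Basis k (?\<Lambda> \<times> ?J) (\<lambda>z. f (\<theta> z))" if "smooth_on Basis \<Omega> f" for f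
      by (rule Ck_on_compose[where V=\<Omega> and B=Basis]) (use \<Omega> opn that Suc \<theta>C C(5) in \<open>auto intro: smooth_on_Ck\<close>)
    have exV: "\<exists>v. v 0 = c \<and> (\<forall>t\<in>?J. (v has_vector_derivative matvec (A (\<theta> (x, t))) (v t)) (at t))"
      if x: "x \<in> ?\<Lambda>" for c x
    proof (rule ode_exists[OF T(1) _ T(2)])
      have "continuous_on (?J \<times> UNIV) (\<lambda>p. A (\<theta> (x, fst p)) i j)" if "i \<in> Basis" "j \<in> Basis" for i j
        by (rule continuous_on_compose2[OF Ck_on_imp_continuous_on[OF comp[OF As[OF that]]]])
          (use x in \<open>auto intro!: continuous_intros\<close>)
      then show "continuous_on (?J \<times> UNIV) (\<lambda>(t, u). matvec (A (\<theta> (x, t))) u)"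
        unfolding matvec_def case_prod_beta by (intro continuous_intros)
      fix t u v assume "t \<in> ?J"
      then show "norm (matvec (A (\<theta> (x, t))) u - matvec (A (\<theta> (x, t))) v) \<le> N * norm (u - v)"
        using order_trans[OF norm_matvec_le mult_right_mono[OF N(2)[OF \<theta>C[OF x]]], of t "u - v"] by (simp add: matvec_diff)
    qed (use N in simp)
    define V where "V c x = (SOME v. v 0 = c \<and>
      (\<forall>t\<in>?J. (v has_vector_derivative matvec (A (\<theta> (x, t))) (v t)) (at t)))" for c x
    have V: "V c x 0 = c \<and> (\<forall>t\<in>?J. (V c x has_vector_derivative matvec (A (\<theta> (x, t))) (V c x t)) (at t))"
      if "x \<in> ?\<Lambda>" for c x
      unfolding V_def by (rule someI_ex[OF exV[OF that]])
    have V: "\<And>c x. x \<in> ?\<Lambda> \<Longrightarrow> V c x 0 = c"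
      "\<And>c x t. x \<in> ?\<Lambda> \<Longrightarrow> t \<in> ?J \<Longrightarrow> (V c x has_vector_derivative matvec (A (\<theta> (x, t))) (V c x t)) (at t)"
      using V by blast+
    define v where "v c z = V c (fst z) (snd z)" for c z
    have vk: "Ck_on Basis k (?\<Lambda> \<times> ?J) (\<lambda>z. v c z \<bullet> i)" if i: "i \<in> Basis" for c i
    proof (rule linear_ode_Ck[OF open_ball T(1) _ T(2), where a="\<lambda>z. A (\<theta> z)" and b="\<lambda>z i. 0" and w="v c"])
      show "Ck_on Basis k ?\<Lambda> (\<lambda>x. v c (x, 0) \<bullet> i)" for i
        by (rule Ck_on_cong[OF _ _ Ck_on_const[of _ _ _ "c \<bullet> i"]]) (auto simp: v_def V)
      show "Ck_on Basis k (?\<Lambda> \<times> ?J) (\<lambda>z. 0)" by (rule Ck_on_const) (use opn in simp)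
    qed (use N i comp As \<theta>C V(2) in \<open>auto simp: v_def\<close>)
    have dv: "((\<lambda>s. \<theta> (x + s *\<^sub>R c, t) \<bullet> i) has_real_derivative v c (x, t) \<bullet> i) (at 0)"
      if c: "c \<in> Basis" and x: "x \<in> ?\<Lambda>" and t: "t \<in> ?J" for c i x t
    proof -
      let ?q = "\<lambda>s t. (1 / s) *\<^sub>R (\<theta> (x + s *\<^sub>R c, t) - \<theta> (x, t))"
      \<comment> \<open>The linearization error of the field between two nearby solutions, divided
        by \<open>s\<close>. The Lipschitz bound on the flow compares the distance of the solutions
        with \<open>s\<close>, so \<open>lin\<close> makes this uniformly small.\<close>
      let ?e = "\<lambda>s t. (1 / s) *\<^sub>R (a (\<theta> (x + s *\<^sub>R c, t)) - a (\<theta> (x, t)) - matvec (A (\<theta> (x, t))) (\<theta> (x + s *\<^sub>R c, t) - \<theta> (x, t)))"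
      have ev: "\<forall>\<^sub>F s in at (0::real). x + s *\<^sub>R c \<in> ?\<Lambda> \<and> s \<noteq> 0"
        using eventually_relopen[of Basis ?\<Lambda> x c] c x
        by (auto simp: eventually_at_filter elim: eventually_mono)
      have e: "uniform_limit ?J ?e (\<lambda>_. 0) (at 0)"
      proof (rule uniform_limitI)
        fix \<epsilon> :: real assume \<epsilon>: "\<epsilon> > 0"
        then have "\<epsilon> / (2 * K) > 0" using K by simp
        from lin[OF this] obtain \<delta> where \<delta>: "\<delta> > 0" "\<And>y z. y \<in> C \<Longrightarrow> z \<in> C \<Longrightarrow> dist y z < \<delta> \<Longrightarrow>
            norm (a y - a z - matvec (A z) (y - z)) \<le> norm (y - z) * (\<epsilon> / (2 * K))" by blast
        have "\<forall>\<^sub>F s in at (0::real). \<bar>s\<bar> < \<delta> / K"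
          unfolding eventually_at using \<delta> K by (intro exI[of _ "\<delta> / K"]) (auto simp: dist_real_def)
        then show "\<forall>\<^sub>F s in at 0. \<forall>t\<in>?J. dist (?e s t) 0 < \<epsilon>"
          using ev
        proof (eventually_elim, intro ballI)
          fix s t assume s: "\<bar>s\<bar> < \<delta> / K" "x + s *\<^sub>R c \<in> ?\<Lambda> \<and> s \<noteq> 0" and t: "t \<in> ?J"
          let ?y = "\<theta> (x + s *\<^sub>R c, t)" and ?z = "\<theta> (x, t)"
          have yz: "norm (?y - ?z) \<le> K * \<bar>s\<bar>" using \<theta>L[OF x _ t, of "x + s *\<^sub>R c"] s c by simp
          also have "\<dots> < \<delta>" using s(1) K by (simp add: field_simps)
          finally have "norm (a ?y - a ?z - matvec (A ?z) (?y - ?z)) \<le> norm (?y - ?z) * (\<epsilon> / (2 * K))"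
            using s x t by (intro \<delta>(2) \<theta>C) (auto simp: dist_norm)
          also have "\<dots> \<le> (K * \<bar>s\<bar>) * (\<epsilon> / (2 * K))" using yz \<epsilon> K by (intro mult_right_mono) auto
          also have "\<dots> = \<bar>s\<bar> * (\<epsilon> / 2)" using K by simp
          finally have "norm (a ?y - a ?z - matvec (A ?z) (?y - ?z)) / \<bar>s\<bar> \<le> \<epsilon> / 2"
            using s by (simp add: divide_le_eq mult.commute)
          also have "\<epsilon> / 2 < \<epsilon>" using \<epsilon> by simp
          finally show "dist (?e s t) 0 < \<epsilon>" by simp
        qed
      qed
      have "uniform_limit ?J (\<lambda>s t. ?q s t - v c (x, t)) (\<lambda>_. 0) (at 0)"
      proof (rule gronwall_limit[OF _ T(1) _ e, where L=N])
        show "\<forall>\<^sub>F s in at 0. \<forall>t\<in>?J. \<exists>D. ((\<lambda>t. ?q s t - v c (x, t)) has_vector_derivative D) (at t) \<and>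
            norm D \<le> N * norm (?q s t - v c (x, t)) + norm (?e s t)"
          using ev
        proof (eventually_elim, intro ballI)
          fix s t assume s: "x + s *\<^sub>R c \<in> ?\<Lambda> \<and> s \<noteq> 0" and t: "t \<in> ?J"
          let ?D = "(1 / s) *\<^sub>R (a (\<theta> (x + s *\<^sub>R c, t)) - a (\<theta> (x, t))) - matvec (A (\<theta> (x, t))) (v c (x, t))"
          have D: "((\<lambda>t. ?q s t - v c (x, t)) has_vector_derivative ?D) (at t)"
            unfolding v_def fst_conv snd_conv
            by (intro has_vector_derivative_diff V(2)
                bounded_linear.has_vector_derivative[OF bounded_linear_scaleR_right] d\<theta>) (use s x t in auto)
          have "?D = matvec (A (\<theta> (x, t))) (?q s t - v c (x, t)) + ?e s t"
          proof (rule euclidean_eqI)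
            fix i :: 'e assume i: "i \<in> Basis"
            show "?D \<bullet> i = (matvec (A (\<theta> (x, t))) (?q s t - v c (x, t)) + ?e s t) \<bullet> i"
              using s i by (simp add: inner_add_left inner_diff_left matvec_inner
                  sum_subtractf sum_distrib_left sum.distrib diff_divide_distrib sum_divide_distrib algebra_simps)
          qed
          moreover have "norm (matvec (A (\<theta> (x, t))) (?q s t - v c (x, t))) \<le> N * norm (?q s t - v c (x, t))"
            by (rule order_trans[OF norm_matvec_le mult_right_mono[OF N(2)[OF \<theta>C[OF x t]]]]) auto
          ultimately have "norm ?D \<le> N * norm (?q s t - v c (x, t)) + norm (?e s t)"
            by (rule norm_sum_split)
          then show "\<exists>D. ((\<lambda>t. ?q s t - v c (x, t)) has_vector_derivative D) (at t) \<and>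
            norm D \<le> N * norm (?q s t - v c (x, t)) + norm (?e s t)"
            using D by blast
        qed
        have "\<forall>\<^sub>F s in at 0. ?q s 0 - v c (x, 0) = 0"
          using ev by eventually_elim (use x in \<open>simp add: \<theta>0 v_def V\<close>)
        then show "((\<lambda>s. ?q s 0 - v c (x, 0)) \<longlongrightarrow> 0) (at 0)"
          by (rule tendsto_eventually)
      qed (use N in simp)
      then have "((\<lambda>s. ?q s t - v c (x, t)) \<longlongrightarrow> 0) (at 0)"
        using t tendsto_uniform_limitI by fastforce
      then have "((\<lambda>s. ?q s t) \<longlongrightarrow> v c (x, t)) (at 0)" by (rule LIM_zero_cancel)
      then have "((\<lambda>s. ?q s t \<bullet> i) \<longlongrightarrow> v c (x, t) \<bullet> i) (at 0)" by (intro tendsto_intros)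
      then show ?thesis by (simp add: DERIV_def inner_diff_left)
    qed
    show ?case
    proof
      fix i :: 'e assume i: "i \<in> Basis"
      define D where "D d z = (if d = (0, 1) then a (\<theta> z) \<bullet> i else v (fst d) z \<bullet> i)" for d :: "'e \<times> real" and z
      show "Ck_on Basis (Suc k) (?\<Lambda> \<times> ?J) (\<lambda>z. \<theta> z \<bullet> i)"
      proof (rule Ck_on_SucI[where D=D])
        fix d :: "'e \<times> real" and z assume d: "d \<in> Basis" and z: "z \<in> ?\<Lambda> \<times> ?J"
        then obtain x t where z': "z = (x, t)" "x \<in> ?\<Lambda>" "t \<in> ?J" by auto
        from d show "((\<lambda>s. \<theta> (z + s *\<^sub>R d) \<bullet> i) has_real_derivative D d z) (at 0)"
        proof (cases rule: Basis_prod_real_cases)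
          case (1 c)
          then show ?thesis using dv[OF 1(2) z'(2,3), of i] by (simp add: D_def z')
        next
          case 2
          then show ?thesis using has_partial_time[OF d\<theta>[OF z'(2,3)], of i] by (simp add: D_def z')
        qed
      next
        fix d :: "'e \<times> real" assume d: "d \<in> Basis"
        then show "Ck_on Basis k (?\<Lambda> \<times> ?J) (D d)"
        proof (cases rule: Basis_prod_real_cases)
          case (1 c)
          then show ?thesis using vk[OF i] by (simp add: D_def[abs_def])
        next
          case 2
          then show ?thesis using comp[OF a[OF i]] by (simp add: D_def[abs_def])
        qed
      qed (use opn c0 in \<open>auto intro!: continuous_intros\<close>)
    qed
  qed
  show ?thesis
  proof (rule that[of r T \<theta>])
    show "ball x0 r \<subseteq> \<Omega>" using C(5) R by (auto simp: C_def r_def)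
  qed (use r T \<theta>0 \<theta>C C(5) d\<theta> Ck in \<open>auto simp: smooth_on_def\<close>)
qed

section \<open>The smooth inverse function theorem\<close>

lemma linear_matvec: "linear (matvec a)"
  by (rule linearI) (simp_all add: matvec_def inner_add_left algebra_simps sum.distrib scaleR_sum_right sum_distrib_left)

lemma matvec_inv:
  assumes "bij (matvec a)"
  shows "matvec a (inv (matvec a) v) = v" "inv (matvec a) (matvec a v) = v" "linear (inv (matvec a))"
proof -
  show 1: "matvec a (inv (matvec a) v) = v" for v using assms by (simp add: bij_is_surj surj_f_inv_f)
  show 2: "inv (matvec a) (matvec a v) = v" for v using assms by (simp add: bij_is_inj)
  show "linear (inv (matvec a))"
  proof (rule linearI)
    interpret linear "matvec a" by (rule linear_matvec)
    show "inv (matvec a) (u + v) = inv (matvec a) u + inv (matvec a) v" for u v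
      by (metis 1 2 add)
    show "inv (matvec a) (r *\<^sub>R v) = r *\<^sub>R inv (matvec a) v" for r v
      by (metis 1 2 scaleR)
  qed
qed

text \<open>The resolvent identity. It reduces continuity and differentiability of the inverse to
  those of the coefficients.\<close>

lemma matvec_inv_diff:
  assumes "bij (matvec a)" "bij (matvec b)"
  shows "inv (matvec b) v - inv (matvec a) v = - inv (matvec b) (matvec (\<lambda>i j. b i j - a i j) (inv (matvec a) v))"
proof -
  interpret linear "inv (matvec b)" by (rule matvec_inv(3)[OF assms(2)])
  have "matvec (\<lambda>i j. b i j - a i j) (inv (matvec a) v) = matvec b (inv (matvec a) v) - v"
    using matvec_inv(1)[OF assms(1), of v] by (simp add: matvec_def algebra_simps sum_subtractf)
  then show ?thesis by (simp add: diff matvec_inv(2)[OF assms(2)])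
qed

lemma linear_inner_expand:
  fixes f :: "'e::euclidean_space \<Rightarrow> 'e"
  assumes "linear f"
  shows "f v \<bullet> j = (\<Sum>k\<in>Basis. (v \<bullet> k) * (f k \<bullet> j))"
proof -
  interpret linear f by fact
  have "f v = f (\<Sum>k\<in>Basis. (v \<bullet> k) *\<^sub>R k)" by (simp add: euclidean_representation)
  then show ?thesis by (simp add: sum scaleR inner_sum_left)
qed

text \<open>Invertibility at \<open>y0\<close> bounds the matrix below by some \<open>c\<close>. A
  perturbation smaller than \<open>c / 2\<close> keeps the lower bound \<open>c / 2\<close>, and the
  resolvent identity then bounds the change of the inverse.\<close>

lemma matrix_inverse_continuous:
  fixes M :: "'d::euclidean_space \<Rightarrow> 'e::euclidean_space \<Rightarrow> 'e \<Rightarrow> real"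
  assumes V: "open V" and M: "\<And>i j. i \<in> Basis \<Longrightarrow> j \<in> Basis \<Longrightarrow> continuous_on V (\<lambda>y. M y i j)"
    and bij: "\<And>y. y \<in> V \<Longrightarrow> bij (matvec (M y))"
  shows "continuous_on V (\<lambda>y. inv (matvec (M y)) v)"
  unfolding continuous_on_eq_continuous_at[OF V] continuous_at
proof
  fix y0 assume y0: "y0 \<in> V"
  let ?N = "\<lambda>y. inv (matvec (M y))" and ?S = "\<lambda>y. \<Sum>i\<in>Basis. \<Sum>j\<in>Basis. \<bar>M y i j - M y0 i j\<bar>"
  obtain c where c: "c > 0" "\<And>h. c * norm h \<le> norm (matvec (M y0) h)"
    using linear_inj_bounded_below_pos[OF linear_matvec bij_is_inj[OF bij[OF y0]]] by blast
  have "continuous_on V ?S" by (intro continuous_intros M)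
  then have "isCont ?S y0" using y0 V continuous_on_eq_continuous_at by blast
  then have "(?S \<longlongrightarrow> ?S y0) (at y0)" by (simp only: continuous_at)
  then have lim: "(?S \<longlongrightarrow> 0) (at y0)" by simp
  have "\<forall>\<^sub>F y in at y0. ?S y < c / 2" using tendstoD[OF lim, of "c/2"] c(1) by (auto elim: eventually_mono)
  moreover have "\<forall>\<^sub>F y in at y0. y \<in> V" using V y0 by (metis eventually_at_topological)
  ultimately have "\<forall>\<^sub>F y in at y0. norm (?N y v - ?N y0 v) \<le> ?S y * (norm (?N y0 v) * (2 / c))"
  proof eventually_elim
    case (elim y)
    let ?h = "?N y (matvec (\<lambda>i j. M y i j - M y0 i j) (?N y0 v))"
    have eq: "matvec (M y) u - matvec (M y0) u = matvec (\<lambda>i j. M y i j - M y0 i j) u" for u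
      by (simp add: matvec_def algebra_simps sum_subtractf)
    have "norm (matvec (\<lambda>i j. M y i j - M y0 i j) ?h) \<le> ?S y * norm ?h" by (rule norm_matvec_le)
    also have "\<dots> \<le> c / 2 * norm ?h" using elim by (intro mult_right_mono) auto
    finally have "norm (matvec (M y) ?h - matvec (M y0) ?h) \<le> c / 2 * norm ?h" by (simp only: eq)
    moreover have "norm (matvec (M y0) ?h) \<le> norm (matvec (M y) ?h) + norm (matvec (M y) ?h - matvec (M y0) ?h)"
      using norm_triangle_ineq4[of "matvec (M y) ?h" "matvec (M y) ?h - matvec (M y0) ?h"] by simp
    ultimately have "c / 2 * norm ?h \<le> norm (matvec (M y) ?h)" using c(2)[of ?h] by simp
    also have "matvec (M y) ?h = matvec (\<lambda>i j. M y i j - M y0 i j) (?N y0 v)"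
      by (rule matvec_inv(1)[OF bij[OF elim(2)]])
    also have "norm \<dots> \<le> ?S y * norm (?N y0 v)" by (rule norm_matvec_le)
    finally have "norm ?h \<le> ?S y * norm (?N y0 v) * (2 / c)" using c(1) by (simp add: field_simps)
    then show ?case using matvec_inv_diff[OF bij[OF y0] bij[OF elim(2)], of v] by (simp add: mult.assoc)
  qed
  moreover have "((\<lambda>y. ?S y * (norm (?N y0 v) * (2 / c))) \<longlongrightarrow> 0) (at y0)"
    by (rule tendsto_mult_left_zero[OF lim])
  ultimately have "((\<lambda>y. ?N y v - ?N y0 v) \<longlongrightarrow> 0) (at y0)"
    by (rule Lim_null_comparison)
  then show "((\<lambda>y. ?N y v) \<longlongrightarrow> ?N y0 v) (at y0)" by (rule LIM_zero_cancel)
qed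

text \<open>Dividing the resolvent identity by \<open>s\<close> and passing to the limit expresses
  the derivative of the inverse through the inverse itself and the derivatives of the coefficients,
  so the order rises by induction.\<close>

lemma matrix_inverse_Ck:
  fixes M :: "'d::euclidean_space \<Rightarrow> 'e::euclidean_space \<Rightarrow> 'e \<Rightarrow> real"
  assumes V: "open V" and M: "\<And>i j. i \<in> Basis \<Longrightarrow> j \<in> Basis \<Longrightarrow> Ck_on Basis k V (\<lambda>y. M y i j)"
    and bij: "\<And>y. y \<in> V \<Longrightarrow> bij (matvec (M y))"
  shows "Ck_on Basis k V (\<lambda>y. inv (matvec (M y)) v \<bullet> j)"
  using M
proof (induction k arbitrary: v j)
  case 0
  then show ?case using matrix_inverse_continuous[OF V _ bij, where v=v] by (auto intro!: continuous_intros)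
next
  case (Suc k)
  let ?N = "\<lambda>y. inv (matvec (M y))"
  have contN: "continuous_on V (\<lambda>y. ?N y v)" for v
    by (rule matrix_inverse_continuous[OF V _ bij]) (use Suc.prems in auto)
  have IH: "Ck_on Basis k V (\<lambda>y. ?N y v \<bullet> j)" for v j
    by (rule Suc.IH) (rule Ck_on_Suc_imp[OF Suc.prems])
  show ?case
  proof (rule Ck_on_SucI)
    show "continuous_on V (\<lambda>y. ?N y v \<bullet> j)" by (intro continuous_intros contN)
    fix b :: 'd assume b: "b \<in> Basis"
    let ?D = "\<lambda>y. - (\<Sum>k\<in>Basis. (\<Sum>l\<in>Basis. partial_deriv b (\<lambda>y. M y k l) y * (?N y v \<bullet> l)) * (?N y k \<bullet> j))"
    show "Ck_on Basis k V ?D"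
      using V by (intro Ck_on_minus Ck_on_sum Ck_on_mult IH Ck_on_partial[OF Suc.prems] b) auto
    fix y assume y: "y \<in> V"
    have ev: "\<forall>\<^sub>F s in at (0::real). y + s *\<^sub>R b \<in> V"
      using eventually_relopen[of Basis V y b] V b y by (auto simp: eventually_at_filter elim: eventually_mono)
    have "((\<lambda>s. - (\<Sum>k\<in>Basis. (\<Sum>l\<in>Basis. (M (y + s *\<^sub>R b) k l - M y k l) / s * (?N y v \<bullet> l)) * (?N (y + s *\<^sub>R b) k \<bullet> j)))
        \<longlongrightarrow> ?D y) (at 0)"
    proof (intro tendsto_intros)
      fix k l :: 'e assume "k \<in> Basis" "l \<in> Basis"
      then show "((\<lambda>s. (M (y + s *\<^sub>R b) k l - M y k l) / s) \<longlongrightarrow> partial_deriv b (\<lambda>y. M y k l) y) (at 0)"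
        using Ck_on_has_partial[OF Suc.prems b y] by (simp add: DERIV_def)
    next
      fix k :: 'e
      have "isCont (\<lambda>y. ?N y k) y" using contN[of k] V y by (simp add: continuous_on_eq_continuous_at)
      moreover have "((\<lambda>s::real. y + s *\<^sub>R b) \<longlongrightarrow> y + 0 *\<^sub>R b) (at 0)" by (intro tendsto_intros)
      ultimately show "((\<lambda>s::real. ?N (y + s *\<^sub>R b) k) \<longlongrightarrow> ?N y k) (at 0)"
        using isCont_tendsto_compose by fastforce
    qed
    moreover have "\<forall>\<^sub>F s in at (0::real). (?N (y + s *\<^sub>R b) v \<bullet> j - ?N y v \<bullet> j) / s =
        - (\<Sum>k\<in>Basis. (\<Sum>l\<in>Basis. (M (y + s *\<^sub>R b) k l - M y k l) / s * (?N y v \<bullet> l)) * (?N (y + s *\<^sub>R b) k \<bullet> j))"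
      using ev
    proof eventually_elim
      case (elim s)
      let ?m = "matvec (\<lambda>k l. M (y + s *\<^sub>R b) k l - M y k l) (?N y v)"
      have "?N (y + s *\<^sub>R b) v \<bullet> j - ?N y v \<bullet> j = - (?N (y + s *\<^sub>R b) ?m \<bullet> j)"
        unfolding inner_diff_left[symmetric] matvec_inv_diff[OF bij[OF y] bij[OF elim]] by simp
      also have "\<dots> = - (\<Sum>k\<in>Basis. (?m \<bullet> k) * (?N (y + s *\<^sub>R b) k \<bullet> j))"
        by (subst linear_inner_expand[OF matvec_inv(3)[OF bij[OF elim]]]) simp
      finally show ?case
        by (simp add: matvec_inner sum_divide_distrib[symmetric] divide_inverse sum_distrib_left sum_distrib_right mult_ac)
    qed
    ultimately show "((\<lambda>s. ?N (y + s *\<^sub>R b) v \<bullet> j) has_real_derivative ?D y) (at 0)"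
      unfolding DERIV_def by (simp add: tendsto_cong)
  qed (use V in auto)
qed

text \<open>The differentiable inverse function theorem supplies \<open>H\<close>, with derivative
  the inverse Jacobian at \<open>H y\<close>. If \<open>H\<close> has order \<open>k\<close>, so has
  that derivative by \<open>matrix_inverse_Ck\<close>, and \<open>H\<close> gains one order.\<close>

lemma smooth_inverse_function:
  fixes G :: "'e::euclidean_space \<Rightarrow> 'e"
  assumes U: "open U" "x0 \<in> U" and G: "\<And>i. i \<in> Basis \<Longrightarrow> smooth_on Basis U (\<lambda>x. G x \<bullet> i)"
    and inj: "\<And>h. (\<And>i. i \<in> Basis \<Longrightarrow> (\<Sum>b\<in>Basis. (h \<bullet> b) * partial_deriv b (\<lambda>x. G x \<bullet> i) x0) = 0) \<Longrightarrow> h = 0"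
  obtains U' V H where "open U'" "U' \<subseteq> U" "x0 \<in> U'" "open V" "homeomorphism U' V G H"
    "\<And>i. i \<in> Basis \<Longrightarrow> smooth_on Basis V (\<lambda>x. H x \<bullet> i)"
proof -
  define A where "A x i j = partial_deriv j (\<lambda>x. G x \<bullet> i) x" for x i j
  have As: "smooth_on Basis U (\<lambda>x. A x i j)" if "i \<in> Basis" "j \<in> Basis" for i j
    unfolding A_def by (rule smooth_on_partial[OF G[OF that(1)] that(2)])
  define f' where "f' x = Blinfun (matvec (A x))" for x
  have f': "blinfun_apply (f' x) = matvec (A x)" for x
    unfolding f'_def by (rule bounded_linear_Blinfun_apply) (simp add: linear_conv_bounded_linear[symmetric] linear_matvec)
  have dG: "(G has_derivative blinfun_apply (f' x)) (at x)" if "x \<in> U" for x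
    using has_derivative_of_smooth_components[OF U(1) G that]
    by (simp add: f' matvec_def[abs_def] A_def mult.commute)
  have "continuous_on U f'"
    by (rule continuous_on_blinfun_componentwise)
      (auto simp: f' matvec_def intro!: continuous_intros smooth_on_imp_continuous_on[OF As])
  moreover have "inj (matvec (A x0))"
  proof (subst linear_injective_0[OF linear_matvec], intro allI impI)
    fix h assume h: "matvec (A x0) h = 0"
    show "h = 0"
    proof (rule inj)
      fix i :: 'e assume "i \<in> Basis"
      then have "matvec (A x0) h \<bullet> i = (\<Sum>b\<in>Basis. A x0 i b * (h \<bullet> b))" by (rule matvec_inner)
      then show "(\<Sum>b\<in>Basis. (h \<bullet> b) * partial_deriv b (\<lambda>x. G x \<bullet> i) x0) = 0" using h by (simp add: A_def mult.commute)
    qed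
  qed
  then obtain g where g: "linear g" "g \<circ> matvec (A x0) = id"
    using linear_injective_left_inverse[OF linear_matvec] by blast
  then have "Blinfun g o\<^sub>L f' x0 = id_blinfun"
    by (intro blinfun_eqI) (simp add: f' bounded_linear_Blinfun_apply linear_conv_bounded_linear[symmetric] fun_eq_iff)
  ultimately obtain U' V H H' where IFT: "open U'" "U' \<subseteq> U" "x0 \<in> U'" "open V" "G x0 \<in> V" "homeomorphism U' V G H"
    "\<And>y. y \<in> V \<Longrightarrow> (H has_derivative (H' y)) (at y)"
    "\<And>y. y \<in> V \<Longrightarrow> H' y = inv (blinfun_apply (f' (H y)))"
    "\<And>y. y \<in> V \<Longrightarrow> bij (blinfun_apply (f' (H y)))"
    using inverse_function_theorem[OF U(1) dG _ U(2)] by metis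
  have HU: "H y \<in> U" if "y \<in> V" for y
    using IFT(2,6) that by (auto simp: homeomorphism_def)
  have "\<forall>i\<in>Basis. Ck_on Basis k V (\<lambda>y. H y \<bullet> i)" for k
  proof (induction k)
    case 0
    then show ?case using IFT(6) by (auto simp: homeomorphism_def intro!: continuous_intros)
  next
    case (Suc k)
    show ?case
    proof
      fix i :: 'e assume i: "i \<in> Basis"
      show "Ck_on Basis (Suc k) V (\<lambda>y. H y \<bullet> i)"
      proof (rule Ck_on_SucI)
        show "continuous_on V (\<lambda>y. H y \<bullet> i)" using Suc i Ck_on_imp_continuous_on by blast
        fix b :: 'e assume b: "b \<in> Basis"
        show "Ck_on Basis k V (\<lambda>y. inv (matvec (A (H y))) b \<bullet> i)"
        proof (rule matrix_inverse_Ck[OF IFT(4)])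
          show "Ck_on Basis k V (\<lambda>y. A (H y) i j)" if "i \<in> Basis" "j \<in> Basis" for i j
            by (rule Ck_on_compose[OF subset_refl _ _ smooth_on_Ck[OF As[OF that]]]) (use U IFT Suc HU in auto)
          show "bij (matvec (A (H y)))" if "y \<in> V" for y using IFT(9)[OF that] by (simp add: f')
        qed
        fix y assume y: "y \<in> V"
        have "((\<lambda>s. y + s *\<^sub>R b) has_derivative (\<lambda>s. s *\<^sub>R b)) (at 0)" by (auto intro!: derivative_eq_intros)
        from has_derivative_compose[OF this, of H "H' y"] IFT(7)[OF y]
        have "((\<lambda>s. H (y + s *\<^sub>R b)) has_derivative (\<lambda>s. H' y (s *\<^sub>R b))) (at 0)" by simp
        then have "((\<lambda>s. H (y + s *\<^sub>R b) \<bullet> i) has_derivative (\<lambda>s. H' y (s *\<^sub>R b) \<bullet> i)) (at 0)"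
          by (rule has_derivative_inner_left)
        also have "(\<lambda>s. H' y (s *\<^sub>R b) \<bullet> i) = (*) (inv (matvec (A (H y))) b \<bullet> i)"
          using linear_cmul[OF matvec_inv(3)[OF IFT(9)[OF y, unfolded f']]] IFT(8)[OF y] by (auto simp: f')
        finally show "((\<lambda>s. H (y + s *\<^sub>R b) \<bullet> i) has_real_derivative inv (matvec (A (H y))) b \<bullet> i) (at 0)"
          by (simp add: has_field_derivative_def)
      qed (use IFT in auto)
    qed
  qed
  then show ?thesis using that IFT by (auto simp: smooth_on_def)
qed

section \<open>Closed conformal fields in coordinates\<close>

text \<open>The set of axes may change along with the domain. This is what restricts functions from
  an open set to a coordinate subspace, and from there to the slice without the axis
  \<open>e\<close>.\<close>

lemma smooth_on_restrict:
  assumes "A \<subseteq> Basis" "B \<subseteq> Basis" "relopen A U" "relopen B W" "W \<subseteq> U" "smooth_on A U F"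
  shows "smooth_on B W F"
  using smooth_on_compose[OF assms(1,3,4,6), of "\<lambda>x. x"] assms(4,5) by (auto intro: smooth_on_inner)

section \<open>Closed one-forms on convex sets\<close>

lemma smooth_on_curve_within:
  fixes F :: "'e::euclidean_space \<Rightarrow> real"
  assumes "B \<subseteq> Basis" "relopen B V" "smooth_on B V F" "\<gamma> ` S \<subseteq> V" "t \<in> S"
    and "(\<gamma> has_vector_derivative v) (at t within S)"
  shows "((\<lambda>t. F (\<gamma> t)) has_real_derivative (\<Sum>b\<in>B. (v \<bullet> b) * partial_deriv b F (\<gamma> t))) (at t within S)"
proof -
  have "(F has_derivative (\<lambda>h. \<Sum>b\<in>B. (h \<bullet> b) * partial_deriv b F (\<gamma> t))) (at (\<gamma> t) within \<gamma> ` S)"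
    by (rule has_derivative_subset[OF has_derivative_of_partials[OF assms(1,2) _ smooth_on_Ck[OF assms(3)]]])
      (use assms in auto)
  from has_derivative_in_compose[OF assms(6)[unfolded has_vector_derivative_def] this]
  have "((\<lambda>t. F (\<gamma> t)) has_derivative (\<lambda>s. \<Sum>b\<in>B. ((s *\<^sub>R v) \<bullet> b) * partial_deriv b F (\<gamma> t))) (at t within S)" .
  also have "(\<lambda>s. \<Sum>b\<in>B. ((s *\<^sub>R v) \<bullet> b) * partial_deriv b F (\<gamma> t)) =
      (*) (\<Sum>b\<in>B. (v \<bullet> b) * partial_deriv b F (\<gamma> t))"
    by (intro ext, unfold sum_distrib_right, intro sum.cong refl) simp
  finally show ?thesis unfolding has_field_derivative_def .
qed

lemma constant_of_partials_zero:
  fixes F :: "'e::euclidean_space \<Rightarrow> real"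
  assumes "B \<subseteq> Basis" "relopen B V" "convex V" "smooth_on B V F"
    and "\<And>x b. x \<in> V \<Longrightarrow> b \<in> B \<Longrightarrow> partial_deriv b F x = 0" "x \<in> V" "y \<in> V"
  shows "F x = F y"
proof -
  have "\<exists>c. \<forall>x\<in>V. F x = c"
  proof (rule has_derivative_zero_constant[OF assms(3)])
    fix x assume x: "x \<in> V"
    show "(F has_derivative (\<lambda>h. 0)) (at x within V)"
      using has_derivative_of_partials[OF assms(1,2) x smooth_on_Ck[OF assms(4)]] assms(5)[OF x] by simp
  qed
  then show ?thesis using assms(6,7) by auto
qed

text \<open>The Poincare lemma: the form is integrated along the straight segments from
  \<open>x0\<close>, which lie in \<open>V\<close> by convexity.\<close>

lemma closed_form_exact:
  fixes \<omega> :: "'e::euclidean_space \<Rightarrow> 'e \<Rightarrow> real"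
  assumes B: "B \<subseteq> Basis" and V: "relopen B V" "convex V" and x0: "x0 \<in> V"
    and \<omega>: "\<And>b. b \<in> B \<Longrightarrow> smooth_on B V (\<omega> b)"
    and closed: "\<And>b c x. b \<in> B \<Longrightarrow> c \<in> B \<Longrightarrow> x \<in> V \<Longrightarrow> partial_deriv b (\<omega> c) x = partial_deriv c (\<omega> b) x"
  obtains \<tau> where "smooth_on B V \<tau>" "\<tau> x0 = 0" "\<And>b x. b \<in> B \<Longrightarrow> x \<in> V \<Longrightarrow> partial_deriv b \<tau> x = \<omega> b x"
proof -
  define p where "p x s = x0 + s *\<^sub>R (x - x0)" for x s
  define \<tau> where "\<tau> x = integral (cbox 0 1) (\<lambda>s. \<Sum>l\<in>B. \<omega> l (p x s) * ((x - x0) \<bullet> l))" for x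
  have Vs: "V \<subseteq> span B" using V(1) by (simp add: openin_euclidean_subtopology_iff)
  have pV: "p x s \<in> V" if "x \<in> V" "s \<in> {0..1}" for x s
    using convexD_alt[OF V(2) x0 that(1), of s] that by (simp add: p_def algebra_simps)
  have \<omega>c: "continuous_on V (\<omega> l)" "continuous_on V (partial_deriv b (\<omega> l))" if "l \<in> B" "b \<in> B" for l b
    using \<omega>[OF that(1)] smooth_on_partial[OF \<omega>[OF that(1)] that(2)] by (auto intro: smooth_on_imp_continuous_on)
  have main: "((\<lambda>r. \<tau> (x + r *\<^sub>R b)) has_real_derivative \<omega> b x) (at 0)" if b: "b \<in> B" and x: "x \<in> V" for b x
  proof -
    \<comment> \<open>The parameters for which the line through \<open>x\<close> stays in
      \<open>V\<close>: an open convex set containing 0, over which the integral may be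
      differentiated.\<close>
    define S where "S = {r::real. x + r *\<^sub>R b \<in> V}"
    have line: "x + r *\<^sub>R b \<in> span B" for r using b x Vs by (auto intro!: span_add span_mul intro: span_base)
    obtain O' where O': "open O'" "V = span B \<inter> O'" using V(1) by (metis openin_open)
    have "S = (\<lambda>r. x + r *\<^sub>R b) -` O'" using O' line by (auto simp: S_def)
    moreover have "open ((\<lambda>r::real. x + r *\<^sub>R b) -` O')"
      by (intro continuous_open_vimage O' continuous_intros)
    moreover have "0 \<in> S" using x by (simp add: S_def)
    ultimately have S: "open S" "0 \<in> S" by simp_all
    have "convex S" unfolding S_def
    proof (rule convexI, safe)
      fix r r' a c :: real assume *: "x + r *\<^sub>R b \<in> V" "x + r' *\<^sub>R b \<in> V" "0 \<le> a" "0 \<le> c" "a + c = 1"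
      have "a *\<^sub>R (x + r *\<^sub>R b) + c *\<^sub>R (x + r' *\<^sub>R b) \<in> V" using * V(2) by (intro convexD)
      also have "a *\<^sub>R (x + r *\<^sub>R b) + c *\<^sub>R (x + r' *\<^sub>R b) = (a + c) *\<^sub>R x + (a * r + c * r') *\<^sub>R b"
        by (simp add: algebra_simps)
      finally show "x + (a *\<^sub>R r + c *\<^sub>R r') *\<^sub>R b \<in> V" using * by simp
    qed
    define fx where "fx r s = (\<Sum>l\<in>B. s * partial_deriv b (\<omega> l) (p (x + r *\<^sub>R b) s) * ((x + r *\<^sub>R b - x0) \<bullet> l)
        + \<omega> l (p (x + r *\<^sub>R b) s) * (b \<bullet> l))" for r s
    have cp: "continuous_on (S \<times> cbox 0 1) (\<lambda>q. F (p (x + fst q *\<^sub>R b) (snd q)))" if "continuous_on V F" for F :: "'e \<Rightarrow> real"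
      by (rule continuous_on_compose2[OF that]) (auto simp: p_def[abs_def] intro!: continuous_intros, auto simp: S_def p_def[symmetric] intro: pV)
    have "((\<lambda>r. integral (cbox 0 1) (\<lambda>s. \<Sum>l\<in>B. \<omega> l (p (x + r *\<^sub>R b) s) * ((x + r *\<^sub>R b - x0) \<bullet> l)))
        has_real_derivative integral (cbox 0 1) (fx 0)) (at 0 within S)"
    proof (rule leibniz_rule_field_derivative)
      fix r s :: real assume r: "r \<in> S" and s: "s \<in> cbox 0 1"
      have mem: "p (x + r *\<^sub>R b) s \<in> V" using r s by (auto simp: S_def intro: pV)
      have dw: "((\<lambda>r. \<omega> l (p (x + r *\<^sub>R b) s)) has_real_derivative s * partial_deriv b (\<omega> l) (p (x + r *\<^sub>R b) s)) (at r within S)"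
        if l: "l \<in> B" for l
      proof -
        have eq: "p x s + (s * r) *\<^sub>R b = p (x + r *\<^sub>R b) s" for r by (simp add: p_def algebra_simps)
        have "((\<lambda>q. \<omega> l (p x s + q *\<^sub>R b)) has_real_derivative partial_deriv b (\<omega> l) (p (x + r *\<^sub>R b) s)) (at (s * r))"
          by (rule has_partial_shift) (use smooth_on_has_partial[OF \<omega>[OF l] b mem] in \<open>simp add: eq\<close>)
        from DERIV_chain2[OF this DERIV_cmult[OF DERIV_ident, of s]]
        show ?thesis by (simp only: eq mult_1_right mult.commute[of _ s])
      qed
      show "((\<lambda>r. \<Sum>l\<in>B. \<omega> l (p (x + r *\<^sub>R b) s) * ((x + r *\<^sub>R b - x0) \<bullet> l)) has_real_derivative fx r s) (at r within S)"
        unfolding fx_def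
      proof (rule DERIV_sum)
        fix l assume l: "l \<in> B"
        have "((\<lambda>r. (x + r *\<^sub>R b - x0) \<bullet> l) has_real_derivative b \<bullet> l) (at r within S)"
          by (auto intro!: derivative_eq_intros simp: inner_add_left inner_diff_left)
        from DERIV_mult[OF dw[OF l] this]
        show "((\<lambda>r. \<omega> l (p (x + r *\<^sub>R b) s) * ((x + r *\<^sub>R b - x0) \<bullet> l)) has_real_derivative
            s * partial_deriv b (\<omega> l) (p (x + r *\<^sub>R b) s) * ((x + r *\<^sub>R b - x0) \<bullet> l)
            + \<omega> l (p (x + r *\<^sub>R b) s) * (b \<bullet> l)) (at r within S)"
          by (simp only: mult.commute[of "b \<bullet> l"])
      qed
    next
      fix r assume r: "r \<in> S"
      show "(\<lambda>s. \<Sum>l\<in>B. \<omega> l (p (x + r *\<^sub>R b) s) * ((x + r *\<^sub>R b - x0) \<bullet> l)) integrable_on cbox 0 1"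
      proof (rule integrable_continuous, intro continuous_intros)
        fix l assume l: "l \<in> B"
        show "continuous_on (cbox 0 1) (\<lambda>s. \<omega> l (p (x + r *\<^sub>R b) s))"
          by (rule continuous_on_compose2[OF \<omega>c(1)[OF l l]])
            (use r in \<open>auto simp: p_def[abs_def] intro!: continuous_intros\<close>, use r in \<open>auto simp: S_def p_def[symmetric] intro: pV\<close>)
      qed
    next
      show "continuous_on (S \<times> cbox 0 1) (\<lambda>(r, s). fx r s)"
        unfolding fx_def case_prod_beta by (intro continuous_intros cp \<omega>c b)
    qed (use S \<open>convex S\<close> in auto)
    then have 1: "((\<lambda>r. \<tau> (x + r *\<^sub>R b)) has_real_derivative integral (cbox 0 1) (fx 0)) (at 0)"
      unfolding \<tau>_def at_within_open[OF S(2,1)] .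
    \<comment> \<open>Closedness exchanges the two indices in the differentiated integrand and turns
      it into the \<open>s\<close>-derivative of \<open>s * \<omega> b (p x s)\<close>, whose
      boundary values are 0 and \<open>\<omega> b x\<close>.\<close>
    have "(fx 0 has_integral 1 * \<omega> b (p x 1) - 0 * \<omega> b (p x 0)) {0..1}"
    proof (rule fundamental_theorem_of_calculus)
      fix s :: real assume s: "s \<in> {0..1}"
      have "((\<lambda>s. p x s) has_vector_derivative (x - x0)) (at s within {0..1})"
        unfolding p_def by (auto intro!: derivative_eq_intros)
      then have "((\<lambda>s. \<omega> b (p x s)) has_real_derivative (\<Sum>c\<in>B. ((x - x0) \<bullet> c) * partial_deriv c (\<omega> b) (p x s))) (at s within {0..1})"
        by (rule smooth_on_curve_within[OF B V(1) \<omega>[OF b] _ s, rotated]) (use pV x in auto)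
      from DERIV_mult[OF DERIV_ident this]
      have "((\<lambda>s. s * \<omega> b (p x s)) has_real_derivative
          \<omega> b (p x s) + (\<Sum>c\<in>B. ((x - x0) \<bullet> c) * partial_deriv c (\<omega> b) (p x s)) * s) (at s within {0..1})" by simp
      also have "\<omega> b (p x s) + (\<Sum>c\<in>B. ((x - x0) \<bullet> c) * partial_deriv c (\<omega> b) (p x s)) * s = fx 0 s"
      proof -
        have "(\<Sum>l\<in>B. \<omega> l (p x s) * (b \<bullet> l)) = (\<Sum>l\<in>B. if l = b then \<omega> b (p x s) else 0)"
          using b subsetD[OF B] by (intro sum.cong refl) (simp add: inner_Basis)
        also have "\<dots> = \<omega> b (p x s)" using b finite_subset[OF B finite_Basis] by simp
        finally have d: "(\<Sum>l\<in>B. \<omega> l (p x s) * (b \<bullet> l)) = \<omega> b (p x s)" .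
        have "partial_deriv c (\<omega> b) (p x s) = partial_deriv b (\<omega> c) (p x s)" if "c \<in> B" for c
          using closed[OF that b pV[OF x s]] .
        then have "(\<Sum>c\<in>B. ((x - x0) \<bullet> c) * partial_deriv c (\<omega> b) (p x s)) * s
            = (\<Sum>l\<in>B. s * partial_deriv b (\<omega> l) (p x s) * ((x - x0) \<bullet> l))"
          unfolding sum_distrib_right by (intro sum.cong refl) (simp add: mult_ac)
        then show ?thesis using d by (simp add: fx_def sum.distrib)
      qed
      finally show "((\<lambda>s. s * \<omega> b (p x s)) has_vector_derivative fx 0 s) (at s within {0..1})"
        by (simp add: has_real_derivative_iff_has_vector_derivative)
    qed simp
    then have "integral (cbox 0 1) (fx 0) = \<omega> b x" by (simp add: integral_unique p_def)
    with 1 show ?thesis by simp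
  qed
  show ?thesis
  proof (rule that[of \<tau>])
    show "\<tau> x0 = 0" by (simp add: \<tau>_def)
    show pd: "partial_deriv b \<tau> x = \<omega> b x" if "b \<in> B" "x \<in> V" for b x
      by (rule partial_deriv_eqI[OF main[OF that]])
    have cont: "continuous_on V \<tau>"
      unfolding \<tau>_def
    proof (rule integral_continuous_on_param)
      have "continuous_on (V \<times> cbox 0 1) (\<lambda>q. \<omega> l (p (fst q) (snd q)))" if "l \<in> B" for l
        by (rule continuous_on_compose2[OF \<omega>c(1)[OF that that]])
          (auto simp: p_def[abs_def] intro!: continuous_intros, auto simp: p_def[symmetric] intro: pV)
      then show "continuous_on (V \<times> cbox 0 1) (\<lambda>(x, s). \<Sum>l\<in>B. \<omega> l (p x s) * ((x - x0) \<bullet> l))"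
        unfolding case_prod_beta by (intro continuous_intros)
    qed
    show "smooth_on B V \<tau>" unfolding smooth_on_def
    proof
      fix k show "Ck_on B k V \<tau>"
      proof (cases k)
        case (Suc j)
        show ?thesis unfolding Suc
          by (rule Ck_on_SucI[where D=\<omega>]) (use V cont main \<omega> in \<open>auto simp: smooth_on_def\<close>)
      qed (use cont in simp)
    qed
  qed
qed

section \<open>Consequences of the closedness equation at one point, as algebra of
  coefficients\<close>

context
  fixes B :: "'i set" and G :: "'i \<Rightarrow> 'i \<Rightarrow> real" and dG :: "'i \<Rightarrow> 'i \<Rightarrow> 'i \<Rightarrow> real"
    and X :: "'i \<Rightarrow> real" and dX :: "'i \<Rightarrow> 'i \<Rightarrow> real" and \<phi> :: real
  assumes symG: "\<And>i j. i \<in> B \<Longrightarrow> j \<in> B \<Longrightarrow> G i j = G j i"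
    and symdG: "\<And>i j k. i \<in> B \<Longrightarrow> j \<in> B \<Longrightarrow> k \<in> B \<Longrightarrow> dG i j k = dG i k j"
    and E: "\<And>i l. i \<in> B \<Longrightarrow> l \<in> B \<Longrightarrow>
      (\<Sum>k\<in>B. G l k * dX i k) + (\<Sum>j\<in>B. (dG i j l + dG j i l - dG l i j) * X j) / 2 = \<phi> * G i l"
begin

text \<open>Closedness of the form dual to \<open>X\<close>, where \<open>dG i l k\<close> stands
  for the \<open>i\<close>-th derivative of \<open>G l k\<close>. Once \<open>E\<close> has
  eliminated \<open>dX\<close>, the remaining expression is visibly symmetric in \<open>i\<close>
  and \<open>l\<close>.\<close>

lemma lowered_derivative_symmetric:
  assumes "i \<in> B" "l \<in> B"
  shows "(\<Sum>k\<in>B. dG i l k * X k + G l k * dX i k) = (\<Sum>k\<in>B. dG l i k * X k + G i k * dX l k)"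
proof -
  have "(\<Sum>k\<in>B. dG i l k * X k + G l k * dX i k) =
      \<phi> * G i l + (\<Sum>j\<in>B. (dG i j l - dG j i l + dG l i j) * X j) / 2" if "i \<in> B" "l \<in> B" for i l
  proof -
    have "(\<Sum>k\<in>B. dG i l k * X k) = (\<Sum>j\<in>B. (dG i j l + dG j i l - dG l i j) * X j) / 2
        + (\<Sum>j\<in>B. (dG i j l - dG j i l + dG l i j) * X j) / 2"
      unfolding sum_divide_distrib sum.distrib[symmetric]
      by (rule sum.cong) (use symdG that in \<open>auto simp: field_simps\<close>)
    then show ?thesis using E[OF that] by (simp add: sum.distrib)
  qed
  from this[OF assms] this[OF assms(2,1)] show ?thesis
    using symG[OF assms] by (simp, intro sum.cong) (use symdG assms in auto)
qed

text \<open>The left side is the product rule for the squared length of \<open>X\<close>. After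
  \<open>dX\<close> is eliminated by \<open>E\<close>, the surviving derivatives of the metric are
  antisymmetric in the two summation indices and cancel.\<close>

lemma norm_square_derivative:
  assumes i: "i \<in> B"
  shows "(\<Sum>l\<in>B. (\<Sum>k\<in>B. dG i l k * X k + G l k * dX i k) * X l + (\<Sum>k\<in>B. G l k * X k) * dX i l)
    = 2 * \<phi> * (\<Sum>k\<in>B. G i k * X k)"
proof -
  have 1: "(\<Sum>k\<in>B. dG i l k * X k + G l k * dX i k) =
      \<phi> * G i l + (\<Sum>j\<in>B. (dG i j l - dG j i l + dG l i j) * X j) / 2" if "l \<in> B" for l
  proof -
    have "(\<Sum>k\<in>B. dG i l k * X k) = (\<Sum>j\<in>B. (dG i j l + dG j i l - dG l i j) * X j) / 2
        + (\<Sum>j\<in>B. (dG i j l - dG j i l + dG l i j) * X j) / 2"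
      unfolding sum_divide_distrib sum.distrib[symmetric]
      by (rule sum.cong) (use symdG that i in \<open>auto simp: field_simps\<close>)
    then show ?thesis using E[OF i that] by (simp add: sum.distrib)
  qed
  have "(\<Sum>l\<in>B. (\<Sum>k\<in>B. G l k * X k) * dX i l) = (\<Sum>l\<in>B. \<Sum>k\<in>B. G l k * X k * dX i l)"
    by (simp add: sum_distrib_right)
  also have "\<dots> = (\<Sum>k\<in>B. \<Sum>l\<in>B. G l k * X k * dX i l)" by (rule sum.swap)
  also have "\<dots> = (\<Sum>k\<in>B. (\<Sum>l\<in>B. G k l * dX i l) * X k)"
    unfolding sum_distrib_right by (intro sum.cong refl) (simp add: symG mult_ac)
  also have "\<dots> = (\<Sum>k\<in>B. (\<phi> * G i k - (\<Sum>j\<in>B. (dG i j k + dG j i k - dG k i j) * X j) / 2) * X k)"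
  proof (rule sum.cong[OF refl])
    fix k assume "k \<in> B"
    from E[OF i this] have "(\<Sum>l\<in>B. G k l * dX i l) = \<phi> * G i k - (\<Sum>j\<in>B. (dG i j k + dG j i k - dG k i j) * X j) / 2"
      by linarith
    then show "(\<Sum>l\<in>B. G k l * dX i l) * X k = (\<phi> * G i k - (\<Sum>j\<in>B. (dG i j k + dG j i k - dG k i j) * X j) / 2) * X k"
      by (simp only:)
  qed
  finally have 2: "(\<Sum>l\<in>B. (\<Sum>k\<in>B. G l k * X k) * dX i l) = \<dots>" .
  have "(\<Sum>l\<in>B. \<Sum>j\<in>B. dG l i j * X j * X l) = (\<Sum>j\<in>B. \<Sum>l\<in>B. dG l i j * X j * X l)" by (rule sum.swap)
  also have "\<dots> = (\<Sum>l\<in>B. \<Sum>j\<in>B. dG j i l * X j * X l)" by (intro sum.cong refl) (simp add: mult_ac)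
  finally have 3: "(\<Sum>l\<in>B. \<Sum>j\<in>B. dG l i j * X j * X l) = (\<Sum>l\<in>B. \<Sum>j\<in>B. dG j i l * X j * X l)" .
  have "(\<Sum>l\<in>B. (\<Sum>k\<in>B. dG i l k * X k + G l k * dX i k) * X l + (\<Sum>k\<in>B. G l k * X k) * dX i l)
      = (\<Sum>l\<in>B. (\<phi> * G i l + (\<Sum>j\<in>B. (dG i j l - dG j i l + dG l i j) * X j) / 2) * X l)
        + (\<Sum>k\<in>B. (\<phi> * G i k - (\<Sum>j\<in>B. (dG i j k + dG j i k - dG k i j) * X j) / 2) * X k)"
    by (rule trans[OF sum.distrib]) (intro arg_cong2[of _ _ _ _ "(+)"] sum.cong refl 2, simp only: 1)
  also have "\<dots> = (\<Sum>l\<in>B. 2 * \<phi> * (G i l * X l) + (\<Sum>j\<in>B. (dG l i j - dG j i l) * X j) * X l)"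
    unfolding sum.distrib[symmetric]
  proof (rule sum.cong[OF refl])
    fix l assume "l \<in> B"
    have eq: "(\<Sum>j\<in>B. (dG l i j - dG j i l) * X j) = (\<Sum>j\<in>B. (dG i j l - dG j i l + dG l i j) * X j) / 2
        - (\<Sum>j\<in>B. (dG i j l + dG j i l - dG l i j) * X j) / 2"
      unfolding sum_divide_distrib sum_subtractf[symmetric] by (rule sum.cong) (auto simp: field_simps)
    show "(\<phi> * G i l + (\<Sum>j\<in>B. (dG i j l - dG j i l + dG l i j) * X j) / 2) * X l +
         (\<phi> * G i l - (\<Sum>j\<in>B. (dG i j l + dG j i l - dG l i j) * X j) / 2) * X l =
         2 * \<phi> * (G i l * X l) + (\<Sum>j\<in>B. (dG l i j - dG j i l) * X j) * X l"
      unfolding eq by (simp add: algebra_simps)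
  qed
  also have "\<dots> = 2 * \<phi> * (\<Sum>k\<in>B. G i k * X k) + ((\<Sum>l\<in>B. \<Sum>j\<in>B. dG l i j * X j * X l) - (\<Sum>l\<in>B. \<Sum>j\<in>B. dG j i l * X j * X l))"
    by (simp add: sum.distrib sum_distrib_left sum_distrib_right sum_subtractf left_diff_distrib)
  finally show ?thesis using 3 by simp
qed

text \<open>The coordinate form of \<open>L\<^sub>X g = 2 \<phi> g\<close>, obtained by adding
  \<open>E\<close> for \<open>(i, l)\<close> and \<open>(l, i)\<close>: the Christoffel terms
  combine to the derivative of the metric along \<open>X\<close>.\<close>

lemma lie_derivative_coefficients:
  assumes il: "i \<in> B" "l \<in> B"
  shows "(\<Sum>j\<in>B. X j * dG j i l) + (\<Sum>j\<in>B. G j l * dX i j) + (\<Sum>j\<in>B. G i j * dX l j) = 2 * \<phi> * G i l"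
proof -
  have "(\<Sum>j\<in>B. G j l * dX i j) = (\<Sum>j\<in>B. G l j * dX i j)" using symG il by simp
  moreover have "(\<Sum>j\<in>B. (dG i j l + dG j i l - dG l i j) * X j) / 2 + (\<Sum>j\<in>B. (dG l j i + dG j l i - dG i l j) * X j) / 2
      = (\<Sum>j\<in>B. X j * dG j i l)"
    unfolding sum_divide_distrib sum.distrib[symmetric]
    by (rule sum.cong) (use symdG il in \<open>auto simp: field_simps\<close>)
  ultimately show ?thesis using E[OF il] E[OF il(2,1)] symG[OF il] by (simp add: algebra_simps)
qed

end

text \<open>\<open>B\<close> is the set of axes of the chart, \<open>V\<close> its image, \<open>g i j\<close> and \<open>X k\<close> are the coefficients of the metric
  and of the field.  The last assumption is \<open>\<nabla>\<^sub>i X = \<phi> \<partial>\<^sub>i\<close> with lowered index, written with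
  Christoffel symbols of the first kind.\<close>
locale closed_conformal_chart =
  fixes B V :: "'e::euclidean_space set" and g :: "'e \<Rightarrow> 'e \<Rightarrow> 'e \<Rightarrow> real" and X :: "'e \<Rightarrow> 'e \<Rightarrow> real"
    and \<phi> :: "'e \<Rightarrow> real" and x0 :: 'e
  assumes B: "B \<subseteq> Basis" and V: "relopen B V" "convex V" and x0: "x0 \<in> V"
    and g_smooth: "i \<in> B \<Longrightarrow> j \<in> B \<Longrightarrow> smooth_on B V (g i j)"
    and g_sym: "i \<in> B \<Longrightarrow> j \<in> B \<Longrightarrow> x \<in> V \<Longrightarrow> g i j x = g j i x"
    and g_pos: "x \<in> V \<Longrightarrow> \<exists>i\<in>B. c i \<noteq> 0 \<Longrightarrow> (\<Sum>i\<in>B. \<Sum>j\<in>B. g i j x * c i * c j) > 0"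
    and X_smooth: "k \<in> B \<Longrightarrow> smooth_on B V (X k)"
    and X_nonzero: "x \<in> V \<Longrightarrow> \<exists>k\<in>B. X k x \<noteq> 0"
    and covariant_derivative: "i \<in> B \<Longrightarrow> l \<in> B \<Longrightarrow> x \<in> V \<Longrightarrow>
      (\<Sum>k\<in>B. g l k x * partial_deriv i (X k) x) +
      (\<Sum>j\<in>B. (partial_deriv i (g j l) x + partial_deriv j (g i l) x - partial_deriv l (g i j) x) * X j x) / 2
      = \<phi> x * g i l x"
begin

lemma finB: "finite B" using B finite_subset finite_Basis by blast

definition "X_low l x = (\<Sum>k\<in>B. g l k x * X k x)"
definition "X_sq x = (\<Sum>l\<in>B. X_low l x * X l x)"
definition "X_norm x = sqrt (X_sq x)"
definition "\<nu> x = inverse (X_norm x)"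
definition "N k x = \<nu> x * X k x"
definition "N_low l x = \<nu> x * X_low l x"

lemma X_sq_pos: "x \<in> V \<Longrightarrow> X_sq x > 0"
  using g_pos[of x "\<lambda>k. X k x"] X_nonzero[of x]
  by (simp add: X_sq_def X_low_def sum_distrib_left sum_distrib_right mult_ac)

lemma X_norm_pos: "x \<in> V \<Longrightarrow> X_norm x > 0"
  and \<nu>_pos: "x \<in> V \<Longrightarrow> \<nu> x > 0"
  and X_norm_\<nu>: "x \<in> V \<Longrightarrow> \<nu> x * X_norm x = 1"
  and X_norm_sq: "x \<in> V \<Longrightarrow> X_norm x * X_norm x = X_sq x"
  using X_sq_pos by (simp_all add: X_norm_def \<nu>_def less_imp_neq[THEN not_sym] less_imp_le)

lemma smooth_X_low: "l \<in> B \<Longrightarrow> smooth_on B V (X_low l)"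
  unfolding X_low_def[abs_def] by (intro smooth_on_sum smooth_on_mult V g_smooth X_smooth)

lemma smooth_X_sq: "smooth_on B V X_sq"
  unfolding X_sq_def[abs_def] by (intro smooth_on_sum smooth_on_mult V smooth_X_low X_smooth)

lemma smooth_X_norm: "smooth_on B V X_norm"
  unfolding X_norm_def[abs_def] by (intro smooth_on_sqrt V smooth_X_sq X_sq_pos)

lemma smooth_\<nu>: "smooth_on B V \<nu>"
  unfolding \<nu>_def[abs_def] using X_norm_pos by (intro smooth_on_inverse V smooth_X_norm) force

lemma smooth_N: "k \<in> B \<Longrightarrow> smooth_on B V (N k)"
  unfolding N_def[abs_def] by (intro smooth_on_mult V smooth_\<nu> X_smooth)

lemma smooth_N_low: "k \<in> B \<Longrightarrow> smooth_on B V (N_low k)"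
  unfolding N_low_def[abs_def] by (intro smooth_on_mult V smooth_\<nu> smooth_X_low)

lemma partial_X_low:
  assumes "i \<in> B" "l \<in> B" "x \<in> V"
  shows "partial_deriv i (X_low l) x = (\<Sum>k\<in>B. partial_deriv i (g l k) x * X k x + g l k x * partial_deriv i (X k) x)"
proof -
  have "partial_deriv i (X_low l) x = (\<Sum>k\<in>B. partial_deriv i (\<lambda>x. g l k x * X k x) x)"
    unfolding X_low_def[abs_def] using assms
    by (intro partial_deriv_sum[of _ B V]) (auto intro!: smooth_on_mult V g_smooth X_smooth)
  also have "\<dots> = (\<Sum>k\<in>B. partial_deriv i (g l k) x * X k x + g l k x * partial_deriv i (X k) x)"
    by (intro sum.cong refl partial_deriv_mult[of B V] g_smooth X_smooth assms)
  finally show ?thesis .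
qed

lemma symmetric_partial_g:
  "i \<in> B \<Longrightarrow> j \<in> B \<Longrightarrow> k \<in> B \<Longrightarrow> x \<in> V \<Longrightarrow> partial_deriv i (g j k) x = partial_deriv i (g k j) x"
  by (rule partial_deriv_cong[OF V(1)]) (auto intro: g_sym)

lemma partial_X_sq:
  assumes "i \<in> B" "x \<in> V"
  shows "partial_deriv i X_sq x = 2 * \<phi> x * X_low i x"
proof -
  have "partial_deriv i X_sq x = (\<Sum>l\<in>B. partial_deriv i (\<lambda>x. X_low l x * X l x) x)"
    unfolding X_sq_def[abs_def] using assms
    by (intro partial_deriv_sum[of _ B V]) (auto intro!: smooth_on_mult V smooth_X_low X_smooth)
  also have "\<dots> = (\<Sum>l\<in>B. partial_deriv i (X_low l) x * X l x + X_low l x * partial_deriv i (X l) x)"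
    by (intro sum.cong refl partial_deriv_mult[of B V] smooth_X_low X_smooth assms)
  also have "\<dots> = (\<Sum>l\<in>B. (\<Sum>k\<in>B. partial_deriv i (g l k) x * X k x + g l k x * partial_deriv i (X k) x) * X l x
      + (\<Sum>k\<in>B. g l k x * X k x) * partial_deriv i (X l) x)"
    by (intro sum.cong refl) (simp add: partial_X_low assms X_low_def[of _ x])
  also have "\<dots> = 2 * \<phi> x * (\<Sum>k\<in>B. g i k x * X k x)"
    by (rule norm_square_derivative) (use assms g_sym symmetric_partial_g covariant_derivative in auto)
  finally show ?thesis by (simp add: X_low_def)
qed

lemma partial_X_norm:
  assumes "i \<in> B" "x \<in> V"
  shows "partial_deriv i X_norm x = \<phi> x * N_low i x"
proof (rule partial_deriv_eqI)
  have "((\<lambda>s. sqrt (X_sq (x + s *\<^sub>R i))) has_real_derivative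
      inverse (sqrt (X_sq (x + 0 *\<^sub>R i))) / 2 * partial_deriv i X_sq x) (at 0)"
    by (rule DERIV_chain2[OF DERIV_real_sqrt smooth_on_has_partial[OF smooth_X_sq assms]])
      (use X_sq_pos assms in simp)
  then show "((\<lambda>s. X_norm (x + s *\<^sub>R i)) has_real_derivative \<phi> x * N_low i x) (at 0)"
    using partial_X_sq[OF assms] by (simp add: X_norm_def \<nu>_def N_low_def mult_ac)
qed

lemma partial_\<nu>:
  assumes "i \<in> B" "x \<in> V"
  shows "partial_deriv i \<nu> x = - (\<phi> x * \<nu> x * \<nu> x * N_low i x)"
proof (rule partial_deriv_eqI)
  have "((\<lambda>s. inverse (X_norm (x + s *\<^sub>R i))) has_real_derivative
      - (partial_deriv i X_norm x * inverse ((X_norm (x + 0 *\<^sub>R i))\<^sup>2))) (at 0)"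
    using DERIV_inverse_fun[OF smooth_on_has_partial[OF smooth_X_norm assms]] X_norm_pos[OF assms(2)]
    by (simp add: numeral_2_eq_2)
  then show "((\<lambda>s. \<nu> (x + s *\<^sub>R i)) has_real_derivative - (\<phi> x * \<nu> x * \<nu> x * N_low i x)) (at 0)"
    using partial_X_norm[OF assms] by (simp add: \<nu>_def power2_eq_square mult_ac)
qed

lemma N_low_eq: "N_low l x = (\<Sum>k\<in>B. g l k x * N k x)"
  by (simp add: N_low_def N_def X_low_def sum_distrib_left mult_ac)

lemma N_unit:
  assumes "x \<in> V"
  shows "(\<Sum>k\<in>B. N k x * N_low k x) = 1"
proof -
  have "(\<Sum>k\<in>B. N k x * N_low k x) = \<nu> x * \<nu> x * X_sq x"
    by (simp add: N_def N_low_def X_sq_def sum_distrib_left mult_ac)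
  also have "\<dots> = (\<nu> x * X_norm x) * (\<nu> x * X_norm x)"
    using X_norm_sq[OF assms] by (simp add: mult_ac)
  finally show ?thesis using X_norm_\<nu>[OF assms] by simp
qed

text \<open>The form dual to \<open>X\<close> is closed, and the derivative of the factor
  \<open>\<nu>\<close> is proportional to that same form, so the extra term of the product rule is
  symmetric.\<close>

lemma N_low_closed:
  assumes "i \<in> B" "l \<in> B" "x \<in> V"
  shows "partial_deriv i (N_low l) x = partial_deriv l (N_low i) x"
proof -
  have eq: "partial_deriv i (N_low l) x = - (\<phi> x * \<nu> x * N_low i x * N_low l x) + \<nu> x * partial_deriv i (X_low l) x"
    if "i \<in> B" "l \<in> B" for i l
    using partial_deriv_mult[OF smooth_\<nu> smooth_X_low[OF that(2)] that(1) assms(3)] partial_\<nu>[OF that(1) assms(3)]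
    by (simp add: N_low_def[abs_def] mult_ac)
  have "partial_deriv i (X_low l) x = partial_deriv l (X_low i) x"
    unfolding partial_X_low[OF assms] partial_X_low[OF assms(2,1,3)]
    by (rule lowered_derivative_symmetric[where \<phi>="\<phi> x"])
      (use assms g_sym symmetric_partial_g covariant_derivative in auto)
  then show ?thesis using eq[OF assms(1,2)] eq[OF assms(2,1)] by simp
qed

text \<open>For a rescaled field, \<open>L\<^sub>N g\<close> is \<open>\<nu> L\<^sub>X g\<close>
  plus the symmetrized product of \<open>d\<nu>\<close> with the form dual to \<open>X\<close>.
  Since \<open>d\<nu>\<close> is \<open>- \<phi> \<nu>\<^sup>2\<close> times \<open>N_low\<close>,
  this product removes precisely the part along \<open>N\<close>.\<close>

lemma lie_derivative_unit:
  assumes il: "i \<in> B" "l \<in> B" and x: "x \<in> V"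
  shows "(\<Sum>j\<in>B. N j x * partial_deriv j (g i l) x) + (\<Sum>j\<in>B. g j l x * partial_deriv i (N j) x)
    + (\<Sum>j\<in>B. g i j x * partial_deriv l (N j) x) = 2 * \<phi> x * \<nu> x * (g i l x - N_low i x * N_low l x)"
proof -
  have N: "partial_deriv i (N j) x = - (\<phi> x * \<nu> x * N_low i x * N j x) + \<nu> x * partial_deriv i (X j) x"
    if "i \<in> B" "j \<in> B" for i j
    using partial_deriv_mult[OF smooth_\<nu> X_smooth[OF that(2)] that(1) x] partial_\<nu>[OF that(1) x]
    by (simp add: N_def[abs_def] mult_ac)
  have 1: "(\<Sum>j\<in>B. N j x * partial_deriv j (g i l) x) = \<nu> x * (\<Sum>j\<in>B. X j x * partial_deriv j (g i l) x)"
    by (simp add: N_def sum_distrib_left mult_ac)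
  have "(\<Sum>j\<in>B. g j l x * partial_deriv i (N j) x) = (\<Sum>j\<in>B. g l j x * N j x * (- (\<phi> x * \<nu> x * N_low i x)) + \<nu> x * (g j l x * partial_deriv i (X j) x))"
  proof (rule sum.cong[OF refl])
    fix j assume j: "j \<in> B"
    show "g j l x * partial_deriv i (N j) x = g l j x * N j x * (- (\<phi> x * \<nu> x * N_low i x)) + \<nu> x * (g j l x * partial_deriv i (X j) x)"
      unfolding N[OF il(1) j] g_sym[OF j il(2) x] by (simp add: algebra_simps)
  qed
  then have 2: "(\<Sum>j\<in>B. g j l x * partial_deriv i (N j) x) = N_low l x * (- (\<phi> x * \<nu> x * N_low i x)) + \<nu> x * (\<Sum>j\<in>B. g j l x * partial_deriv i (X j) x)"
    unfolding N_low_eq[of l] by (simp only: sum.distrib sum_distrib_left sum_distrib_right)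
  have "(\<Sum>j\<in>B. g i j x * partial_deriv l (N j) x) = (\<Sum>j\<in>B. g i j x * N j x * (- (\<phi> x * \<nu> x * N_low l x)) + \<nu> x * (g i j x * partial_deriv l (X j) x))"
    by (intro sum.cong refl) (simp add: N[OF il(2)] algebra_simps)
  then have 3: "(\<Sum>j\<in>B. g i j x * partial_deriv l (N j) x) = N_low i x * (- (\<phi> x * \<nu> x * N_low l x)) + \<nu> x * (\<Sum>j\<in>B. g i j x * partial_deriv l (X j) x)"
    unfolding N_low_eq[of i] by (simp only: sum.distrib sum_distrib_left sum_distrib_right)
  have "(\<Sum>j\<in>B. X j x * partial_deriv j (g i l) x) + (\<Sum>j\<in>B. g j l x * partial_deriv i (X j) x)
    + (\<Sum>j\<in>B. g i j x * partial_deriv l (X j) x) = 2 * \<phi> x * g i l x"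
    by (rule lie_derivative_coefficients) (use assms g_sym symmetric_partial_g covariant_derivative in auto)
  from arg_cong[OF this, of "\<lambda>r. \<nu> x * r"] show ?thesis
    unfolding 1 2 3 by (simp add: algebra_simps)
qed

end

text \<open>The transformation rule of a bilinear form under a linear change of its arguments. It
  serves the change of coordinates for the metric, positivity on the slice, and the final comparison
  of metrics.\<close>

lemma congruence_sum:
  fixes G :: "'k \<Rightarrow> 'k \<Rightarrow> real"
  shows "(\<Sum>a\<in>A. \<Sum>b\<in>A. (\<Sum>k\<in>B. \<Sum>l\<in>B. G k l * M a k * M b l) * p a * q b) =
    (\<Sum>k\<in>B. \<Sum>l\<in>B. G k l * (\<Sum>a\<in>A. p a * M a k) * (\<Sum>b\<in>A. q b * M b l))"
proof -
  let ?t = "\<lambda>a b k l. G k l * M a k * M b l * p a * q b"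
  have "(\<Sum>a\<in>A. \<Sum>b\<in>A. (\<Sum>k\<in>B. \<Sum>l\<in>B. G k l * M a k * M b l) * p a * q b) =
      (\<Sum>a\<in>A. \<Sum>b\<in>A. \<Sum>k\<in>B. \<Sum>l\<in>B. ?t a b k l)"
    by (simp add: sum_distrib_right)
  also have "\<dots> = (\<Sum>a\<in>A. \<Sum>k\<in>B. \<Sum>b\<in>A. \<Sum>l\<in>B. ?t a b k l)" by (intro sum.cong refl sum.swap)
  also have "\<dots> = (\<Sum>k\<in>B. \<Sum>a\<in>A. \<Sum>b\<in>A. \<Sum>l\<in>B. ?t a b k l)" by (rule sum.swap)
  also have "\<dots> = (\<Sum>k\<in>B. \<Sum>a\<in>A. \<Sum>l\<in>B. \<Sum>b\<in>A. ?t a b k l)"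
    by (rule sum.cong[OF refl], rule sum.cong[OF refl], rule sum.swap)
  also have "\<dots> = (\<Sum>k\<in>B. \<Sum>l\<in>B. \<Sum>a\<in>A. \<Sum>b\<in>A. ?t a b k l)" by (rule sum.cong[OF refl], rule sum.swap)
  also have "\<dots> = (\<Sum>k\<in>B. \<Sum>l\<in>B. G k l * (\<Sum>a\<in>A. p a * M a k) * (\<Sum>b\<in>A. q b * M b l))"
    by (intro sum.cong refl) (simp add: sum_distrib_left sum_distrib_right mult_ac)
  finally show ?thesis .
qed

lemma sum_delta_right: "finite B \<Longrightarrow> j \<in> B \<Longrightarrow> (\<Sum>l\<in>B. c l * (if j = l then 1 else 0)) = (c j :: real)"
  by (simp add: if_distrib[where f="\<lambda>r. _ * r"] cong: if_cong)

text \<open>A chart in which the unit field \<open>N = X / |X|\<close> is the coordinate field of the axis \<open>e\<close>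
  and the \<open>e\<close>-coordinate is a primitive \<open>\<tau>\<close> of the dual form.\<close>
locale straightened_chart = closed_conformal_chart +
  fixes e :: 'a and Z W :: "'a set" and \<Psi> \<Theta> :: "'a \<Rightarrow> 'a" and \<tau> :: "'a \<Rightarrow> real"
  assumes e: "e \<in> B" and Z: "relopen B Z" and W: "relopen B W" "W \<subseteq> V"
    and hom: "homeomorphism Z W \<Psi> \<Theta>"
    and \<Psi>_smooth: "k \<in> B \<Longrightarrow> smooth_on B Z (\<lambda>z. \<Psi> z \<bullet> k)"
    and \<Theta>_smooth: "k \<in> B \<Longrightarrow> smooth_on B W (\<lambda>x. \<Theta> x \<bullet> k)"
    and \<Psi>_flow: "k \<in> B \<Longrightarrow> z \<in> Z \<Longrightarrow> partial_deriv e (\<lambda>z. \<Psi> z \<bullet> k) z = N k (\<Psi> z)"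
    and \<tau>_smooth: "smooth_on B V \<tau>"
    and \<tau>_partial: "b \<in> B \<Longrightarrow> x \<in> V \<Longrightarrow> partial_deriv b \<tau> x = N_low b x"
    and \<tau>_\<Psi>: "z \<in> Z \<Longrightarrow> \<tau> (\<Psi> z) = z \<bullet> e"
begin

lemma \<Psi>_W: "z \<in> Z \<Longrightarrow> \<Psi> z \<in> W" and \<Theta>_Z: "x \<in> W \<Longrightarrow> \<Theta> x \<in> Z"
  and \<Theta>_\<Psi>: "z \<in> Z \<Longrightarrow> \<Theta> (\<Psi> z) = z" and \<Psi>_\<Theta>: "x \<in> W \<Longrightarrow> \<Psi> (\<Theta> x) = x"
  using hom by (auto simp: homeomorphism_def)

lemma \<Psi>_V: "z \<in> Z \<Longrightarrow> \<Psi> z \<in> V" using \<Psi>_W W by blast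

text \<open>The Jacobian of \<open>\<Psi>\<close>: its row \<open>a\<close> is the coordinate field
  of the axis \<open>a\<close>, written in the original chart.\<close>

definition "A a k z = partial_deriv a (\<lambda>z. \<Psi> z \<bullet> k) z"

lemma smooth_A: "a \<in> B \<Longrightarrow> k \<in> B \<Longrightarrow> smooth_on B Z (A a k)"
  unfolding A_def[abs_def] by (rule smooth_on_partial[OF \<Psi>_smooth])

lemma A_e: "k \<in> B \<Longrightarrow> z \<in> Z \<Longrightarrow> A e k z = N k (\<Psi> z)"
  by (simp add: A_def \<Psi>_flow)

lemma smooth_pull: "smooth_on B V F \<Longrightarrow> smooth_on B Z (\<lambda>z. F (\<Psi> z))"
  by (rule smooth_on_compose[OF B V(1) Z _ \<Psi>_smooth \<Psi>_V])

lemma partial_pull: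
  "smooth_on B V F \<Longrightarrow> a \<in> B \<Longrightarrow> z \<in> Z \<Longrightarrow>
    partial_deriv a (\<lambda>z. F (\<Psi> z)) z = (\<Sum>k\<in>B. partial_deriv k F (\<Psi> z) * A a k z)"
  unfolding A_def by (rule partial_deriv_compose[OF B V(1) Z _ \<Psi>_smooth \<Psi>_V])

lemma inner_B: "a \<in> B \<Longrightarrow> b \<in> B \<Longrightarrow> a \<bullet> b = (if a = b then 1 else 0)"
  using B by (simp add: inner_Basis subset_iff)

text \<open>Differentiate \<open>\<tau> (\<Psi> z) = z \<bullet> e\<close> and use that
  \<open>N_low\<close> is the differential of \<open>\<tau>\<close>. Thus every coordinate field
  except that of \<open>e\<close> is orthogonal to \<open>N\<close>.\<close>

lemma N_low_A:
  assumes "a \<in> B" "z \<in> Z"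
  shows "(\<Sum>k\<in>B. N_low k (\<Psi> z) * A a k z) = (if a = e then 1 else 0)"
proof -
  have "(\<Sum>k\<in>B. N_low k (\<Psi> z) * A a k z) = partial_deriv a (\<lambda>z. \<tau> (\<Psi> z)) z"
    unfolding partial_pull[OF \<tau>_smooth assms] by (intro sum.cong refl) (simp add: \<tau>_partial \<Psi>_V assms)
  also have "\<dots> = partial_deriv a (\<lambda>z. z \<bullet> e) z"
    by (rule partial_deriv_cong[OF Z assms(2,1)]) (rule \<tau>_\<Psi>)
  finally show ?thesis by (simp add: partial_deriv_inner inner_B assms e)
qed

text \<open>The coefficients of the metric in the straightened coordinates.\<close>

definition "P a b z = (\<Sum>k\<in>B. \<Sum>l\<in>B. g k l (\<Psi> z) * A a k z * A b l z)"

lemma smooth_P: "a \<in> B \<Longrightarrow> b \<in> B \<Longrightarrow> smooth_on B Z (P a b)"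
  unfolding P_def[abs_def] by (intro smooth_on_sum smooth_on_mult Z smooth_A smooth_pull g_smooth)

lemma P_sym:
  assumes "z \<in> Z"
  shows "P a b z = P b a z"
proof -
  have "P a b z = (\<Sum>l\<in>B. \<Sum>k\<in>B. g k l (\<Psi> z) * A a k z * A b l z)"
    unfolding P_def by (rule sum.swap)
  also have "\<dots> = P b a z"
    unfolding P_def by (intro sum.cong refl) (simp add: g_sym[OF _ _ \<Psi>_V[OF assms]] mult_ac)
  finally show ?thesis .
qed

text \<open>The coordinate field of \<open>e\<close> is \<open>N\<close>, so its row of the metric
  is \<open>N_low\<close> evaluated on the coordinate fields.\<close>

lemma P_e:
  assumes "b \<in> B" "z \<in> Z"
  shows "P e b z = (if b = e then 1 else 0)"
proof -
  have "P e b z = (\<Sum>l\<in>B. \<Sum>k\<in>B. g k l (\<Psi> z) * A e k z * A b l z)"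
    unfolding P_def by (rule sum.swap)
  also have "\<dots> = (\<Sum>l\<in>B. N_low l (\<Psi> z) * A b l z)"
  proof (rule sum.cong[OF refl])
    fix l assume l: "l \<in> B"
    have "N_low l (\<Psi> z) = (\<Sum>k\<in>B. g k l (\<Psi> z) * A e k z)"
      unfolding N_low_eq by (intro sum.cong refl) (simp add: A_e assms g_sym[OF l _ \<Psi>_V[OF assms(2)]])
    then show "(\<Sum>k\<in>B. g k l (\<Psi> z) * A e k z * A b l z) = N_low l (\<Psi> z) * A b l z"
      by (simp add: sum_distrib_right)
  qed
  finally show ?thesis by (simp add: N_low_A assms)
qed

text \<open>The differential of the norm is a multiple of \<open>N_low\<close>, which kills all axes
  but \<open>e\<close>. This is why the warping function depends on one variable.\<close>

lemma partial_norm: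
  assumes "a \<in> B" "z \<in> Z"
  shows "partial_deriv a (\<lambda>z. X_norm (\<Psi> z)) z = (if a = e then \<phi> (\<Psi> z) else 0)"
proof -
  have "partial_deriv a (\<lambda>z. X_norm (\<Psi> z)) z = (\<Sum>k\<in>B. \<phi> (\<Psi> z) * (N_low k (\<Psi> z) * A a k z))"
    unfolding partial_pull[OF smooth_X_norm assms]
    by (intro sum.cong refl) (simp add: partial_X_norm \<Psi>_V assms)
  then show ?thesis using N_low_A[OF assms] by (simp add: sum_distrib_left[symmetric])
qed

lemma partial_e_\<nu>:
  assumes "z \<in> Z"
  shows "partial_deriv e (\<lambda>z. \<nu> (\<Psi> z)) z = - (\<phi> (\<Psi> z) * \<nu> (\<Psi> z) * \<nu> (\<Psi> z))"
proof -
  have "partial_deriv e (\<lambda>z. \<nu> (\<Psi> z)) z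
      = (\<Sum>k\<in>B. - (\<phi> (\<Psi> z) * \<nu> (\<Psi> z) * \<nu> (\<Psi> z)) * (N_low k (\<Psi> z) * A e k z))"
    unfolding partial_pull[OF smooth_\<nu> e assms]
    by (intro sum.cong refl) (simp add: partial_\<nu> \<Psi>_V assms)
  then show ?thesis using N_low_A[OF e assms] by (simp only: sum_distrib_left[symmetric]) simp
qed

text \<open>Symmetry of second derivatives, that is, the commuting of the coordinate fields of
  \<open>e\<close> and \<open>a\<close>, followed by the flow equation.\<close>

lemma partial_e_A:
  assumes "a \<in> B" "k \<in> B" "z \<in> Z"
  shows "partial_deriv e (A a k) z = (\<Sum>m\<in>B. partial_deriv m (N k) (\<Psi> z) * A a m z)"
proof -
  have "partial_deriv e (A a k) z = partial_deriv a (A e k) z"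
    unfolding A_def[abs_def]
    by (rule partial_deriv_commute[OF Z smooth_on_Ck[OF \<Psi>_smooth[OF assms(2)]] e assms(1,3)])
  also have "\<dots> = partial_deriv a (\<lambda>z. N k (\<Psi> z)) z"
    by (rule partial_deriv_cong[OF Z assms(3,1)]) (rule A_e[OF assms(2)])
  finally show ?thesis by (simp add: partial_pull[OF smooth_N[OF assms(2)] assms(1,3)])
qed

text \<open>Because the coordinate fields commute with \<open>N\<close>, the derivative along
  \<open>e\<close> is \<open>L\<^sub>N g\<close> evaluated on two of them. The correction by
  \<open>N_low\<close> disappears since both are orthogonal to \<open>N\<close>.\<close>

lemma partial_e_P:
  assumes ab: "a \<in> B - {e}" "b \<in> B - {e}" and z: "z \<in> Z"
  shows "partial_deriv e (P a b) z = 2 * \<phi> (\<Psi> z) * \<nu> (\<Psi> z) * P a b z"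
proof -
  have ab': "a \<in> B" "b \<in> B" using ab by auto
  let ?x = "\<Psi> z"
  have x: "?x \<in> V" by (rule \<Psi>_V[OF z])
  let ?Ng = "\<lambda>k l. \<Sum>m\<in>B. N m ?x * partial_deriv m (g k l) ?x"
  let ?c = "2 * \<phi> ?x * \<nu> ?x"
  have D: "partial_deriv e (\<lambda>z. g k l (\<Psi> z) * A a k z * A b l z) z =
      ?Ng k l * A a k z * A b l z
      + g k l ?x * (\<Sum>m\<in>B. partial_deriv m (N k) ?x * A a m z) * A b l z
      + g k l ?x * A a k z * (\<Sum>m\<in>B. partial_deriv m (N l) ?x * A b m z)" if kl: "k \<in> B" "l \<in> B" for k l
  proof -
    have s: "smooth_on B Z (\<lambda>z. g k l (\<Psi> z))" "smooth_on B Z (A a k)" "smooth_on B Z (A b l)"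
      using kl ab' by (auto intro: smooth_pull g_smooth smooth_A)
    have "partial_deriv e (\<lambda>z. g k l (\<Psi> z)) z = ?Ng k l"
      unfolding partial_pull[OF g_smooth[OF kl] e z]
      by (intro sum.cong refl) (simp add: A_e z mult.commute)
    then show ?thesis
      using partial_deriv_mult[OF smooth_on_mult[OF Z s(1,2)] s(3) e z]
        partial_deriv_mult[OF s(1,2) e z] partial_e_A[OF ab'(1) kl(1) z] partial_e_A[OF ab'(2) kl(2) z]
      by (simp add: algebra_simps)
  qed
  have "partial_deriv e (P a b) z = (\<Sum>k\<in>B. \<Sum>l\<in>B. partial_deriv e (\<lambda>z. g k l (\<Psi> z) * A a k z * A b l z) z)"
    unfolding P_def[abs_def]
    by (subst partial_deriv_sum[of _ B Z], (intro smooth_on_sum smooth_on_mult Z smooth_A smooth_pull g_smooth ab' e z; assumption)+,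
        intro sum.cong refl partial_deriv_sum[of _ B Z] smooth_on_mult Z smooth_A smooth_pull g_smooth ab' e z)
  also have "\<dots> = (\<Sum>k\<in>B. \<Sum>l\<in>B. ?Ng k l * A a k z * A b l z)
      + (\<Sum>k\<in>B. \<Sum>l\<in>B. g k l ?x * (\<Sum>m\<in>B. partial_deriv m (N k) ?x * A a m z) * A b l z)
      + (\<Sum>k\<in>B. \<Sum>l\<in>B. g k l ?x * A a k z * (\<Sum>m\<in>B. partial_deriv m (N l) ?x * A b m z))"
    by (simp add: D sum.distrib)
  \<comment> \<open>Renaming and interchanging summation indices moves the derivative of
    \<open>N\<close> from the Jacobian onto the metric coefficient, matching the form of
    \<open>lie_derivative_unit\<close>.\<close>
  also have "(\<Sum>k\<in>B. \<Sum>l\<in>B. g k l ?x * (\<Sum>m\<in>B. partial_deriv m (N k) ?x * A a m z) * A b l z)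
      = (\<Sum>k\<in>B. \<Sum>l\<in>B. (\<Sum>j\<in>B. g j l ?x * partial_deriv k (N j) ?x) * A a k z * A b l z)"
  proof -
    have "(\<Sum>k\<in>B. \<Sum>l\<in>B. g k l ?x * (\<Sum>m\<in>B. partial_deriv m (N k) ?x * A a m z) * A b l z)
        = (\<Sum>l\<in>B. \<Sum>k\<in>B. \<Sum>m\<in>B. g k l ?x * partial_deriv m (N k) ?x * A a m z * A b l z)"
      by (subst sum.swap) (simp add: sum_distrib_left sum_distrib_right mult_ac)
    also have "\<dots> = (\<Sum>l\<in>B. \<Sum>m\<in>B. \<Sum>k\<in>B. g k l ?x * partial_deriv m (N k) ?x * A a m z * A b l z)"
      by (intro sum.cong refl sum.swap)
    also have "\<dots> = (\<Sum>m\<in>B. \<Sum>l\<in>B. \<Sum>k\<in>B. g k l ?x * partial_deriv m (N k) ?x * A a m z * A b l z)"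
      by (rule sum.swap)
    finally show ?thesis by (simp add: sum_distrib_right)
  qed
  also have "(\<Sum>k\<in>B. \<Sum>l\<in>B. g k l ?x * A a k z * (\<Sum>m\<in>B. partial_deriv m (N l) ?x * A b m z))
      = (\<Sum>k\<in>B. \<Sum>l\<in>B. (\<Sum>j\<in>B. g k j ?x * partial_deriv l (N j) ?x) * A a k z * A b l z)"
  proof (rule sum.cong[OF refl])
    fix k
    have "(\<Sum>l\<in>B. g k l ?x * A a k z * (\<Sum>m\<in>B. partial_deriv m (N l) ?x * A b m z))
        = (\<Sum>l\<in>B. \<Sum>m\<in>B. g k l ?x * partial_deriv m (N l) ?x * A a k z * A b m z)"
      by (simp add: sum_distrib_left mult_ac)
    also have "\<dots> = (\<Sum>m\<in>B. \<Sum>l\<in>B. g k l ?x * partial_deriv m (N l) ?x * A a k z * A b m z)" by (rule sum.swap)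
    finally show "(\<Sum>l\<in>B. g k l ?x * A a k z * (\<Sum>m\<in>B. partial_deriv m (N l) ?x * A b m z))
        = (\<Sum>l\<in>B. (\<Sum>j\<in>B. g k j ?x * partial_deriv l (N j) ?x) * A a k z * A b l z)"
      by (simp add: sum_distrib_right)
  qed
  also have "(\<Sum>k\<in>B. \<Sum>l\<in>B. ?Ng k l * A a k z * A b l z)
      + (\<Sum>k\<in>B. \<Sum>l\<in>B. (\<Sum>j\<in>B. g j l ?x * partial_deriv k (N j) ?x) * A a k z * A b l z)
      + (\<Sum>k\<in>B. \<Sum>l\<in>B. (\<Sum>j\<in>B. g k j ?x * partial_deriv l (N j) ?x) * A a k z * A b l z)
      = (\<Sum>k\<in>B. \<Sum>l\<in>B. (?Ng k l + (\<Sum>j\<in>B. g j l ?x * partial_deriv k (N j) ?x)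
          + (\<Sum>j\<in>B. g k j ?x * partial_deriv l (N j) ?x)) * A a k z * A b l z)"
    by (simp only: distrib_right sum.distrib)
  also have "\<dots> = (\<Sum>k\<in>B. \<Sum>l\<in>B. (?c * (g k l ?x - N_low k ?x * N_low l ?x)) * A a k z * A b l z)"
    by (intro sum.cong refl) (simp only: lie_derivative_unit[OF _ _ x])
  also have "\<dots> = (\<Sum>k\<in>B. \<Sum>l\<in>B. ?c * (g k l ?x * A a k z * A b l z)
      - ?c * ((N_low k ?x * A a k z) * (N_low l ?x * A b l z)))"
    by (intro sum.cong refl) (simp add: algebra_simps)
  also have "\<dots> = ?c * P a b z - ?c * ((\<Sum>k\<in>B. N_low k ?x * A a k z) * (\<Sum>l\<in>B. N_low l ?x * A b l z))"
    unfolding P_def by (simp only: sum_subtractf sum_product) (simp only: sum_distrib_left)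
  finally show ?thesis using N_low_A[OF ab'(1) z] ab by simp
qed

text \<open>The metric divided by the squared length of \<open>X\<close>; restricted to the slice it
  becomes the metric of the fibre.\<close>

definition "Q a b z = P a b z * (\<nu> (\<Psi> z) * \<nu> (\<Psi> z))"

lemma smooth_Q: "a \<in> B \<Longrightarrow> b \<in> B \<Longrightarrow> smooth_on B Z (Q a b)"
  unfolding Q_def[abs_def] by (intro smooth_on_mult Z smooth_P smooth_pull smooth_\<nu>)

lemma P_eq: "z \<in> Z \<Longrightarrow> P a b z = (X_norm (\<Psi> z))\<^sup>2 * Q a b z"
  using X_norm_\<nu>[OF \<Psi>_V] by (simp add: Q_def power2_eq_square) (metis mult.assoc mult.commute mult.right_neutral)

lemma partial_e_Q:
  assumes "a \<in> B - {e}" "b \<in> B - {e}" "z \<in> Z"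
  shows "partial_deriv e (Q a b) z = 0"
proof -
  have s: "smooth_on B Z (\<lambda>z. \<nu> (\<Psi> z))" by (rule smooth_pull[OF smooth_\<nu>])
  show ?thesis
    using partial_deriv_mult[OF smooth_P smooth_on_mult[OF Z s s] e assms(3), of a b]
      partial_deriv_mult[OF s s e assms(3)] partial_e_P[OF assms] partial_e_\<nu>[OF assms(3)] assms
    by (simp add: Q_def[abs_def] algebra_simps)
qed

lemma jacobian_inverse_left:
  assumes "i \<in> B" "k \<in> B" "x \<in> W"
  shows "(\<Sum>b\<in>B. A b k (\<Theta> x) * partial_deriv i (\<lambda>x. \<Theta> x \<bullet> b) x) = (if i = k then 1 else 0)"
proof -
  have "(\<Sum>b\<in>B. A b k (\<Theta> x) * partial_deriv i (\<lambda>x. \<Theta> x \<bullet> b) x) = partial_deriv i (\<lambda>x. \<Psi> (\<Theta> x) \<bullet> k) x"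
    unfolding A_def
    by (rule partial_deriv_compose[symmetric, OF B Z W(1) \<Psi>_smooth[OF assms(2)] \<Theta>_smooth \<Theta>_Z assms(3,1)])
  also have "\<dots> = partial_deriv i (\<lambda>x. x \<bullet> k) x"
    by (rule partial_deriv_cong[OF W(1) assms(3,1)]) (simp add: \<Psi>_\<Theta>)
  finally show ?thesis by (simp add: partial_deriv_inner inner_B assms)
qed

lemma jacobian_inverse_right:
  assumes "a \<in> B" "b \<in> B" "z \<in> Z"
  shows "(\<Sum>k\<in>B. partial_deriv k (\<lambda>x. \<Theta> x \<bullet> a) (\<Psi> z) * A b k z) = (if a = b then 1 else 0)"
proof -
  have "(\<Sum>k\<in>B. partial_deriv k (\<lambda>x. \<Theta> x \<bullet> a) (\<Psi> z) * A b k z) = partial_deriv b (\<lambda>z. \<Theta> (\<Psi> z) \<bullet> a) z"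
    unfolding A_def
    by (rule partial_deriv_compose[symmetric, OF B W(1) Z \<Theta>_smooth[OF assms(1)] \<Psi>_smooth \<Psi>_W assms(3,2)])
  also have "\<dots> = partial_deriv b (\<lambda>z. z \<bullet> a) z"
    by (rule partial_deriv_cong[OF Z assms(3,2)]) (simp add: \<Theta>_\<Psi>)
  finally show ?thesis by (auto simp add: partial_deriv_inner inner_B assms)
qed

text \<open>\<open>T\<close> is the Jacobian of \<open>\<Theta>\<close>. Transforming
  \<open>P\<close> back with it recovers the original metric, and the sum splits because the row and
  column of \<open>e\<close> in \<open>P\<close> are those of the identity matrix.\<close>

lemma metric_pullback:
  assumes ij: "i \<in> B" "j \<in> B" and x: "x \<in> W"
  defines "T \<equiv> \<lambda>i b. partial_deriv i (\<lambda>x. \<Theta> x \<bullet> b) x"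
  shows "g i j x = T i e * T j e + (X_norm x)\<^sup>2 * (\<Sum>a\<in>B - {e}. \<Sum>b\<in>B - {e}. Q a b (\<Theta> x) * T i a * T j b)"
proof -
  let ?z = "\<Theta> x"
  have z: "?z \<in> Z" by (rule \<Theta>_Z[OF x])
  have inv: "(\<Sum>b\<in>B. T i b * A b k ?z) = (if i = k then 1 else 0)" if "i \<in> B" "k \<in> B" for i k
    using jacobian_inverse_left[OF that x] by (simp add: T_def mult.commute)
  have "(\<Sum>a\<in>B. \<Sum>b\<in>B. P a b ?z * T i a * T j b)
      = (\<Sum>k\<in>B. \<Sum>l\<in>B. g k l x * (\<Sum>a\<in>B. T i a * A a k ?z) * (\<Sum>b\<in>B. T j b * A b l ?z))"
    unfolding P_def congruence_sum by (simp add: \<Psi>_\<Theta>[OF x])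
  also have "\<dots> = (\<Sum>k\<in>B. \<Sum>l\<in>B. g k l x * (if i = k then 1 else 0) * (if j = l then 1 else 0))"
    by (intro sum.cong refl) (simp add: inv ij)
  also have "\<dots> = g i j x" by (simp only: sum_delta_right[OF finB] ij)
  finally have 1: "g i j x = (\<Sum>a\<in>B. \<Sum>b\<in>B. P a b ?z * T i a * T j b)" by simp
  have row: "(\<Sum>b\<in>B. P a b ?z * T i a * T j b) = (\<Sum>b\<in>B - {e}. P a b ?z * T i a * T j b)" if "a \<in> B - {e}" for a
    using sum.remove[OF finB e, of "\<lambda>b. P a b ?z * T i a * T j b"] P_sym[OF z, of a e] P_e[OF _ z, of a] that by auto
  have "(\<Sum>b\<in>B. P e b ?z * T i e * T j b) = (\<Sum>b\<in>B. if b = e then T i e * T j b else 0)"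
    by (intro sum.cong refl) (simp add: P_e[OF _ z])
  also have "\<dots> = T i e * T j e" using finB e by simp
  finally have "g i j x = T i e * T j e + (\<Sum>a\<in>B - {e}. \<Sum>b\<in>B - {e}. P a b ?z * T i a * T j b)"
    unfolding 1 using sum.remove[OF finB e, of "\<lambda>a. \<Sum>b\<in>B. P a b ?z * T i a * T j b"] row by simp
  also have "(\<Sum>a\<in>B - {e}. \<Sum>b\<in>B - {e}. P a b ?z * T i a * T j b)
      = (X_norm x)\<^sup>2 * (\<Sum>a\<in>B - {e}. \<Sum>b\<in>B - {e}. Q a b ?z * T i a * T j b)"
    unfolding sum_distrib_left by (intro sum.cong refl) (simp add: P_eq[OF z] \<Psi>_\<Theta>[OF x] mult_ac)
  finally show ?thesis .
qed

text \<open>The coefficients are pushed forward to a vector \<open>v\<close> by the Jacobian of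
  \<open>\<Psi>\<close>. Applying the Jacobian of \<open>\<Theta>\<close> recovers them from
  \<open>v\<close>, so \<open>v\<close> is nonzero and positivity of \<open>g\<close>
  applies.\<close>

lemma Q_pos:
  assumes z: "z \<in> Z" and c: "\<exists>a\<in>B - {e}. c a \<noteq> 0"
  shows "(\<Sum>a\<in>B - {e}. \<Sum>b\<in>B - {e}. Q a b z * c a * c b) > 0"
proof -
  let ?B = "B - {e}"
  define v where "v k = (\<Sum>a\<in>?B. c a * A a k z)" for k
  have "\<exists>k\<in>B. v k \<noteq> 0"
  proof (rule ccontr)
    assume "\<not> (\<exists>k\<in>B. v k \<noteq> 0)"
    then have v0: "v k = 0" if "k \<in> B" for k using that by auto
    obtain a where a: "a \<in> ?B" "c a \<noteq> 0" using c by auto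
    have "0 = (\<Sum>k\<in>B. partial_deriv k (\<lambda>x. \<Theta> x \<bullet> a) (\<Psi> z) * v k)" using v0 by simp
    also have "\<dots> = (\<Sum>k\<in>B. \<Sum>b\<in>?B. c b * (partial_deriv k (\<lambda>x. \<Theta> x \<bullet> a) (\<Psi> z) * A b k z))"
      by (simp add: v_def sum_distrib_left mult_ac)
    also have "\<dots> = (\<Sum>b\<in>?B. c b * (\<Sum>k\<in>B. partial_deriv k (\<lambda>x. \<Theta> x \<bullet> a) (\<Psi> z) * A b k z))"
      by (subst sum.swap) (simp add: sum_distrib_left)
    also have "\<dots> = (\<Sum>b\<in>?B. if b = a then c b else 0)"
      by (intro sum.cong refl) (use a jacobian_inverse_right[OF _ _ z] in auto)
    also have "\<dots> = c a" using finB a by simp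
    finally show False using a by simp
  qed
  from g_pos[OF \<Psi>_V[OF z] this] have "0 < (\<Sum>k\<in>B. \<Sum>l\<in>B. g k l (\<Psi> z) * v k * v l)" .
  also have "\<dots> = (\<Sum>a\<in>?B. \<Sum>b\<in>?B. P a b z * c a * c b)"
    unfolding P_def v_def congruence_sum ..
  finally have "0 < (\<nu> (\<Psi> z) * \<nu> (\<Psi> z)) * \<dots>"
    using \<nu>_pos[OF \<Psi>_V[OF z]] by simp
  then show ?thesis by (simp add: Q_def sum_distrib_left mult_ac)
qed

end

text \<open>Composition with this projection extends functions from \<open>span B\<close> to the
  whole space, constant along the other axes, so that the flow and inverse function theorems become
  applicable.\<close>

definition axis_proj :: "'e::euclidean_space set \<Rightarrow> 'e \<Rightarrow> 'e" where
  "axis_proj B x = (\<Sum>b\<in>B. (x \<bullet> b) *\<^sub>R b)"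

context
  fixes B :: "'e::euclidean_space set"
  assumes B: "B \<subseteq> Basis"
begin

lemma axis_proj_inner: "i \<in> Basis \<Longrightarrow> axis_proj B x \<bullet> i = (if i \<in> B then x \<bullet> i else 0)"
  unfolding axis_proj_def by (rule inner_coord_sum[OF B])

lemma axis_proj_in_span: "axis_proj B x \<in> span B"
  unfolding axis_proj_def by (intro span_sum span_mul span_base)

lemma axis_proj_id: "x \<in> span B \<Longrightarrow> axis_proj B x = x"
  unfolding axis_proj_def by (rule span_coord_sum[OF B])

lemma in_span_axes_iff: "x \<in> span B \<longleftrightarrow> (\<forall>i\<in>Basis - B. x \<bullet> i = 0)"
proof
  assume "x \<in> span B"
  then have eq: "axis_proj B x = x" by (rule axis_proj_id)
  show "\<forall>i\<in>Basis - B. x \<bullet> i = 0"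
  proof
    fix i assume "i \<in> Basis - B"
    then have "axis_proj B x \<bullet> i = 0" using axis_proj_inner[of i x] by simp
    then show "x \<bullet> i = 0" by (simp only: eq)
  qed
next
  assume "\<forall>i\<in>Basis - B. x \<bullet> i = 0"
  then show "x \<in> span B"
    using axis_proj_in_span[of x] euclidean_eqI[of "axis_proj B x" x] by (auto simp: axis_proj_inner)
qed

lemma continuous_axis_proj: "continuous_on S (axis_proj B)"
  unfolding axis_proj_def[abs_def] by (intro continuous_intros)

lemma open_vimage_axis_proj:
  assumes "relopen B U" shows "open (axis_proj B -` U)"
proof -
  obtain T where T: "open T" "U = span B \<inter> T" using assms by (metis openin_open)
  then have "axis_proj B -` U = axis_proj B -` T" using axis_proj_in_span by auto
  then show ?thesis using open_vimage[OF T(1) continuous_axis_proj] by simp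
qed

lemma smooth_lift:
  assumes "relopen B U" "smooth_on B U F"
  shows "smooth_on Basis (axis_proj B -` U) (\<lambda>x. F (axis_proj B x))"
proof (rule smooth_on_compose[OF B assms(1) _ assms(2)])
  show "relopen Basis (axis_proj B -` U)" using open_vimage_axis_proj[OF assms(1)] by simp
  fix b assume "b \<in> B"
  then have "(\<lambda>x. axis_proj B x \<bullet> b) = (\<lambda>x. x \<bullet> b)" using axis_proj_inner B by auto
  then show "smooth_on Basis (axis_proj B -` U) (\<lambda>x. axis_proj B x \<bullet> b)"
    using open_vimage_axis_proj[OF assms(1)] by (simp add: smooth_on_inner)
qed auto

lemma partial_lift:
  assumes "b \<in> B"
  shows "partial_deriv b (\<lambda>x. F (axis_proj B x)) x = partial_deriv b F (axis_proj B x)"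
proof -
  have "axis_proj B (x + s *\<^sub>R b) = axis_proj B x + s *\<^sub>R b" for s
  proof (rule euclidean_eqI)
    fix i :: 'e assume i: "i \<in> Basis"
    have "i \<notin> B \<Longrightarrow> b \<bullet> i = 0" using i assms B by (auto simp: inner_Basis)
    then show "axis_proj B (x + s *\<^sub>R b) \<bullet> i = (axis_proj B x + s *\<^sub>R b) \<bullet> i"
      using axis_proj_inner[OF i] by (simp add: inner_add_left)
  qed
  then show ?thesis by (simp add: partial_deriv_def)
qed

end

lemma sum_Basis_prod_real:
  fixes F :: "'d::euclidean_space \<times> real \<Rightarrow> real"
  shows "(\<Sum>d\<in>Basis. F d) = (\<Sum>c\<in>Basis. F (c, 0)) + F (0, 1)"
proof -
  have "(\<Sum>d\<in>Basis. F d) = sum F ((\<lambda>c. (c, 0)) ` Basis) + sum F ((\<lambda>v. (0, v)) ` Basis)"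
    unfolding Basis_prod_def by (rule sum.union_disjoint) auto
  also have "sum F ((\<lambda>c. (c, 0)) ` Basis) = (\<Sum>c\<in>Basis. F (c, 0))"
    by (subst sum.reindex) (auto simp: inj_on_def)
  finally show ?thesis by simp
qed

section \<open>Construction of the straightened coordinates\<close>

context closed_conformal_chart
begin

lemma straightening:
  obtains e Z W \<Psi> \<Theta> \<tau> D \<epsilon> where "straightened_chart B V g X \<phi> x0 e Z W \<Psi> \<Theta> \<tau>" "x0 \<in> W"
    "relopen (B - {e}) D" "convex D" "D \<noteq> {}" "\<epsilon> > 0" "Z = {z \<in> span B. \<bar>z \<bullet> e\<bar> < \<epsilon> \<and> z - (z \<bullet> e) *\<^sub>R e \<in> D}"
proof -
  \<comment> \<open>An axis along which \<open>X\<close> has a nonzero component at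
    \<open>x0\<close>; the hyperplane orthogonal to it is transverse to \<open>N\<close>
    there.\<close>
  obtain e where e: "e \<in> B" "X e x0 \<noteq> 0" using X_nonzero[OF x0] by auto
  have eb: "e \<in> Basis" using e B by auto
  have Ne: "N e x0 \<noteq> 0" using e \<nu>_pos[OF x0] by (simp add: N_def)
  obtain \<tau> where \<tau>: "smooth_on B V \<tau>" "\<tau> x0 = 0" "\<And>b x. b \<in> B \<Longrightarrow> x \<in> V \<Longrightarrow> partial_deriv b \<tau> x = N_low b x"
    using closed_form_exact[OF B V x0 smooth_N_low N_low_closed] by blast
  have Vs: "V \<subseteq> span B" using V(1) by (simp add: openin_euclidean_subtopology_iff)
  define p where "p = axis_proj B"
  define Om where "Om = p -` V"
  have pi: "p x \<bullet> i = (if i \<in> B then x \<bullet> i else 0)" if "i \<in> Basis" for x i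
    unfolding p_def by (rule axis_proj_inner[OF B that])
  have pid: "x \<in> span B \<Longrightarrow> p x = x" for x unfolding p_def by (rule axis_proj_id[OF B])
  have Om: "open Om" "x0 \<in> Om"
    using open_vimage_axis_proj[OF B V(1)] x0 pid Vs by (auto simp: Om_def p_def[symmetric])
  \<comment> \<open>The unit field extended to the whole space without components along the missing
    axes, so that its flow preserves those coordinates.\<close>
  define Nv where "Nv x = (\<Sum>b\<in>B. N b (p x) *\<^sub>R b)" for x
  have Nvi: "Nv x \<bullet> i = (if i \<in> B then N i (p x) else 0)" if "i \<in> Basis" for x i
    unfolding Nv_def by (rule inner_coord_sum[OF B that])
  have Nv_smooth: "smooth_on Basis Om (\<lambda>x. Nv x \<bullet> i)" if "i \<in> Basis" for i
  proof (cases "i \<in> B")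
    case True
    then show ?thesis using smooth_lift[OF B V(1) smooth_N[OF True]] Nvi[OF that] by (simp add: Om_def p_def)
  next
    case False
    then show ?thesis using Nvi[OF that] Om by (simp add: smooth_on_const)
  qed
  obtain r T \<theta> where \<theta>: "r > 0" "T > 0" "ball x0 r \<subseteq> Om"
    "\<And>x. x \<in> ball x0 r \<Longrightarrow> \<theta> (x, 0) = x"
    "\<And>x t. x \<in> ball x0 r \<Longrightarrow> t \<in> {-T<..<T} \<Longrightarrow> \<theta> (x, t) \<in> Om"
    "\<And>x t. x \<in> ball x0 r \<Longrightarrow> t \<in> {-T<..<T} \<Longrightarrow> ((\<lambda>t. \<theta> (x, t)) has_vector_derivative Nv (\<theta> (x, t))) (at t)"
    "\<And>i. i \<in> Basis \<Longrightarrow> smooth_on Basis (ball x0 r \<times> {-T<..<T}) (\<lambda>z. \<theta> z \<bullet> i)"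
    by (rule smooth_local_flow[OF Om Nv_smooth]) blast+
  let ?J = "{-T<..<T}" and ?\<Lambda> = "ball x0 r"
  have const: "f t = f 0" if "\<And>t. t \<in> ?J \<Longrightarrow> (f has_real_derivative 0) (at t)" "t \<in> ?J" for f t
  proof -
    have "\<exists>c. \<forall>t\<in>?J. f t = c"
      by (rule has_field_derivative_zero_constant) (auto intro!: has_field_derivative_at_within[OF that(1)])
    then show ?thesis using that(2) \<theta>(2) by auto
  qed
  have \<theta>_off: "\<theta> (x, t) \<bullet> i = x \<bullet> i" if x: "x \<in> ?\<Lambda>" and t: "t \<in> ?J" and i: "i \<in> Basis - B" for x t i
  proof -
    have "((\<lambda>t. \<theta> (x, t) \<bullet> i) has_real_derivative 0) (at t)" if "t \<in> ?J" for t
      using bounded_linear.has_vector_derivative[OF bounded_linear_inner_left \<theta>(6)[OF x that], of i] Nvi[of i] i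
      by (simp add: has_real_derivative_iff_has_vector_derivative)
    from const[OF this t] show ?thesis using \<theta>(4)[OF x] by simp
  qed
  define \<tau>' where "\<tau>' x = \<tau> (p x)" for x
  have \<tau>'_smooth: "smooth_on Basis Om \<tau>'"
    using smooth_lift[OF B V(1) \<tau>(1)] by (simp add: \<tau>'_def[abs_def] Om_def p_def)
  have \<tau>'_partial: "partial_deriv b \<tau>' x = N_low b (p x)" if "b \<in> B" "x \<in> Om" for b x
    using partial_lift[OF B that(1), of \<tau> x] \<tau>(3)[OF that(1), of "p x"] that(2) by (simp add: \<tau>'_def[abs_def] p_def Om_def)
  \<comment> \<open>Since \<open>\<tau>\<close> has differential \<open>N_low\<close> and
    \<open>N\<close> has length one, \<open>\<tau>\<close> grows at unit speed along the
    flow.\<close>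
  have \<tau>'_\<theta>: "\<tau>' (\<theta> (x, t)) = \<tau>' x + t" if x: "x \<in> ?\<Lambda>" and t: "t \<in> ?J" for x t
  proof -
    have "((\<lambda>t. \<tau>' (\<theta> (x, t)) - t) has_real_derivative 0) (at t)" if t: "t \<in> ?J" for t
    proof -
      have "(\<Sum>b\<in>Basis. (Nv (\<theta> (x, t)) \<bullet> b) * partial_deriv b \<tau>' (\<theta> (x, t)))
          = (\<Sum>b\<in>B. (Nv (\<theta> (x, t)) \<bullet> b) * partial_deriv b \<tau>' (\<theta> (x, t)))"
        by (rule sum.mono_neutral_right) (use B Nvi in auto)
      also have "\<dots> = (\<Sum>b\<in>B. N b (p (\<theta> (x, t))) * N_low b (p (\<theta> (x, t))))"
        using B by (intro sum.cong refl) (simp add: Nvi \<tau>'_partial \<theta>(5)[OF x t] subset_iff)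
      also have "\<dots> = 1" using \<theta>(5)[OF x t] by (intro N_unit) (simp add: Om_def)
      finally have "((\<lambda>t. \<tau>' (\<theta> (x, t))) has_real_derivative 1) (at t)"
        using smooth_on_curve[OF Om(1) \<tau>'_smooth \<theta>(5)[OF x t] \<theta>(6)[OF x t]] by simp
      from DERIV_diff[OF this DERIV_ident] show ?thesis by simp
    qed
    from const[OF this t] show ?thesis using \<theta>(4)[OF x] by simp
  qed
  \<comment> \<open>The foot point of \<open>z\<close> in the hyperplane through \<open>x0\<close>:
    the \<open>e\<close>-coordinate is replaced by that of \<open>x0\<close>. The flow time
    \<open>h z\<close> is then the one that brings \<open>\<tau>\<close> to the value
    \<open>z \<bullet> e\<close>.\<close>
  define yy where "yy z = z - (z \<bullet> e) *\<^sub>R e + (x0 \<bullet> e) *\<^sub>R e" for z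
  define h where "h z = z \<bullet> e - \<tau>' (yy z)" for z
  define \<Psi> where "\<Psi> z = \<theta> (yy z, h z)" for z
  define A0 where "A0 = yy -` ?\<Lambda>"
  define Z0 where "Z0 = A0 \<inter> h -` ?J"
  have yyc: "continuous_on S yy" for S unfolding yy_def[abs_def] by (intro continuous_intros)
  have A0: "open A0" unfolding A0_def by (rule open_vimage[OF open_ball yyc])
  have \<tau>'yy_smooth: "smooth_on Basis A0 (\<lambda>z. \<tau>' (yy z))"
  proof (rule smooth_on_compose[OF subset_refl _ _ \<tau>'_smooth])
    fix b :: 'e assume "b \<in> Basis"
    have eq: "(\<lambda>z. yy z \<bullet> b) = (\<lambda>z. z \<bullet> (b - (e \<bullet> b) *\<^sub>R e) + (x0 \<bullet> e) * (e \<bullet> b))"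
      by (auto simp: yy_def inner_add_left inner_diff_left inner_diff_right)
    show "smooth_on Basis A0 (\<lambda>z. yy z \<bullet> b)"
      unfolding eq using A0 by (intro smooth_on_add smooth_on_inner smooth_on_const) auto
  qed (use Om A0 \<theta>(3) in \<open>auto simp: A0_def\<close>)
  have h_smooth: "smooth_on Basis A0 h"
    unfolding h_def[abs_def] using A0 by (intro smooth_on_diff smooth_on_inner \<tau>'yy_smooth) auto
  have Z0: "open Z0"
    unfolding Z0_def
    by (rule continuous_open_preimage[OF smooth_on_imp_continuous_on[OF h_smooth] A0]) auto
  have Z0D: "yy z \<in> ?\<Lambda>" "h z \<in> ?J" if "z \<in> Z0" for z using that by (auto simp: Z0_def A0_def)
  have \<Psi>_smooth: "smooth_on Basis Z0 (\<lambda>z. \<Psi> z \<bullet> i)" if i: "i \<in> Basis" for i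
    unfolding \<Psi>_def
  proof (rule smooth_on_compose[OF subset_refl _ _ \<theta>(7)[OF i]])
    fix b :: "'e \<times> real" assume "b \<in> Basis"
    then show "smooth_on Basis Z0 (\<lambda>z. (yy z, h z) \<bullet> b)"
    proof (cases rule: Basis_prod_real_cases)
      case (1 c)
      have eq: "(\<lambda>z. (yy z, h z) \<bullet> b) = (\<lambda>z. z \<bullet> (c - (e \<bullet> c) *\<^sub>R e) + (x0 \<bullet> e) * (e \<bullet> c))"
        by (auto simp: 1 yy_def inner_add_left inner_diff_left inner_diff_right)
      show ?thesis
        unfolding eq using Z0 by (intro smooth_on_add smooth_on_inner smooth_on_const) auto
    next
      case 2
      then show ?thesis using smooth_on_subset[OF h_smooth, of Z0] by (simp add: Z0_def)
    qed
  qed (use Z0 Z0D in \<open>auto intro!: open_Times\<close>)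
  have \<Psi>_Om: "\<Psi> z \<in> Om" if "z \<in> Z0" for z
    unfolding \<Psi>_def by (rule \<theta>(5)[OF Z0D[OF that]])
  have \<Psi>_off: "\<Psi> z \<bullet> i = z \<bullet> i" if "z \<in> Z0" "i \<in> Basis - B" for z i
  proof -
    have "e \<bullet> i = 0" using that(2) e eb by (auto simp: inner_Basis)
    then show ?thesis using \<theta>_off[OF Z0D[OF that(1)] that(2)] by (simp add: \<Psi>_def yy_def inner_add_left inner_diff_left)
  qed
  \<comment> \<open>Moving \<open>z\<close> along \<open>e\<close> leaves the foot point fixed and
    adds the same amount to the flow time, so the \<open>e\<close>-lines are flow lines.\<close>
  have \<Psi>_e: "((\<lambda>s. \<Psi> (z + s *\<^sub>R e) \<bullet> i) has_real_derivative Nv (\<Psi> z) \<bullet> i) (at 0)" if z: "z \<in> Z0" for z i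
  proof -
    have "yy (z + s *\<^sub>R e) = yy z" for s using eb by (simp add: yy_def algebra_simps)
    moreover have "h (z + s *\<^sub>R e) = h z + s" for s using eb calculation by (simp add: h_def inner_add_left)
    ultimately show ?thesis
      using has_partial_time[OF \<theta>(6)[OF Z0D[OF z]], of i] by (simp add: \<Psi>_def)
  qed
  have \<tau>'_\<Psi>: "\<tau>' (\<Psi> z) = z \<bullet> e" if z: "z \<in> Z0" for z
    using \<tau>'_\<theta>[OF Z0D[OF z]] by (simp add: \<Psi>_def h_def)
  \<comment> \<open>The point sent to \<open>x0\<close>: its \<open>e\<close>-coordinate is 0
    because \<open>\<tau>\<close> was normalized to vanish at \<open>x0\<close>.\<close>
  define z0 where "z0 = x0 - (x0 \<bullet> e) *\<^sub>R e"
  have z0: "yy z0 = x0" "z0 \<bullet> e = 0" "h z0 = 0" "z0 \<in> Z0" "z0 \<in> span (B - {e})"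
  proof -
    show 1: "z0 \<bullet> e = 0" using eb by (simp add: z0_def inner_diff_left)
    show 2: "yy z0 = x0" unfolding yy_def 1 by (simp add: z0_def)
    show 3: "h z0 = 0" using 1 2 \<tau>(2) pid x0 Vs by (auto simp: h_def \<tau>'_def)
    show "z0 \<in> Z0" using 2 3 \<theta>(1,2) by (simp add: Z0_def A0_def)
    have Be: "B - {e} \<subseteq> Basis" using B by auto
    show "z0 \<in> span (B - {e})"
      unfolding in_span_axes_iff[OF Be] using x0 Vs eb in_span_axes_iff[OF B] by (auto simp: z0_def inner_diff_left inner_Basis)
  qed
  have \<Psi>z0: "\<Psi> z0 = x0" using z0 \<theta>(1,4) by (simp add: \<Psi>_def)
  \<comment> \<open>The derivative of the flow time at \<open>z0\<close> in a direction other than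
    \<open>e\<close>.\<close>
  define \<kappa> where "\<kappa> b = - partial_deriv b \<tau>' x0" for b
  \<comment> \<open>At \<open>z0\<close> the flow time is 0 and the flow is the identity in space.
    Only the variation of the flow time adds to the direction \<open>b\<close>, by a multiple of
    \<open>N\<close>.\<close>
  have \<Psi>_partial: "partial_deriv b (\<lambda>z. \<Psi> z \<bullet> i) z0 = b \<bullet> i + \<kappa> b * (Nv x0 \<bullet> i)"
    if b: "b \<in> Basis" "b \<noteq> e" and i: "i \<in> Basis" for b i
  proof (rule partial_deriv_eqI)
    let ?\<gamma> = "\<lambda>s::real. (x0 + s *\<^sub>R b, - \<tau>' (x0 + s *\<^sub>R b))"
    have be: "b \<bullet> e = 0" using b eb by (simp add: inner_Basis)
    have eq: "\<Psi> (z0 + s *\<^sub>R b) = \<theta> (?\<gamma> s)" for s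
    proof -
      have "yy (z0 + s *\<^sub>R b) = x0 + s *\<^sub>R b"
        using z0(1,2) be by (simp add: yy_def inner_add_left algebra_simps)
      then show ?thesis using z0(2) be by (simp add: \<Psi>_def h_def inner_add_left)
    qed
    have "((\<lambda>s. \<tau>' (x0 + s *\<^sub>R b)) has_vector_derivative partial_deriv b \<tau>' x0) (at 0)"
      using smooth_on_has_partial[OF \<tau>'_smooth b(1) Om(2)] by (simp add: has_real_derivative_iff_has_vector_derivative)
    then have "(?\<gamma> has_vector_derivative (b, \<kappa> b)) (at 0)"
      unfolding \<kappa>_def by (intro has_vector_derivative_Pair has_vector_derivative_minus) (auto intro!: derivative_eq_intros)
    moreover have mem: "?\<gamma> 0 \<in> ?\<Lambda> \<times> ?J"
      using \<theta>(1,2) \<tau>(2) pid x0 Vs by (auto simp: \<tau>'_def)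
    ultimately have "((\<lambda>s. \<theta> (?\<gamma> s) \<bullet> i) has_real_derivative
        (\<Sum>d\<in>Basis. ((b, \<kappa> b) \<bullet> d) * partial_deriv d (\<lambda>w. \<theta> w \<bullet> i) (?\<gamma> 0))) (at 0)"
      by (intro smooth_on_curve[where U="?\<Lambda> \<times> ?J"] \<theta>(7) i open_Times) auto
    also have g0: "?\<gamma> 0 = (x0, 0)" using \<tau>(2) pid x0 Vs by (auto simp: \<tau>'_def)
    also have "(\<Sum>d\<in>Basis. ((b, \<kappa> b) \<bullet> d) * partial_deriv d (\<lambda>w. \<theta> w \<bullet> i) (x0, 0))
        = (\<Sum>c\<in>Basis. (b \<bullet> c) * partial_deriv (c, 0) (\<lambda>w. \<theta> w \<bullet> i) (x0, 0))
          + \<kappa> b * partial_deriv (0, 1) (\<lambda>w. \<theta> w \<bullet> i) (x0, 0)"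
      by (simp add: sum_Basis_prod_real)
    also have "partial_deriv (0, 1) (\<lambda>w. \<theta> w \<bullet> i) (x0, 0) = Nv x0 \<bullet> i"
      using \<theta>(1,2,4) by (intro partial_deriv_eqI) (use has_partial_time[OF \<theta>(6), of x0 0 i] in simp)
    also have "(\<Sum>c\<in>Basis. (b \<bullet> c) * partial_deriv (c, 0) (\<lambda>w. \<theta> w \<bullet> i) (x0, 0)) = (\<Sum>c\<in>Basis. (b \<bullet> c) * (c \<bullet> i))"
    proof (intro sum.cong refl arg_cong2[where f="(*)"])
      fix c :: 'e assume c: "c \<in> Basis"
      have "partial_deriv c (\<lambda>x. \<theta> (x, 0) \<bullet> i) x0 = partial_deriv c (\<lambda>x. x \<bullet> i) x0"
        by (rule partial_deriv_cong[of Basis ?\<Lambda>]) (use c \<theta>(1,4) in auto)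
      then show "partial_deriv (c, 0) (\<lambda>w. \<theta> w \<bullet> i) (x0, 0) = c \<bullet> i"
        by (simp add: partial_deriv_inner) (simp add: partial_deriv_def)
    qed
    also have "\<dots> = b \<bullet> i" by (simp add: euclidean_inner[of b i] inner_commute)
    finally show "((\<lambda>s. \<Psi> (z0 + s *\<^sub>R b) \<bullet> i) has_real_derivative b \<bullet> i + \<kappa> b * (Nv x0 \<bullet> i)) (at 0)"
      by (simp only: eq)
  qed
  have \<Psi>_partial_e: "partial_deriv e (\<lambda>z. \<Psi> z \<bullet> i) z0 = Nv x0 \<bullet> i" for i
    using partial_deriv_eqI[OF \<Psi>_e[OF z0(4)]] \<Psi>z0 by simp
  \<comment> \<open>The Jacobian sends \<open>e\<close> to \<open>N\<close> and every other axis to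
    itself plus a multiple of \<open>N\<close>. The component along \<open>e\<close> therefore
    isolates the total multiple of \<open>N\<close>, which vanishes because the
    \<open>e\<close>-component of \<open>N\<close> does not; the remaining components
    follow.\<close>
  have inj: "v = 0" if v: "\<And>i. i \<in> Basis \<Longrightarrow> (\<Sum>b\<in>Basis. (v \<bullet> b) * partial_deriv b (\<lambda>z. \<Psi> z \<bullet> i) z0) = 0" for v
  proof -
    define K where "K = (\<Sum>b\<in>Basis - {e}. (v \<bullet> b) * \<kappa> b)"
    have eq: "(v \<bullet> e + K) * (Nv x0 \<bullet> i) + (\<Sum>b\<in>Basis - {e}. (v \<bullet> b) * (b \<bullet> i)) = 0" if i: "i \<in> Basis" for i
    proof -
      have "0 = (v \<bullet> e) * (Nv x0 \<bullet> i) + (\<Sum>b\<in>Basis - {e}. (v \<bullet> b) * partial_deriv b (\<lambda>z. \<Psi> z \<bullet> i) z0)"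
        using v[OF i] sum.remove[OF finite_Basis eb, of "\<lambda>b. (v \<bullet> b) * partial_deriv b (\<lambda>z. \<Psi> z \<bullet> i) z0"]
        by (simp add: \<Psi>_partial_e)
      also have "(\<Sum>b\<in>Basis - {e}. (v \<bullet> b) * partial_deriv b (\<lambda>z. \<Psi> z \<bullet> i) z0)
          = (\<Sum>b\<in>Basis - {e}. (v \<bullet> b) * (b \<bullet> i) + (v \<bullet> b) * \<kappa> b * (Nv x0 \<bullet> i))"
        by (intro sum.cong refl) (use \<Psi>_partial i in \<open>simp add: distrib_left\<close>)
      finally show ?thesis by (simp add: K_def sum.distrib sum_distrib_right distrib_right)
    qed
    have sm: "(\<Sum>b\<in>Basis - {e}. (v \<bullet> b) * (b \<bullet> i)) = (if i = e then 0 else v \<bullet> i)" if i: "i \<in> Basis" for i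
    proof -
      have "(\<Sum>b\<in>Basis - {e}. (v \<bullet> b) * (b \<bullet> i)) = (\<Sum>b\<in>Basis - {e}. if b = i then v \<bullet> i else 0)"
        using i by (intro sum.cong refl) (auto simp: inner_Basis)
      then show ?thesis using i by simp
    qed
    have "Nv x0 \<bullet> e \<noteq> 0" using Ne Nvi[OF eb] e pid x0 Vs by auto
    then have 1: "v \<bullet> e + K = 0" using eq[OF eb] sm[OF eb] by simp
    then have 2: "v \<bullet> i = 0" if "i \<in> Basis" "i \<noteq> e" for i using eq[OF that(1)] sm[OF that(1)] that by simp
    then have "K = 0" unfolding K_def by (intro sum.neutral) auto
    moreover have "v \<bullet> i = 0" if "i \<in> Basis" for i using 1 2[OF that] \<open>K = 0\<close> by (cases "i = e") auto
    ultimately show ?thesis using euclidean_eqI[of v 0] by simp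
  qed
  obtain U' V' H where IF: "open U'" "U' \<subseteq> Z0" "z0 \<in> U'" "open V'" "homeomorphism U' V' \<Psi> H"
    "\<And>i. i \<in> Basis \<Longrightarrow> smooth_on Basis V' (\<lambda>x. H x \<bullet> i)"
    using smooth_inverse_function[OF Z0 z0(4) \<Psi>_smooth inj] by blast
  obtain R where R: "R > 0" "ball z0 R \<subseteq> U'" using IF(1,3) openE by blast
  \<comment> \<open>Half the radius, so that an interval of length \<open>2 * \<epsilon>\<close>
    times a ball of radius \<open>\<epsilon>\<close> fits inside the ball of radius
    \<open>R\<close>.\<close>
  define \<epsilon> where "\<epsilon> = R / 2"
  have \<epsilon>: "\<epsilon> > 0" using R by (simp add: \<epsilon>_def)
  define D where "D = span (B - {e}) \<inter> ball z0 \<epsilon>"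
  define C where "C = {z. \<bar>z \<bullet> e\<bar> < \<epsilon> \<and> z - (z \<bullet> e) *\<^sub>R e \<in> ball z0 \<epsilon>}"
  define Z where "Z = {z \<in> span B. \<bar>z \<bullet> e\<bar> < \<epsilon> \<and> z - (z \<bullet> e) *\<^sub>R e \<in> D}"
  have Be: "B - {e} \<subseteq> Basis" using B by auto
  have ZC: "Z = span B \<inter> C"
  proof -
    have "z - (z \<bullet> e) *\<^sub>R e \<in> span (B - {e})" if "z \<in> span B" for z
      using that eb unfolding in_span_axes_iff[OF Be] in_span_axes_iff[OF B] by (auto simp: inner_diff_left inner_Basis)
    then show ?thesis by (auto simp: Z_def C_def D_def)
  qed
  have C: "open C"
  proof -
    have "C = (\<lambda>z. z \<bullet> e) -` {-\<epsilon><..<\<epsilon>} \<inter> (\<lambda>z. z - (z \<bullet> e) *\<^sub>R e) -` ball z0 \<epsilon>"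
      by (auto simp: C_def)
    also have "open \<dots>"
      by (intro open_Int open_vimage continuous_intros) auto
    finally show ?thesis .
  qed
  have CU: "C \<subseteq> U'"
  proof
    fix z assume z: "z \<in> C"
    have "norm (z - z0) \<le> norm (z - (z \<bullet> e) *\<^sub>R e - z0) + norm ((z \<bullet> e) *\<^sub>R e)"
      using norm_triangle_ineq[of "z - (z \<bullet> e) *\<^sub>R e - z0" "(z \<bullet> e) *\<^sub>R e"] by simp
    also have "\<dots> < \<epsilon> + \<epsilon>"
      using z eb by (intro add_strict_mono) (auto simp: C_def dist_norm norm_minus_commute)
    finally show "z \<in> U'" using R by (auto simp: \<epsilon>_def dist_norm norm_minus_commute)
  qed
  have Zrel: "relopen B Z" unfolding ZC using C by (simp add: openin_open_Int)
  have ZZ0: "z \<in> Z0" "z \<in> span B" if "z \<in> Z" for z using that ZC CU IF(2) by auto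
  \<comment> \<open>The coordinates along the missing axes are unchanged by \<open>\<Psi>\<close>,
    so both \<open>\<Psi>\<close> and its inverse respect the coordinate subspace.\<close>
  have \<Psi>_span: "\<Psi> z \<in> span B \<longleftrightarrow> z \<in> span B" if "z \<in> Z0" for z
    unfolding in_span_axes_iff[OF B] using \<Psi>_off[OF that] by simp
  define W where "W = \<Psi> ` Z"
  have hU: "\<Psi> ` U' = V'" "\<And>z. z \<in> U' \<Longrightarrow> H (\<Psi> z) = z" "\<And>x. x \<in> V' \<Longrightarrow> \<Psi> (H x) = x" "\<And>x. x \<in> V' \<Longrightarrow> H x \<in> U'"
    "continuous_on V' H" "continuous_on U' \<Psi>"
    using IF(5) by (auto simp: homeomorphism_def)
  have WV': "W \<subseteq> V'" using hU(1) CU ZC by (auto simp: W_def)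
  have W_eq: "W = span B \<inter> (V' \<inter> H -` C)"
  proof
    show "W \<subseteq> span B \<inter> (V' \<inter> H -` C)"
      using \<Psi>_span ZZ0 WV' hU(2) ZC CU by (auto simp: W_def subset_iff)
    show "span B \<inter> (V' \<inter> H -` C) \<subseteq> W"
    proof
      fix x assume x: "x \<in> span B \<inter> (V' \<inter> H -` C)"
      then have "H x \<in> Z0" "\<Psi> (H x) = x" using hU(3,4) IF(2) by auto
      then have "H x \<in> span B" using \<Psi>_span[of "H x"] x by simp
      then have "H x \<in> Z" using x ZC by auto
      then show "x \<in> W" using \<open>\<Psi> (H x) = x\<close> by (force simp: W_def)
    qed
  qed
  have "open (V' \<inter> H -` C)" by (rule continuous_open_preimage[OF hU(5) IF(4) C])
  then have Wrel: "relopen B W" unfolding W_eq by (simp add: openin_open_Int)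
  have WV: "W \<subseteq> V"
  proof
    fix x assume "x \<in> W"
    then obtain z where z: "z \<in> Z" "x = \<Psi> z" by (auto simp: W_def)
    then have "x \<in> Om" "x \<in> span B" using \<Psi>_Om \<Psi>_span ZZ0 by auto
    then show "x \<in> V" using pid by (simp add: Om_def)
  qed
  have z0D: "z0 \<in> D" using z0(5) \<epsilon> by (simp add: D_def)
  have z0Z: "z0 \<in> Z"
  proof -
    have "z0 \<in> span B" using z0(5) span_mono[of "B - {e}" B] by auto
    then show ?thesis using z0D z0(2) \<epsilon> by (simp add: Z_def)
  qed
  show ?thesis
  proof (rule that[of e Z W \<Psi> H \<tau> D \<epsilon>])
    show "straightened_chart B V g X \<phi> x0 e Z W \<Psi> H \<tau>"
    proof (unfold_locales)
      show "homeomorphism Z W \<Psi> H"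
        using IF(5) CU ZC by (intro homeomorphism_of_subsets[OF IF(5), of Z W]) (auto simp: W_def hU(1)[symmetric])
      fix k assume k: "k \<in> B"
      then have kb: "k \<in> Basis" using B by auto
      show "smooth_on B Z (\<lambda>z. \<Psi> z \<bullet> k)"
        by (rule smooth_on_restrict[OF subset_refl B _ Zrel _ \<Psi>_smooth[OF kb]]) (use Z0 ZZ0 in auto)
      show "smooth_on B W (\<lambda>x. H x \<bullet> k)"
        by (rule smooth_on_restrict[OF subset_refl B _ Wrel WV' IF(6)[OF kb]]) (use IF(4) in simp)
      show "partial_deriv e (\<lambda>z. \<Psi> z \<bullet> k) z = N k (\<Psi> z)" if z: "z \<in> Z" for z
      proof -
        have "p (\<Psi> z) = \<Psi> z" using \<Psi>_span ZZ0[OF z] by (intro pid) simp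
        then show ?thesis
          using partial_deriv_eqI[OF \<Psi>_e[OF ZZ0(1)[OF z]], of k] Nvi[OF kb, of "\<Psi> z"] k by simp
      qed
    next
      show "\<tau> (\<Psi> z) = z \<bullet> e" if z: "z \<in> Z" for z
      proof -
        have "p (\<Psi> z) = \<Psi> z" using \<Psi>_span ZZ0[OF z] by (intro pid) simp
        then show ?thesis using \<tau>'_\<Psi>[OF ZZ0(1)[OF z]] by (simp add: \<tau>'_def)
      qed
    qed (use e(1) Zrel Wrel WV \<tau> in auto)
    show "x0 \<in> W" using z0Z \<Psi>z0 by (force simp: W_def)
    show "relopen (B - {e}) D" unfolding D_def by (simp add: openin_open_Int)
    show "convex D" unfolding D_def by (intro convex_Int subspace_imp_convex subspace_span convex_ball)
    show "D \<noteq> {}" using z0D by auto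
  qed (use \<epsilon> Z_def in auto)
qed

end

text \<open>Separation of variables on the product shape of \<open>Z\<close>: the norm is constant
  on the convex copies of \<open>D\<close>, hence a function of the \<open>e\<close>-coordinate,
  while \<open>Q\<close> is constant along the \<open>e\<close>-lines, hence determined on
  \<open>D\<close>, where it plays the part of \<open>hh\<close>.\<close>

lemma (in closed_conformal_chart) warped_coordinates:
  obtains e Z W \<Psi> \<Theta> D \<epsilon> f hh where "e \<in> B" "relopen B W" "x0 \<in> W" "W \<subseteq> V" "relopen (B - {e}) D" "D \<noteq> {}" "\<epsilon> > 0"
    "Z = {z \<in> span B. \<bar>z \<bullet> e\<bar> < \<epsilon> \<and> z - (z \<bullet> e) *\<^sub>R e \<in> D}" "relopen B Z" "homeomorphism Z W \<Psi> \<Theta>"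
    "\<And>k. k \<in> B \<Longrightarrow> smooth_on B Z (\<lambda>z. \<Psi> z \<bullet> k)" "\<And>k. k \<in> B \<Longrightarrow> smooth_on B W (\<lambda>x. \<Theta> x \<bullet> k)"
    "smooth_on Basis {-\<epsilon><..<\<epsilon>} f" "\<And>t. t \<in> {-\<epsilon><..<\<epsilon>} \<Longrightarrow> f t > 0"
    "\<And>a b. a \<in> B - {e} \<Longrightarrow> b \<in> B - {e} \<Longrightarrow> smooth_on (B - {e}) D (hh a b)"
    "\<And>a b y. y \<in> D \<Longrightarrow> hh a b y = hh b a y"
    "\<And>c y. y \<in> D \<Longrightarrow> \<exists>a\<in>B - {e}. c a \<noteq> 0 \<Longrightarrow> (\<Sum>a\<in>B - {e}. \<Sum>b\<in>B - {e}. hh a b y * c a * c b) > 0"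
    "\<And>i j x. i \<in> B \<Longrightarrow> j \<in> B \<Longrightarrow> x \<in> W \<Longrightarrow> g i j x =
      partial_deriv i (\<lambda>x. \<Theta> x \<bullet> e) x * partial_deriv j (\<lambda>x. \<Theta> x \<bullet> e) x + (f (\<Theta> x \<bullet> e))\<^sup>2 *
      (\<Sum>a\<in>B - {e}. \<Sum>b\<in>B - {e}. hh a b (\<Theta> x - (\<Theta> x \<bullet> e) *\<^sub>R e)
        * partial_deriv i (\<lambda>x. \<Theta> x \<bullet> a) x * partial_deriv j (\<lambda>x. \<Theta> x \<bullet> b) x)"
proof -
  obtain e Z W \<Psi> \<Theta> \<tau> D \<epsilon> where S: "straightened_chart B V g X \<phi> x0 e Z W \<Psi> \<Theta> \<tau>" and x0W: "x0 \<in> W"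
    and D: "relopen (B - {e}) D" "convex D" "D \<noteq> {}" and \<epsilon>: "\<epsilon> > 0"
    and Z_def: "Z = {z \<in> span B. \<bar>z \<bullet> e\<bar> < \<epsilon> \<and> z - (z \<bullet> e) *\<^sub>R e \<in> D}"
    using straightening by blast
  interpret straightened_chart B V g X \<phi> x0 e Z W \<Psi> \<Theta> \<tau> by (rule S)
  have Be: "B - {e} \<subseteq> Basis" using B by auto
  have eb: "e \<in> Basis" using e B by auto
  have Ds: "D \<subseteq> span (B - {e})" using D(1) by (simp add: openin_euclidean_subtopology_iff)
  have De: "y \<bullet> e = 0" if "y \<in> D" for y
    using that Ds in_span_axes_iff[OF Be, of y] eb by auto
  have mem: "y + t *\<^sub>R e \<in> Z" if "y \<in> D" "\<bar>t\<bar> < \<epsilon>" for y t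
  proof -
    have "y \<in> span B" using that(1) Ds span_mono[of "B - {e}" B] by auto
    then have "y + t *\<^sub>R e \<in> span B" using e by (auto intro!: span_add span_mul intro: span_base)
    then show ?thesis using that De[OF that(1)] eb by (simp add: Z_def inner_add_left)
  qed
  have DZ: "D \<subseteq> Z" using mem[of _ 0] \<epsilon> by auto
  have decomp: "z - (z \<bullet> e) *\<^sub>R e \<in> D" "\<bar>z \<bullet> e\<bar> < \<epsilon>" if "z \<in> Z" for z using that by (auto simp: Z_def)
  obtain y1 where y1: "y1 \<in> D" using D by auto
  define s where "s z = X_norm (\<Psi> z)" for z
  have s_smooth: "smooth_on B Z s" unfolding s_def[abs_def] by (rule smooth_pull[OF smooth_X_norm])
  \<comment> \<open>The norm of \<open>X\<close> read along the \<open>e\<close>-line over one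
    chosen point of \<open>D\<close>; \<open>s_f\<close> shows that the choice is
    immaterial.\<close>
  define f where "f t = s (y1 + t *\<^sub>R e)" for t
  have s_f: "s z = f (z \<bullet> e)" if z: "z \<in> Z" for z
  proof -
    define t where "t = z \<bullet> e"
    have t: "\<bar>t\<bar> < \<epsilon>" using decomp[OF z] by (simp add: t_def)
    have "s ((z - t *\<^sub>R e) + t *\<^sub>R e) = s (y1 + t *\<^sub>R e)"
    proof (rule constant_of_partials_zero[OF Be D(1,2), where F="\<lambda>y. s (y + t *\<^sub>R e)"])
      show "smooth_on (B - {e}) D (\<lambda>y. s (y + t *\<^sub>R e))"
      proof (rule smooth_on_compose[OF B Z D(1) s_smooth])
        show "smooth_on (B - {e}) D (\<lambda>y. (y + t *\<^sub>R e) \<bullet> b)" for b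
          unfolding inner_add_left by (intro smooth_on_add smooth_on_inner smooth_on_const D)
      qed (rule mem[OF _ t])
      fix y b assume yb: "y \<in> D" "b \<in> B - {e}"
      have "partial_deriv b (\<lambda>y. s (y + t *\<^sub>R e)) y = partial_deriv b s (y + t *\<^sub>R e)"
        by (simp add: partial_deriv_def algebra_simps)
      then show "partial_deriv b (\<lambda>y. s (y + t *\<^sub>R e)) y = 0"
        using partial_norm[of b, OF _ mem[OF yb(1) t]] yb(2) by (simp add: s_def[abs_def])
    qed (use decomp(1)[OF z] y1 in \<open>auto simp: t_def\<close>)
    then show ?thesis by (simp add: f_def t_def)
  qed
  have Q_const: "Q a b z = Q a b (z - (z \<bullet> e) *\<^sub>R e)" if ab: "a \<in> B - {e}" "b \<in> B - {e}" and z: "z \<in> Z" for a b z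
  proof -
    let ?y = "z - (z \<bullet> e) *\<^sub>R e" and ?I = "{-\<epsilon><..<\<epsilon>}"
    have "\<exists>c. \<forall>t\<in>?I. Q a b (?y + t *\<^sub>R e) = c"
    proof (rule has_field_derivative_zero_constant)
      fix t assume "t \<in> ?I"
      then have m: "?y + t *\<^sub>R e \<in> Z" by (intro mem decomp(1)[OF z]) auto
      have "((\<lambda>t. Q a b (?y + t *\<^sub>R e)) has_real_derivative 0) (at t)"
        by (rule has_partial_shift)
          (use smooth_on_has_partial[OF smooth_Q e m, of a b] partial_e_Q[OF ab m] ab in simp)
      then show "((\<lambda>t. Q a b (?y + t *\<^sub>R e)) has_real_derivative 0) (at t within ?I)"
        by (rule has_field_derivative_at_within)
    qed auto
    then obtain c where c: "\<And>t. t \<in> ?I \<Longrightarrow> Q a b (?y + t *\<^sub>R e) = c" by blast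
    have "z \<bullet> e \<in> ?I" "0 \<in> ?I" using decomp(2)[OF z] \<epsilon> by auto
    from c[OF this(1)] c[OF this(2)] show ?thesis by simp
  qed
  show ?thesis
  proof (rule that[of e W D \<epsilon> Z \<Psi> \<Theta> f Q])
    show "smooth_on Basis {-\<epsilon><..<\<epsilon>} f"
      unfolding f_def
    proof (rule smooth_on_compose[OF B Z relopen_Basis[THEN iffD2] s_smooth])
      show "smooth_on Basis {-\<epsilon><..<\<epsilon>} (\<lambda>t. (y1 + t *\<^sub>R e) \<bullet> b)" for b
      proof -
        have I: "relopen Basis {-\<epsilon><..<\<epsilon>}" by (subst relopen_Basis) simp
        show ?thesis
          using smooth_on_add[OF I smooth_on_const[OF I, of "y1 \<bullet> b"] smooth_on_inner[OF I, of "e \<bullet> b"]]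
          by (simp add: inner_add_left)
      qed
    qed (use mem[OF y1] in auto)
    show "f t > 0" if "t \<in> {-\<epsilon><..<\<epsilon>}" for t
    proof -
      have "y1 + t *\<^sub>R e \<in> Z" using that by (intro mem[OF y1]) auto
      then show ?thesis unfolding f_def s_def by (intro X_norm_pos \<Psi>_V)
    qed
    show "smooth_on (B - {e}) D (Q a b)" if "a \<in> B - {e}" "b \<in> B - {e}" for a b
      by (rule smooth_on_restrict[OF B Be Z D(1) DZ smooth_Q]) (use that in auto)
    show "Q a b y = Q b a y" if "y \<in> D" for a b y
      using P_sym[of y a b] that DZ by (auto simp: Q_def)
    show "(\<Sum>a\<in>B - {e}. \<Sum>b\<in>B - {e}. Q a b y * c a * c b) > 0" if "y \<in> D" "\<exists>a\<in>B - {e}. c a \<noteq> 0" for c y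
      by (rule Q_pos) (use that DZ in auto)
    fix i j x assume ij: "i \<in> B" "j \<in> B" and x: "x \<in> W"
    have "X_norm x = f (\<Theta> x \<bullet> e)" using s_f[OF \<Theta>_Z[OF x]] \<Psi>_\<Theta>[OF x] by (simp add: s_def)
    moreover have "Q a b (\<Theta> x) = Q a b (\<Theta> x - (\<Theta> x \<bullet> e) *\<^sub>R e)" if "a \<in> B - {e}" "b \<in> B - {e}" for a b
      by (rule Q_const[OF that \<Theta>_Z[OF x]])
    ultimately show "g i j x = partial_deriv i (\<lambda>x. \<Theta> x \<bullet> e) x * partial_deriv j (\<lambda>x. \<Theta> x \<bullet> e) x + (f (\<Theta> x \<bullet> e))\<^sup>2 *
      (\<Sum>a\<in>B - {e}. \<Sum>b\<in>B - {e}. Q a b (\<Theta> x - (\<Theta> x \<bullet> e) *\<^sub>R e)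
        * partial_deriv i (\<lambda>x. \<Theta> x \<bullet> a) x * partial_deriv j (\<lambda>x. \<Theta> x \<bullet> b) x)"
      using metric_pullback[OF ij x] by simp
  qed (fact e W x0W D \<epsilon> Z_def Z hom \<Psi>_smooth \<Theta>_smooth)+
qed

section \<open>Charts and tangent vectors\<close>

lemma at_within_relopen:
  assumes "relopen B U" "x \<in> U"
  shows "at x within U = at x within span B"
proof -
  obtain T where T: "open T" "U = span B \<inter> T" using assms(1) by (metis openin_open)
  show ?thesis by (rule at_within_nhd[of x T]) (use T assms in auto)
qed

text \<open>The relatively open sets around a point all induce the filter of \<open>span B\<close>
  there, so local continuity patches together; partial derivatives are local by nature, and
  induction does the rest.\<close>

lemma Ck_on_local:
  assumes "relopen B U" "\<And>x. x \<in> U \<Longrightarrow> \<exists>T. relopen B T \<and> x \<in> T \<and> Ck_on B k T F"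
  shows "Ck_on B k U F"
proof -
  have cont: "continuous_on U F" if ex: "\<And>x. x \<in> U \<Longrightarrow> \<exists>T. relopen B T \<and> x \<in> T \<and> continuous_on T F" for F :: "'a \<Rightarrow> real"
    unfolding continuous_on_eq_continuous_within
  proof
    fix x assume x: "x \<in> U"
    then obtain T where T: "relopen B T" "x \<in> T" "continuous_on T F" using ex[OF x] by blast
    then have "continuous (at x within T) F" using continuous_on_eq_continuous_within by blast
    then show "continuous (at x within U) F"
      by (simp only: at_within_relopen[OF assms(1) x] at_within_relopen[OF T(1,2)])
  qed
  show ?thesis using assms(2)
  proof (induction k arbitrary: F)
    case 0
    then show ?case using cont by simp
  next
    case (Suc k)
    show ?case
    proof (rule Ck_on_SucI[OF assms(1)])
      show "continuous_on U F"
      proof (rule cont)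
        fix x assume "x \<in> U"
        then obtain T where "relopen B T" "x \<in> T" "Ck_on B (Suc k) T F" using Suc.prems by blast
        then show "\<exists>T. relopen B T \<and> x \<in> T \<and> continuous_on T F"
          using Ck_on_imp_continuous_on[of B "Suc k" T F] by blast
      qed
      show "((\<lambda>s. F (x + s *\<^sub>R b)) has_real_derivative partial_deriv b F x) (at 0)" if b: "b \<in> B" and x: "x \<in> U" for b x
      proof -
        obtain T where "x \<in> T" "Ck_on B (Suc k) T F" using Suc.prems[OF x] by blast
        then show ?thesis using Ck_on_has_partial[of B k T F b x] b by blast
      qed
      show "Ck_on B k U (partial_deriv b F)" if "b \<in> B" for b

      proof (rule Suc.IH)
        fix x assume "x \<in> U"
        then obtain T where "relopen B T" "x \<in> T" "Ck_on B (Suc k) T F" using Suc.prems by blast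
        then show "\<exists>T. relopen B T \<and> x \<in> T \<and> Ck_on B k T (partial_deriv b F)"
          using Ck_on_partial[of B k T F b] that by blast
      qed
    qed
  qed
qed

lemma smooth_on_local:
  assumes "relopen B U" "\<And>x. x \<in> U \<Longrightarrow> \<exists>T. relopen B T \<and> x \<in> T \<and> smooth_on B T F"
  shows "smooth_on B U F"
  unfolding smooth_on_def
proof
  fix k show "Ck_on B k U F"
  proof (rule Ck_on_local[OF assms(1)])
    fix x assume "x \<in> U"
    then obtain T where "relopen B T" "x \<in> T" "smooth_on B T F" using assms(2) by blast
    then show "\<exists>T. relopen B T \<and> x \<in> T \<and> Ck_on B k T F" using smooth_on_Ck[of B T F k] by blast
  qed
qed

section \<open>Charts and coordinate changes\<close>

locale smooth_mfd =
  fixes M :: "('a, 'e::euclidean_space) mfd"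
  assumes mfd: "smooth_manifold M"
begin

abbreviation "B \<equiv> axes M"
abbreviation "img c \<equiv> snd c ` fst c"

lemma B: "B \<subseteq> Basis" and hausdorff: "Hausdorff_space (mtop M)" and second_countable: "second_countable (mtop M)"
  and cover: "topspace (mtop M) = (\<Union>c\<in>atlas M. fst c)"
  using mfd by (auto simp: smooth_manifold_def)

lemma finB: "finite B" using B finite_subset finite_Basis by blast

lemma chart_open: "c \<in> atlas M \<Longrightarrow> openin (mtop M) (fst c)"
  and img_open: "c \<in> atlas M \<Longrightarrow> relopen B (img c)"
  and chart_homeo: "c \<in> atlas M \<Longrightarrow> homeomorphic_map (subtopology (mtop M) (fst c)) (top_of_set (img c)) (snd c)"
  and transition: "c \<in> atlas M \<Longrightarrow> d \<in> atlas M \<Longrightarrow> b \<in> B \<Longrightarrow>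
    smooth_on B (snd c ` (fst c \<inter> fst d)) (coordinate d b \<circ> chart_inv c)"
  using mfd by (auto simp: smooth_manifold_def)

lemma chart_subset: "c \<in> atlas M \<Longrightarrow> fst c \<subseteq> topspace (mtop M)"
  using cover by auto

lemma chart_inj: "c \<in> atlas M \<Longrightarrow> inj_on (snd c) (fst c)"
  using homeomorphic_imp_injective_map[OF chart_homeo[of c]] chart_subset[of c] by (simp add: Int_absorb1)

lemma chart_inv_chart: "c \<in> atlas M \<Longrightarrow> p \<in> fst c \<Longrightarrow> chart_inv c (snd c p) = p"
  unfolding chart_inv_def by (rule inv_into_f_f[OF chart_inj])

lemma chart_chart_inv: "x \<in> img c \<Longrightarrow> snd c (chart_inv c x) = x"
  and chart_inv_in: "x \<in> img c \<Longrightarrow> chart_inv c x \<in> fst c"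
  unfolding chart_inv_def by (auto intro: f_inv_into_f inv_into_into)

lemma chart_image_open:
  assumes "c \<in> atlas M" "openin (mtop M) W" "W \<subseteq> fst c"
  shows "relopen B (snd c ` W)"
proof -
  have "openin (subtopology (mtop M) (fst c)) W"
    using openin_subtopology_Int[OF assms(2), of "fst c"] assms(3) by (simp add: Int_absorb2)
  then have "openin (top_of_set (img c)) (snd c ` W)"
    using homeomorphic_imp_open_map[OF chart_homeo[OF assms(1)]] by (simp add: open_map_def)
  then show ?thesis using img_open[OF assms(1)] openin_trans by blast
qed

lemma chart_vimage_open:
  assumes "c \<in> atlas M" "relopen B T" "T \<subseteq> img c"
  shows "openin (mtop M) {p \<in> fst c. snd c p \<in> T}"
proof -
  have "openin (top_of_set (img c)) T"
    by (rule openin_subset_trans[OF assms(2,3)]) (use img_open[OF assms(1)] openin_imp_subset in blast)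
  then have "openin (subtopology (mtop M) (fst c)) {p \<in> topspace (subtopology (mtop M) (fst c)). snd c p \<in> T}"
    using homeomorphic_imp_continuous_map[OF chart_homeo[OF assms(1)]] by (simp add: continuous_map_def)
  then have "openin (subtopology (mtop M) (fst c)) {p \<in> fst c. snd c p \<in> T}"
    using chart_subset[OF assms(1)] by (simp add: Int_absorb1)
  then show ?thesis using chart_open[OF assms(1)] openin_trans_full by blast
qed

lemma compose_chart_change:
  assumes "c \<in> atlas M" "d \<in> atlas M" "openin (mtop M) W" "W \<subseteq> fst c \<inter> fst d"
    and F: "smooth_on B (snd d ` W) (F \<circ> chart_inv d)"
  shows "smooth_on B (snd c ` W) (\<lambda>x. (F \<circ> chart_inv d) (snd d (chart_inv c x)))"
    and "\<And>x. x \<in> snd c ` W \<Longrightarrow> (F \<circ> chart_inv d) (snd d (chart_inv c x)) = (F \<circ> chart_inv c) x"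
proof -
  have W: "W \<subseteq> fst c" "W \<subseteq> fst d" using assms by auto
  show "(F \<circ> chart_inv d) (snd d (chart_inv c x)) = (F \<circ> chart_inv c) x" if "x \<in> snd c ` W" for x
    using that W chart_inv_chart[OF assms(1)] chart_inv_chart[OF assms(2)] by (auto simp: subset_iff)
  show "smooth_on B (snd c ` W) (\<lambda>x. (F \<circ> chart_inv d) (snd d (chart_inv c x)))"
  proof (rule smooth_on_compose[OF B _ _ F])
    fix b assume "b \<in> B"
    then show "smooth_on B (snd c ` W) (\<lambda>x. snd d (chart_inv c x) \<bullet> b)"
      using smooth_on_subset[OF transition[OF assms(1,2)], of b "snd c ` W"] assms(4)
      by (auto simp: coordinate_def o_def)
  next
    show "relopen B (snd d ` W)" "relopen B (snd c ` W)"
      using chart_image_open[OF assms(2,3) W(2)] chart_image_open[OF assms(1,3) W(1)] by simp_all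
    fix x assume "x \<in> snd c ` W"
    then show "snd d (chart_inv c x) \<in> snd d ` W" using chart_inv_chart[OF assms(1)] W by (auto simp: subset_iff)
  qed
qed

text \<open>Smoothness near a point is witnessed by some unspecified chart; compatibility of charts
  transfers it to any chart around the point.\<close>

lemma smooth_at_in_chart:
  assumes "smooth_at M p F" "c \<in> atlas M" "p \<in> fst c"
  obtains W where "openin (mtop M) W" "p \<in> W" "W \<subseteq> fst c" "smooth_on B (snd c ` W) (F \<circ> chart_inv c)"
proof -
  obtain d W where d: "d \<in> atlas M" "openin (mtop M) W" "p \<in> W" "W \<subseteq> fst d" "smooth_on B (snd d ` W) (F \<circ> chart_inv d)"
    using assms(1) by (auto simp: smooth_at_def)
  let ?W = "W \<inter> fst c"
  have W: "openin (mtop M) ?W" "?W \<subseteq> fst c \<inter> fst d" using d chart_open[OF assms(2)] by auto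
  have s: "smooth_on B (snd d ` ?W) (F \<circ> chart_inv d)"
    by (rule smooth_on_subset[OF d(5)]) auto
  have rel: "relopen B (snd c ` ?W)" using W by (intro chart_image_open assms) auto
  show ?thesis
  proof (rule that[of ?W])
    show "smooth_on B (snd c ` ?W) (F \<circ> chart_inv c)"
      by (rule smooth_on_cong[OF rel compose_chart_change(2,1)[OF assms(2) d(1) W s]])
  qed (use W d assms in auto)
qed

text \<open>The neighbourhoods witnessing smoothness vary with the point;
  \<open>smooth_on_local\<close> patches them over the whole chart image.\<close>

lemma smooth_in_chart:
  assumes "\<And>p. p \<in> fst c \<Longrightarrow> smooth_at M p F" "c \<in> atlas M"
  shows "smooth_on B (img c) (F \<circ> chart_inv c)"
proof (rule smooth_on_local[OF img_open[OF assms(2)]])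
  fix x assume "x \<in> img c"
  then obtain p where p: "p \<in> fst c" "x = snd c p" by auto
  obtain W where "openin (mtop M) W" "p \<in> W" "W \<subseteq> fst c" "smooth_on B (snd c ` W) (F \<circ> chart_inv c)"
    using smooth_at_in_chart[OF assms(1)[OF p(1)] assms(2) p(1)] by blast
  then show "\<exists>T. relopen B T \<and> x \<in> T \<and> smooth_on B T (F \<circ> chart_inv c)"
    using p chart_image_open[OF assms(2)] by blast
qed

lemma smooth_atI:
  assumes "c \<in> atlas M" "relopen B T" "T \<subseteq> img c" "smooth_on B T (F \<circ> chart_inv c)" "p \<in> fst c" "snd c p \<in> T"
  shows "smooth_at M p F"
proof -
  have "snd c ` {p \<in> fst c. snd c p \<in> T} = T" using assms(3) by auto
  then show ?thesis
    unfolding smooth_at_def using assms chart_vimage_open[OF assms(1-3)]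
    by (intro bexI[of _ c] exI[of _ "{p \<in> fst c. snd c p \<in> T}"]) auto
qed

lemma smooth_at_coordinate:
  assumes "c \<in> atlas M" "p \<in> fst c"
  shows "smooth_at M p (coordinate c b)"
proof (rule smooth_atI[OF assms(1) img_open[OF assms(1)] subset_refl _ assms(2)])
  show "smooth_on B (img c) (coordinate c b \<circ> chart_inv c)"
    by (rule smooth_on_cong[OF img_open[OF assms(1)] _ smooth_on_inner[OF img_open[OF assms(1)], of b]])
      (simp add: coordinate_def chart_chart_inv)
qed (use assms in auto)

lemma inner_axes: "a \<in> B \<Longrightarrow> b \<in> B \<Longrightarrow> a \<bullet> b = (if a = b then 1 else 0)"
  using B by (simp add: inner_Basis subset_iff)

lemma chart_deriv_coordinate:
  assumes "c \<in> atlas M" "p \<in> fst c" "i \<in> B"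
  shows "chart_deriv c i (coordinate c b) p = i \<bullet> b"
proof -
  have "chart_deriv c i (coordinate c b) p = partial_deriv i (\<lambda>x. x \<bullet> b) (snd c p)"
    unfolding chart_deriv_def
    by (rule partial_deriv_cong[OF img_open[OF assms(1)] _ assms(3)])
      (use assms in \<open>auto simp: coordinate_def chart_chart_inv[of _ c] chart_inv_chart\<close>)
  then show ?thesis by (simp add: partial_deriv_inner)
qed

lemma chart_deriv_change:
  assumes "c \<in> atlas M" "d \<in> atlas M" "p \<in> fst c" "p \<in> fst d" "smooth_at M p F" "i \<in> B"
  shows "chart_deriv d i F p = (\<Sum>b\<in>B. chart_deriv d i (coordinate c b) p * chart_deriv c b F p)"
proof -
  obtain W where W: "openin (mtop M) W" "p \<in> W" "W \<subseteq> fst c" "smooth_on B (snd c ` W) (F \<circ> chart_inv c)"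
    using smooth_at_in_chart[OF assms(5,1,3)] by blast
  let ?W = "W \<inter> fst d"
  have W': "openin (mtop M) ?W" "?W \<subseteq> fst d \<inter> fst c" "?W \<subseteq> fst d" "?W \<subseteq> fst c" "p \<in> ?W"
    using W assms(4) chart_open[OF assms(2)] by auto
  have s: "smooth_on B (snd c ` ?W) (F \<circ> chart_inv c)" by (rule smooth_on_subset[OF W(4)]) auto
  have rel: "relopen B (snd d ` ?W)" "relopen B (snd c ` ?W)"
    using chart_image_open[OF assms(2) W'(1,3)] chart_image_open[OF assms(1) W'(1,4)] by simp_all
  have "chart_deriv d i F p = partial_deriv i (\<lambda>x. (F \<circ> chart_inv c) (snd c (chart_inv d x))) (snd d p)"
    unfolding chart_deriv_def
    by (rule partial_deriv_cong[OF rel(1) _ assms(6)])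
      (use W' compose_chart_change(2)[OF assms(2,1) W'(1,2) s] in \<open>auto simp: o_def\<close>)
  also have "\<dots> = (\<Sum>b\<in>B. partial_deriv b (F \<circ> chart_inv c) (snd c (chart_inv d (snd d p)))
      * partial_deriv i (\<lambda>x. snd c (chart_inv d x) \<bullet> b) (snd d p))"
  proof (rule partial_deriv_compose[OF B rel(2,1) s])
    fix b assume "b \<in> B"
    then show "smooth_on B (snd d ` ?W) (\<lambda>x. snd c (chart_inv d x) \<bullet> b)"
      using smooth_on_subset[OF transition[OF assms(2,1)], of b "snd d ` ?W"] W'(2)
      by (auto simp: coordinate_def o_def)
  next
    show "snd d p \<in> snd d ` ?W" using W' by blast
    fix x assume "x \<in> snd d ` ?W"
    then show "snd c (chart_inv d x) \<in> snd c ` ?W" using chart_inv_chart[OF assms(2)] W' by (auto simp: subset_iff)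
  qed (rule assms)
  finally show ?thesis
    using assms by (simp add: chart_deriv_def chart_inv_chart coordinate_def o_def mult.commute)
qed

section \<open>Tangent vectors in coordinates\<close>

lemma coord_vec_coordinate:
  assumes "c \<in> atlas M" "p \<in> fst c" "b \<in> B"
  shows "coord_vec M c p \<xi> (coordinate c b) = \<xi> \<bullet> b"
proof -
  have "coord_vec M c p \<xi> (coordinate c b) = (\<Sum>i\<in>B. (\<xi> \<bullet> i) * (if b = i then 1 else 0))"
    using assms smooth_at_coordinate chart_deriv_coordinate inner_axes by (auto simp: coord_vec_def intro!: sum.cong)
  then show ?thesis by (simp only: sum_delta_right[OF finB assms(3)])
qed

lemma inner_axes_sum: "b \<in> B \<Longrightarrow> (\<Sum>a\<in>B. r a *\<^sub>R a) \<bullet> b = r b"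
  using inner_coord_sum[OF B, of b r] B by auto

text \<open>The vector may have been given in another chart. The chain rule rewrites it in
  \<open>c\<close>, and its values on the coordinate functions are the components. On functions that
  are not smooth near \<open>p\<close> both sides are 0 by convention.\<close>

lemma tangent_expand:
  assumes c: "c \<in> atlas M" "p \<in> fst c" and v: "v \<in> tangent_space M p"
  shows "v = coord_vec M c p (\<Sum>b\<in>B. v (coordinate c b) *\<^sub>R b)"
proof
  fix F
  obtain d \<xi> where d: "d \<in> atlas M" "p \<in> fst d" "v = coord_vec M d p \<xi>" using v by (auto simp: tangent_space_def)
  show "v F = coord_vec M c p (\<Sum>b\<in>B. v (coordinate c b) *\<^sub>R b) F"
  proof (cases "smooth_at M p F")
    case True
    have "v F = (\<Sum>i\<in>B. (\<xi> \<bullet> i) * (\<Sum>b\<in>B. chart_deriv d i (coordinate c b) p * chart_deriv c b F p))"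
      using True by (simp add: d coord_vec_def) (intro sum.cong refl, simp add: chart_deriv_change[OF c(1) d(1) c(2) d(2) True])
    also have "\<dots> = (\<Sum>b\<in>B. (\<Sum>i\<in>B. (\<xi> \<bullet> i) * chart_deriv d i (coordinate c b) p) * chart_deriv c b F p)"
      by (simp add: sum_distrib_left sum_distrib_right mult.assoc) (rule sum.swap)
    also have "\<dots> = (\<Sum>b\<in>B. v (coordinate c b) * chart_deriv c b F p)"
      using smooth_at_coordinate[OF c] by (simp add: d coord_vec_def)
    finally show ?thesis using True by (simp add: coord_vec_def inner_axes_sum)
  next
    case False
    then show ?thesis by (simp add: d coord_vec_def)
  qed
qed

lemma tangent_apply:
  assumes "c \<in> atlas M" "p \<in> fst c" "v \<in> tangent_space M p"
  shows "v F = (if smooth_at M p F then \<Sum>b\<in>B. v (coordinate c b) * chart_deriv c b F p else 0)"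
  by (subst tangent_expand[OF assms]) (simp add: coord_vec_def inner_axes_sum)

lemma coord_vec_tangent: "c \<in> atlas M \<Longrightarrow> p \<in> fst c \<Longrightarrow> coord_vec M c p \<xi> \<in> tangent_space M p"
  unfolding tangent_space_def by blast

lemma coord_vec_linear:
  "coord_vec M c p (r *\<^sub>R \<xi> + \<eta>) = (\<lambda>F. r * coord_vec M c p \<xi> F + coord_vec M c p \<eta> F)"
  by (auto simp: coord_vec_def inner_add_left sum.distrib sum_distrib_left algebra_simps)

lemma coord_vec_zero: "coord_vec M c p 0 = (\<lambda>F. 0)"
  by (auto simp: coord_vec_def)

end

section \<open>Bump functions and vector fields with prescribed value\<close>

text \<open>The powers make this family closed under differentiation, up to linear combinations.\<close>
definition flat :: "nat \<Rightarrow> real \<Rightarrow> real" where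
  "flat k x = (if x > 0 then exp (- inverse x) * inverse x ^ k else 0)"

lemma flat_tendsto: "((\<lambda>x. flat k x) \<longlongrightarrow> 0) (at_right 0)"
proof -
  have "((\<lambda>y::real. y ^ k / exp y) \<longlongrightarrow> 0) at_top" by (rule tendsto_power_div_exp_0)
  then have "((\<lambda>x::real. inverse x ^ k / exp (inverse x)) \<longlongrightarrow> 0) (at_right 0)"
    by (rule filterlim_compose) (rule filterlim_inverse_at_top_right)
  moreover have "\<forall>\<^sub>F x in at_right 0. inverse x ^ k / exp (inverse x) = flat k x"
    by (auto simp: eventually_at_filter flat_def exp_minus divide_inverse mult.commute)
  ultimately show ?thesis by (simp add: tendsto_cong)
qed

lemma flat_has_derivative: "(flat k has_real_derivative (flat (k + 2) x - k * flat (k + 1) x)) (at x)"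
proof -
  consider "x > 0" | "x < 0" | "x = 0" by linarith
  then show ?thesis
  proof cases
    case 1
    have "((\<lambda>x. exp (- inverse x) * inverse x ^ k) has_real_derivative
        exp (- inverse x) * (inverse x * inverse x) * inverse x ^ k
         + exp (- inverse x) * (k * inverse x ^ (k - 1) * (- (inverse x * inverse x)))) (at x)"
      using 1 by (auto intro!: derivative_eq_intros simp: power2_eq_square)
    also have "exp (- inverse x) * (inverse x * inverse x) * inverse x ^ k
         + exp (- inverse x) * (k * inverse x ^ (k - 1) * (- (inverse x * inverse x)))
         = flat (k + 2) x - k * flat (k + 1) x"
      using 1 by (cases k) (auto simp: flat_def algebra_simps)
    finally show ?thesis
      by (rule has_field_derivative_transform_within_open[where S="{0<..}"]) (use 1 in \<open>auto simp: flat_def\<close>)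
  next
    case 2
    have "((\<lambda>x. 0) has_real_derivative 0) (at x)" by simp
    then have "(flat k has_real_derivative 0) (at x)"
      by (rule has_field_derivative_transform_within_open[where S="{..<0}"]) (use 2 in \<open>auto simp: flat_def\<close>)
    then show ?thesis using 2 by (simp add: flat_def)
  next
    case 3
    \<comment> \<open>At 0 the quotient vanishes on the left, and on the right it equals
      \<open>flat (Suc k)\<close>, which tends to 0.\<close>
    have "((\<lambda>h. (flat k (0 + h) - flat k 0) / h) \<longlongrightarrow> 0) (at 0)"
    proof (rule filterlim_split_at)
      have "\<forall>\<^sub>F h in at_right 0. flat (Suc k) h = (flat k (0 + h) - flat k 0) / h"
        by (auto simp: eventually_at_filter flat_def divide_inverse)
      then show "((\<lambda>h. (flat k (0 + h) - flat k 0) / h) \<longlongrightarrow> 0) (at_right 0)"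
        using flat_tendsto[of "Suc k"] by (rule Lim_transform_eventually[rotated])
      have "\<forall>\<^sub>F h in at_left 0. 0 = (flat k (0 + h) - flat k 0) / h"
        by (auto simp: eventually_at_filter flat_def)
      then show "((\<lambda>h. (flat k (0 + h) - flat k 0) / h) \<longlongrightarrow> 0) (at_left 0)"
        by (rule Lim_transform_eventually[OF tendsto_const])
    qed
    then show ?thesis using 3 by (simp add: DERIV_def flat_def)
  qed
qed

lemma smooth_flat: "smooth_on Basis UNIV (flat k)"
proof -
  have rel: "relopen Basis (UNIV :: real set)" by (subst relopen_Basis) simp
  have "Ck_on Basis n UNIV (flat k)" for n
  proof (induction n arbitrary: k)
    case 0
    then show ?case
      by (auto intro!: continuous_at_imp_continuous_on DERIV_isCont[OF flat_has_derivative])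
  next
    case (Suc n)
    show ?case
    proof (rule Ck_on_SucI[OF rel, where D="\<lambda>b x. flat (k + 2) x - k * flat (k + 1) x"])
      show "continuous_on UNIV (flat k)"
        by (auto intro!: continuous_at_imp_continuous_on DERIV_isCont[OF flat_has_derivative])
      fix b :: real assume "b \<in> Basis"
      then have b: "b = 1" by simp
      show "((\<lambda>s. flat k (x + s *\<^sub>R b)) has_real_derivative flat (k + 2) x - k * flat (k + 1) x) (at 0)" for x
        using flat_has_derivative[of k x] DERIV_shift[of "flat k" _ 0 x] by (simp add: b add.commute)
      show "Ck_on Basis n UNIV (\<lambda>x. flat (k + 2) x - k * flat (k + 1) x)"
        by (rule Ck_on_diff[OF rel Suc.IH Ck_on_mult[OF rel Ck_on_const[OF rel] Suc.IH]])
    qed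
  qed
  then show ?thesis by (simp add: smooth_on_def)
qed

text \<open>The function \<open>exp (- 1 / u)\<close> composed with \<open>r\<^sup>2\<close> minus
  the squared distance. That distance is written as a sum over coordinates so that its smoothness
  follows from the algebra of smooth functions.\<close>

lemma bump_function:
  fixes x0 :: "'e::euclidean_space"
  assumes r: "r > 0" and rel: "relopen B (U :: 'e set)"
  shows "\<exists>\<beta>. smooth_on B U \<beta> \<and> \<beta> x0 > 0 \<and> (\<forall>x. x \<notin> cball x0 r \<longrightarrow> \<beta> x = 0)"
proof -
  define \<beta> where "\<beta> x = flat 0 (r\<^sup>2 - (\<Sum>b\<in>Basis. (x \<bullet> b - x0 \<bullet> b) * (x \<bullet> b - x0 \<bullet> b)))" for x
  have eq: "(\<Sum>b\<in>Basis. (x \<bullet> b - x0 \<bullet> b) * (x \<bullet> b - x0 \<bullet> b)) = (norm (x - x0))\<^sup>2" for x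
    unfolding power2_norm_eq_inner by (subst euclidean_inner) (simp only: inner_diff_left)
  have "smooth_on B U \<beta>"
    unfolding \<beta>_def[abs_def]
  proof (rule smooth_on_compose[OF subset_refl _ rel smooth_flat])
    show "relopen Basis (UNIV :: real set)" by (subst relopen_Basis) simp
    fix b :: real assume "b \<in> Basis"
    then have "b = 1" by simp
    moreover have "smooth_on B U (\<lambda>x. r\<^sup>2 - (\<Sum>b\<in>Basis. (x \<bullet> b - x0 \<bullet> b) * (x \<bullet> b - x0 \<bullet> b)))"
      by (intro smooth_on_diff smooth_on_const smooth_on_sum smooth_on_mult smooth_on_inner rel)
    ultimately show "smooth_on B U (\<lambda>x. (r\<^sup>2 - (\<Sum>b\<in>Basis. (x \<bullet> b - x0 \<bullet> b) * (x \<bullet> b - x0 \<bullet> b))) \<bullet> b)" by simp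
  qed simp
  moreover have "\<beta> x0 > 0" using r by (simp add: \<beta>_def flat_def)
  moreover have "\<beta> x = 0" if "x \<notin> cball x0 r" for x
  proof -
    have "r\<^sup>2 \<le> (norm (x - x0))\<^sup>2" using that r by (intro power_mono) (auto simp: dist_norm norm_minus_commute)
    then show ?thesis by (simp add: \<beta>_def eq flat_def)
  qed
  ultimately show ?thesis by blast
qed

context smooth_mfd
begin

lemma chart_inv_continuous:
  assumes "c \<in> atlas M"
  shows "continuous_map (top_of_set (img c)) (mtop M) (chart_inv c)"
  unfolding continuous_map_def
proof (intro conjI allI impI)
  show "chart_inv c \<in> topspace (top_of_set (img c)) \<rightarrow> topspace (mtop M)"
    using chart_inv_in[of _ c] chart_subset[OF assms] by auto
  fix U assume U: "openin (mtop M) U"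
  have "{x \<in> topspace (top_of_set (img c)). chart_inv c x \<in> U} = snd c ` (U \<inter> fst c)"
    using chart_inv_in[of _ c] chart_chart_inv[of _ c] chart_inv_chart[OF assms] by (force simp: image_iff)
  moreover have "relopen B (snd c ` (U \<inter> fst c))"
    using U chart_open[OF assms] by (intro chart_image_open assms) auto
  then have "openin (top_of_set (img c)) (snd c ` (U \<inter> fst c))"
    by (rule openin_subset_trans) (use openin_imp_subset[OF img_open[OF assms]] in auto)
  ultimately show "openin (top_of_set (img c)) {x \<in> topspace (top_of_set (img c)). chart_inv c x \<in> U}" by simp
qed

text \<open>Needed because \<open>closed_soliton\<close> speaks of global fields only. A coordinate
  field cut off by a bump function extends by zero; a positive multiple of the coordinate vector at
  \<open>p\<close> is enough, as it can be divided out later.\<close>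

lemma vector_field_extension:
  assumes c: "c \<in> atlas M" "p \<in> fst c" and i: "i \<in> B"
  obtains Y r where "vector_field M Y" "r > 0" "Y p = coord_vec M c p (r *\<^sub>R i)"
proof -
  obtain T where T: "open T" "img c = span B \<inter> T" using img_open[OF c(1)] by (metis openin_open)
  then obtain r where r: "r > 0" "cball (snd c p) r \<subseteq> T"
    using c(2) by (metis IntD2 imageI open_contains_cball)
  obtain \<beta> where \<beta>: "smooth_on B (img c) \<beta>" "\<beta> (snd c p) > 0" "\<And>x. x \<notin> cball (snd c p) r \<Longrightarrow> \<beta> x = 0"
    using bump_function[OF r(1) img_open[OF c(1)], of "snd c p"] by blast
  \<comment> \<open>A compact set outside which the field vanishes. In a Hausdorff space it is
    closed, so every point outside the chart has a neighbourhood on which the field is zero.\<close>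
  define K where "K = chart_inv c ` (cball (snd c p) r \<inter> span B)"
  have sub: "cball (snd c p) r \<inter> span B \<subseteq> img c" using T r by auto
  have "compact (cball (snd c p) r \<inter> span B)" by (intro compact_Int_closed compact_cball closed_span)
  then have "compactin (top_of_set (img c)) (cball (snd c p) r \<inter> span B)"
    using sub by (simp add: compactin_subtopology)
  then have "compactin (mtop M) K"
    unfolding K_def by (rule image_compactin[OF _ chart_inv_continuous[OF c(1)]])
  then have Kc: "closedin (mtop M) K" using hausdorff by (rule compactin_imp_closedin[rotated])
  define Y where "Y q = (if q \<in> fst c then coord_vec M c q (\<beta> (snd c q) *\<^sub>R i) else (\<lambda>F. 0))" for q
  have Y0: "Y q = (\<lambda>F. 0)" if "q \<notin> K" for q
  proof (cases "q \<in> fst c")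
    case True
    have "snd c q \<in> span B" using True T by auto
    then have "snd c q \<notin> cball (snd c p) r"
      using that True chart_inv_chart[OF c(1) True] unfolding K_def by (metis IntI imageI)
    then show ?thesis using \<beta>(3) True by (simp add: Y_def coord_vec_zero)
  qed (simp add: Y_def)
  have Yc: "Y q F = \<beta> (snd c q) * chart_deriv c i F q" if "q \<in> fst c" "smooth_at M q F" for q F
  proof -
    have "Y q F = (\<Sum>b\<in>B. (\<beta> (snd c q) * chart_deriv c b F q) * (if i = b then 1 else 0))"
      using that i by (simp add: Y_def coord_vec_def inner_axes) (intro sum.cong refl, simp)
    then show ?thesis by (simp only: sum_delta_right[OF finB i])
  qed
  have "vector_field M Y"
    unfolding vector_field_def
  proof (intro conjI ballI)
    fix q assume q: "q \<in> topspace (mtop M)"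
    then obtain d where d: "d \<in> atlas M" "q \<in> fst d" using cover by auto
    show "Y q \<in> tangent_space M q"
      using coord_vec_tangent[OF c(1), of q] coord_vec_tangent[OF d, of 0] by (simp add: Y_def coord_vec_zero)
  next
    fix d b q assume d: "d \<in> atlas M" "b \<in> B" "q \<in> fst d"
    show "smooth_at M q (\<lambda>q. Y q (coordinate d b))"
    proof (cases "q \<in> fst c")
      case True
      let ?W = "fst c \<inter> fst d"
      have W: "relopen B (snd c ` ?W)" using chart_open[OF c(1)] chart_open[OF d(1)] by (intro chart_image_open c) auto
      show ?thesis
      proof (rule smooth_atI[OF c(1) W _ _ True])
        have "smooth_on B (snd c ` ?W) (\<lambda>x. \<beta> x * partial_deriv i (coordinate d b \<circ> chart_inv c) x)"
          by (intro smooth_on_mult W smooth_on_partial[OF transition[OF c(1) d(1,2)] i] smooth_on_subset[OF \<beta>(1)]) auto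
        then show "smooth_on B (snd c ` ?W) ((\<lambda>q. Y q (coordinate d b)) \<circ> chart_inv c)"
        proof (rule smooth_on_cong[OF W, rotated])
          fix x assume "x \<in> snd c ` ?W"
          then obtain q where q: "q \<in> fst c" "q \<in> fst d" "x = snd c q" by auto
          then show "\<beta> x * partial_deriv i (coordinate d b \<circ> chart_inv c) x = ((\<lambda>q. Y q (coordinate d b)) \<circ> chart_inv c) x"
            using Yc[OF q(1) smooth_at_coordinate[OF d(1) q(2)]] by (simp add: chart_inv_chart[OF c(1)] chart_deriv_def)
        qed
      qed (use True d in auto)
    next
      case False
      let ?W = "(topspace (mtop M) - K) \<inter> fst d"
      have W: "relopen B (snd d ` ?W)"
        using Kc chart_open[OF d(1)] by (intro chart_image_open d) auto
      have "K \<subseteq> fst c" using sub chart_inv_in[of _ c] by (auto simp: K_def)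
      then have q: "q \<in> ?W" using False d chart_subset[OF d(1)] by auto
      show ?thesis
      proof (rule smooth_atI[OF d(1) W _ _ d(3)])
        show "smooth_on B (snd d ` ?W) ((\<lambda>q. Y q (coordinate d b)) \<circ> chart_inv d)"
          by (rule smooth_on_cong[OF W _ smooth_on_const[OF W, of 0]])
            (use chart_inv_chart[OF d(1)] Y0 in auto)
      qed (use q in auto)
    qed
  qed
  moreover have "Y p = coord_vec M c p (\<beta> (snd c p) *\<^sub>R i)" using c by (simp add: Y_def)
  ultimately show ?thesis using that \<beta>(2) by blast
qed

end

section \<open>Metrics in charts\<close>

text \<open>The inverse metric is introduced by a definite description, whose use requires unique
  existence. Positivity makes the kernel trivial, which gives uniqueness directly and existence
  through injectivity in finite dimension.\<close>

lemma positive_definite_inverse: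
  fixes G :: "'e::euclidean_space \<Rightarrow> 'e \<Rightarrow> real"
  assumes B: "B \<subseteq> Basis"
    and pos: "\<And>c. \<exists>i\<in>B. c i \<noteq> 0 \<Longrightarrow> (\<Sum>i\<in>B. \<Sum>j\<in>B. G i j * c i * c j) > 0"
  shows "\<exists>!h. (\<forall>i j. i \<notin> B \<or> j \<notin> B \<longrightarrow> h i j = 0) \<and>
    (\<forall>i\<in>B. \<forall>j\<in>B. (\<Sum>k\<in>B. G i k * h k j) = (if i = j then 1 else 0))"
proof -
  have kernel: "d k = 0" if "\<And>i. i \<in> B \<Longrightarrow> (\<Sum>k\<in>B. G i k * d k) = 0" "k \<in> B" for d k
  proof (rule ccontr)
    assume "d k \<noteq> 0"
    then have "0 < (\<Sum>i\<in>B. \<Sum>j\<in>B. G i j * d i * d j)" using that(2) by (intro pos) auto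
    also have "\<dots> = (\<Sum>i\<in>B. d i * (\<Sum>j\<in>B. G i j * d j))"
      by (simp add: sum_distrib_left mult_ac)
    finally show False using that(1) by simp
  qed
  \<comment> \<open>The matrix is padded by the identity on the axes outside \<open>B\<close>, so
    that it becomes an endomorphism of the whole space.\<close>
  define a where "a i j = (if i \<in> B \<and> j \<in> B then G i j else if i = j then 1 else 0)" for i j
  have av: "matvec a v \<bullet> i = (if i \<in> B then \<Sum>k\<in>B. G i k * (v \<bullet> k) else v \<bullet> i)" if i: "i \<in> Basis" for v i
  proof -
    have "matvec a v \<bullet> i = (\<Sum>k\<in>Basis. a i k * (v \<bullet> k))" by (rule matvec_inner[OF i])
    also have "\<dots> = (if i \<in> B then \<Sum>k\<in>B. G i k * (v \<bullet> k) else v \<bullet> i)"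
    proof (cases "i \<in> B")
      case True
      then have "(\<Sum>k\<in>Basis. a i k * (v \<bullet> k)) = (\<Sum>k\<in>B. a i k * (v \<bullet> k))"
        by (intro sum.mono_neutral_right) (use B in \<open>auto simp: a_def\<close>)
      then show ?thesis using True by (simp add: a_def)
    next
      case False
      then have "(\<Sum>k\<in>Basis. a i k * (v \<bullet> k)) = (\<Sum>k\<in>Basis. (v \<bullet> k) * (if i = k then 1 else 0))"
        by (intro sum.cong refl) (auto simp: a_def)
      then show ?thesis using False i by (simp add: sum_delta_right)
    qed
    finally show ?thesis .
  qed
  have "inj (matvec a)"
  proof (subst linear_injective_0[OF linear_matvec], intro allI impI)
    fix v assume v: "matvec a v = 0"
    have 1: "(\<Sum>k\<in>B. G i k * (v \<bullet> k)) = 0" if "i \<in> B" for i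
      using av[of i v] v that B by auto
    have "v \<bullet> k = 0" if "k \<in> Basis" for k
      using kernel[of "\<lambda>k. v \<bullet> k" k, OF 1] av[OF that, of v] v by (cases "k \<in> B") auto
    then show "v = 0" using euclidean_eqI[of v 0] by simp
  qed
  then have "surj (matvec a)" by (rule linear_inj_imp_surj[OF linear_matvec])
  then obtain w where w: "\<And>j. matvec a (w j) = j" by (metis surjD)
  define h where "h i j = (if i \<in> B \<and> j \<in> B then w j \<bullet> i else 0)" for i j
  show ?thesis
  proof (rule ex1I[of _ h])
    have "(\<Sum>k\<in>B. G i k * h k j) = (if i = j then 1 else 0)" if "i \<in> B" "j \<in> B" for i j
    proof -
      have "(\<Sum>k\<in>B. G i k * h k j) = matvec a (w j) \<bullet> i"
        using av[of i "w j"] that B by (auto simp: h_def intro!: sum.cong)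
      then show ?thesis using that subsetD[OF B] by (simp add: w inner_Basis)
    qed
    then show "(\<forall>i j. i \<notin> B \<or> j \<notin> B \<longrightarrow> h i j = 0) \<and>
      (\<forall>i\<in>B. \<forall>j\<in>B. (\<Sum>k\<in>B. G i k * h k j) = (if i = j then 1 else 0))" by (auto simp: h_def)
    then have h: "\<And>i j. i \<in> B \<Longrightarrow> j \<in> B \<Longrightarrow> (\<Sum>k\<in>B. G i k * h k j) = (if i = j then 1 else 0)" by blast
    fix h' assume h': "(\<forall>i j. i \<notin> B \<or> j \<notin> B \<longrightarrow> h' i j = 0) \<and>
      (\<forall>i\<in>B. \<forall>j\<in>B. (\<Sum>k\<in>B. G i k * h' k j) = (if i = j then 1 else 0))"
    show "h' = h"
    proof (intro ext)
      fix i j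
      show "h' i j = h i j"
      proof (cases "i \<in> B \<and> j \<in> B")
        case True
        have "h' i j - h i j = 0"
          by (rule kernel[of "\<lambda>k. h' k j - h k j"])
            (use True h h' in \<open>auto simp: right_diff_distrib sum_subtractf\<close>)
        then show ?thesis by simp
      next
        case False
        then have "h' i j = 0" using h' by blast
        then show ?thesis using False by (auto simp: h_def)
      qed
    qed
  qed
qed

locale riem_mfd = smooth_mfd M for M :: "('a, 'e::euclidean_space) mfd" +
  fixes g :: "'a metric"
  assumes metric: "riemannian_metric M g"
begin

lemma g_commute: "p \<in> topspace (mtop M) \<Longrightarrow> v \<in> tangent_space M p \<Longrightarrow> w \<in> tangent_space M p \<Longrightarrow> g p v w = g p w v"
  and g_linear: "p \<in> topspace (mtop M) \<Longrightarrow> u \<in> tangent_space M p \<Longrightarrow> v \<in> tangent_space M p \<Longrightarrow> w \<in> tangent_space M p \<Longrightarrow>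
    g p (\<lambda>F. r * u F + v F) w = r * g p u w + g p v w"
  and g_positive: "p \<in> topspace (mtop M) \<Longrightarrow> v \<in> tangent_space M p \<Longrightarrow> v \<noteq> (\<lambda>F. 0) \<Longrightarrow> g p v v > 0"
  and metric_coeff_smooth: "c \<in> atlas M \<Longrightarrow> a \<in> B \<Longrightarrow> b \<in> B \<Longrightarrow> p \<in> fst c \<Longrightarrow> smooth_at M p (metric_coeff M g c a b)"
  using metric unfolding riemannian_metric_def by blast+

section \<open>Metric, Christoffel symbols and closedness at a point of a chart\<close>

context
  fixes c p assumes c: "c \<in> atlas M" and p: "p \<in> fst c"
begin

lemma p_top: "p \<in> topspace (mtop M)" using chart_subset[OF c] p by blast

lemma g_coord_left:
  assumes "finite A" and w: "w \<in> tangent_space M p"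
  shows "g p (coord_vec M c p (\<Sum>b\<in>A. r b *\<^sub>R b)) w = (\<Sum>b\<in>A. r b * g p (coord_vec M c p b) w)"
  using assms(1)
proof (induction A rule: finite_induct)
  case empty
  have z: "(\<lambda>F. 0) \<in> tangent_space M p" using coord_vec_tangent[OF c p, of 0] by (simp add: coord_vec_zero)
  have "g p (\<lambda>F. 0) w = 0" using g_linear[OF p_top z z w, of 1] by simp
  then show ?case by (simp add: coord_vec_zero)
next
  case (insert a A)
  then show ?case
    using g_linear[OF p_top coord_vec_tangent[OF c p] coord_vec_tangent[OF c p] w, of "r a" a "\<Sum>b\<in>A. r b *\<^sub>R b"]
    by (simp add: coord_vec_linear)
qed

lemma g_expand:
  assumes v: "v \<in> tangent_space M p" and w: "w \<in> tangent_space M p"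
  shows "g p v w = (\<Sum>i\<in>B. \<Sum>j\<in>B. metric_coeff M g c i j p * v (coordinate c i) * w (coordinate c j))"
proof -
  have left: "g p v u = (\<Sum>i\<in>B. v (coordinate c i) * g p (coord_vec M c p i) u)"
    if "v \<in> tangent_space M p" "u \<in> tangent_space M p" for u v
    by (subst tangent_expand[OF c p that(1)]) (rule g_coord_left[OF finB that(2)])
  have "g p (coord_vec M c p i) w = (\<Sum>j\<in>B. w (coordinate c j) * metric_coeff M g c i j p)" for i
  proof -
    have "g p (coord_vec M c p i) w = g p w (coord_vec M c p i)"
      by (rule g_commute[OF p_top coord_vec_tangent[OF c p] w])
    also have "\<dots> = (\<Sum>j\<in>B. w (coordinate c j) * g p (coord_vec M c p j) (coord_vec M c p i))"
      by (rule left[OF w coord_vec_tangent[OF c p]])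
    finally show ?thesis
      by (simp add: metric_coeff_def g_commute[OF p_top coord_vec_tangent[OF c p] coord_vec_tangent[OF c p], of i])
  qed
  then show ?thesis using left[OF v w] by (simp add: sum_distrib_left mult_ac)
qed

lemma metric_coeff_commute: "metric_coeff M g c i j p = metric_coeff M g c j i p"
  unfolding metric_coeff_def by (rule g_commute[OF p_top coord_vec_tangent[OF c p] coord_vec_tangent[OF c p]])

lemma metric_coeff_pos:
  assumes "\<exists>i\<in>B. r i \<noteq> 0"
  shows "(\<Sum>i\<in>B. \<Sum>j\<in>B. metric_coeff M g c i j p * r i * r j) > 0"
proof -
  let ?v = "coord_vec M c p (\<Sum>b\<in>B. r b *\<^sub>R b)"
  have v: "?v (coordinate c i) = r i" if "i \<in> B" for i
    using coord_vec_coordinate[OF c p that] inner_axes_sum[OF that] by simp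
  then have "?v \<noteq> (\<lambda>F. 0)" using assms by metis
  then have "g p ?v ?v > 0" by (rule g_positive[OF p_top coord_vec_tangent[OF c p]])
  then show ?thesis using g_expand[OF coord_vec_tangent[OF c p] coord_vec_tangent[OF c p], of "\<Sum>b\<in>B. r b *\<^sub>R b" "\<Sum>b\<in>B. r b *\<^sub>R b"] v
    by simp
qed

lemma inverse_metric:
  assumes "i \<in> B" "j \<in> B"
  shows "(\<Sum>k\<in>B. metric_coeff M g c i k p * inverse_metric_coeff M g c k j p) = (if i = j then 1 else 0)"
proof -
  let ?P = "\<lambda>h. (\<forall>i j. i \<notin> B \<or> j \<notin> B \<longrightarrow> h i j = 0) \<and>
             (\<forall>i\<in>B. \<forall>j\<in>B. (\<Sum>k\<in>B. metric_coeff M g c i k p * h k j) = (if i = j then 1 else 0))"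
  have "\<exists>!h. ?P h" by (rule positive_definite_inverse[OF B metric_coeff_pos])
  then have "?P (The ?P)" by (rule theI')
  then show ?thesis unfolding inverse_metric_coeff_def using assms by blast
qed

text \<open>Contraction with the metric cancels the inverse metric and leaves the Christoffel
  symbols of the first kind, so no derivative of an inverse matrix enters the later
  computations.\<close>

lemma christoffel_lowered:
  assumes "l \<in> B"
  shows "(\<Sum>k\<in>B. metric_coeff M g c l k p * christoffel M g c k i j p) =
    (chart_deriv c i (metric_coeff M g c j l) p + chart_deriv c j (metric_coeff M g c i l) p
        - chart_deriv c l (metric_coeff M g c i j) p) / 2"
proof -
  let ?D = "\<lambda>m. chart_deriv c i (metric_coeff M g c j m) p + chart_deriv c j (metric_coeff M g c i m) p
        - chart_deriv c m (metric_coeff M g c i j) p"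
  have "(\<Sum>k\<in>B. metric_coeff M g c l k p * christoffel M g c k i j p) =
      (\<Sum>k\<in>B. \<Sum>m\<in>B. metric_coeff M g c l k p * inverse_metric_coeff M g c k m p * ?D m / 2)"
    unfolding christoffel_def by (simp add: sum_distrib_left mult.assoc sum_divide_distrib)
  also have "\<dots> = (\<Sum>m\<in>B. (?D m / 2) * (\<Sum>k\<in>B. metric_coeff M g c l k p * inverse_metric_coeff M g c k m p))"
    by (subst sum.swap, unfold sum_distrib_left, intro sum.cong refl) simp
  also have "\<dots> = (\<Sum>m\<in>B. (?D m / 2) * (if l = m then 1 else 0))"
    by (intro sum.cong refl) (simp only: inverse_metric[OF assms])
  also have "\<dots> = ?D l / 2" by (rule sum_delta_right[OF finB assms])
  finally show ?thesis .
qed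

text \<open>The equation is tested on a global field whose value at \<open>p\<close> is
  \<open>r\<close> times the coordinate vector of \<open>i\<close>; then the positive factor
  \<open>r\<close> is cancelled.\<close>

lemma closed_in_chart:
  assumes closed: "closed_soliton M g X \<rho>" and i: "i \<in> B" and k: "k \<in> B"
  shows "chart_deriv c i (\<lambda>q. X q (coordinate c k)) p + (\<Sum>j\<in>B. christoffel M g c k i j p * X p (coordinate c j))
    = (scalar_curvature M g p - \<rho> p) * (if i = k then 1 else 0)"
proof -
  let ?t = "\<lambda>i k. chart_deriv c i (\<lambda>q. X q (coordinate c k)) p + (\<Sum>j\<in>B. christoffel M g c k i j p * X p (coordinate c j))"
  obtain Y r where Y: "vector_field M Y" "r > 0" "Y p = coord_vec M c p (r *\<^sub>R i)"
    using vector_field_extension[OF c p i] by blast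
  have Yb: "Y p (coordinate c b) = r * (if i = b then 1 else 0)" if "b \<in> B" for b
    using coord_vec_coordinate[OF c p that, of "r *\<^sub>R i"] Y(3) i that by (simp add: inner_axes)
  have "cov_deriv M g c Y X p (coordinate c k) = (scalar_curvature M g p - \<rho> p) * Y p (coordinate c k)"
    using closed Y(1) c p by (simp add: closed_soliton_def)
  moreover have "cov_deriv M g c Y X p (coordinate c k) = (\<Sum>b\<in>B. Y p (coordinate c b) * ?t b k)"
    unfolding cov_deriv_def coord_vec_coordinate[OF c p k] by (rule inner_axes_sum[OF k])
  moreover have "(\<Sum>b\<in>B. Y p (coordinate c b) * ?t b k) = (\<Sum>b\<in>B. (r * ?t b k) * (if i = b then 1 else 0))"
    by (intro sum.cong refl) (simp only: Yb mult_ac)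
  ultimately have "r * ?t i k = r * ((scalar_curvature M g p - \<rho> p) * (if i = k then 1 else 0))"
    using Yb[OF k] sum_delta_right[OF finB i, of "\<lambda>b. r * ?t b k"] by simp
  then show ?thesis using Y(2) by simp
qed

text \<open>The lowered form of the equation, shaped to match the last assumption of
  \<open>closed_conformal_chart\<close>.\<close>

lemma closed_lowered:
  assumes closed: "closed_soliton M g X \<rho>" and i: "i \<in> B" and l: "l \<in> B"
  shows "(\<Sum>k\<in>B. metric_coeff M g c l k p * chart_deriv c i (\<lambda>q. X q (coordinate c k)) p) +
    (\<Sum>j\<in>B. (chart_deriv c i (metric_coeff M g c j l) p + chart_deriv c j (metric_coeff M g c i l) p
        - chart_deriv c l (metric_coeff M g c i j) p) * X p (coordinate c j)) / 2
    = (scalar_curvature M g p - \<rho> p) * metric_coeff M g c i l p"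
proof -
  let ?G = "\<lambda>k. metric_coeff M g c l k p" and ?\<phi> = "scalar_curvature M g p - \<rho> p"
  have "(\<Sum>j\<in>B. (chart_deriv c i (metric_coeff M g c j l) p + chart_deriv c j (metric_coeff M g c i l) p
        - chart_deriv c l (metric_coeff M g c i j) p) * X p (coordinate c j)) / 2
      = (\<Sum>j\<in>B. (\<Sum>k\<in>B. ?G k * christoffel M g c k i j p) * X p (coordinate c j))"
    unfolding sum_divide_distrib by (intro sum.cong refl) (simp add: christoffel_lowered[OF l])
  also have "\<dots> = (\<Sum>k\<in>B. ?G k * (\<Sum>j\<in>B. christoffel M g c k i j p * X p (coordinate c j)))"
    by (simp add: sum_distrib_left sum_distrib_right mult.assoc) (rule sum.swap)
  finally have "(\<Sum>k\<in>B. ?G k * chart_deriv c i (\<lambda>q. X q (coordinate c k)) p) +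
    (\<Sum>j\<in>B. (chart_deriv c i (metric_coeff M g c j l) p + chart_deriv c j (metric_coeff M g c i l) p
        - chart_deriv c l (metric_coeff M g c i j) p) * X p (coordinate c j)) / 2
    = (\<Sum>k\<in>B. ?G k * (chart_deriv c i (\<lambda>q. X q (coordinate c k)) p + (\<Sum>j\<in>B. christoffel M g c k i j p * X p (coordinate c j))))"
    by (simp add: distrib_left sum.distrib)
  also have "\<dots> = (\<Sum>k\<in>B. (?G k * ?\<phi>) * (if i = k then 1 else 0))"
    by (intro sum.cong refl) (simp only: closed_in_chart[OF closed i] mult.assoc)
  also have "\<dots> = ?\<phi> * metric_coeff M g c i l p"
    unfolding sum_delta_right[OF finB i] by (simp add: metric_coeff_commute[of l i])
  finally show ?thesis .
qed

end

end

section \<open>The local product\<close>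

text \<open>This version presupposes no manifold structure. It serves the product with the interval,
  for which openness of the neighbourhood is supplied by hand.\<close>

lemma smooth_at_chartI:
  assumes "c \<in> atlas M" "openin (mtop M) {p \<in> fst c. snd c p \<in> T}" "T \<subseteq> snd c ` fst c"
    "smooth_on (axes M) T (F \<circ> chart_inv c)" "p \<in> fst c" "snd c p \<in> T"
  shows "smooth_at M p F"
proof -
  have "snd c ` {p \<in> fst c. snd c p \<in> T} = T" using assms(3) by auto
  then show ?thesis
    unfolding smooth_at_def using assms
    by (intro bexI[of _ c] exI[of _ "{p \<in> fst c. snd c p \<in> T}"]) auto
qed

text \<open>A chart domain on which the metric is \<open>dt\<^sup>2 + f(t)\<^sup>2 hh\<close> in the coordinates \<open>\<Theta>\<close>, where \<open>t\<close> is the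
  coordinate of the axis \<open>e\<close>.\<close>
locale warped_chart = riem_mfd M g for M :: "('a, 'e::euclidean_space) mfd" and g +
  fixes c :: "('a, 'e) chart" and e :: 'e and W Z D :: "'e set" and \<Psi> \<Theta> :: "'e \<Rightarrow> 'e" and \<epsilon> :: real
    and f :: "real \<Rightarrow> real" and hh :: "'e \<Rightarrow> 'e \<Rightarrow> 'e \<Rightarrow> real"
  assumes c: "c \<in> atlas M" and e: "e \<in> B" and W: "relopen B W" "W \<subseteq> img c"
    and D: "relopen (B - {e}) D" and \<epsilon>: "\<epsilon> > 0"
    and Z_def: "Z = {z \<in> span B. \<bar>z \<bullet> e\<bar> < \<epsilon> \<and> z - (z \<bullet> e) *\<^sub>R e \<in> D}" and Z: "relopen B Z"
    and hom: "homeomorphism Z W \<Psi> \<Theta>"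
    and \<Psi>_smooth: "\<And>k. k \<in> B \<Longrightarrow> smooth_on B Z (\<lambda>z. \<Psi> z \<bullet> k)"
    and \<Theta>_smooth: "\<And>k. k \<in> B \<Longrightarrow> smooth_on B W (\<lambda>x. \<Theta> x \<bullet> k)"
    and hh_smooth: "\<And>a b. a \<in> B - {e} \<Longrightarrow> b \<in> B - {e} \<Longrightarrow> smooth_on (B - {e}) D (hh a b)"
    and hh_sym: "\<And>a b y. y \<in> D \<Longrightarrow> hh a b y = hh b a y"
    and hh_pos: "\<And>r y. y \<in> D \<Longrightarrow> \<exists>a\<in>B - {e}. r a \<noteq> 0 \<Longrightarrow> (\<Sum>a\<in>B - {e}. \<Sum>b\<in>B - {e}. hh a b y * r a * r b) > 0"
    and warped: "\<And>i j x. i \<in> B \<Longrightarrow> j \<in> B \<Longrightarrow> x \<in> W \<Longrightarrow> metric_coeff M g c i j (chart_inv c x) =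
      partial_deriv i (\<lambda>x. \<Theta> x \<bullet> e) x * partial_deriv j (\<lambda>x. \<Theta> x \<bullet> e) x + (f (\<Theta> x \<bullet> e))\<^sup>2 *
      (\<Sum>a\<in>B - {e}. \<Sum>b\<in>B - {e}. hh a b (\<Theta> x - (\<Theta> x \<bullet> e) *\<^sub>R e)
        * partial_deriv i (\<lambda>x. \<Theta> x \<bullet> a) x * partial_deriv j (\<lambda>x. \<Theta> x \<bullet> b) x)"
begin

section \<open>Domain, slice and product map\<close>

definition "\<zeta> q = \<Theta> (snd c q)"
definition "\<sigma> z = chart_inv c (\<Psi> z)"
definition "foot z = z - (z \<bullet> e) *\<^sub>R e"
definition "U = {q \<in> fst c. snd c q \<in> W}"
text \<open>The slice \<open>t = 0\<close>, since points of \<open>D\<close> have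
  \<open>e\<close>-coordinate 0. Taking the fibre as a subset of the original manifold keeps its
  point type.\<close>

definition "Sl = {q \<in> U. \<zeta> q \<in> D}"
definition "I = {-\<epsilon><..<\<epsilon>}"
definition "S = \<lparr> mtop = subtopology (mtop M) Sl, axes = B - {e}, atlas = {(Sl, \<zeta>)} \<rparr>"
definition "\<Phi> q = (\<zeta> q \<bullet> e, \<sigma> (foot (\<zeta> q)))"
definition "\<Phi>' n = \<sigma> (\<zeta> (snd n) + fst n *\<^sub>R e)" for n :: "real \<times> 'a"
definition "cN = (I \<times> Sl, \<lambda>(t, q). t *\<^sub>R e + \<zeta> q)"
text \<open>The metric of the fibre, given directly by the components of the vectors in its only
  chart; being a formula in the values of \<open>v\<close> and \<open>w\<close>, it is bilinear on
  arbitrary functionals.\<close>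

definition "h q v w = (\<Sum>a\<in>B - {e}. \<Sum>b\<in>B - {e}. hh a b (\<zeta> q) * v (coordinate (Sl, \<zeta>) a) * w (coordinate (Sl, \<zeta>) b))"
  for v w :: "'a tvec"

abbreviation "NN \<equiv> interval_product I e S"

lemma S_simps: "mtop S = subtopology (mtop M) Sl" "axes S = B - {e}" "atlas S = {(Sl, \<zeta>)}"
  by (simp_all add: S_def)

lemma N_simps: "mtop NN = prod_topology (top_of_set I) (subtopology (mtop M) Sl)" "axes NN = B" "atlas NN = {cN}"
  using e by (auto simp: interval_product_def S_simps cN_def)

lemma Be: "B - {e} \<subseteq> Basis" and eb: "e \<in> Basis" using B e by auto

lemma Ds: "D \<subseteq> span (B - {e})" using openin_imp_subset[OF D] .

lemma D_inner_e: "y \<in> D \<Longrightarrow> y \<bullet> e = 0"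
  using Ds in_span_axes_iff[OF Be, of y] eb by auto

lemma D_add: "y \<in> D \<Longrightarrow> t \<in> I \<Longrightarrow> y + t *\<^sub>R e \<in> Z"
proof -
  assume y: "y \<in> D" and t: "t \<in> I"
  have "y \<in> span B" using y Ds span_mono[of "B - {e}" B] by auto
  then have "y + t *\<^sub>R e \<in> span B" using e by (auto intro!: span_add span_mul intro: span_base)
  then show ?thesis using D_inner_e[OF y] eb y t by (simp add: Z_def inner_add_left I_def abs_less_iff)
qed

lemma DZ: "y \<in> D \<Longrightarrow> y \<in> Z" using D_add[of y 0] \<epsilon> by (simp add: I_def)

lemma Z_decomp: "z \<in> Z \<Longrightarrow> foot z \<in> D" "z \<in> Z \<Longrightarrow> z \<bullet> e \<in> I" "foot z + (z \<bullet> e) *\<^sub>R e = z"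
  by (auto simp: Z_def foot_def I_def)

lemma foot_D: "y \<in> D \<Longrightarrow> foot (y + t *\<^sub>R e) = y" "y \<in> D \<Longrightarrow> (y + t *\<^sub>R e) \<bullet> e = t"
  using D_inner_e[of y] eb by (auto simp: foot_def inner_add_left)

lemma \<Psi>_W: "z \<in> Z \<Longrightarrow> \<Psi> z \<in> W" and \<Theta>_Z: "x \<in> W \<Longrightarrow> \<Theta> x \<in> Z"
  and \<Theta>_\<Psi>: "z \<in> Z \<Longrightarrow> \<Theta> (\<Psi> z) = z" and \<Psi>_\<Theta>: "x \<in> W \<Longrightarrow> \<Psi> (\<Theta> x) = x"
  and cont\<Psi>: "continuous_on Z \<Psi>" and cont\<Theta>: "continuous_on W \<Theta>"
  using hom by (auto simp: homeomorphism_def)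

lemma \<sigma>_U: "z \<in> Z \<Longrightarrow> \<sigma> z \<in> U" and \<zeta>_\<sigma>: "z \<in> Z \<Longrightarrow> \<zeta> (\<sigma> z) = z" and chart_\<sigma>: "z \<in> Z \<Longrightarrow> snd c (\<sigma> z) = \<Psi> z"
  using \<Psi>_W[of z] W(2) chart_inv_in[of "\<Psi> z" c] chart_chart_inv[of "\<Psi> z" c] \<Theta>_\<Psi>[of z]
  by (auto simp: \<sigma>_def \<zeta>_def U_def subset_iff)

lemma \<zeta>_Z: "q \<in> U \<Longrightarrow> \<zeta> q \<in> Z" and \<sigma>_\<zeta>: "q \<in> U \<Longrightarrow> \<sigma> (\<zeta> q) = q"
  using chart_inv_chart[OF c, of q] by (auto simp: \<zeta>_def \<sigma>_def U_def \<Theta>_Z \<Psi>_\<Theta>)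

lemma \<sigma>_Sl: "y \<in> D \<Longrightarrow> \<sigma> y \<in> Sl" using \<sigma>_U[OF DZ] \<zeta>_\<sigma>[OF DZ] by (simp add: Sl_def)

lemma SlU: "Sl \<subseteq> U" and Sl_D: "q \<in> Sl \<Longrightarrow> \<zeta> q \<in> D" by (auto simp: Sl_def)

lemma U_open: "openin (mtop M) U" unfolding U_def by (rule chart_vimage_open[OF c W])

lemma U_top: "U \<subseteq> topspace (mtop M)" "Sl \<subseteq> topspace (mtop M)"
  using openin_subset[OF U_open] SlU by auto

lemma homeo_U: "homeomorphic_maps (subtopology (mtop M) U) (top_of_set Z) \<zeta> \<sigma>"
  unfolding homeomorphic_maps_def
proof (intro conjI ballI)
  have "continuous_map (subtopology (mtop M) (fst c)) euclidean (snd c)"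
    using homeomorphic_imp_continuous_map[OF chart_homeo[OF c]] by (simp add: continuous_map_in_subtopology)
  then have "continuous_map (subtopology (mtop M) U) euclidean (snd c)"
    by (rule continuous_map_from_subtopology_mono) (auto simp: U_def)
  then have 1: "continuous_map (subtopology (mtop M) U) (top_of_set W) (snd c)"
    by (rule continuous_map_into_subtopology) (auto simp: U_def)
  have "continuous_map (top_of_set W) (top_of_set Z) \<Theta>" using cont\<Theta> \<Theta>_Z by simp
  from continuous_map_compose[OF 1 this]
  show "continuous_map (subtopology (mtop M) U) (top_of_set Z) \<zeta>" by (simp add: o_def \<zeta>_def[abs_def])
  have "continuous_map (top_of_set Z) (top_of_set (img c)) \<Psi>" using cont\<Psi> \<Psi>_W W(2) by auto
  from continuous_map_compose[OF this chart_inv_continuous[OF c]]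
  have "continuous_map (top_of_set Z) (mtop M) \<sigma>" by (simp add: o_def \<sigma>_def[abs_def])
  then show "continuous_map (top_of_set Z) (subtopology (mtop M) U) \<sigma>"
    by (rule continuous_map_into_subtopology) (auto intro: \<sigma>_U)
qed (auto simp: \<sigma>_\<zeta> \<zeta>_\<sigma>)

lemma S_image: "\<zeta> ` Sl = D"
proof
  show "\<zeta> ` Sl \<subseteq> D" using Sl_D by auto
  show "D \<subseteq> \<zeta> ` Sl"
  proof
    fix y assume y: "y \<in> D"
    then show "y \<in> \<zeta> ` Sl" using \<sigma>_Sl[OF y] \<zeta>_\<sigma>[OF DZ[OF y]] by (metis imageI)
  qed
qed

lemma homeo_Sl: "homeomorphic_maps (subtopology (mtop M) Sl) (top_of_set D) \<zeta> \<sigma>"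
proof -
  have eq: "U \<inter> Sl = Sl" "Z \<inter> D = D" using SlU DZ by auto
  have "\<zeta> ` (topspace (subtopology (mtop M) U) \<inter> Sl) = topspace (top_of_set Z) \<inter> D"
    using U_top SlU DZ S_image by (simp add: Int_absorb1 Int_absorb2 inf.absorb2 subset_iff)
  from homeomorphic_maps_subtopologies[OF homeo_U this]
  show ?thesis by (simp add: subtopology_subtopology eq)
qed

text \<open>Both \<open>\<Phi>\<close> and its inverse factor through the coordinate set
  \<open>Z\<close>, which splits as an interval times \<open>D\<close>; continuity is checked on
  each factor.\<close>

lemma homeo_product:
  "homeomorphic_maps (subtopology (mtop M) U) (mtop NN) \<Phi> \<Phi>'"
  "continuous_map (mtop NN) (top_of_set Z) (snd cN)"
proof -
  have \<zeta>c: "continuous_map (subtopology (mtop M) U) (top_of_set Z) \<zeta>"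
    and \<sigma>c: "continuous_map (top_of_set Z) (subtopology (mtop M) U) \<sigma>"
    using homeo_U by (auto simp: homeomorphic_maps_def)
  have \<zeta>S: "continuous_map (subtopology (mtop M) Sl) (top_of_set D) \<zeta>"
    and \<sigma>S: "continuous_map (top_of_set D) (subtopology (mtop M) Sl) \<sigma>"
    using homeo_Sl by (auto simp: homeomorphic_maps_def)
  have zI: "continuous_map (top_of_set Z) (top_of_set I) (\<lambda>z. z \<bullet> e)"
    using Z_decomp by (auto intro!: continuous_intros)
  have zD: "continuous_map (top_of_set Z) (top_of_set D) foot"
    using Z_decomp by (auto simp: foot_def[abs_def] intro!: continuous_intros)
  have "continuous_map (subtopology (mtop M) U) (prod_topology (top_of_set I) (subtopology (mtop M) Sl)) \<Phi>"
    unfolding \<Phi>_def[abs_def] continuous_map_paired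
    using continuous_map_compose[OF \<zeta>c zI] continuous_map_compose[OF continuous_map_compose[OF \<zeta>c zD] \<sigma>S]
    unfolding o_def by blast
  moreover have "continuous_map (prod_topology (top_of_set I) (subtopology (mtop M) Sl))
      (prod_topology (top_of_set I) (top_of_set D)) (\<lambda>n. (fst n, \<zeta> (snd n)))"
    unfolding continuous_map_paired
    using continuous_map_compose[OF continuous_map_snd \<zeta>S] by (intro conjI continuous_map_fst) (simp add: o_def)
  moreover have "continuous_map (top_of_set (I \<times> D)) (top_of_set Z) (\<lambda>x. fst x *\<^sub>R e + snd x)"
    using D_add by (auto intro!: continuous_intros simp: add.commute)
  ultimately have 1: "continuous_map (subtopology (mtop M) U) (mtop NN) \<Phi>"
    and 2: "continuous_map (mtop NN) (top_of_set Z) (\<lambda>n. fst n *\<^sub>R e + \<zeta> (snd n))"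
    using continuous_map_compose[of "mtop NN" "top_of_set (I \<times> D)" "\<lambda>n. (fst n, \<zeta> (snd n))" "top_of_set Z"
        "\<lambda>x. fst x *\<^sub>R e + snd x"] by (simp_all add: N_simps o_def)
  from 2 show "continuous_map (mtop NN) (top_of_set Z) (snd cN)" by (simp add: cN_def case_prod_unfold)
  from continuous_map_compose[OF 2 \<sigma>c] have 3: "continuous_map (mtop NN) (subtopology (mtop M) U) \<Phi>'"
    by (simp add: o_def \<Phi>'_def[abs_def] add.commute)
  show "homeomorphic_maps (subtopology (mtop M) U) (mtop NN) \<Phi> \<Phi>'"
    unfolding homeomorphic_maps_def
  proof (intro conjI 1 3 ballI)
    fix q assume "q \<in> topspace (subtopology (mtop M) U)"
    then have q: "q \<in> U" by simp
    have z: "\<zeta> q \<in> Z" by (rule \<zeta>_Z[OF q])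
    show "\<Phi>' (\<Phi> q) = q"
      using \<zeta>_\<sigma>[OF DZ[OF Z_decomp(1)[OF z]]] Z_decomp(3)[of "\<zeta> q"] \<sigma>_\<zeta>[OF q] by (simp add: \<Phi>_def \<Phi>'_def)
  next
    fix n assume "n \<in> topspace (mtop NN)"
    then obtain t q where n: "n = (t, q)" "t \<in> I" "q \<in> Sl" by (auto simp: N_simps)
    have y: "\<zeta> q \<in> D" by (rule Sl_D[OF n(3)])
    show "\<Phi> (\<Phi>' n) = n"
      using \<zeta>_\<sigma>[OF D_add[OF y n(2)]] foot_D[OF y, of t] \<sigma>_\<zeta>[of q] n SlU by (auto simp: \<Phi>_def \<Phi>'_def)
  qed
qed

lemma N_topspace: "topspace (mtop NN) = I \<times> Sl"
  using U_top by (auto simp: N_simps)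

lemma cN_\<Phi>: "q \<in> U \<Longrightarrow> snd cN (\<Phi> q) = \<zeta> q"
  using \<zeta>_\<sigma>[OF DZ[OF Z_decomp(1)[OF \<zeta>_Z]]] Z_decomp(3)[of "\<zeta> q"] by (simp add: cN_def \<Phi>_def add.commute)

lemma \<Phi>_in: "q \<in> U \<Longrightarrow> \<Phi> q \<in> I \<times> Sl"
  using Z_decomp[of "\<zeta> q"] \<zeta>_Z \<sigma>_Sl by (auto simp: \<Phi>_def)

lemma cN_Z: "n \<in> I \<times> Sl \<Longrightarrow> snd cN n \<in> Z"
  using D_add[OF Sl_D] by (auto simp: cN_def add.commute)

lemma cN_image: "snd cN ` fst cN = Z"
proof
  show "snd cN ` fst cN \<subseteq> Z" using cN_Z by (auto simp: cN_def)
  show "Z \<subseteq> snd cN ` fst cN"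
  proof
    fix z assume z: "z \<in> Z"
    have "snd cN (\<Phi> (\<sigma> z)) = z" using cN_\<Phi>[OF \<sigma>_U[OF z]] \<zeta>_\<sigma>[OF z] by simp
    moreover have "\<Phi> (\<sigma> z) \<in> fst cN" using \<Phi>_in[OF \<sigma>_U[OF z]] by (simp add: cN_def)
    ultimately show "z \<in> snd cN ` fst cN" by (metis imageI)
  qed
qed

lemma cN_inv: "z \<in> Z \<Longrightarrow> chart_inv cN z = \<Phi> (\<sigma> z)"
  unfolding chart_inv_def
proof (rule inv_into_f_eq)
  assume z: "z \<in> Z"
  show "snd cN (\<Phi> (\<sigma> z)) = z" using cN_\<Phi>[OF \<sigma>_U[OF z]] \<zeta>_\<sigma>[OF z] by simp
  show "\<Phi> (\<sigma> z) \<in> fst cN" using \<Phi>_in[OF \<sigma>_U[OF z]] by (simp add: cN_def)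
  have "\<Phi> (\<sigma> (snd cN n)) = n" if "n \<in> fst cN" for n
  proof -
    have "n \<in> topspace (mtop NN)" using that by (simp add: N_topspace cN_def)
    then have "\<Phi> (\<Phi>' n) = n" using homeo_product(1) by (simp add: homeomorphic_maps_def)
    then show ?thesis by (simp add: \<Phi>'_def cN_def case_prod_beta add.commute)
  qed
  then show "inj_on (snd cN) (fst cN)" by (rule inj_on_inverseI[where g="\<lambda>z. \<Phi> (\<sigma> z)"])
qed

lemma smooth_at_N:
  assumes "relopen B T" "T \<subseteq> Z" "smooth_on B T (\<lambda>z. F (\<Phi> (\<sigma> z)))" "n \<in> I \<times> Sl" "snd cN n \<in> T"
  shows "smooth_at NN n F"
proof (rule smooth_at_chartI[of cN _ T])
  have "openin (top_of_set Z) T" by (rule openin_subset_trans[OF assms(1,2) openin_imp_subset[OF Z]])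
  then have "openin (mtop NN) {n \<in> topspace (mtop NN). snd cN n \<in> T}"
    using homeo_product(2) by (simp add: continuous_map_def)
  then show "openin (mtop NN) {n \<in> fst cN. snd cN n \<in> T}" by (simp add: N_topspace cN_def)
  show "smooth_on (axes NN) T (F \<circ> chart_inv cN)"
    unfolding N_simps
  proof (rule smooth_on_cong[OF assms(1) _ assms(3)])
    fix z assume "z \<in> T"
    then have "z \<in> Z" using assms(2) by blast
    then show "F (\<Phi> (\<sigma> z)) = (F \<circ> chart_inv cN) z" by (simp add: cN_inv)
  qed
  show "cN \<in> atlas NN" by (simp add: N_simps)
  show "T \<subseteq> snd cN ` fst cN" unfolding cN_image by (rule assms(2))
  show "n \<in> fst cN" using assms(4) by (simp add: cN_def)
qed (rule assms(5))

lemma S_inv: "y \<in> D \<Longrightarrow> chart_inv (Sl, \<zeta>) y = \<sigma> y"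
  unfolding chart_inv_def
proof (rule inv_into_f_eq)
  show "inj_on (snd (Sl, \<zeta>)) (fst (Sl, \<zeta>))"
    by (rule inj_on_inverseI[where g=\<sigma>]) (use \<sigma>_\<zeta> SlU in auto)
qed (simp_all add: \<sigma>_Sl \<zeta>_\<sigma> DZ)

section \<open>The slice as a Riemannian manifold\<close>

lemma smooth_manifold_S: "smooth_manifold S"
  unfolding smooth_manifold_def S_simps
proof (intro conjI ballI)
  show "Hausdorff_space (subtopology (mtop M) Sl)" by (rule Hausdorff_space_subtopology[OF hausdorff])
  show "second_countable (subtopology (mtop M) Sl)" by (rule second_countable_subtopology[OF second_countable])
  show "topspace (subtopology (mtop M) Sl) = (\<Union>c\<in>{(Sl, \<zeta>)}. fst c)" using U_top by auto
  fix d assume d: "d \<in> {(Sl, \<zeta>)}"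
  have T: "topspace (subtopology (mtop M) Sl) = Sl" using U_top by auto
  have "openin (subtopology (mtop M) Sl) Sl"
    using openin_topspace[of "subtopology (mtop M) Sl"] by (simp only: T)
  then show "openin (subtopology (mtop M) Sl) (fst d)" using d by simp
  show "relopen (B - {e}) (snd d ` fst d)" using d D by (simp add: S_image)
  have "subtopology (subtopology (mtop M) Sl) Sl = subtopology (mtop M) Sl" by (simp add: subtopology_subtopology)
  then show "homeomorphic_map (subtopology (subtopology (mtop M) Sl) (fst d)) (top_of_set (snd d ` fst d)) (snd d)"
    using d homeo_Sl S_image by (auto simp: homeomorphic_map_maps)
  fix d' b assume d': "d' \<in> {(Sl, \<zeta>)}" and b: "b \<in> B - {e}"
  show "smooth_on (B - {e}) (snd d ` (fst d \<inter> fst d')) (coordinate d' b \<circ> chart_inv d)"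
    using d d' by (simp add: S_image)
      (rule smooth_on_cong[OF D _ smooth_on_inner[OF D, of b]], simp add: coordinate_def S_inv \<zeta>_\<sigma> DZ)
qed (use B in auto)

lemma riemannian_S: "riemannian_manifold S h"
proof -
  interpret S: smooth_mfd S by unfold_locales (rule smooth_manifold_S)
  have cS: "(Sl, \<zeta>) \<in> atlas S" by (simp add: S_simps)
  have fin: "finite (B - {e})" using finB by simp
  show ?thesis
    unfolding riemannian_manifold_def riemannian_metric_def
  proof (intro conjI ballI smooth_manifold_S allI impI)
    fix q assume "q \<in> topspace (mtop S)"
    then have q: "q \<in> Sl" by (simp add: S_simps)
    show "h q v w = h q w v" for v w
    proof -
      have "h q v w = (\<Sum>b\<in>B - {e}. \<Sum>a\<in>B - {e}. hh a b (\<zeta> q) * v (coordinate (Sl, \<zeta>) a) * w (coordinate (Sl, \<zeta>) b))"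
        unfolding h_def by (rule sum.swap)
      also have "\<dots> = h q w v"
        unfolding h_def by (intro sum.cong refl) (simp add: hh_sym[OF Sl_D[OF q]] mult_ac)
      finally show ?thesis .
    qed
    show "h q (\<lambda>F. r * u F + v F) w = r * h q u w + h q v w" for r u v w
      by (simp add: h_def sum_distrib_left sum.distrib[symmetric] algebra_simps)
    fix v assume v: "v \<in> tangent_space S q" "v \<noteq> (\<lambda>F. 0)"
    \<comment> \<open>By \<open>tangent_expand\<close> a tangent vector with vanishing components is
      the zero functional, so a nonzero one has a nonzero component.\<close>
    have "\<exists>a\<in>B - {e}. v (coordinate (Sl, \<zeta>) a) \<noteq> 0"
    proof (rule ccontr)
      assume "\<not> ?thesis"
      then have "(\<Sum>b\<in>axes S. v (coordinate (Sl, \<zeta>) b) *\<^sub>R b) = 0" by (auto simp: S_simps intro!: sum.neutral)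
      then have "v = (\<lambda>F. 0)" using S.tangent_expand[OF cS _ v(1)] q by (simp add: S.coord_vec_zero)
      with v(2) show False by simp
    qed
    then show "0 < h q v v" unfolding h_def by (rule hh_pos[OF Sl_D[OF q]])
  next
    fix d a b q assume d: "d \<in> atlas S" and ab: "a \<in> axes S" "b \<in> axes S" and "q \<in> fst d"
    then have dS: "d = (Sl, \<zeta>)" and q: "q \<in> Sl" by (auto simp: S_simps)
    have mc: "metric_coeff S h d a b q = hh a b (\<zeta> q)" if q: "q \<in> Sl" for q
    proof -
      have cv: "coord_vec S (Sl, \<zeta>) q v (coordinate (Sl, \<zeta>) i) = v \<bullet> i" if "i \<in> B - {e}" for v i
        using S.coord_vec_coordinate[OF cS, of q i v] q that by (simp add: S_simps)
      have "metric_coeff S h d a b q = (\<Sum>a'\<in>B - {e}. (\<Sum>b'\<in>B - {e}. hh a' b' (\<zeta> q) * (if b = b' then 1 else 0)) * (if a = a' then 1 else 0))"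
        unfolding metric_coeff_def h_def dS sum_distrib_right
        by (intro sum.cong refl) (use ab in \<open>simp add: cv S_simps inner_axes\<close>)
      also have "\<dots> = hh a b (\<zeta> q)"
        using ab by (simp only: sum_delta_right[OF fin] S_simps)
      finally show ?thesis .
    qed
    show "smooth_at S q (metric_coeff S h d a b)"
    proof (rule S.smooth_atI[OF cS, of D])
      show "smooth_on (axes S) D (metric_coeff S h d a b \<circ> chart_inv (Sl, \<zeta>))"
        unfolding S_simps
        by (rule smooth_on_cong[OF D _ hh_smooth[of a b]]) (use ab mc \<sigma>_Sl \<zeta>_\<sigma>[OF DZ] in \<open>auto simp: S_inv S_simps\<close>)
    qed (use q D Sl_D in \<open>auto simp: S_simps S_image\<close>)
  qed
qed

section \<open>The product map as an isometry\<close>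

lemma smooth_at_S_coordinate: "q \<in> Sl \<Longrightarrow> smooth_at S q (coordinate (Sl, \<zeta>) b)"
proof -
  assume q: "q \<in> Sl"
  interpret S: smooth_mfd S by unfold_locales (rule smooth_manifold_S)
  show ?thesis by (rule S.smooth_at_coordinate) (use q in \<open>auto simp: S_simps\<close>)
qed

text \<open>A tangent vector sees only values near \<open>q\<close>, so \<open>G\<close> has to be
  known only on \<open>U\<close>, where in the chart \<open>c\<close> it is a component of
  \<open>\<Theta>\<close>.\<close>

lemma tangent_pull:
  assumes q: "q \<in> U" and v: "v \<in> tangent_space M q" and G: "\<And>q. q \<in> U \<Longrightarrow> G q = \<zeta> q \<bullet> k" and k: "k \<in> B"
  shows "v G = (\<Sum>i\<in>B. v (coordinate c i) * partial_deriv i (\<lambda>x. \<Theta> x \<bullet> k) (snd c q))"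
proof -
  have q': "q \<in> fst c" "snd c q \<in> W" using q by (auto simp: U_def)
  have eq: "(G \<circ> chart_inv c) x = \<Theta> x \<bullet> k" if "x \<in> W" for x
  proof -
    have x: "x \<in> img c" using that W by auto
    then have "chart_inv c x \<in> U" using that by (simp add: U_def chart_chart_inv chart_inv_in)
    then show ?thesis using G x by (simp add: \<zeta>_def chart_chart_inv)
  qed
  have "smooth_at M q G"
    by (rule smooth_atI[OF c W(1,2) _ q'], rule smooth_on_cong[OF W(1) _ \<Theta>_smooth[OF k]]) (simp only: eq)
  then have "v G = (\<Sum>i\<in>B. v (coordinate c i) * chart_deriv c i G q)"
    using tangent_apply[OF c q'(1) v] by simp
  also have "\<dots> = (\<Sum>i\<in>B. v (coordinate c i) * partial_deriv i (\<lambda>x. \<Theta> x \<bullet> k) (snd c q))"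
    unfolding chart_deriv_def
    by (intro sum.cong refl arg_cong2[where f="(*)"] partial_deriv_cong[OF W(1) q'(2)] eq)
  finally show ?thesis .
qed

lemma isometry: "isometry_onto M g U NN (warped_metric f S h) \<Phi>"
  unfolding isometry_onto_def
proof (intro conjI ballI)
  show hm: "homeomorphic_map (subtopology (mtop M) U) (mtop NN) \<Phi>"
    using homeo_product(1) by (auto simp: homeomorphic_map_maps)
  have cnt: "continuous_map (subtopology (mtop M) U) (mtop NN) \<Phi>" "continuous_map (mtop NN) (subtopology (mtop M) U) \<Phi>'"
    and inv1: "\<And>q. q \<in> U \<Longrightarrow> \<Phi>' (\<Phi> q) = q" and inv2: "\<And>n. n \<in> I \<times> Sl \<Longrightarrow> \<Phi> (\<Phi>' n) = n"
    using homeo_product(1) U_top by (auto simp: homeomorphic_maps_def N_topspace)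
  show "smooth_map M U NN \<Phi>"
    unfolding smooth_map_def N_simps(2,3)
  proof (intro conjI cnt ballI impI)
    fix q d b assume q: "q \<in> U" and d: "d \<in> {cN}" and b: "b \<in> B"
    show "smooth_at M q (coordinate d b \<circ> \<Phi>)"
    proof (rule smooth_atI[OF c W])
      have "(coordinate d b \<circ> \<Phi> \<circ> chart_inv c) x = \<Theta> x \<bullet> b" if "x \<in> W" for x
      proof -
        have x: "x \<in> img c" using that W by auto
        then have "chart_inv c x \<in> U" using that by (simp add: U_def chart_chart_inv chart_inv_in)
        then show ?thesis using d x by (simp add: coordinate_def cN_\<Phi> \<zeta>_def chart_chart_inv)
      qed
      then show "smooth_on B W (coordinate d b \<circ> \<Phi> \<circ> chart_inv c)"
        by (intro smooth_on_cong[OF W(1) _ \<Theta>_smooth[OF b]]) simp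
    qed (use q in \<open>auto simp: U_def\<close>)
  qed
  \<comment> \<open>The inverse in \<open>isometry_onto\<close> is given by choice; on the product
    it coincides with the explicit map \<open>\<Phi>'\<close>.\<close>
  have inv_eq: "inv_into U \<Phi> n = \<Phi>' n" if n: "n \<in> I \<times> Sl" for n
  proof (rule inv_into_f_eq)
    show "inj_on \<Phi> U" using inv1 by (rule inj_on_inverseI)
    have "n \<in> topspace (mtop NN)" using n by (simp add: N_topspace)
    then show "\<Phi>' n \<in> U" using cnt(2) U_top by (auto simp: continuous_map_def)
    show "\<Phi> (\<Phi>' n) = n" by (rule inv2[OF n])
  qed
  show "smooth_map NN (topspace (mtop NN)) M (inv_into U \<Phi>)"
    unfolding smooth_map_def
  proof (intro conjI ballI impI)
    have "continuous_map (mtop NN) (mtop M) \<Phi>'" using cnt(2) by (simp add: continuous_map_in_subtopology)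
    then show "continuous_map (subtopology (mtop NN) (topspace (mtop NN))) (mtop M) (inv_into U \<Phi>)"
      by (simp, rule_tac continuous_map_eq) (auto simp: N_topspace inv_eq)
    fix n d b assume "n \<in> topspace (mtop NN)" and d: "d \<in> atlas M" "inv_into U \<Phi> n \<in> fst d" and b: "b \<in> B"
    then have n: "n \<in> I \<times> Sl" by (simp add: N_topspace)
    let ?V = "snd c ` (fst c \<inter> fst d)"
    have V: "relopen B ?V" using chart_open[OF c] chart_open[OF d(1)] by (intro chart_image_open c) auto
    \<comment> \<open>The target may be read in any chart \<open>d\<close> of the manifold, so the
      argument is confined to the coordinates whose points lie in both \<open>c\<close> and
      \<open>d\<close>.\<close>
    define T where "T = Z \<inter> \<Psi> -` ?V"
    have "\<Psi> \<in> Z \<rightarrow> span B" using \<Psi>_W openin_imp_subset[OF W(1)] by auto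
    then have "openin (top_of_set Z) T" unfolding T_def by (rule continuous_openin_preimage[OF cont\<Psi> _ V])
    then have T: "relopen B T" by (rule openin_trans[OF _ Z])
    show "smooth_at NN n (coordinate d b \<circ> inv_into U \<Phi>)"
    proof (rule smooth_at_N[OF T])
      have "smooth_on B T (\<lambda>z. (coordinate d b \<circ> chart_inv c) (\<Psi> z))"
        by (rule smooth_on_compose[OF B V T transition[OF c d(1) b] smooth_on_subset[OF \<Psi>_smooth]]) (auto simp: T_def)
      then show "smooth_on B T (\<lambda>z. (coordinate d b \<circ> inv_into U \<Phi>) (\<Phi> (\<sigma> z)))"
      proof (rule smooth_on_cong[OF T, rotated])
        fix z assume "z \<in> T"
        then have z: "z \<in> Z" by (simp add: T_def)
        have "inv_into U \<Phi> (\<Phi> (\<sigma> z)) = \<sigma> z"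
          using inv_eq[OF \<Phi>_in[OF \<sigma>_U[OF z]]] inv1[OF \<sigma>_U[OF z]] by simp
        then show "(coordinate d b \<circ> chart_inv c) (\<Psi> z) = (coordinate d b \<circ> inv_into U \<Phi>) (\<Phi> (\<sigma> z))"
          by (simp add: \<sigma>_def)
      qed
      have "\<Phi>' n = \<sigma> (snd cN n)" by (simp add: \<Phi>'_def cN_def case_prod_beta add.commute)
      then have "\<sigma> (snd cN n) \<in> fst d" "\<sigma> (snd cN n) \<in> fst c"
        using d(2) inv_eq[OF n] \<sigma>_U[OF cN_Z[OF n]] by (auto simp: U_def)
      then show "snd cN n \<in> T"
        using cN_Z[OF n] chart_\<sigma>[OF cN_Z[OF n]] by (auto simp: T_def intro!: image_eqI[of _ _ "\<sigma> (snd cN n)"])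
    qed (use n in \<open>auto simp: T_def\<close>)
  qed
  fix q v w assume q: "q \<in> U" and v: "v \<in> tangent_space M q" and w: "w \<in> tangent_space M q"
  define z where "z = \<zeta> q"
  have z: "z \<in> Z" unfolding z_def by (rule \<zeta>_Z[OF q])
  define q' where "q' = \<sigma> (foot z)"
  have q': "q' \<in> Sl" "\<zeta> q' = foot z"
    using \<sigma>_Sl \<zeta>_\<sigma>[OF DZ] Z_decomp(1)[OF z] by (auto simp: q'_def)
  have \<Phi>q: "\<Phi> q = (z \<bullet> e, q')" by (simp add: \<Phi>_def z_def q'_def)
  define T where "T i k = partial_deriv i (\<lambda>x. \<Theta> x \<bullet> k) (snd c q)" for i k
  let ?d = "differential NN (\<Phi> q) \<Phi>"
  \<comment> \<open>The differential is 0 on functions not smooth at the image point, so smoothness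
    of the functions tested must be checked before their pullbacks can be evaluated.\<close>
  have N_coord: "smooth_at NN (\<Phi> q) G" if "\<And>q. q \<in> U \<Longrightarrow> G (\<Phi> q) = \<zeta> q \<bullet> k" for G k
  proof (rule smooth_at_N[OF Z subset_refl _ \<Phi>_in[OF q]])
    show "smooth_on B Z (\<lambda>z. G (\<Phi> (\<sigma> z)))"
      by (rule smooth_on_cong[OF Z _ smooth_on_inner[OF Z, of k]]) (simp add: that \<sigma>_U \<zeta>_\<sigma>)
    show "snd cN (\<Phi> q) \<in> Z" by (simp add: cN_\<Phi>[OF q] \<zeta>_Z[OF q])
  qed
  have diff: "?d u G = (\<Sum>i\<in>B. u (coordinate c i) * T i k)"
    if "u \<in> tangent_space M q" "\<And>q. q \<in> U \<Longrightarrow> G (\<Phi> q) = \<zeta> q \<bullet> k" "k \<in> B" for u G k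
    using N_coord[OF that(2)] tangent_pull[OF q that(1) _ that(3), of "G \<circ> \<Phi>"] that(2)
    by (simp add: differential_def T_def o_def)
  have d_e: "?d u fst = (\<Sum>i\<in>B. u (coordinate c i) * T i e)" if "u \<in> tangent_space M q" for u
    by (rule diff[OF that _ e]) (simp add: \<Phi>_def)
  have d_a: "differential S q' snd (?d u) (coordinate (Sl, \<zeta>) a) = (\<Sum>i\<in>B. u (coordinate c i) * T i a)"
    if u: "u \<in> tangent_space M q" and a: "a \<in> B - {e}" for u a
  proof -
    have "(coordinate (Sl, \<zeta>) a \<circ> snd) (\<Phi> q) = \<zeta> q \<bullet> a" if q: "q \<in> U" for q
    proof -
      have "e \<bullet> a = 0" using a e inner_axes by auto
      then show ?thesis
        using \<zeta>_\<sigma>[OF DZ[OF Z_decomp(1)[OF \<zeta>_Z[OF q]]]]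
        by (simp add: coordinate_def \<Phi>_def) (simp add: foot_def inner_diff_left)
    qed
    then have "?d u (coordinate (Sl, \<zeta>) a \<circ> snd) = (\<Sum>i\<in>B. u (coordinate c i) * T i a)"
      using a by (intro diff[OF u]) auto
    then show ?thesis using smooth_at_S_coordinate[OF q'(1)] by (simp add: differential_def[of S])
  qed
  let ?v = "\<lambda>i. v (coordinate c i)" and ?w = "\<lambda>i. w (coordinate c i)" and ?H = "\<lambda>a b. hh a b (foot z)"
  have qc: "q \<in> fst c" "snd c q \<in> W" using q by (auto simp: U_def)
  have co: "metric_coeff M g c i j q = T i e * T j e + (f (z \<bullet> e))\<^sup>2 * (\<Sum>a\<in>B - {e}. \<Sum>b\<in>B - {e}. ?H a b * T i a * T j b)"
    if "i \<in> B" "j \<in> B" for i j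
    using warped[OF that qc(2)] chart_inv_chart[OF c qc(1)] by (simp add: T_def z_def \<zeta>_def foot_def)
  have "g q v w = (\<Sum>i\<in>B. \<Sum>j\<in>B. metric_coeff M g c i j q * ?v i * ?w j)"
    by (rule g_expand[OF c qc(1) v w])
  also have "\<dots> = (\<Sum>i\<in>B. \<Sum>j\<in>B. (?v i * T i e) * (?w j * T j e)
      + (f (z \<bullet> e))\<^sup>2 * ((\<Sum>a\<in>B - {e}. \<Sum>b\<in>B - {e}. ?H a b * T i a * T j b) * ?v i * ?w j))"
    by (intro sum.cong refl) (simp add: co algebra_simps)
  also have "\<dots> = (\<Sum>i\<in>B. ?v i * T i e) * (\<Sum>j\<in>B. ?w j * T j e)
      + (f (z \<bullet> e))\<^sup>2 * (\<Sum>i\<in>B. \<Sum>j\<in>B. (\<Sum>a\<in>B - {e}. \<Sum>b\<in>B - {e}. ?H a b * T i a * T j b) * ?v i * ?w j)"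
    by (simp only: sum.distrib sum_product) (simp only: sum_distrib_left)
  \<comment> \<open>By \<open>congruence_sum\<close> the Jacobian is moved from the metric
    coefficients onto the two vectors, whose transformed components are those of their
    images.\<close>
  also have "\<dots> = (\<Sum>i\<in>B. ?v i * T i e) * (\<Sum>j\<in>B. ?w j * T j e)
      + (f (z \<bullet> e))\<^sup>2 * (\<Sum>a\<in>B - {e}. \<Sum>b\<in>B - {e}. ?H a b * (\<Sum>i\<in>B. ?v i * T i a) * (\<Sum>j\<in>B. ?w j * T j b))"
    by (simp only: congruence_sum)
  also have "\<dots> = warped_metric f S h (\<Phi> q) (?d v) (?d w)"
    unfolding \<Phi>q warped_metric_def prod.case h_def q'(2)
    by (simp add: \<Phi>q[symmetric] d_e[OF v] d_e[OF w] d_a[OF v] d_a[OF w])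
  finally show "g q v w = warped_metric f S h (\<Phi> q) (?d v) (?d w)" .
qed

end

text \<open>The passage from the manifold to coordinates: around a zero-free point a small chart
  piece satisfies all assumptions of \<open>closed_conformal_chart\<close>.\<close>

lemma (in riem_mfd) warped_chart_exists:
  assumes X: "vector_field M X" and closed: "closed_soliton M g X \<rho>"
    and p: "p \<in> topspace (mtop M)" "X p \<noteq> (\<lambda>F. 0)"
  obtains c e W Z D \<Psi> \<Theta> \<epsilon> f hh where "warped_chart M g c e W Z D \<Psi> \<Theta> \<epsilon> f hh" "p \<in> fst c" "snd c p \<in> W"
    "smooth_on Basis {-\<epsilon><..<\<epsilon>} f" "\<And>t. t \<in> {-\<epsilon><..<\<epsilon>} \<Longrightarrow> f t > 0"
proof -
  obtain c where c: "c \<in> atlas M" "p \<in> fst c" using p(1) cover by auto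
  define x0 where "x0 = snd c p"
  define G where "G i j x = metric_coeff M g c i j (chart_inv c x)" for i j x
  define Xc where "Xc k x = X (chart_inv c x) (coordinate c k)" for k x
  define \<phi> where "\<phi> x = scalar_curvature M g (chart_inv c x) - \<rho> (chart_inv c x)" for x
  have X_at: "smooth_at M q (\<lambda>q. X q (coordinate c k))" if "k \<in> B" "q \<in> fst c" for k q
    using X c(1) that by (simp add: vector_field_def)
  have G_img: "smooth_on B (img c) (G i j)" if "i \<in> B" "j \<in> B" for i j
    using smooth_in_chart[OF metric_coeff_smooth[OF c(1) that] c(1)] by (simp add: o_def G_def[abs_def])
  have X_img: "smooth_on B (img c) (Xc k)" if "k \<in> B" for k
    using smooth_in_chart[OF X_at[OF that] c(1)] by (simp add: o_def Xc_def[abs_def])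
  have "X p \<in> tangent_space M p" using X p(1) by (simp add: vector_field_def)
  note Xp = tangent_expand[OF c this]
  have "\<exists>k\<in>B. X p (coordinate c k) \<noteq> 0"
  proof (rule ccontr)
    assume "\<not> ?thesis"
    then have "(\<Sum>b\<in>B. X p (coordinate c b) *\<^sub>R b) = 0" by (auto intro!: sum.neutral)
    then show False using Xp p(2) by (simp add: coord_vec_zero)
  qed
  then obtain k where k: "k \<in> B" "Xc k x0 \<noteq> 0"
    by (auto simp: Xc_def x0_def chart_inv_chart[OF c])
  \<comment> \<open>Some component of \<open>X\<close> is nonzero at \<open>p\<close> and, by
    continuity, remains so nearby, which guarantees a nowhere vanishing field on the piece chosen
    next.\<close>
  have "openin (top_of_set (img c)) (img c \<inter> Xc k -` (- {0}))"
    by (rule continuous_openin_preimage_gen[OF smooth_on_imp_continuous_on[OF X_img[OF k(1)]]]) auto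
  then have "relopen B (img c \<inter> Xc k -` (- {0}))" by (rule openin_trans[OF _ img_open[OF c(1)]])
  then obtain T where T: "open T" "img c \<inter> Xc k -` (- {0}) = span B \<inter> T" by (metis openin_open)
  have x0T: "x0 \<in> span B \<inter> T" unfolding T(2)[symmetric] using c k by (simp add: x0_def)
  then obtain r where r: "r > 0" "ball x0 r \<subseteq> T" using T(1) by (meson IntD2 openE)
  \<comment> \<open>A ball cut with the coordinate subspace is convex, as the construction of the
    primitive \<open>\<tau>\<close> requires.\<close>
  define V where "V = span B \<inter> ball x0 r"
  have V_sub: "V \<subseteq> img c \<inter> Xc k -` (- {0})" unfolding T(2) V_def using r by auto
  have V: "relopen B V" unfolding V_def by (simp add: openin_open_Int)
  have cV: "chart_inv c x \<in> fst c" "snd c (chart_inv c x) = x" if "x \<in> V" for x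
    using that V_sub chart_inv_in[of x c] chart_chart_inv[of x c] by auto
  have pd: "partial_deriv i (G j l) x = chart_deriv c i (metric_coeff M g c j l) (chart_inv c x)"
    "partial_deriv i (Xc j) x = chart_deriv c i (\<lambda>q. X q (coordinate c j)) (chart_inv c x)"
    if "x \<in> V" for i j l x
    using cV[OF that] by (simp_all add: chart_deriv_def o_def G_def[abs_def] Xc_def[abs_def])
  interpret closed_conformal_chart B V G Xc \<phi> x0
  proof (unfold_locales)
    show "convex V" unfolding V_def by (intro convex_Int subspace_imp_convex subspace_span convex_ball)
    show "x0 \<in> V" using x0T r by (simp add: V_def)
    show "smooth_on B V (G i j)" if "i \<in> B" "j \<in> B" for i j
      by (rule smooth_on_subset[OF G_img[OF that]]) (use V_sub in auto)
    show "smooth_on B V (Xc j)" if "j \<in> B" for j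
      by (rule smooth_on_subset[OF X_img[OF that]]) (use V_sub in auto)
    show "\<exists>k\<in>B. Xc k x \<noteq> 0" if "x \<in> V" for x using that V_sub k(1) by auto
    fix x assume x: "x \<in> V"
    show "G i j x = G j i x" for i j
      unfolding G_def by (rule metric_coeff_commute[OF c(1) cV(1)[OF x]])
    show "(\<Sum>i\<in>B. \<Sum>j\<in>B. G i j x * s i * s j) > 0" if "\<exists>i\<in>B. s i \<noteq> 0" for s
      unfolding G_def by (rule metric_coeff_pos[OF c(1) cV(1)[OF x] that])
    show "(\<Sum>k\<in>B. G l k x * partial_deriv i (Xc k) x) +
      (\<Sum>j\<in>B. (partial_deriv i (G j l) x + partial_deriv j (G i l) x - partial_deriv l (G i j) x) * Xc j x) / 2
      = \<phi> x * G i l x" if "i \<in> B" "l \<in> B" for i l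
      using closed_lowered[OF c(1) cV(1)[OF x] closed that]
      unfolding pd[OF x] by (simp only: G_def Xc_def \<phi>_def)
  qed (rule B V)+
  obtain e Z W \<Psi> \<Theta> D \<epsilon> f hh where co: "e \<in> B" "relopen B W" "x0 \<in> W" "W \<subseteq> V" "relopen (B - {e}) D" "D \<noteq> {}" "\<epsilon> > 0"
    "Z = {z \<in> span B. \<bar>z \<bullet> e\<bar> < \<epsilon> \<and> z - (z \<bullet> e) *\<^sub>R e \<in> D}" "relopen B Z" "homeomorphism Z W \<Psi> \<Theta>"
    "\<And>k. k \<in> B \<Longrightarrow> smooth_on B Z (\<lambda>z. \<Psi> z \<bullet> k)" "\<And>k. k \<in> B \<Longrightarrow> smooth_on B W (\<lambda>x. \<Theta> x \<bullet> k)"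
    "smooth_on Basis {-\<epsilon><..<\<epsilon>} f" "\<And>t. t \<in> {-\<epsilon><..<\<epsilon>} \<Longrightarrow> f t > 0"
    "\<And>a b. a \<in> B - {e} \<Longrightarrow> b \<in> B - {e} \<Longrightarrow> smooth_on (B - {e}) D (hh a b)"
    "\<And>a b y. y \<in> D \<Longrightarrow> hh a b y = hh b a y"
    "\<And>s y. y \<in> D \<Longrightarrow> \<exists>a\<in>B - {e}. s a \<noteq> 0 \<Longrightarrow> (\<Sum>a\<in>B - {e}. \<Sum>b\<in>B - {e}. hh a b y * s a * s b) > 0"
    "\<And>i j x. i \<in> B \<Longrightarrow> j \<in> B \<Longrightarrow> x \<in> W \<Longrightarrow> G i j x =
      partial_deriv i (\<lambda>x. \<Theta> x \<bullet> e) x * partial_deriv j (\<lambda>x. \<Theta> x \<bullet> e) x + (f (\<Theta> x \<bullet> e))\<^sup>2 *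
      (\<Sum>a\<in>B - {e}. \<Sum>b\<in>B - {e}. hh a b (\<Theta> x - (\<Theta> x \<bullet> e) *\<^sub>R e)
        * partial_deriv i (\<lambda>x. \<Theta> x \<bullet> a) x * partial_deriv j (\<lambda>x. \<Theta> x \<bullet> b) x)"
    by (rule warped_coordinates) blast
  show ?thesis
  proof (rule that[of c e W Z D \<Psi> \<Theta> \<epsilon> f hh])
    show "warped_chart M g c e W Z D \<Psi> \<Theta> \<epsilon> f hh"
    proof (unfold_locales)
      show "W \<subseteq> img c" using co(4) V_sub by blast
      show "metric_coeff M g c i j (chart_inv c x) =
          partial_deriv i (\<lambda>x. \<Theta> x \<bullet> e) x * partial_deriv j (\<lambda>x. \<Theta> x \<bullet> e) x + (f (\<Theta> x \<bullet> e))\<^sup>2 *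
          (\<Sum>a\<in>B - {e}. \<Sum>b\<in>B - {e}. hh a b (\<Theta> x - (\<Theta> x \<bullet> e) *\<^sub>R e)
            * partial_deriv i (\<lambda>x. \<Theta> x \<bullet> a) x * partial_deriv j (\<lambda>x. \<Theta> x \<bullet> b) x)"
        if "i \<in> B" "j \<in> B" "x \<in> W" for i j x
        using co(18)[OF that] by (simp only: G_def)
    qed (fact c co)+
    show "snd c p \<in> W" using co(3) by (simp add: x0_def)
  qed (fact c co)+
qed

theorem theorem1p5:
  fixes M :: "('a, 'e::euclidean_space) mfd"
    and g :: "'a metric"
    and X :: "'a \<Rightarrow> 'a tvec"
    and \<rho> :: "'a \<Rightarrow> real"
    and n :: nat
  assumes soliton: "almost_yamabe_soliton M g X \<rho>"
    and dim: "mfd_dim M = n"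
    and nontrivial: "\<not> killing_soliton M g \<rho>"
    and closed: "closed_soliton M g X \<rho>"
    and compact_levels: "\<And>t. t > 0 \<Longrightarrow> compactin (mtop M) (norm_level_set M g X t)"
  shows "\<forall>p\<in>topspace (mtop M). X p \<noteq> (\<lambda>F. 0) \<longrightarrow>
    (\<exists>(U :: 'a set) (I :: real set) (S :: ('a, 'e) mfd) (h :: 'a metric) (f :: real \<Rightarrow> real) e \<Phi>.
       openin (mtop M) U \<and> p \<in> U \<and>
       is_interval I \<and> open I \<and>
       riemannian_manifold S h \<and> mfd_dim S = n - 1 \<and>
       smooth_on Basis I f \<and> (\<forall>t\<in>I. f t > 0) \<and>
       e \<in> Basis - axes S \<and>
       isometry_onto M g U (interval_product I e S) (warped_metric f S h) \<Phi>)"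
proof (intro ballI impI)
  fix p assume p: "p \<in> topspace (mtop M)" "X p \<noteq> (\<lambda>F. 0)"
  interpret riem_mfd M g
    using soliton by unfold_locales (auto simp: almost_yamabe_soliton_def riemannian_manifold_def)
  have X: "vector_field M X" using soliton by (simp add: almost_yamabe_soliton_def)
  obtain c e W Z D \<Psi> \<Theta> \<epsilon> f hh where wc: "warped_chart M g c e W Z D \<Psi> \<Theta> \<epsilon> f hh" and pc: "p \<in> fst c" "snd c p \<in> W"
    and f: "smooth_on Basis {-\<epsilon><..<\<epsilon>} f" "\<And>t. t \<in> {-\<epsilon><..<\<epsilon>} \<Longrightarrow> f t > 0"
    by (rule warped_chart_exists[OF X closed p]) blast
  interpret W: warped_chart M g c e W Z D \<Psi> \<Theta> \<epsilon> f hh by (rule wc)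
  show "\<exists>(U :: 'a set) (I :: real set) (S :: ('a, 'e) mfd) (h :: 'a metric) (f :: real \<Rightarrow> real) e \<Phi>.
       openin (mtop M) U \<and> p \<in> U \<and>
       is_interval I \<and> open I \<and>
       riemannian_manifold S h \<and> mfd_dim S = n - 1 \<and>
       smooth_on Basis I f \<and> (\<forall>t\<in>I. f t > 0) \<and>
       e \<in> Basis - axes S \<and>
       isometry_onto M g U (interval_product I e S) (warped_metric f S h) \<Phi>"
  proof (intro exI conjI)
    show "openin (mtop M) W.U" by (rule W.U_open)
    show "p \<in> W.U" using pc by (simp add: W.U_def)
    show "is_interval W.I" "open W.I" by (simp_all add: W.I_def is_interval_convex_1)
    show "riemannian_manifold W.S W.h" by (rule W.riemannian_S)
    \<comment> \<open>The axis \<open>e\<close> belongs to the axes of the manifold, so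
      \<open>n\<close> is at least 1 and the truncated subtraction is exact.\<close>
    show "mfd_dim W.S = n - 1" using dim W.e finB by (simp add: mfd_dim_def W.S_simps)
    show "smooth_on Basis W.I f" "\<forall>t\<in>W.I. f t > 0" using f by (simp_all add: W.I_def)
    show "e \<in> Basis - axes W.S" using W.eb by (simp add: W.S_simps)
    show "isometry_onto M g W.U (interval_product W.I e W.S) (warped_metric f W.S W.h) W.\<Phi>"
      by (rule W.isometry)
  qed
qed

end
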